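(* Let $\mathcal C$ be a concrete monoidal $W^*$-category with a bi-regular braiding $c$, let $L\in\mathcal C$ be an object with underlying Hilbert space $\mathscr L$, and let $F\in\mathcal U_{\mathcal C}(L\otimes L)$ be a bi-regular multiplicative unitary in $\mathcal C$. Let $A(F):=[(\omega\otimes\mathrm{id})(F)\mid\omega\in\mathcal B(\mathscr L)_*]$, and for $a\in A(F)$ put $\Delta(a):=F(a\otimes\mathrm{id}_L)F^*$. Then $(A(F),\Delta)$ is a bi-simplifiable $C^*$-bialgebra in $(A(\mathcal C),\boxtimes)$ (where $A(F)$ stands for the object $(L,A(F))$ of $A(\mathcal C)$).
   Context: A $W^*$-category is a $C^*$-category whose Hom-spaces are dual Banach spaces; a functor between $W^*$-categories is normal if it is ultraweakly continuous on Hom-spaces. A concrete monoidal $W^*$-category is a monoidal $W^*$-category $(\mathcal C,\otimes,\mathbb 1)$ (with normal bifunctor $\otimes$) together with a normal strong monoidal ($*$-preserving) functor to the category of Hilbert spaces and bounded maps with the Hilbert space tensor product. The Hilbert space underlying $H,K,L\in\mathcal C$ is denoted $\mathscr H,\mathscr K,\mathscr L$; coherence isomorphisms are suppressed and morphisms are identified with the bounded operators they induce. $\mathcal U_{\mathcal C}(X)$ is the set of unitary endomorphisms of $X$ in $\mathcal C$. A braiding $c$ on $\mathcal C$ is a family of natural isomorphisms $c_{X,Y}:X\otimes Y\to Y\otimes X$ with $c_{U,V\otimes W}=(\mathrm{id}_V\otimes c_{U,W})(c_{U,V}\otimes \mathrm{id}_W)$ and $c_{U\otimes V,W}=(c_{U,W}\otimes\mathrm{id}_V)(\mathrm{id}_U\otimes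 c_{V,W})$. $[X]$ denotes the norm-closed linear span; $\mathcal K(\cdot,\cdot)$ the compact operators; $\mathcal B(\cdot,\cdot)_*$ the predual; $(\mathrm{id}\otimes\omega)$, $(\omega\otimes\mathrm{id})$ the slice maps; $M(A)$ the multiplier algebra. The braiding $c$ is bi-regular if it is unitary and for all $H,K\in\mathcal C$: $[(\mathrm{id}\otimes\omega)(c_{H,K})\mid\omega\in\mathcal B(\mathscr K,\mathscr H)_*]=\mathcal K(\mathscr H,\mathscr K)$ and $[(\omega\otimes\mathrm{id})(c_{H,K})\mid\omega\in\mathcal B(\mathscr H,\mathscr K)_*]=\mathcal K(\mathscr K,\mathscr H)$. $F\in\mathcal U_{\mathcal C}(L\otimes L)$ is a multiplicative unitary in $\mathcal C$ if $F_{23}F_{12}=F_{12}(c_{L,L}^{-1})_{12}F_{23}(c_{L,L})_{12}F_{23}$ on $L\otimes L\otimes L$ ($F_{12}=F\otimes\mathrm{id}_L$, $F_{23}=\mathrm{id}_L\otimes F$, etc.). It is bi-regular if $$[(\mathrm{id}\otimes\omega)(c_{L,L}^{-1}F)\mid\omega\in\mathcal B(\mathscr L)_*]=\mathcal K(\mathscr L)=[(\omega\otimes\mathrm{id})(c_{L,L}F^* )\mid\omega\in\mathcal B(\mathscr L)_*].$$ In this situation $A(F)$ is a $C^*$-algebra acting non-degenerately on $\mathscr L$. The category $A(\mathcal C)$: objects are pairs $(H,A)$ with $H\in\mathcal C$ and $A\subseteq\mathcal B(\mathscr H)$ a $C^*$-subalgebra of the form $A=[(\omega\otimes\mathrm{id})(X)\mid\omega\in\mathcal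 B(\mathscr K)_*]$ for some $K\in\mathcal C$ and $X\in\mathrm{End}_{\mathcal C}(K\otimes H)$. Morphisms $(H_1,A_1)\to(H_2,A_2)$ are non-degenerate $*$-homomorphisms $A_1\to M(A_2)$ of the form $a\mapsto V(a\otimes\mathrm{id}_K)V^*$ for some $K\in\mathcal C$ and some partial isometry $V\in\mathrm{Hom}_{\mathcal C}(H_1\otimes K,H_2)$ (composed after extension to multiplier algebras). Tensor product: $(H_1,A_1)\boxtimes(H_2,A_2):=(H_1\otimes H_2,A_1\boxtimes A_2)$ with $A_1\boxtimes A_2:=[\iota_1(A_1)\cdot\iota_2(A_2)]\subseteq\mathcal B(\mathscr H_1\otimes\mathscr H_2)$, $\iota_1(a)=a\otimes\mathrm{id}_{\mathscr H_2}$, $\iota_2(b)=c_{H_1,H_2}^{-1}(b\otimes\mathrm{id}_{\mathscr H_1})c_{H_1,H_2}$; on morphisms, $f\boxtimes g$ is determined by $\iota_1(a)\iota_2(b)\mapsto\iota_1(f(a))\iota_2(g(b))$. A $C^*$-bialgebra in $(A(\mathcal C),\boxtimes)$ is an object $A$ with a morphism $\Delta:A\to A\boxtimes A$ of $A(\mathcal C)$ such that $(\Delta\boxtimes\mathrm{id})\circ\Delta=(\mathrm{id}\boxtimes\Delta)\circ\Delta$. It is bi-simplifiable if $A\boxtimes A=[\Delta(A)\cdot\iota_1(A)]=[\Delta(A)\cdot\iota_2(A)]$.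
   Formalization: The embedding ι₂ in ⊠ is corrected to ι₂(b)=c_{H2,H1}(b⊗id)c_{H2,H1}^{-1} (reverse braiding); with ι₂ as printed the claim fails, e.g. for Yetter–Drinfeld modules over Z/2 with L=ℓ²(Z/3)⊗ℓ²(Z/2). Both formulas agree for symmetric c. *)

theory Defs
  imports "HOL-Analysis.Analysis"
begin

section \<open>Complex Hilbert spaces and bounded operators\<close>

text \<open>The inner product is linear in its second argument.\<close>

class chilbert_space = real_inner + banach +
  fixes scaleC :: "complex \<Rightarrow> 'a \<Rightarrow> 'a" (infixr \<open>*\<^sub>C\<close> 75)
    and cinner :: "'a \<Rightarrow> 'a \<Rightarrow> complex"
  assumes scaleC_add_right: "a *\<^sub>C (x + y) = a *\<^sub>C x + a *\<^sub>C y"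
    and scaleC_add_left: "(a + b) *\<^sub>C x = a *\<^sub>C x + b *\<^sub>C x"
    and scaleC_scaleC: "a *\<^sub>C (b *\<^sub>C x) = (a * b) *\<^sub>C x"
    and scaleR_scaleC: "r *\<^sub>R x = complex_of_real r *\<^sub>C x"
    and cinner_add_right: "cinner x (y + z) = cinner x y + cinner x z"
    and cinner_scaleC_right: "cinner x (a *\<^sub>C y) = a * cinner x y"
    and cinner_commute: "cinner x y = cnj (cinner y x)"
    and inner_Re_cinner: "inner x y = Re (cinner x y)"

global_interpretation complex_vector: vector_space "scaleC :: complex \<Rightarrow> 'a::chilbert_space \<Rightarrow> 'a"
proof
  fix x :: 'a
  show "1 *\<^sub>C x = x"
    using scaleR_scaleC[of 1 x] by simp
qed (simp_all add: scaleC_add_right scaleC_add_left scaleC_scaleC)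

text \<open>
  All Hilbert spaces occurring below are closed complex subspaces of one ambient Hilbert space
  \<open>'v\<close>.  This is no restriction: a family of Hilbert spaces indexed by a set embeds into its
  Hilbert space direct sum.  A bounded operator from \<open>H\<close> to \<open>K\<close> is represented by its extension
  by zero on the orthogonal complement of \<open>H\<close>; with this convention composition, adjoint and
  operator norm are those of the ambient space.
\<close>

type_synonym 'v op = "'v \<Rightarrow>\<^sub>L 'v"

definition op_scale :: "complex \<Rightarrow> ('v::chilbert_space) op \<Rightarrow> 'v op" where
  "op_scale a T = Blinfun (\<lambda>x. a *\<^sub>C blinfun_apply T x)"

lemma norm_scaleC: "norm (a *\<^sub>C x) = cmod a * norm (x :: 'v::chilbert_space)"
proof -
  have comm: "cinner (a *\<^sub>C x) y = cnj a * cinner x y" for y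
    by (metis cinner_commute cinner_scaleC_right complex_cnj_mult)
  have real: "cinner x x = complex_of_real (inner x x)"
    using arg_cong[OF cinner_commute[of x x], of Im]
    by (simp add: complex_eq_iff inner_Re_cinner)
  have "cinner (a *\<^sub>C x) (a *\<^sub>C x) = (a * cnj a) * cinner x x"
    by (simp add: comm cinner_scaleC_right)
  also have "\<dots> = complex_of_real ((cmod a)\<^sup>2 * inner x x)"
    by (simp only: real complex_norm_square[symmetric] of_real_mult)
  finally have "cinner (a *\<^sub>C x) (a *\<^sub>C x) = complex_of_real ((cmod a)\<^sup>2 * inner x x)" .
  hence "inner (a *\<^sub>C x) (a *\<^sub>C x) = (cmod a)\<^sup>2 * inner x x"
    by (simp add: inner_Re_cinner)
  thus ?thesis
    by (simp add: norm_eq_sqrt_inner real_sqrt_mult)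
qed

lemma blinfun_apply_op_scale [simp]: "blinfun_apply (op_scale a T) x = a *\<^sub>C blinfun_apply T x"
proof -
  have "bounded_linear (\<lambda>x::'a. a *\<^sub>C x)"
    by (rule bounded_linear_intro[where K = "cmod a"])
      (simp_all add: scaleC_add_right scaleR_scaleC scaleC_scaleC norm_scaleC mult.commute)
  from bounded_linear_compose[OF this blinfun.bounded_linear_right[of T]]
  have "bounded_linear (\<lambda>x. a *\<^sub>C blinfun_apply T x)" .
  thus ?thesis
    by (simp add: op_scale_def bounded_linear_Blinfun_apply)
qed

global_interpretation op_vector: vector_space "op_scale :: complex \<Rightarrow> ('v::chilbert_space) op \<Rightarrow> 'v op"
  by standard
    (auto intro!: blinfun_eqI simp: blinfun.add_left complex_vector.scale_right_distrib
      complex_vector.scale_left_distrib)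

abbreviation opspan :: "('v::chilbert_space) op set \<Rightarrow> 'v op set" where
  "opspan S \<equiv> closure (op_vector.span S)"

definition hilbert_subspace :: "('v::chilbert_space) set \<Rightarrow> bool" where
  "hilbert_subspace H \<longleftrightarrow> complex_vector.subspace H \<and> closed H"

definition bop :: "('v::chilbert_space) set \<Rightarrow> 'v set \<Rightarrow> 'v op set" where
  "bop H K = {T :: 'v op. (\<forall>a x. T (a *\<^sub>C x) = a *\<^sub>C T x) \<and> (\<forall>x. T x \<in> K) \<and>
                 (\<forall>x. (\<forall>h\<in>H. cinner h x = 0) \<longrightarrow> T x = 0)}"

definition ident :: "('v::chilbert_space) set \<Rightarrow> 'v op" where
  "ident H = (THE P :: 'v op. P \<in> bop H H \<and> (\<forall>x\<in>H. P x = x))"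

definition adj :: "('v::chilbert_space) op \<Rightarrow> 'v op" where
  "adj T = (THE S :: 'v op. \<forall>x y. cinner (S x) y = cinner x (T y))"

definition inv_op :: "('v::chilbert_space) set \<Rightarrow> 'v set \<Rightarrow> 'v op \<Rightarrow> 'v op" where
  "inv_op H K T = (THE S :: 'v op. S \<in> bop K H \<and> S o\<^sub>L T = ident H \<and> T o\<^sub>L S = ident K)"

definition compact_op :: "('v::chilbert_space) set \<Rightarrow> 'v set \<Rightarrow> 'v op set" where
  "compact_op H K = {T \<in> bop H K. compact (closure (blinfun_apply T ` {x \<in> H. norm x \<le> 1}))}"

text \<open>
  The normal functionals on \<open>bop H K\<close>; only their values on \<open>bop H K\<close> are relevant.
\<close>

definition normal_functionals :: "('v::chilbert_space) set \<Rightarrow> 'v set \<Rightarrow> ('v op \<Rightarrow> complex) set" where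
  "normal_functionals H K =
     {\<lambda>T. \<Sum>n. cinner (\<eta> n) (blinfun_apply T (\<xi> n)) | \<xi> \<eta> :: nat \<Rightarrow> 'v.
        range \<xi> \<subseteq> H \<and> range \<eta> \<subseteq> K \<and>
        summable (\<lambda>n. (norm (\<xi> n))\<^sup>2) \<and> summable (\<lambda>n. (norm (\<eta> n))\<^sup>2)}"

definition weak_topology :: "'v op set \<Rightarrow> (('v::chilbert_space) op \<Rightarrow> complex) set \<Rightarrow> 'v op topology" where
  "weak_topology E M = topology_generated_by {{T \<in> E. \<phi> T \<in> U} | \<phi> U. \<phi> \<in> M \<and> open U}"


section \<open>Dual Banach spaces\<close>

text \<open>
  For a subspace \<open>E\<close> of operators, \<open>dual_space E\<close> is the dual Banach space with norm
  \<open>dual_norm E\<close>; functionals are set to zero outside \<open>E\<close> so that equality is equality on \<open>E\<close>.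
  \<open>is_predual E M\<close> says that \<open>M\<close> is a Banach space of functionals on \<open>E\<close> such that
  evaluation identifies \<open>E\<close> isometrically with the dual of \<open>M\<close>.
\<close>

definition dual_space :: "('v::chilbert_space) op set \<Rightarrow> ('v op \<Rightarrow> complex) set" where
  "dual_space E = {\<phi>. (\<forall>S\<in>E. \<forall>T\<in>E. \<phi> (S + T) = \<phi> S + \<phi> T) \<and>
                      (\<forall>a. \<forall>T\<in>E. \<phi> (op_scale a T) = a * \<phi> T) \<and>
                      (\<exists>B. \<forall>T\<in>E. cmod (\<phi> T) \<le> B * norm T) \<and>
                      (\<forall>T. T \<notin> E \<longrightarrow> \<phi> T = 0)}"

definition dual_norm :: "('v::chilbert_space) op set \<Rightarrow> ('v op \<Rightarrow> complex) \<Rightarrow> real" where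
  "dual_norm E \<phi> = (SUP T\<in>{T \<in> E. norm T \<le> 1}. cmod (\<phi> T))"

definition is_predual :: "('v::chilbert_space) op set \<Rightarrow> ('v op \<Rightarrow> complex) set \<Rightarrow> bool" where
  "is_predual E M \<longleftrightarrow>
     M \<subseteq> dual_space E \<and> (\<lambda>T. 0) \<in> M \<and>
     (\<forall>\<phi>\<in>M. \<forall>\<psi>\<in>M. (\<lambda>T. \<phi> T + \<psi> T) \<in> M) \<and> (\<forall>a. \<forall>\<phi>\<in>M. (\<lambda>T. a * \<phi> T) \<in> M) \<and>
     (\<forall>\<phi>\<in>dual_space E. (\<forall>\<epsilon>>0. \<exists>\<psi>\<in>M. dual_norm E (\<lambda>T. \<phi> T - \<psi> T) < \<epsilon>) \<longrightarrow> \<phi> \<in> M) \<and>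
     (\<forall>T\<in>E. norm T = (SUP \<phi>\<in>{\<phi> \<in> M. dual_norm E \<phi> \<le> 1}. cmod (\<phi> T))) \<and>
     (\<forall>\<Lambda> :: ('v op \<Rightarrow> complex) \<Rightarrow> complex.
        (\<forall>\<phi>\<in>M. \<forall>\<psi>\<in>M. \<Lambda> (\<lambda>T. \<phi> T + \<psi> T) = \<Lambda> \<phi> + \<Lambda> \<psi>) \<and>
        (\<forall>a. \<forall>\<phi>\<in>M. \<Lambda> (\<lambda>T. a * \<phi> T) = a * \<Lambda> \<phi>) \<and>
        (\<exists>B. \<forall>\<phi>\<in>M. cmod (\<Lambda> \<phi>) \<le> B * dual_norm E \<phi>)
        \<longrightarrow> (\<exists>T\<in>E. \<forall>\<phi>\<in>M. \<Lambda> \<phi> = \<phi> T))"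


section \<open>Concrete monoidal \<open>W\<^sup>*\<close>-categories\<close>

text \<open>
  \<open>hilbert_tensor H K T t\<close>: the Hilbert space \<open>T\<close> together with \<open>t :: H \<times> K \<rightarrow> T\<close> is a Hilbert
  space tensor product of \<open>H\<close> and \<open>K\<close>.  Giving such a \<open>t\<close> is the same as giving a unitary from
  the Hilbert space tensor product onto \<open>T\<close>.
\<close>

definition hilbert_tensor ::
    "('v::chilbert_space) set \<Rightarrow> 'v set \<Rightarrow> 'v set \<Rightarrow> ('v \<Rightarrow> 'v \<Rightarrow> 'v) \<Rightarrow> bool" where
  "hilbert_tensor H K T t \<longleftrightarrow>
     (\<forall>x\<in>H. \<forall>x'\<in>H. \<forall>y\<in>K. t (x + x') y = t x y + t x' y) \<and>
     (\<forall>x\<in>H. \<forall>y\<in>K. \<forall>y'\<in>K. t x (y + y') = t x y + t x y') \<and>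
     (\<forall>a. \<forall>x\<in>H. \<forall>y\<in>K. t (a *\<^sub>C x) y = a *\<^sub>C t x y \<and> t x (a *\<^sub>C y) = a *\<^sub>C t x y) \<and>
     (\<forall>x\<in>H. \<forall>x'\<in>H. \<forall>y\<in>K. \<forall>y'\<in>K. cinner (t x y) (t x' y') = cinner x x' * cinner y y') \<and>
     T = closure (complex_vector.span {t x y | x y. x \<in> H \<and> y \<in> K})"

text \<open>
  Morphisms are identified with the operators they induce, so \<open>Hom \<C> X Y\<close> is a set of bounded
  operators.  \<open>Hs\<close> is the underlying Hilbert space, \<open>Pre\<close> the predual of a Hom-space;
  \<open>vten\<close> and \<open>vunit\<close> encode the (unitary) structure maps
  \<open>Hs X \<otimes> Hs Y \<rightarrow> Hs (X \<otimes> Y)\<close> and \<open>\<complex> \<rightarrow> Hs 1\<close>, \<open>1 \<mapsto> vunit\<close>, of the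
  strong monoidal functor to Hilbert spaces.
\<close>

record (overloaded) ('o, 'v::chilbert_space) wcat =
  Obj :: "'o set"
  Hs :: "'o \<Rightarrow> 'v set"
  Hom :: "'o \<Rightarrow> 'o \<Rightarrow> 'v op set"
  Pre :: "'o \<Rightarrow> 'o \<Rightarrow> ('v op \<Rightarrow> complex) set"
  tens :: "'o \<Rightarrow> 'o \<Rightarrow> 'o" (infixr \<open>\<otimes>\<index>\<close> 70)
  tunit :: 'o
  vten :: "'o \<Rightarrow> 'o \<Rightarrow> 'v \<Rightarrow> 'v \<Rightarrow> 'v"
  vunit :: 'v

definition idm :: "('o, 'v::chilbert_space, 'm) wcat_scheme \<Rightarrow> 'o \<Rightarrow> 'v op" where
  "idm \<C> X = ident (Hs \<C> X)"

definition invm :: "('o, 'v::chilbert_space, 'm) wcat_scheme \<Rightarrow> 'o \<Rightarrow> 'o \<Rightarrow> 'v op \<Rightarrow> 'v op" where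
  "invm \<C> X Y T = inv_op (Hs \<C> X) (Hs \<C> Y) T"

text \<open>\<open>tensop \<C> X X' Y Y' S T\<close> is \<open>S \<otimes> T\<close> for bounded operators
  \<open>S :: Hs X \<rightarrow> Hs X'\<close> and \<open>T :: Hs Y \<rightarrow> Hs Y'\<close>, not necessarily in the category.\<close>

definition tensop :: "('o, 'v::chilbert_space, 'm) wcat_scheme \<Rightarrow> 'o \<Rightarrow> 'o \<Rightarrow> 'o \<Rightarrow> 'o
    \<Rightarrow> 'v op \<Rightarrow> 'v op \<Rightarrow> 'v op" where
  "tensop \<C> X X' Y Y' S T =
     (THE R :: 'v op. R \<in> bop (Hs \<C> (X \<otimes>\<^bsub>\<C>\<^esub> Y)) (Hs \<C> (X' \<otimes>\<^bsub>\<C>\<^esub> Y')) \<and>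
        (\<forall>x\<in>Hs \<C> X. \<forall>y\<in>Hs \<C> Y. R (vten \<C> X Y x y) = vten \<C> X' Y' (S x) (T y)))"

abbreviation tensR :: "('o, 'v::chilbert_space, 'm) wcat_scheme \<Rightarrow> 'o \<Rightarrow> 'o \<Rightarrow> 'v op \<Rightarrow> 'o \<Rightarrow> 'v op" where
  "tensR \<C> X X' S Z \<equiv> tensop \<C> X X' Z Z S (idm \<C> Z)"

abbreviation tensL :: "('o, 'v::chilbert_space, 'm) wcat_scheme \<Rightarrow> 'o \<Rightarrow> 'o \<Rightarrow> 'o \<Rightarrow> 'v op \<Rightarrow> 'v op" where
  "tensL \<C> Z X X' S \<equiv> tensop \<C> Z Z X X' (idm \<C> Z) S"

definition assoc :: "('o, 'v::chilbert_space, 'm) wcat_scheme \<Rightarrow> 'o \<Rightarrow> 'o \<Rightarrow> 'o \<Rightarrow> 'v op" where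
  "assoc \<C> X Y Z =
     (THE R :: 'v op. R \<in> bop (Hs \<C> ((X \<otimes>\<^bsub>\<C>\<^esub> Y) \<otimes>\<^bsub>\<C>\<^esub> Z)) (Hs \<C> (X \<otimes>\<^bsub>\<C>\<^esub> (Y \<otimes>\<^bsub>\<C>\<^esub> Z))) \<and>
        (\<forall>x\<in>Hs \<C> X. \<forall>y\<in>Hs \<C> Y. \<forall>z\<in>Hs \<C> Z.
           R (vten \<C> (X \<otimes>\<^bsub>\<C>\<^esub> Y) Z (vten \<C> X Y x y) z) =
           vten \<C> X (Y \<otimes>\<^bsub>\<C>\<^esub> Z) x (vten \<C> Y Z y z)))"

definition assoc_inv :: "('o, 'v::chilbert_space, 'm) wcat_scheme \<Rightarrow> 'o \<Rightarrow> 'o \<Rightarrow> 'o \<Rightarrow> 'v op" where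
  "assoc_inv \<C> X Y Z =
     invm \<C> ((X \<otimes>\<^bsub>\<C>\<^esub> Y) \<otimes>\<^bsub>\<C>\<^esub> Z) (X \<otimes>\<^bsub>\<C>\<^esub> (Y \<otimes>\<^bsub>\<C>\<^esub> Z)) (assoc \<C> X Y Z)"

definition lunit :: "('o, 'v::chilbert_space, 'm) wcat_scheme \<Rightarrow> 'o \<Rightarrow> 'v op" where
  "lunit \<C> X = (THE R :: 'v op. R \<in> bop (Hs \<C> (tunit \<C> \<otimes>\<^bsub>\<C>\<^esub> X)) (Hs \<C> X) \<and>
     (\<forall>x\<in>Hs \<C> X. R (vten \<C> (tunit \<C>) X (vunit \<C>) x) = x))"

definition runit :: "('o, 'v::chilbert_space, 'm) wcat_scheme \<Rightarrow> 'o \<Rightarrow> 'v op" where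
  "runit \<C> X = (THE R :: 'v op. R \<in> bop (Hs \<C> (X \<otimes>\<^bsub>\<C>\<^esub> tunit \<C>)) (Hs \<C> X) \<and>
     (\<forall>x\<in>Hs \<C> X. R (vten \<C> X (tunit \<C>) x (vunit \<C>)) = x))"

abbreviation hom_topology :: "('o, 'v::chilbert_space, 'm) wcat_scheme \<Rightarrow> 'o \<Rightarrow> 'o \<Rightarrow> 'v op topology" where
  "hom_topology \<C> X Y \<equiv> weak_topology (Hom \<C> X Y) (Pre \<C> X Y)"

text \<open>
  Compatibility of the functor to Hilbert spaces with the monoidal structures forces the
  associator and the unitors to be the canonical unitaries, so it only has to be required that
  these lie in the category; their naturality, the pentagon and triangle identities and the
  bifunctoriality of \<open>\<otimes>\<close> then hold.
  Likewise the \<open>C\<^sup>*\<close>-identity and the positivity of \<open>T\<^sup>*T\<close> hold for a norm-closed \<open>*\<close>-category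
  of operators.
\<close>

locale concrete_monoidal_wstar_category =
  fixes \<C> :: "('o, 'v::chilbert_space, 'm) wcat_scheme" (structure)
  assumes hilbert_subspace_Hs: "X \<in> Obj \<C> \<Longrightarrow> hilbert_subspace (Hs \<C> X)"
    and Hom_bop: "\<lbrakk>X \<in> Obj \<C>; Y \<in> Obj \<C>\<rbrakk> \<Longrightarrow> Hom \<C> X Y \<subseteq> bop (Hs \<C> X) (Hs \<C> Y)"
    and Hom_subspace: "\<lbrakk>X \<in> Obj \<C>; Y \<in> Obj \<C>\<rbrakk> \<Longrightarrow> op_vector.subspace (Hom \<C> X Y)"
    and Hom_closed: "\<lbrakk>X \<in> Obj \<C>; Y \<in> Obj \<C>\<rbrakk> \<Longrightarrow> closed (Hom \<C> X Y)"
    and Hom_id: "X \<in> Obj \<C> \<Longrightarrow> idm \<C> X \<in> Hom \<C> X X"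
    and Hom_comp: "\<lbrakk>X \<in> Obj \<C>; Y \<in> Obj \<C>; Z \<in> Obj \<C>; S \<in> Hom \<C> X Y; T \<in> Hom \<C> Y Z\<rbrakk>
                   \<Longrightarrow> T o\<^sub>L S \<in> Hom \<C> X Z"
    and Hom_adj: "\<lbrakk>X \<in> Obj \<C>; Y \<in> Obj \<C>; T \<in> Hom \<C> X Y\<rbrakk> \<Longrightarrow> adj T \<in> Hom \<C> Y X"
    and Hom_predual: "\<lbrakk>X \<in> Obj \<C>; Y \<in> Obj \<C>\<rbrakk> \<Longrightarrow> is_predual (Hom \<C> X Y) (Pre \<C> X Y)"
    and functor_normal: "\<lbrakk>X \<in> Obj \<C>; Y \<in> Obj \<C>\<rbrakk> \<Longrightarrow>
          continuous_map (hom_topology \<C> X Y)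
            (weak_topology (bop (Hs \<C> X) (Hs \<C> Y)) (normal_functionals (Hs \<C> X) (Hs \<C> Y)))
            (\<lambda>T. T)"
    and tens_Obj: "\<lbrakk>X \<in> Obj \<C>; Y \<in> Obj \<C>\<rbrakk> \<Longrightarrow> X \<otimes> Y \<in> Obj \<C>"
    and vten_tensor: "\<lbrakk>X \<in> Obj \<C>; Y \<in> Obj \<C>\<rbrakk> \<Longrightarrow>
          hilbert_tensor (Hs \<C> X) (Hs \<C> Y) (Hs \<C> (X \<otimes> Y)) (vten \<C> X Y)"
    and tens_Hom: "\<lbrakk>X \<in> Obj \<C>; X' \<in> Obj \<C>; Y \<in> Obj \<C>; Y' \<in> Obj \<C>; S \<in> Hom \<C> X X'; T \<in> Hom \<C> Y Y'\<rbrakk>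
          \<Longrightarrow> tensop \<C> X X' Y Y' S T \<in> Hom \<C> (X \<otimes> Y) (X' \<otimes> Y')"
    and tens_normal_left: "\<lbrakk>X \<in> Obj \<C>; X' \<in> Obj \<C>; Y \<in> Obj \<C>; Y' \<in> Obj \<C>; T \<in> Hom \<C> Y Y'\<rbrakk> \<Longrightarrow>
          continuous_map (hom_topology \<C> X X') (hom_topology \<C> (X \<otimes> Y) (X' \<otimes> Y'))
            (\<lambda>S. tensop \<C> X X' Y Y' S T)"
    and tens_normal_right: "\<lbrakk>X \<in> Obj \<C>; X' \<in> Obj \<C>; Y \<in> Obj \<C>; Y' \<in> Obj \<C>; S \<in> Hom \<C> X X'\<rbrakk> \<Longrightarrow>
          continuous_map (hom_topology \<C> Y Y') (hom_topology \<C> (X \<otimes> Y) (X' \<otimes> Y'))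
            (\<lambda>T. tensop \<C> X X' Y Y' S T)"
    and assoc_Hom: "\<lbrakk>X \<in> Obj \<C>; Y \<in> Obj \<C>; Z \<in> Obj \<C>\<rbrakk> \<Longrightarrow>
          assoc \<C> X Y Z \<in> Hom \<C> ((X \<otimes> Y) \<otimes> Z) (X \<otimes> (Y \<otimes> Z))"
    and tunit_Obj: "tunit \<C> \<in> Obj \<C>"
    and vunit: "norm (vunit \<C>) = 1" "Hs \<C> (tunit \<C>) = range (\<lambda>a. a *\<^sub>C vunit \<C>)"
    and lunit_Hom: "X \<in> Obj \<C> \<Longrightarrow> lunit \<C> X \<in> Hom \<C> (tunit \<C> \<otimes> X) X"
    and runit_Hom: "X \<in> Obj \<C> \<Longrightarrow> runit \<C> X \<in> Hom \<C> (X \<otimes> tunit \<C>) X"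

definition isomorphism :: "('o, 'v::chilbert_space, 'm) wcat_scheme \<Rightarrow> 'o \<Rightarrow> 'o \<Rightarrow> 'v op \<Rightarrow> bool" where
  "isomorphism \<C> X Y T \<longleftrightarrow> T \<in> Hom \<C> X Y \<and>
     (\<exists>S\<in>Hom \<C> Y X. S o\<^sub>L T = idm \<C> X \<and> T o\<^sub>L S = idm \<C> Y)"

definition unitaries :: "('o, 'v::chilbert_space, 'm) wcat_scheme \<Rightarrow> 'o \<Rightarrow> 'o \<Rightarrow> 'v op set" where
  "unitaries \<C> X Y = {T \<in> Hom \<C> X Y. adj T o\<^sub>L T = idm \<C> X \<and> T o\<^sub>L adj T = idm \<C> Y}"


section \<open>Slice maps and bi-regular braidings\<close>

text \<open>
  For \<open>T :: Hs H \<otimes> Hs K \<rightarrow> Hs H' \<otimes> Hs K'\<close>, \<open>slice_snd \<C> H H' K K' T \<omega>\<close> is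
  \<open>(id \<otimes> \<omega>)(T) :: Hs H \<rightarrow> Hs H'\<close> and \<open>slice_fst \<C> H H' K K' T \<omega>\<close> is
  \<open>(\<omega> \<otimes> id)(T) :: Hs K \<rightarrow> Hs K'\<close>.  The former is determined by
  \<open>\<langle>y, (id \<otimes> \<omega>)(T) x\<rangle> = \<omega> ((\<langle>y| \<otimes> id) T (|x\<rangle> \<otimes> id))\<close>, and \<open>coeff_fst\<close> is
  the argument of \<open>\<omega>\<close> in this formula; similarly for the latter.
\<close>

definition coeff_fst :: "('o, 'v::chilbert_space, 'm) wcat_scheme \<Rightarrow> 'o \<Rightarrow> 'o \<Rightarrow> 'o \<Rightarrow> 'o
    \<Rightarrow> 'v op \<Rightarrow> 'v \<Rightarrow> 'v \<Rightarrow> 'v op" where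
  "coeff_fst \<C> H H' K K' T y x =
     (THE R :: 'v op. R \<in> bop (Hs \<C> K) (Hs \<C> K') \<and>
        (\<forall>k\<in>Hs \<C> K. \<forall>k'\<in>Hs \<C> K'. cinner k' (R k) = cinner (vten \<C> H' K' y k') (T (vten \<C> H K x k))))"

definition coeff_snd :: "('o, 'v::chilbert_space, 'm) wcat_scheme \<Rightarrow> 'o \<Rightarrow> 'o \<Rightarrow> 'o \<Rightarrow> 'o
    \<Rightarrow> 'v op \<Rightarrow> 'v \<Rightarrow> 'v \<Rightarrow> 'v op" where
  "coeff_snd \<C> H H' K K' T y x =
     (THE R :: 'v op. R \<in> bop (Hs \<C> H) (Hs \<C> H') \<and>
        (\<forall>h\<in>Hs \<C> H. \<forall>h'\<in>Hs \<C> H'. cinner h' (R h) = cinner (vten \<C> H' K' h' y) (T (vten \<C> H K h x))))"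

definition slice_snd :: "('o, 'v::chilbert_space, 'm) wcat_scheme \<Rightarrow> 'o \<Rightarrow> 'o \<Rightarrow> 'o \<Rightarrow> 'o
    \<Rightarrow> 'v op \<Rightarrow> ('v op \<Rightarrow> complex) \<Rightarrow> 'v op" where
  "slice_snd \<C> H H' K K' T \<omega> =
     (THE R :: 'v op. R \<in> bop (Hs \<C> H) (Hs \<C> H') \<and>
        (\<forall>x\<in>Hs \<C> H. \<forall>y\<in>Hs \<C> H'. cinner y (R x) = \<omega> (coeff_fst \<C> H H' K K' T y x)))"

definition slice_fst :: "('o, 'v::chilbert_space, 'm) wcat_scheme \<Rightarrow> 'o \<Rightarrow> 'o \<Rightarrow> 'o \<Rightarrow> 'o
    \<Rightarrow> 'v op \<Rightarrow> ('v op \<Rightarrow> complex) \<Rightarrow> 'v op" where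
  "slice_fst \<C> H H' K K' T \<omega> =
     (THE R :: 'v op. R \<in> bop (Hs \<C> K) (Hs \<C> K') \<and>
        (\<forall>x\<in>Hs \<C> K. \<forall>y\<in>Hs \<C> K'. cinner y (R x) = \<omega> (coeff_snd \<C> H H' K K' T y x)))"

abbreviation normal_on :: "('o, 'v::chilbert_space, 'm) wcat_scheme \<Rightarrow> 'o \<Rightarrow> 'o \<Rightarrow> ('v op \<Rightarrow> complex) set" where
  "normal_on \<C> H K \<equiv> normal_functionals (Hs \<C> H) (Hs \<C> K)"

definition braiding :: "('o, 'v::chilbert_space, 'm) wcat_scheme \<Rightarrow> ('o \<Rightarrow> 'o \<Rightarrow> 'v op) \<Rightarrow> bool" where
  "braiding \<C> c \<longleftrightarrow>
     (\<forall>X\<in>Obj \<C>. \<forall>Y\<in>Obj \<C>. isomorphism \<C> (X \<otimes>\<^bsub>\<C>\<^esub> Y) (Y \<otimes>\<^bsub>\<C>\<^esub> X) (c X Y)) \<and>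
     (\<forall>X\<in>Obj \<C>. \<forall>X'\<in>Obj \<C>. \<forall>Y\<in>Obj \<C>. \<forall>Y'\<in>Obj \<C>. \<forall>S\<in>Hom \<C> X X'. \<forall>T\<in>Hom \<C> Y Y'.
        c X' Y' o\<^sub>L tensop \<C> X X' Y Y' S T = tensop \<C> Y Y' X X' T S o\<^sub>L c X Y) \<and>
     (\<forall>U\<in>Obj \<C>. \<forall>V\<in>Obj \<C>. \<forall>W\<in>Obj \<C>.
        assoc \<C> V W U o\<^sub>L c U (V \<otimes>\<^bsub>\<C>\<^esub> W) o\<^sub>L assoc \<C> U V W =
        tensL \<C> V (U \<otimes>\<^bsub>\<C>\<^esub> W) (W \<otimes>\<^bsub>\<C>\<^esub> U) (c U W) o\<^sub>L assoc \<C> V U W o\<^sub>L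
        tensR \<C> (U \<otimes>\<^bsub>\<C>\<^esub> V) (V \<otimes>\<^bsub>\<C>\<^esub> U) (c U V) W) \<and>
     (\<forall>U\<in>Obj \<C>. \<forall>V\<in>Obj \<C>. \<forall>W\<in>Obj \<C>.
        assoc_inv \<C> W U V o\<^sub>L c (U \<otimes>\<^bsub>\<C>\<^esub> V) W o\<^sub>L assoc_inv \<C> U V W =
        tensR \<C> (U \<otimes>\<^bsub>\<C>\<^esub> W) (W \<otimes>\<^bsub>\<C>\<^esub> U) (c U W) V o\<^sub>L assoc_inv \<C> U W V o\<^sub>L
        tensL \<C> U (V \<otimes>\<^bsub>\<C>\<^esub> W) (W \<otimes>\<^bsub>\<C>\<^esub> V) (c V W))"

definition bi_regular_braiding ::
    "('o, 'v::chilbert_space, 'm) wcat_scheme \<Rightarrow> ('o \<Rightarrow> 'o \<Rightarrow> 'v op) \<Rightarrow> bool" where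
  "bi_regular_braiding \<C> c \<longleftrightarrow>
     braiding \<C> c \<and>
     (\<forall>H\<in>Obj \<C>. \<forall>K\<in>Obj \<C>. c H K \<in> unitaries \<C> (H \<otimes>\<^bsub>\<C>\<^esub> K) (K \<otimes>\<^bsub>\<C>\<^esub> H)) \<and>
     (\<forall>H\<in>Obj \<C>. \<forall>K\<in>Obj \<C>.
        opspan {slice_snd \<C> H K K H (c H K) \<omega> | \<omega>. \<omega> \<in> normal_on \<C> K H} =
          compact_op (Hs \<C> H) (Hs \<C> K) \<and>
        opspan {slice_fst \<C> H K K H (c H K) \<omega> | \<omega>. \<omega> \<in> normal_on \<C> H K} =
          compact_op (Hs \<C> K) (Hs \<C> H))"


section \<open>Multiplicative unitaries\<close>

text \<open>\<open>leg12\<close> and \<open>leg23\<close> are the leg-numbered operators on \<open>(L \<otimes> L) \<otimes> L\<close>.\<close>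

definition leg12 :: "('o, 'v::chilbert_space, 'm) wcat_scheme \<Rightarrow> 'o \<Rightarrow> 'v op \<Rightarrow> 'v op" where
  "leg12 \<C> L T = tensR \<C> (L \<otimes>\<^bsub>\<C>\<^esub> L) (L \<otimes>\<^bsub>\<C>\<^esub> L) T L"

definition leg23 :: "('o, 'v::chilbert_space, 'm) wcat_scheme \<Rightarrow> 'o \<Rightarrow> 'v op \<Rightarrow> 'v op" where
  "leg23 \<C> L T =
     assoc_inv \<C> L L L o\<^sub>L tensL \<C> L (L \<otimes>\<^bsub>\<C>\<^esub> L) (L \<otimes>\<^bsub>\<C>\<^esub> L) T o\<^sub>L assoc \<C> L L L"

definition braid_inv :: "('o, 'v::chilbert_space, 'm) wcat_scheme \<Rightarrow> ('o \<Rightarrow> 'o \<Rightarrow> 'v op)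
    \<Rightarrow> 'o \<Rightarrow> 'o \<Rightarrow> 'v op" where
  "braid_inv \<C> c X Y = invm \<C> (X \<otimes>\<^bsub>\<C>\<^esub> Y) (Y \<otimes>\<^bsub>\<C>\<^esub> X) (c X Y)"

definition multiplicative_unitary :: "('o, 'v::chilbert_space, 'm) wcat_scheme
    \<Rightarrow> ('o \<Rightarrow> 'o \<Rightarrow> 'v op) \<Rightarrow> 'o \<Rightarrow> 'v op \<Rightarrow> bool" where
  "multiplicative_unitary \<C> c L F \<longleftrightarrow>
     F \<in> unitaries \<C> (L \<otimes>\<^bsub>\<C>\<^esub> L) (L \<otimes>\<^bsub>\<C>\<^esub> L) \<and>
     leg23 \<C> L F o\<^sub>L leg12 \<C> L F =
     leg12 \<C> L F o\<^sub>L leg12 \<C> L (braid_inv \<C> c L L) o\<^sub>L leg23 \<C> L F o\<^sub>L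
       leg12 \<C> L (c L L) o\<^sub>L leg23 \<C> L F"

definition bi_regular_multiplicative_unitary :: "('o, 'v::chilbert_space, 'm) wcat_scheme
    \<Rightarrow> ('o \<Rightarrow> 'o \<Rightarrow> 'v op) \<Rightarrow> 'o \<Rightarrow> 'v op \<Rightarrow> bool" where
  "bi_regular_multiplicative_unitary \<C> c L F \<longleftrightarrow>
     multiplicative_unitary \<C> c L F \<and>
     opspan {slice_snd \<C> L L L L (braid_inv \<C> c L L o\<^sub>L F) \<omega> | \<omega>. \<omega> \<in> normal_on \<C> L L} =
       compact_op (Hs \<C> L) (Hs \<C> L) \<and>
     opspan {slice_fst \<C> L L L L (c L L o\<^sub>L adj F) \<omega> | \<omega>. \<omega> \<in> normal_on \<C> L L} =
       compact_op (Hs \<C> L) (Hs \<C> L)"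

definition alg_of :: "('o, 'v::chilbert_space, 'm) wcat_scheme \<Rightarrow> 'o \<Rightarrow> 'v op \<Rightarrow> 'v op set" where
  "alg_of \<C> L F = opspan {slice_fst \<C> L L L L F \<omega> | \<omega>. \<omega> \<in> normal_on \<C> L L}"

definition comult_of :: "('o, 'v::chilbert_space, 'm) wcat_scheme \<Rightarrow> 'o \<Rightarrow> 'v op \<Rightarrow> 'v op \<Rightarrow> 'v op" where
  "comult_of \<C> L F a = F o\<^sub>L tensR \<C> L L a L o\<^sub>L adj F"


section \<open>The category \<open>A(\<C>)\<close>\<close>

definition cstar_subalgebra :: "('v::chilbert_space) set \<Rightarrow> 'v op set \<Rightarrow> bool" where
  "cstar_subalgebra H A \<longleftrightarrow>
     A \<subseteq> bop H H \<and> op_vector.subspace A \<and> closed A \<and>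
     (\<forall>a\<in>A. \<forall>b\<in>A. a o\<^sub>L b \<in> A) \<and> (\<forall>a\<in>A. adj a \<in> A)"

definition alg_obj :: "('o, 'v::chilbert_space, 'm) wcat_scheme \<Rightarrow> 'o \<times> 'v op set \<Rightarrow> bool" where
  "alg_obj \<C> P \<longleftrightarrow> (case P of (H, A) \<Rightarrow>
     H \<in> Obj \<C> \<and> cstar_subalgebra (Hs \<C> H) A \<and>
     (\<exists>K\<in>Obj \<C>. \<exists>X\<in>Hom \<C> (K \<otimes>\<^bsub>\<C>\<^esub> H) (K \<otimes>\<^bsub>\<C>\<^esub> H).
        A = opspan {slice_fst \<C> K K H H X \<omega> | \<omega>. \<omega> \<in> normal_on \<C> K K}))"

text \<open>
  The multiplier algebra of \<open>A\<close>, realized on the closed span of \<open>A H\<close>; for non-degenerate \<open>A\<close>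
  this is the idealizer of \<open>A\<close> in \<open>bop H H\<close>.
\<close>

definition multipliers :: "('v::chilbert_space) set \<Rightarrow> 'v op set \<Rightarrow> 'v op set" where
  "multipliers H A = {T \<in> bop H H. (\<forall>a\<in>A. T o\<^sub>L a \<in> A \<and> a o\<^sub>L T \<in> A) \<and>
     (\<forall>x. (\<forall>a\<in>A. \<forall>h\<in>H. cinner (a h) x = 0) \<longrightarrow> T x = 0)}"

definition alg_mor :: "('o, 'v::chilbert_space, 'm) wcat_scheme \<Rightarrow> 'o \<times> 'v op set \<Rightarrow> 'o \<times> 'v op set
    \<Rightarrow> ('v op \<Rightarrow> 'v op) \<Rightarrow> bool" where
  "alg_mor \<C> P Q f \<longleftrightarrow> alg_obj \<C> P \<and> alg_obj \<C> Q \<and>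
     (case P of (H1, A1) \<Rightarrow> case Q of (H2, A2) \<Rightarrow>
       f ` A1 \<subseteq> multipliers (Hs \<C> H2) A2 \<and>
       (\<forall>a\<in>A1. \<forall>b\<in>A1. f (a + b) = f a + f b) \<and>
       (\<forall>t. \<forall>a\<in>A1. f (op_scale t a) = op_scale t (f a)) \<and>
       (\<forall>a\<in>A1. \<forall>b\<in>A1. f (a o\<^sub>L b) = f a o\<^sub>L f b) \<and>
       (\<forall>a\<in>A1. f (adj a) = adj (f a)) \<and>
       opspan {f a o\<^sub>L b | a b. a \<in> A1 \<and> b \<in> A2} = A2 \<and>
       (\<exists>K\<in>Obj \<C>. \<exists>V\<in>Hom \<C> (H1 \<otimes>\<^bsub>\<C>\<^esub> K) H2. V o\<^sub>L adj V o\<^sub>L V = V \<and>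
          (\<forall>a\<in>A1. f a = V o\<^sub>L tensR \<C> H1 H1 a K o\<^sub>L adj V)))"

text \<open>The extension of a morphism \<open>f\<close> from \<open>P\<close> to \<open>Q\<close> to the multiplier algebras.\<close>

definition extend :: "('o, 'v::chilbert_space, 'm) wcat_scheme \<Rightarrow> 'o \<times> 'v op set \<Rightarrow> 'o \<times> 'v op set
    \<Rightarrow> ('v op \<Rightarrow> 'v op) \<Rightarrow> 'v op \<Rightarrow> 'v op" where
  "extend \<C> P Q f m =
     (THE T :: 'v op. T \<in> multipliers (Hs \<C> (fst Q)) (snd Q) \<and> (\<forall>a\<in>snd P. T o\<^sub>L f a = f (m o\<^sub>L a)))"

definition iota1 :: "('o, 'v::chilbert_space, 'm) wcat_scheme \<Rightarrow> 'o \<Rightarrow> 'o \<Rightarrow> 'v op \<Rightarrow> 'v op" where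
  "iota1 \<C> H1 H2 a = tensR \<C> H1 H1 a H2"

text \<open>
  Of the two embeddings of the second factor, obtained from \<open>c\<close> and from the reverse
  braiding, this is the one that matches the pentagon equation in
  \<open>multiplicative_unitary\<close>: by naturality
  \<open>(c\<^sup>-\<^sup>1)\<^sub>1\<^sub>2 F\<^sub>2\<^sub>3 c\<^sub>1\<^sub>2 = c\<^sub>2\<^sub>3 F\<^sub>1\<^sub>2 (c\<^sup>-\<^sup>1)\<^sub>2\<^sub>3\<close>, whose first-leg slices are
  the operators \<open>iota2 \<C> c L L b\<close> for \<open>b\<close> a slice of \<open>F\<close>.  With
  \<open>c\<^bsub>H1,H2\<^esub>\<^sup>-\<^sup>1 (b \<otimes> id) c\<^bsub>H1,H2\<^esub>\<close> instead, \<open>comult_of\<close> need not take values in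
  multipliers of the braided tensor product; the two agree for symmetric \<open>c\<close>.
\<close>

definition iota2 :: "('o, 'v::chilbert_space, 'm) wcat_scheme \<Rightarrow> ('o \<Rightarrow> 'o \<Rightarrow> 'v op)
    \<Rightarrow> 'o \<Rightarrow> 'o \<Rightarrow> 'v op \<Rightarrow> 'v op" where
  "iota2 \<C> c H1 H2 b = c H2 H1 o\<^sub>L tensR \<C> H2 H2 b H1 o\<^sub>L braid_inv \<C> c H2 H1"

definition box_obj :: "('o, 'v::chilbert_space, 'm) wcat_scheme \<Rightarrow> ('o \<Rightarrow> 'o \<Rightarrow> 'v op)
    \<Rightarrow> 'o \<times> 'v op set \<Rightarrow> 'o \<times> 'v op set \<Rightarrow> 'o \<times> 'v op set" where
  "box_obj \<C> c P Q = (case P of (H1, A1) \<Rightarrow> case Q of (H2, A2) \<Rightarrow>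
     (H1 \<otimes>\<^bsub>\<C>\<^esub> H2, opspan {iota1 \<C> H1 H2 a o\<^sub>L iota2 \<C> c H1 H2 b | a b. a \<in> A1 \<and> b \<in> A2}))"

text \<open>
  \<open>is_box_mor \<C> c P P' Q Q' f g h\<close>: for \<open>f : P \<rightarrow> P'\<close> and \<open>g : Q \<rightarrow> Q'\<close>, the map \<open>h\<close> is the
  morphism \<open>f \<boxtimes> g : P \<boxtimes> Q \<rightarrow> P' \<boxtimes> Q'\<close>; the stated formula determines \<open>h\<close> on the algebra
  of \<open>P \<boxtimes> Q\<close>.
\<close>

definition is_box_mor :: "('o, 'v::chilbert_space, 'm) wcat_scheme \<Rightarrow> ('o \<Rightarrow> 'o \<Rightarrow> 'v op)
    \<Rightarrow> 'o \<times> 'v op set \<Rightarrow> 'o \<times> 'v op set \<Rightarrow> 'o \<times> 'v op set \<Rightarrow> 'o \<times> 'v op set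
    \<Rightarrow> ('v op \<Rightarrow> 'v op) \<Rightarrow> ('v op \<Rightarrow> 'v op) \<Rightarrow> ('v op \<Rightarrow> 'v op) \<Rightarrow> bool" where
  "is_box_mor \<C> c P P' Q Q' f g h \<longleftrightarrow>
     alg_mor \<C> (box_obj \<C> c P Q) (box_obj \<C> c P' Q') h \<and>
     (\<forall>a\<in>snd P. \<forall>b\<in>snd Q.
        h (iota1 \<C> (fst P) (fst Q) a o\<^sub>L iota2 \<C> c (fst P) (fst Q) b) =
        iota1 \<C> (fst P') (fst Q') (f a) o\<^sub>L iota2 \<C> c (fst P') (fst Q') (g b))"


section \<open>Bi-simplifiable \<open>C\<^sup>*\<close>-bialgebras\<close>

text \<open>
  The two sides of coassociativity live on \<open>(H \<otimes> H) \<otimes> H\<close> and \<open>H \<otimes> (H \<otimes> H)\<close> and are compared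
  by means of the associator.
\<close>

definition cstar_bialgebra :: "('o, 'v::chilbert_space, 'm) wcat_scheme \<Rightarrow> ('o \<Rightarrow> 'o \<Rightarrow> 'v op)
    \<Rightarrow> 'o \<times> 'v op set \<Rightarrow> ('v op \<Rightarrow> 'v op) \<Rightarrow> bool" where
  "cstar_bialgebra \<C> c P \<Delta> \<longleftrightarrow>
     alg_obj \<C> P \<and> alg_mor \<C> P (box_obj \<C> c P P) \<Delta> \<and>
     (\<exists>\<Delta>1 \<Delta>2.
        is_box_mor \<C> c P (box_obj \<C> c P P) P P \<Delta> (\<lambda>a. a) \<Delta>1 \<and>
        is_box_mor \<C> c P P P (box_obj \<C> c P P) (\<lambda>a. a) \<Delta> \<Delta>2 \<and>
        (\<forall>a\<in>snd P.
           assoc \<C> (fst P) (fst P) (fst P) o\<^sub>L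
           extend \<C> (box_obj \<C> c P P) (box_obj \<C> c (box_obj \<C> c P P) P) \<Delta>1 (\<Delta> a) o\<^sub>L
           assoc_inv \<C> (fst P) (fst P) (fst P) =
           extend \<C> (box_obj \<C> c P P) (box_obj \<C> c P (box_obj \<C> c P P)) \<Delta>2 (\<Delta> a)))"

definition bi_simplifiable :: "('o, 'v::chilbert_space, 'm) wcat_scheme \<Rightarrow> ('o \<Rightarrow> 'o \<Rightarrow> 'v op)
    \<Rightarrow> 'o \<times> 'v op set \<Rightarrow> ('v op \<Rightarrow> 'v op) \<Rightarrow> bool" where
  "bi_simplifiable \<C> c P \<Delta> \<longleftrightarrow>
     snd (box_obj \<C> c P P) =
       opspan {\<Delta> a o\<^sub>L iota1 \<C> (fst P) (fst P) b | a b. a \<in> snd P \<and> b \<in> snd P} \<and>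
     snd (box_obj \<C> c P P) =
       opspan {\<Delta> a o\<^sub>L iota2 \<C> c (fst P) (fst P) b | a b. a \<in> snd P \<and> b \<in> snd P}"

end

theory Submission
  imports Defs
begin

text \<open>
  The slice of an operator \<open>X\<close> by a vector functional is \<open>\<eta>\<^sup>* X \<xi>\<close>, where \<open>\<xi>\<close> denotes
  the operator \<open>y \<mapsto> \<xi> \<otimes> y\<close>.  A product of two slices therefore contains a rank one operator
  \<open>\<xi> \<eta>\<^sup>*\<close>.  Bi-regularity of \<open>c\<close> says that rank one operators have the same closed span as the
  slices of \<open>c\<close>, so they can be exchanged, and the product becomes a slice of a product of
  operators, in which unitaries on the auxiliary legs may be dropped.

  With \<open>c\<close> in the middle the product of two slices of \<open>F\<close> is a slice of
  \<open>F\<^sub>2\<^sub>3 c\<^sub>1\<^sub>2 F\<^sub>2\<^sub>3 = c\<^sub>1\<^sub>2 F\<^sub>1\<^sub>2\<^sup>* F\<^sub>2\<^sub>3 F\<^sub>1\<^sub>2\<close>, whence \<open>[A \<cdot> A] = A\<close>; bi-regularity of \<open>F\<close> yields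
  \<open>[A\<^sup>* \<cdot> A] = A\<close> in the same way, so \<open>A\<close> is selfadjoint.  The exchange also gives
  \<open>[F (K \<otimes> A)] = K \<otimes> A\<close> for the compact operators \<open>K\<close>; since \<open>\<Delta>\<close> of a slice of \<open>F\<close> is a slice of
  a product of two copies of \<open>F\<close> by the pentagon equation, one of the copies is absorbed and
  \<open>(A, \<Delta>)\<close> is bi-simplifiable.  In a braided tensor product, strands of the second factor pass
  over those of the first, so the two orders of multiplication span the same closed space.
  Finally \<open>\<Delta> \<boxtimes> id\<close> and \<open>id \<boxtimes> \<Delta>\<close> are implemented by \<open>F\<^sub>1\<^sub>2 c\<^sub>2\<^sub>3\<close> and \<open>F\<^sub>2\<^sub>3\<close>, and coassociativity
  is the pentagon equation.
\<close>

section \<open>Complex Hilbert spaces\<close>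

text \<open>Every operation of the setting (\<open>ident\<close>, \<open>adj\<close>,
  \<open>tensop\<close>, \<open>assoc\<close>, the slice maps) is a definite description, so nothing
  can be computed before existence and uniqueness are known. This is what the Hilbert space part
  supplies: projections and Riesz vectors for \<open>ident\<close> and \<open>adj\<close>, extension
  from a total set for tensor products and associators.

  Associators are not suppressed, so each strand picture becomes an identity between words in
  \<open>o\<^sub>L\<close>, which are kept associated to the right. Elements of A are not morphisms,
  and naturality of \<open>c\<close> does not apply to them. They are handled either through the
  morphism whose slices they are, or as plain bounded operators past which a morphism slides.

  The morphisms of A(C) constructed here are conjugations \<open>V (x \<otimes> id) (adj V)\<close>
  with isometric V. Such a formula makes sense for all bounded operators, so its extension to
  multipliers is the same formula, and coassociativity becomes a comparison of two
  unitaries.\<close>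

lemma cinner_add_left: "cinner (x + y) z = cinner x z + cinner y (z :: 'v::chilbert_space)"
  by (metis cinner_add_right cinner_commute complex_cnj_add)

lemma cinner_scaleC_left: "cinner (a *\<^sub>C x) y = cnj a * cinner x (y :: 'v::chilbert_space)"
  by (metis cinner_commute cinner_scaleC_right complex_cnj_mult)

lemma cinner_self: "cinner x x = complex_of_real ((norm (x :: 'v::chilbert_space))\<^sup>2)"
proof -
  have "Im (cinner x x) = 0"
    using arg_cong[OF cinner_commute[of x x], of Im] by simp
  then show ?thesis
    by (simp add: complex_eq_iff inner_Re_cinner[symmetric] power2_norm_eq_inner)
qed

lemma cinner_self_0 [simp]: "cinner x x = 0 \<longleftrightarrow> (x :: 'v::chilbert_space) = 0"
  by (simp add: cinner_self)

lemma cinner_Cauchy_Schwarz: "cmod (cinner x y) \<le> norm x * norm (y :: 'v::chilbert_space)"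
proof (cases "cinner x y = 0")
  case False
  \<comment> \<open>A phase that turns \<open>cinner x y\<close> into its modulus, so that the real
    Cauchy-Schwarz inequality applies to \<open>x\<close> and \<open>a *\<^sub>C y\<close>.\<close>
  define a where "a = cnj (cinner x y) / cmod (cinner x y)"
  have "cmod a = 1" using False by (simp add: a_def norm_divide)
  have "cinner x (a *\<^sub>C y) = cmod (cinner x y)"
    using False complex_norm_square[of "cinner x y"]
    by (simp add: a_def cinner_scaleC_right field_simps power2_eq_square)
  then have "cmod (cinner x y) = inner x (a *\<^sub>C y)"
    by (simp add: inner_Re_cinner)
  also have "\<dots> \<le> norm x * norm (a *\<^sub>C y)"
    by (rule norm_cauchy_schwarz)
  finally show ?thesis
    by (simp add: norm_scaleC \<open>cmod a = 1\<close>)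
qed simp

lemma bounded_bilinear_cinner: "bounded_bilinear (cinner :: 'v::chilbert_space \<Rightarrow> 'v \<Rightarrow> complex)"
proof
  show "\<exists>K. \<forall>a b. norm (cinner (a::'v) b) \<le> norm a * norm b * K"
    by (rule exI[of _ 1]) (simp add: cinner_Cauchy_Schwarz)
qed (simp_all add: cinner_add_left cinner_add_right scaleR_scaleC cinner_scaleC_left
    cinner_scaleC_right scaleR_conv_of_real)

interpretation cinner: bounded_bilinear "cinner :: 'v::chilbert_space \<Rightarrow> 'v \<Rightarrow> complex"
  by (rule bounded_bilinear_cinner)

lemma bounded_linear_scaleC: "bounded_linear (\<lambda>x::'v::chilbert_space. a *\<^sub>C x)"
  by (rule bounded_linear_intro[where K = "cmod a"])
    (simp_all add: scaleC_add_right scaleR_scaleC scaleC_scaleC norm_scaleC mult.commute)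

lemma cinner_sum_list_right:
  "cinner x (\<Sum>i\<leftarrow>l. f i) = (\<Sum>i\<leftarrow>l. cinner x (f i :: 'v::chilbert_space))"
  by (induction l) (simp_all add: cinner_add_right cinner.zero_right)

lemma scaleC_sum_list: "a *\<^sub>C (\<Sum>i\<leftarrow>l. f i) = (\<Sum>i\<leftarrow>l. a *\<^sub>C (f i :: 'v::chilbert_space))"
  by (induction l) (simp_all add: scaleC_add_right)

lemma cinner_eqI: "(\<And>z. cinner z x = cinner z y) \<Longrightarrow> x = (y :: 'v::chilbert_space)"
  by (metis cinner.diff_right cinner_self_0 right_minus_eq)

lemma Pythagoras: "cinner x y = 0 \<Longrightarrow> (norm (x + y))\<^sup>2 = (norm x)\<^sup>2 + (norm (y :: 'v::chilbert_space))\<^sup>2"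
  using cinner_commute[of x y] by (simp add: norm_add_Pythagorean orthogonal_def inner_Re_cinner)

section \<open>Closed complex subspaces and orthogonal projections\<close>

lemma subspace_closure:
  assumes "subspace (S :: 'v::real_normed_vector set)"
  shows "subspace (closure S)"
  unfolding subspace_def
proof (intro conjI ballI allI)
  show "0 \<in> closure S"
    using assms closure_subset[of S] by (auto simp: subspace_def)
next
  fix x y assume "x \<in> closure S" "y \<in> closure S"
  then obtain f g where "\<And>n. f n \<in> S" "f \<longlonglongrightarrow> x" "\<And>n. g n \<in> S" "g \<longlonglongrightarrow> y"
    unfolding closure_sequential by blast
  then show "x + y \<in> closure S"
    using assms unfolding closure_sequential subspace_def
    by (intro exI[of _ "\<lambda>n. f n + g n"]) (auto intro: tendsto_add)
next
  fix c x assume "x \<in> closure S"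
  then obtain f where "\<And>n. f n \<in> S" "f \<longlonglongrightarrow> x"
    unfolding closure_sequential by blast
  then show "c *\<^sub>R x \<in> closure S"
    using assms unfolding closure_sequential subspace_def
    by (intro exI[of _ "\<lambda>n. c *\<^sub>R f n"]) (auto intro: tendsto_intros)
qed

lemma complex_subspace_closure:
  assumes "complex_vector.subspace (S :: 'v::chilbert_space set)"
  shows "complex_vector.subspace (closure S)"
proof -
  have "subspace S"
    using assms by (auto simp: subspace_def complex_vector.subspace_def scaleR_scaleC)
  then have "subspace (closure S)" by (rule subspace_closure)
  moreover have "a *\<^sub>C x \<in> closure S" if "x \<in> closure S" for a x
  proof -
    have "(\<lambda>x. a *\<^sub>C x) ` closure S \<subseteq> closure S"
      using assms closure_subset[of S]
      by (intro image_closure_subset bounded_linear.continuous_on[OF bounded_linear_scaleC] continuous_on_id)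
        (auto simp: complex_vector.subspace_def)
    then show ?thesis using that by blast
  qed
  ultimately show ?thesis by (simp add: subspace_def complex_vector.subspace_def)
qed

lemma hilbert_subspace_closure_span: "hilbert_subspace (closure (complex_vector.span S))"
  by (simp add: hilbert_subspace_def complex_subspace_closure)

lemma cinner_closure_span_0:
  assumes "\<And>y. y \<in> S \<Longrightarrow> cinner y x = 0" and "y \<in> closure (complex_vector.span S)"
  shows "cinner y (x :: 'v::chilbert_space) = 0"
proof -
  have sub: "closed {y. cinner y x = 0}"
    by (intro closed_Collect_eq continuous_intros cinner.continuous_on) 
  have "complex_vector.span S \<subseteq> {y. cinner y x = 0}"
  proof
    fix y assume "y \<in> complex_vector.span S"
    then show "y \<in> {y. cinner y x = 0}"
      using assms(1) by (induction rule: complex_vector.span_induct_alt)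
        (auto simp: cinner_add_left cinner_scaleC_left cinner.zero_left)
  qed
  with sub assms(2) show ?thesis
    by (metis (mono_tags, lifting) closure_minimal mem_Collect_eq subsetD)
qed

text \<open>A minimizing sequence for the distance from \<open>x\<close> to \<open>H\<close> is
  Cauchy by the parallelogram law, and its limit is the foot of the perpendicular because moving it
  along \<open>h\<close> cannot shorten the distance.\<close>

lemma projection_exists:
  assumes "hilbert_subspace (H :: 'v::chilbert_space set)"
  obtains p where "p \<in> H" "\<And>h. h \<in> H \<Longrightarrow> cinner h (x - p) = 0"
proof -
  have H: "complex_vector.subspace H" "closed H" using assms by (auto simp: hilbert_subspace_def)
  have "0 \<in> H" using H(1) by (simp add: complex_vector.subspace_def)
  have scR: "r *\<^sub>R h \<in> H" if "h \<in> H" for r h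
    using that H(1) by (simp add: scaleR_scaleC complex_vector.subspace_def)
  define d where "d = infdist x H"
  have d_le: "d \<le> norm (x - h)" if "h \<in> H" for h
    using infdist_le[OF that, of x] by (simp add: d_def dist_norm)
  have "\<exists>h\<in>H. norm (x - h) < d + 1 / Suc n" for n :: nat
  proof (rule ccontr)
    assume "\<not> ?thesis"
    then have "\<And>h. h \<in> H \<Longrightarrow> d + 1 / Suc n \<le> dist x h" by (force simp: dist_norm)
    then have "d + 1 / Suc n \<le> infdist x H"
      using \<open>0 \<in> H\<close> by (auto simp: infdist_def intro!: cINF_greatest)
    then show False by (simp add: d_def)
  qed
  then obtain f where f: "\<And>n::nat. f n \<in> H" "\<And>n. norm (x - f n) < d + 1 / Suc n"
    by metis
  have d0: "d \<ge> 0" by (simp add: d_def infdist_nonneg)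
  have lim: "(\<lambda>n. norm (x - f n)) \<longlonglongrightarrow> d"
  proof (rule tendsto_sandwich[where f = "\<lambda>_. d" and h = "\<lambda>n. d + 1 / Suc n"])
    show "\<forall>\<^sub>F n in sequentially. d \<le> norm (x - f n)" using d_le f(1) by auto
    show "\<forall>\<^sub>F n in sequentially. norm (x - f n) \<le> d + 1 / real (Suc n)"
      using f(2) by (auto simp: less_imp_le)
    have "(\<lambda>n. 1 / real (Suc n)) \<longlonglongrightarrow> 0" by (rule lim_1_over_n[THEN LIMSEQ_Suc])
    from tendsto_add[OF tendsto_const[of d] this]
    show "(\<lambda>n. d + 1 / real (Suc n)) \<longlonglongrightarrow> d" by simp
  qed simp
  \<comment> \<open>Parallelogram law for \<open>x - f m\<close> and \<open>x - f n\<close>; the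
    midpoint of \<open>f m\<close> and \<open>f n\<close> lies in \<open>H\<close>, hence has
    distance at least \<open>d\<close> from \<open>x\<close>.\<close>
  have par: "(norm (f m - f n))\<^sup>2 \<le> 2 * (norm (x - f m))\<^sup>2 + 2 * (norm (x - f n))\<^sup>2 - 4 * d\<^sup>2" for m n
  proof -
    have "(1/2) *\<^sub>R (f m + f n) \<in> H"
      using f(1) scR H(1) by (simp add: complex_vector.subspace_def)
    then have "d \<le> norm (x - (1/2) *\<^sub>R (f m + f n))" by (rule d_le)
    then have le: "d\<^sup>2 \<le> (norm (x - (1/2) *\<^sub>R (f m + f n)))\<^sup>2" using d0 by (simp add: power_mono)
    have "(norm (f m - f n))\<^sup>2 = 2 * (norm (x - f m))\<^sup>2 + 2 * (norm (x - f n))\<^sup>2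
        - 4 * (norm (x - (1/2) *\<^sub>R (f m + f n)))\<^sup>2"
      by (simp add: power2_norm_eq_inner inner_diff inner_add inner_commute algebra_simps)
    with le show ?thesis by simp
  qed
  have "Cauchy f"
  proof (rule metric_CauchyI)
    fix e :: real assume e: "e > 0"
    have "(\<lambda>n. (norm (x - f n))\<^sup>2) \<longlonglongrightarrow> d\<^sup>2" using lim by (rule tendsto_power)
    moreover have "d\<^sup>2 < d\<^sup>2 + e\<^sup>2 / 4" using e by simp
    ultimately have "\<forall>\<^sub>F n in sequentially. (norm (x - f n))\<^sup>2 < d\<^sup>2 + e\<^sup>2 / 4"
      by (rule order_tendstoD(2))
    then obtain N where N: "\<And>n. n \<ge> N \<Longrightarrow> (norm (x - f n))\<^sup>2 < d\<^sup>2 + e\<^sup>2 / 4"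
      by (auto simp: eventually_sequentially)
    have "dist (f m) (f n) < e" if "m \<ge> N" "n \<ge> N" for m n
    proof -
      have "(norm (f m - f n))\<^sup>2 < e\<^sup>2" using par[of m n] N[OF that(1)] N[OF that(2)] by simp
      then show ?thesis using e by (simp add: dist_norm power_less_imp_less_base)
    qed
    then show "\<exists>M. \<forall>m\<ge>M. \<forall>n\<ge>M. dist (f m) (f n) < e" by blast
  qed
  then obtain p where p: "f \<longlonglongrightarrow> p" by (auto simp: Cauchy_convergent_iff convergent_def)
  have pH: "p \<in> H" using closed_sequentially[OF H(2)] f(1) p by blast
  have "(\<lambda>n. norm (x - f n)) \<longlonglongrightarrow> norm (x - p)" using p by (intro tendsto_intros)
  then have np: "norm (x - p) = d" using lim LIMSEQ_unique by blast
  have re0: "Re (cinner h (x - p)) = 0" if h: "h \<in> H" for h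
  proof (cases "h = 0")
    case False
    \<comment> \<open>The parameter at which \<open>norm ((x - p) - t *\<^sub>R h)\<close> is
      smallest.\<close>
    define t where "t = inner h (x - p) / (norm h)\<^sup>2"
    have "p + t *\<^sub>R h \<in> H" using pH h scR H(1) by (simp add: complex_vector.subspace_def)
    then have "d \<le> norm (x - (p + t *\<^sub>R h))" by (rule d_le)
    then have "d\<^sup>2 \<le> (norm ((x - p) - t *\<^sub>R h))\<^sup>2"
      using d0 by (simp add: power_mono diff_diff_eq)
    also have "\<dots> = d\<^sup>2 - 2 * t * inner h (x - p) + t\<^sup>2 * (norm h)\<^sup>2"
    proof -
      have "(norm (y - t *\<^sub>R h))\<^sup>2 = (norm y)\<^sup>2 - 2 * t * inner h y + t\<^sup>2 * (norm h)\<^sup>2" for y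
        unfolding power2_norm_eq_inner
        by (simp add: inner_diff_left inner_diff_right inner_commute[of y h] power2_eq_square
            right_diff_distrib del: power2_norm_eq_inner)
      then show ?thesis unfolding np[symmetric] .
    qed
    also have "\<dots> = d\<^sup>2 - (inner h (x - p))\<^sup>2 / (norm h)\<^sup>2"
      using False by (simp add: t_def field_simps power2_eq_square)
    finally have "(inner h (x - p))\<^sup>2 / (norm h)\<^sup>2 \<le> 0" by simp
    then have "(inner h (x - p))\<^sup>2 \<le> 0" using False by (simp add: divide_le_0_iff)
    then show ?thesis by (simp add: inner_Re_cinner)
  qed (simp add: cinner.zero_left)
  \<comment> \<open>The real part for \<open>\<i> *\<^sub>C h\<close> is the imaginary part for
    \<open>h\<close>.\<close>
  have "cinner h (x - p) = 0" if h: "h \<in> H" for h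
  proof -
    have "\<i> *\<^sub>C h \<in> H" using h H(1) by (simp add: complex_vector.subspace_def)
    from re0[OF this] re0[OF h] show ?thesis
      by (simp add: cinner_scaleC_left complex_eq_iff)
  qed
  with pH show ?thesis by (rule that)
qed

section \<open>Bounded operators between closed subspaces\<close>

abbreviation cperp :: "('v::chilbert_space) set \<Rightarrow> 'v \<Rightarrow> bool" where
  "cperp H x \<equiv> \<forall>h\<in>H. cinner h x = 0"

text \<open>\<open>'v op\<close> consists of real-linear maps, so complex linearity is a separate
  condition on an operator.\<close>

definition clin :: "('v::chilbert_space) op \<Rightarrow> bool" where
  "clin T \<longleftrightarrow> (\<forall>a x. T (a *\<^sub>C x) = a *\<^sub>C T x)"

lemma clin_scaleC: "clin T \<Longrightarrow> T (a *\<^sub>C x) = a *\<^sub>C T x"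
  by (simp add: clin_def)

lemma bop_clin: "T \<in> bop H K \<Longrightarrow> clin T"
  and bop_range: "T \<in> bop H K \<Longrightarrow> T x \<in> K"
  and bop_perp: "T \<in> bop H K \<Longrightarrow> cperp H x \<Longrightarrow> T x = 0"
  by (auto simp: bop_def clin_def)

lemma bopI:
  assumes "clin T" "\<And>x. T x \<in> K" "\<And>x. cperp H x \<Longrightarrow> T x = 0"
  shows "T \<in> bop H K"
  using assms by (auto simp: bop_def clin_def)

text \<open>By projection every vector is the sum of one in \<open>H\<close> and one that both
  operators kill.\<close>

lemma bop_eqI:
  assumes H: "hilbert_subspace H" and ST: "S \<in> bop H K" "T \<in> bop H K'"
    and eq: "\<And>x. x \<in> H \<Longrightarrow> S x = T x"
  shows "S = T"
proof (rule blinfun_eqI)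
  fix x
  obtain p where p: "p \<in> H" "\<And>h. h \<in> H \<Longrightarrow> cinner h (x - p) = 0"
    using projection_exists[OF H] by blast
  have "S (x - p) = 0" "T (x - p) = 0" using ST p(2) by (auto intro: bop_perp)
  then show "S x = T x" using eq[OF p(1)] by (simp add: blinfun.diff_right)
qed

text \<open>The foot of the perpendicular is unique, which makes its choice additive and
  homogeneous; Pythagoras gives the bound 1.\<close>

lemma ident_exists:
  assumes H: "hilbert_subspace (H :: 'v::chilbert_space set)"
  shows "\<exists>P. P \<in> bop H H \<and> (\<forall>x\<in>H. blinfun_apply P x = x)"
proof -
  have sub: "complex_vector.subspace H" using H by (simp add: hilbert_subspace_def)
  define p where "p x = (SOME p. p \<in> H \<and> cperp H (x - p))" for x
  have "\<exists>p. p \<in> H \<and> cperp H (x - p)" for x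
    by (rule projection_exists[OF H, of x]) blast
  from someI_ex[OF this] have p: "\<And>x. p x \<in> H" "\<And>x h. h \<in> H \<Longrightarrow> cinner h (x - p x) = 0"
    by (simp_all add: p_def)
  have uniq: "q = p x" if "q \<in> H" "cperp H (x - q)" for x q
  proof -
    have "q - p x \<in> H" using that p sub by (simp add: complex_vector.subspace_diff)
    then have "cinner (q - p x) (x - p x) = 0" "cinner (q - p x) (x - q) = 0" using that p by auto
    then have "cinner (q - p x) ((x - p x) - (x - q)) = 0" by (simp only: cinner.diff_right) simp
    then show ?thesis by simp
  qed
  have add: "p (x + y) = p x + p y" for x y
    using p sub by (intro uniq[symmetric])
      (auto simp: complex_vector.subspace_add add_diff_add cinner_add_right)
  have sc: "p (a *\<^sub>C x) = a *\<^sub>C p x" for a x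
    using p sub by (intro uniq[symmetric])
      (auto simp: complex_vector.subspace_scale complex_vector.scale_right_diff_distrib[symmetric]
        cinner_scaleC_right)
  have le: "norm (p x) \<le> norm x" for x
  proof -
    have "(norm (p x + (x - p x)))\<^sup>2 = (norm (p x))\<^sup>2 + (norm (x - p x))\<^sup>2"
      using p by (intro Pythagoras) auto
    then have "(norm (p x))\<^sup>2 \<le> (norm x)\<^sup>2" by simp
    then show ?thesis by (simp add: power_mono_iff)
  qed
  have bl: "bounded_linear p"
    using add sc le by (intro bounded_linear_intro[where K = 1]) (auto simp: scaleR_scaleC)
  have "Blinfun p \<in> bop H H"
    using p sc uniq[of 0] sub
    by (intro bopI) (auto simp: clin_def bounded_linear_Blinfun_apply[OF bl] complex_vector.subspace_0)
  moreover have "\<forall>x\<in>H. Blinfun p x = x"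
    using uniq[symmetric] by (auto simp: bounded_linear_Blinfun_apply[OF bl] cinner.zero_right)
  ultimately show ?thesis by blast
qed

lemma
  assumes H: "hilbert_subspace (H :: 'v::chilbert_space set)"
  shows ident_bop: "ident H \<in> bop H H" and ident_apply: "x \<in> H \<Longrightarrow> ident H x = x"
proof -
  have "\<exists>!P. P \<in> bop H H \<and> (\<forall>x\<in>H. blinfun_apply P x = x)"
    using ident_exists[OF H] bop_eqI[OF H] by (smt (verit, best))
  from theI'[OF this] show "ident H \<in> bop H H" "x \<in> H \<Longrightarrow> ident H x = x"
    unfolding ident_def by auto
qed

lemma bop_comp: "T \<in> bop M Z \<Longrightarrow> S \<in> bop X N \<Longrightarrow> T o\<^sub>L S \<in> bop X Z"
  by (auto simp: bop_def blinfun.zero_right)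

lemma ident_right: "hilbert_subspace H \<Longrightarrow> T \<in> bop H K \<Longrightarrow> T o\<^sub>L ident H = T"
  by (rule bop_eqI) (auto intro: bop_comp ident_bop simp: ident_apply)

lemma ident_diff_perp:
  assumes H: "hilbert_subspace H" shows "cperp H (x - ident H x)"
proof -
  obtain p where p: "p \<in> H" "\<And>h. h \<in> H \<Longrightarrow> cinner h (x - p) = 0"
    using projection_exists[OF H] by blast
  have "ident H (x - p) = 0" using ident_bop[OF H] p(2) by (auto intro: bop_perp)
  then have "ident H x = p" using ident_apply[OF H p(1)] by (simp add: blinfun.diff_right)
  with p show ?thesis by auto
qed

lemma cinner_ident_left: "hilbert_subspace H \<Longrightarrow> h \<in> H \<Longrightarrow> cinner h (ident H x) = cinner h x"
  using ident_diff_perp[of H x] by (simp add: cinner.diff_right)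

lemma norm_ident_le: "hilbert_subspace H \<Longrightarrow> norm (ident H x) \<le> norm (x :: 'v::chilbert_space)"
proof -
  assume H: "hilbert_subspace H"
  have "(norm (ident H x + (x - ident H x)))\<^sup>2 = (norm (ident H x))\<^sup>2 + (norm (x - ident H x))\<^sup>2"
    using ident_diff_perp[OF H, of x] bop_range[OF ident_bop[OF H]] by (intro Pythagoras) auto
  then have "(norm (ident H x))\<^sup>2 \<le> (norm x)\<^sup>2" by simp
  then show ?thesis by (simp add: power_mono_iff)
qed

lemma bop_apply_ident: "hilbert_subspace H \<Longrightarrow> T \<in> bop H K \<Longrightarrow> T (ident H x) = T x"
  by (metis ident_right blinfun_apply_blinfun_compose)

text \<open>The double orthogonal complement: the residual of \<open>y\<close> after projection to
  the closed span is perpendicular to \<open>S\<close>, hence to \<open>y\<close> and to the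
  projection of \<open>y\<close>, hence to itself.\<close>

lemma in_closure_spanI:
  assumes "\<And>x. cperp S x \<Longrightarrow> cinner y x = 0"
  shows "y \<in> closure (complex_vector.span (S :: 'v::chilbert_space set))"
proof -
  let ?H = "closure (complex_vector.span S)"
  obtain p where p: "p \<in> ?H" "\<And>h. h \<in> ?H \<Longrightarrow> cinner h (y - p) = 0"
    using projection_exists[OF hilbert_subspace_closure_span, of S y] by auto
  have "S \<subseteq> ?H" using closure_subset complex_vector.span_superset by blast
  then have "cinner y (y - p) = 0" using assms p by auto
  moreover have "cinner p (y - p) = 0" using p by auto
  ultimately have "cinner (y - p) (y - p) = 0" by (simp add: cinner.diff_left)
  then show ?thesis using p(1) by simp
qed

subsection \<open>Adjoints\<close>

lemma Riesz:
  assumes "bounded_linear (f :: 'v::chilbert_space \<Rightarrow> complex)" and sc: "\<And>a x. f (a *\<^sub>C x) = a * f x"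
  shows "\<exists>z. \<forall>x. cinner z x = f x"
proof (cases "\<forall>x. f x = 0")
  case True
  then show ?thesis by (intro exI[of _ 0]) (simp add: cinner.zero_left)
next
  case False
  interpret bounded_linear f by fact
  let ?N = "{x. f x = 0}"
  have "hilbert_subspace ?N"
    unfolding hilbert_subspace_def complex_vector.subspace_def
    by (auto simp: zero add sc intro!: closed_Collect_eq continuous_on)
  moreover obtain x0 where "f x0 \<noteq> 0" using False by auto
  ultimately obtain p where p: "f p = 0" "\<And>h. f h = 0 \<Longrightarrow> cinner h (x0 - p) = 0"
    using projection_exists[of ?N x0] by auto
  \<comment> \<open>\<open>u\<close> spans the complement of the kernel: subtracting
    \<open>(f x / f u) *\<^sub>C u\<close> from \<open>x\<close> lands in the kernel, which explains
    the factor in the representing vector below.\<close>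
  define u where "u = x0 - p"
  have fu: "f u \<noteq> 0" using p(1) \<open>f x0 \<noteq> 0\<close> by (simp add: u_def diff)
  have perp: "cinner u h = 0" if "f h = 0" for h
    using p(2)[OF that] cinner_commute[of u h] by (simp add: u_def)
  have "u \<noteq> 0" using fu zero by auto
  have "cinner (cnj (f u / cinner u u) *\<^sub>C u) x = f x" for x
  proof -
    have "f (x - (f x / f u) *\<^sub>C u) = 0" using fu by (simp add: diff sc)
    from perp[OF this] have "cinner u x = f x / f u * cinner u u"
      by (simp add: cinner.diff_right cinner_scaleC_right)
    then show ?thesis using fu \<open>u \<noteq> 0\<close> by (simp add: cinner_scaleC_left)
  qed
  then show ?thesis by blast
qed

text \<open>The Riesz vectors define a map \<open>S\<close>, bounded because \<open>S x\<close> can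
  be tested against itself. With uniqueness this makes the description in \<open>adj\<close>
  meaningful.\<close>

lemma cinner_adj:
  assumes T: "clin T" shows "cinner (adj T x) y = cinner x (T y)"
proof -
  have "\<exists>z. \<forall>y. cinner z y = cinner x (T y)" for x
    using T by (intro Riesz cinner.bounded_linear_right[THEN bounded_linear_compose]
        blinfun.bounded_linear_right) (simp add: clin_scaleC cinner_scaleC_right)
  then obtain S where S: "\<And>x y. cinner (S x) y = cinner x (T y)" by metis
  have uniq: "S x = z" if "\<And>y. cinner z y = cinner x (T y)" for x z
    using that S by (intro cinner_eqI) (metis cinner_commute)
  have "norm (S x) \<le> norm x * norm T" for x
  proof (cases "S x = 0")
    case False
    have "(norm (S x))\<^sup>2 = cmod (cinner (S x) (S x))" by (simp add: cinner_self norm_power)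
    also have "\<dots> \<le> norm x * norm (T (S x))" by (simp add: S cinner_Cauchy_Schwarz)
    also have "\<dots> \<le> norm x * (norm T * norm (S x))" by (intro mult_left_mono norm_blinfun) auto
    finally show ?thesis using False by (simp add: power2_eq_square)
  qed simp
  moreover have "S (x + y) = S x + S y" "S (r *\<^sub>R x) = r *\<^sub>R S x" for x y r
    by (rule uniq; simp add: cinner_add_left S scaleR_scaleC cinner_scaleC_left)+
  ultimately have bl: "bounded_linear S" by (intro bounded_linear_intro) auto
  have ex: "\<forall>x y. cinner (Blinfun S x) y = cinner x (T y)"
    by (simp add: bounded_linear_Blinfun_apply[OF bl] S)
  have "\<exists>!R. \<forall>x y. cinner (blinfun_apply R x) y = cinner x (T y)"
  proof (rule ex1I[where a = "Blinfun S"])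
    show "\<forall>x y. cinner (Blinfun S x) y = cinner x (T y)" by (fact ex)
  next
    fix R assume R: "\<forall>x y. cinner (blinfun_apply R x) y = cinner x (T y)"
    show "R = Blinfun S"
    proof (rule blinfun_eqI)
      fix x show "R x = Blinfun S x"
        using uniq[of "R x" x] R by (simp add: bounded_linear_Blinfun_apply[OF bl])
    qed
  qed
  from theI'[OF this] show ?thesis unfolding adj_def by blast
qed

lemma cinner_adj_right: "clin T \<Longrightarrow> cinner x (adj T y) = cinner (T x) y"
  by (metis cinner_adj cinner_commute)

lemma adj_eqI: "clin T \<Longrightarrow> (\<And>x y. cinner (blinfun_apply S x) y = cinner x (T y)) \<Longrightarrow> adj T = S"
  by (intro blinfun_eqI cinner_eqI) (metis cinner_adj cinner_commute)

lemma clin_adj: "clin T \<Longrightarrow> clin (adj T)"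
  unfolding clin_def[of "adj T"]
  by (intro allI cinner_eqI) (simp add: cinner_adj_right cinner_scaleC_right)

lemma adj_adj: "clin T \<Longrightarrow> adj (adj T) = T"
  by (rule adj_eqI) (simp_all add: clin_adj cinner_adj_right)

lemma clin_comp: "clin S \<Longrightarrow> clin T \<Longrightarrow> clin (S o\<^sub>L T)"
  by (simp add: clin_def)

lemma clin_add: "clin S \<Longrightarrow> clin T \<Longrightarrow> clin (S + T)"
  by (simp add: clin_def blinfun.add_left scaleC_add_right)

lemma clin_op_scale: "clin T \<Longrightarrow> clin (op_scale a T)"
  by (simp add: clin_def scaleC_scaleC mult.commute)

lemma adj_comp: "clin S \<Longrightarrow> clin T \<Longrightarrow> adj (S o\<^sub>L T) = adj T o\<^sub>L adj S"
  by (rule adj_eqI) (simp_all add: clin_comp cinner_adj)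

lemma adj_add: "clin S \<Longrightarrow> clin T \<Longrightarrow> adj (S + T) = adj S + adj T"
  by (rule adj_eqI)
    (simp_all add: clin_add cinner_adj blinfun.add_left cinner_add_left cinner_add_right)

lemma adj_op_scale: "clin T \<Longrightarrow> adj (op_scale a T) = op_scale (cnj a) (adj T)"
  by (rule adj_eqI) (simp_all add: clin_op_scale cinner_adj cinner_scaleC_left cinner_scaleC_right)

lemma adj_bop:
  assumes K: "hilbert_subspace H" and T: "T \<in> bop H K" shows "adj T \<in> bop K H"
proof (rule bopI)
  have cl: "clin T" using T by (rule bop_clin)
  then show "clin (adj T)" by (rule clin_adj)
  show "adj T x = 0" if "cperp K x" for x
    using that T cl by (intro cinner_eqI) (simp add: cinner_adj_right cinner.zero_right bop_range)
  show "adj T x \<in> H" for x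
  proof -
    \<comment> \<open>Membership in \<open>H\<close> is expressed as being fixed by the projection,
      which inner products can test.\<close>
    have "ident H (adj T x) = adj T x"
    proof (rule cinner_eqI)
      fix z
      have "cinner z (ident H (adj T x)) = cinner (ident H z) (ident H (adj T x))"
        using ident_diff_perp[OF K, of z] bop_range[OF ident_bop[OF K]] cinner_commute
        by (metis cinner.diff_left cinner.diff_right cinner_ident_left[OF K] complex_cnj_zero_iff
            right_minus_eq)
      also have "\<dots> = cinner (T (ident H z)) x"
        using cl bop_range[OF ident_bop[OF K]] by (simp add: cinner_ident_left[OF K] cinner_adj_right)
      finally show "cinner z (ident H (adj T x)) = cinner z (adj T x)"
        by (simp add: bop_apply_ident[OF K T] cinner_adj_right cl)
    qed
    then show ?thesis using bop_range[OF ident_bop[OF K]] by metis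
  qed
qed

lemma adj_ident: assumes H: "hilbert_subspace H" shows "adj (ident H) = ident H"
proof (rule bop_eqI[OF H adj_bop[OF H ident_bop[OF H]] ident_bop[OF H]])
  fix x assume x: "x \<in> H"
  show "adj (ident H) x = ident H x"
  proof (rule cinner_eqI)
    fix z
    have "cinner z (adj (ident H) x) = cnj (cinner x (ident H z))"
      using bop_clin[OF ident_bop[OF H]] by (simp add: cinner_adj_right cinner_commute[of _ x])
    also have "\<dots> = cinner z x"
      by (simp add: cinner_ident_left[OF H x] cinner_commute[of z x])
    finally show "cinner z (adj (ident H) x) = cinner z (ident H x)"
      by (simp add: ident_apply[OF H x])
  qed
qed

lemma norm_adj_le: assumes "clin T" shows "norm (adj T) \<le> norm T"
proof (rule norm_blinfun_bound)
  fix x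
  show "norm (adj T x) \<le> norm T * norm x"
  proof (cases "adj T x = 0")
    case False
    have "(norm (adj T x))\<^sup>2 = cmod (cinner (adj T x) (adj T x))" by (simp add: cinner_self norm_power)
    also have "\<dots> \<le> norm x * norm (T (adj T x))" by (simp add: cinner_adj assms cinner_Cauchy_Schwarz)
    also have "\<dots> \<le> norm x * (norm T * norm (adj T x))" by (intro mult_left_mono norm_blinfun) auto
    finally show ?thesis using False by (simp add: power2_eq_square mult.commute)
  qed simp
qed simp

lemma bop_add: "complex_vector.subspace K \<Longrightarrow> S \<in> bop H K \<Longrightarrow> T \<in> bop H K \<Longrightarrow> S + T \<in> bop H K"
  by (auto simp: bop_def blinfun.add_left scaleC_add_right complex_vector.subspace_add)

lemma bop_scale: "complex_vector.subspace K \<Longrightarrow> T \<in> bop H K \<Longrightarrow> op_scale a T \<in> bop H K"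
  by (auto simp: bop_def scaleC_scaleC mult.commute complex_vector.subspace_scale)

lemma bop_0: "complex_vector.subspace K \<Longrightarrow> 0 \<in> bop H K"
  by (auto simp: bop_def complex_vector.subspace_0)

lemma closed_bop: assumes "closed K" shows "closed (bop H K)"
proof -
  have eq: "bop H K = (\<Inter>a x. {T. blinfun_apply T (a *\<^sub>C x) - a *\<^sub>C T x = 0}) \<inter> (\<Inter>x. (\<lambda>T. blinfun_apply T x) -` K) \<inter>
    (\<Inter>x\<in>{x. cperp H x}. {T. blinfun_apply T x = 0})"
    by (auto simp: bop_def)
  have c: "continuous_on UNIV (\<lambda>T. blinfun_apply T x)" for x :: 'a
    by (intro continuous_intros)
  show ?thesis unfolding eq
    by (intro closed_Int closed_INT ballI closed_Collect_eq continuous_intros continuous_on_const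
        bounded_linear.continuous_on[OF bounded_linear_scaleC] closed_vimage[OF assms c] c)
qed

subsection \<open>Closed spans of operators\<close>

lemma op_scale_add: "op_scale a (S + T) = op_scale a S + op_scale a T"
  by (fact op_vector.scale_right_distrib)

lemma norm_op_scale: "norm (op_scale a T) \<le> cmod a * norm T"
  by (rule norm_blinfun_bound)
    (simp_all add: norm_scaleC mult.assoc mult_left_mono norm_blinfun)

lemma bounded_linear_op_scale: "bounded_linear (op_scale a :: ('v::chilbert_space) op \<Rightarrow> 'v op)"
  by (rule bounded_linear_intro[where K = "cmod a"])
    (use norm_op_scale[of a] in \<open>auto intro!: blinfun_eqI
      simp: op_scale_add blinfun.scaleR_left scaleR_scaleC scaleC_scaleC mult.commute\<close>)

lemma op_subspace_closure:
  assumes "op_vector.subspace (S :: ('v::chilbert_space) op set)"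
  shows "op_vector.subspace (closure S)"
proof -
  have "r *\<^sub>R T = op_scale (complex_of_real r) T" for r and T :: "'v op"
    by (rule blinfun_eqI) (simp add: blinfun.scaleR_left scaleR_scaleC)
  then have "subspace S"
    using assms by (auto simp: subspace_def op_vector.subspace_def)
  then have "subspace (closure S)" by (rule subspace_closure)
  moreover have "op_scale a x \<in> closure S" if "x \<in> closure S" for a x
  proof -
    have "op_scale a ` closure S \<subseteq> closure S"
      using assms closure_subset[of S]
      by (intro image_closure_subset bounded_linear.continuous_on[OF bounded_linear_op_scale] continuous_on_id)
        (auto simp: op_vector.subspace_def)
    then show ?thesis using that by blast
  qed
  ultimately show ?thesis by (simp add: subspace_def op_vector.subspace_def)
qed

lemma opspan_subspace: "op_vector.subspace (opspan S)"
  by (simp add: op_subspace_closure)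

lemma opspan_base: "x \<in> S \<Longrightarrow> x \<in> opspan S"
  using closure_subset op_vector.span_base by blast

lemma opspan_minimal: "\<lbrakk>S \<subseteq> A; op_vector.subspace A; closed A\<rbrakk> \<Longrightarrow> opspan S \<subseteq> A"
  by (simp add: closure_minimal op_vector.span_minimal)

lemma opspan_subsetI: "(\<And>x. x \<in> S \<Longrightarrow> x \<in> opspan U) \<Longrightarrow> opspan S \<subseteq> opspan U"
  by (intro opspan_minimal opspan_subspace) auto

lemma opspan_eqI:
  "(\<And>x. x \<in> S \<Longrightarrow> x \<in> opspan U) \<Longrightarrow> (\<And>x. x \<in> U \<Longrightarrow> x \<in> opspan S) \<Longrightarrow> opspan S = opspan U"
  by (intro equalityI opspan_subsetI)

lemma opspan_idem: "op_vector.subspace A \<Longrightarrow> closed A \<Longrightarrow> opspan A = A"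
  by (simp only: op_vector.span_eq_iff[THEN iffD2] closure_closed)

text \<open>The map \<open>g\<close> is the identity for linear maps and conjugation for the adjoint.\<close>

definition semilin_on :: "('v::chilbert_space) op set \<Rightarrow> ('v op \<Rightarrow> 'v op) \<Rightarrow> bool" where
  "semilin_on D f \<longleftrightarrow> op_vector.subspace D \<and> closed D \<and> (\<exists>g. (\<forall>S\<in>D. \<forall>T\<in>D. f (S + T) = f S + f T) \<and>
     (\<forall>a. \<forall>T\<in>D. f (op_scale a T) = op_scale (g a) (f T))) \<and> (\<exists>B. \<forall>T\<in>D. norm (f T) \<le> B * norm T)"

text \<open>Linearity is available only on a closed subspace \<open>D\<close>, as for
  \<open>tensop\<close>, which is controlled only for operators between the right spaces.
  Approximants of \<open>x\<close> from the span of \<open>S\<close> stay in \<open>D\<close>, where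
  additivity turns the norm bound into continuity.\<close>

lemma semilin_on_opspan:
  assumes f: "semilin_on D f" and S: "S \<subseteq> D" and U: "\<And>s. s \<in> S \<Longrightarrow> f s \<in> opspan U"
    and x: "x \<in> opspan S"
  shows "f x \<in> opspan U"
proof -
  obtain g B where D: "op_vector.subspace D" "closed D"
    and add: "\<And>S T. S \<in> D \<Longrightarrow> T \<in> D \<Longrightarrow> f (S + T) = f S + f T"
    and sc: "\<And>a T. T \<in> D \<Longrightarrow> f (op_scale a T) = op_scale (g a) (f T)"
    and B: "\<And>T. T \<in> D \<Longrightarrow> norm (f T) \<le> B * norm T"
    using f unfolding semilin_on_def by blast
  have sub: "op_vector.subspace (opspan U)" by (rule opspan_subspace)
  have span: "s \<in> D \<and> f s \<in> opspan U" if "s \<in> op_vector.span S" for s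
    using that
  proof (induction rule: op_vector.span_induct_alt)
    case base
    have "0 \<in> D" using D(1) by (simp add: op_vector.subspace_0)
    moreover have "f 0 = 0" using B[OF \<open>0 \<in> D\<close>] by simp
    ultimately show ?case using sub by (simp add: op_vector.subspace_0)
  next
    case (step c x y)
    then have "op_scale c x \<in> D" "x \<in> D" using S D(1) by (auto simp: op_vector.subspace_scale)
    with step show ?case using D(1) U sub
      by (auto simp: add sc op_vector.subspace_add op_vector.subspace_scale)
  qed
  obtain s where s: "\<And>n. s n \<in> op_vector.span S" "s \<longlonglongrightarrow> x"
    using x by (auto simp: closure_sequential)
  then have xD: "x \<in> D" using closed_sequentially[OF D(2)] span by blast
  have "(\<lambda>n. f (s n)) \<longlonglongrightarrow> f x"
  proof (rule LIM_zero_cancel, rule Lim_null_comparison)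
    show "(\<lambda>n. B * norm (s n - x)) \<longlonglongrightarrow> 0"
      using s(2) by (intro tendsto_mult_right_zero) (simp add: LIM_zero_iff tendsto_norm_zero_iff)
    have "f (s n) = f (s n - x) + f x" for n
      using add[of "s n - x" x] span[OF s(1)] xD D(1) by (simp add: op_vector.subspace_diff)
    then have "norm (f (s n) - f x) \<le> B * norm (s n - x)" for n
      using B[of "s n - x"] span[OF s(1)] xD D(1) by (metis add_diff_cancel_right' op_vector.subspace_diff)
    then show "\<forall>\<^sub>F n in sequentially. norm (f (s n) - f x) \<le> B * norm (s n - x)" by simp
  qed
  then show ?thesis using closed_sequentially[of "opspan U" "\<lambda>n. f (s n)"] span s(1) by simp
qed

lemma semilin_onI:
  assumes "op_vector.subspace D" "closed D" "\<And>S T. S \<in> D \<Longrightarrow> T \<in> D \<Longrightarrow> f (S + T) = f S + f T"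
    "\<And>a T. T \<in> D \<Longrightarrow> f (op_scale a T) = op_scale (g a) (f T)" "\<And>T. T \<in> D \<Longrightarrow> norm (f T) \<le> B * norm T"
  shows "semilin_on D f"
  unfolding semilin_on_def
  by (intro conjI assms(1,2) exI[of _ g] exI[of _ B] ballI allI assms(3-5))

lemma semilin_left: "semilin_on UNIV (\<lambda>T. T o\<^sub>L S)"
  by (rule semilin_onI[where g = "\<lambda>a. a" and B = "norm S"])
    (auto intro!: blinfun_eqI simp: blinfun.add_left mult.commute[of "norm S"] norm_blinfun_compose)

lemma clin_subspace: "op_vector.subspace {T. clin T}"
  by (auto simp: op_vector.subspace_def clin_add clin_op_scale) (simp add: clin_def)

lemma closed_clin: "closed {T. clin (T :: ('v::chilbert_space) op)}"
proof -
  have "T \<in> bop UNIV UNIV" if "clin T" for T :: "'v op"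
  proof (rule bopI[OF that])
    show "T x = 0" if "cperp UNIV x" for x
    proof -
      have "cinner x x = 0" using that by blast
      then show ?thesis by (simp add: blinfun.zero_right)
    qed
  qed simp
  then have "{T. clin T} = bop (UNIV :: 'v set) UNIV" using bop_clin by blast
  then show ?thesis by (simp add: closed_bop)
qed

lemma semilin_right: "clin S \<Longrightarrow> semilin_on UNIV (\<lambda>T. S o\<^sub>L T)"
  by (rule semilin_onI[where g = "\<lambda>a. a" and B = "norm S"])
    (auto intro!: blinfun_eqI simp: blinfun.add_left blinfun.add_right clin_scaleC norm_blinfun_compose)

lemma semilin_adj: "semilin_on {T. clin T} adj"
  by (rule semilin_onI[where g = cnj and B = 1])
    (auto simp: clin_subspace closed_clin adj_add adj_op_scale norm_adj_le)

lemma opspan_clin: "S \<subseteq> {T. clin T} \<Longrightarrow> x \<in> opspan S \<Longrightarrow> clin x"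
  using opspan_minimal[OF _ clin_subspace closed_clin] by blast

lemma opspan_comp_left:
  assumes "x \<in> opspan S" "\<And>s. s \<in> S \<Longrightarrow> s o\<^sub>L T \<in> opspan U"
  shows "x o\<^sub>L T \<in> opspan U"
  by (rule semilin_on_opspan[OF semilin_left, of S]) (use assms in auto)

lemma opspan_comp_right:
  assumes "x \<in> opspan S" "clin T" "\<And>s. s \<in> S \<Longrightarrow> T o\<^sub>L s \<in> opspan U"
  shows "T o\<^sub>L x \<in> opspan U"
  by (rule semilin_on_opspan[OF semilin_right, of T S]) (use assms in auto)

lemma opspan_comp:
  assumes "x \<in> opspan S" "y \<in> opspan T" "S \<subseteq> {T. clin T}"
    and "\<And>s t. s \<in> S \<Longrightarrow> t \<in> T \<Longrightarrow> s o\<^sub>L t \<in> opspan U"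
  shows "x o\<^sub>L y \<in> opspan U"
proof (rule opspan_comp_left[OF assms(1)])
  fix s assume "s \<in> S"
  then show "s o\<^sub>L y \<in> opspan U" using assms by (intro opspan_comp_right[OF assms(2)]) auto
qed

lemma opspan_adj:
  assumes "x \<in> opspan S" "S \<subseteq> {T. clin T}" "\<And>s. s \<in> S \<Longrightarrow> adj s \<in> opspan U"
  shows "adj x \<in> opspan U"
  by (rule semilin_on_opspan[OF semilin_adj, of S]) (use assms in auto)

text \<open>The analogue for families of operators indexed by vectors; it allows the vectors of a
  slice to range over a total set only.\<close>

lemma opspan_vec:
  fixes f :: "'v::chilbert_space \<Rightarrow> 'v op"
  assumes add: "\<And>v w. f (v + w) = f v + f w" and sc: "\<And>a v. f (a *\<^sub>C v) = op_scale (g a) (f v)"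
    and B: "\<And>v. norm (f v) \<le> B * norm v"
    and V: "\<And>v. v \<in> V \<Longrightarrow> f v \<in> opspan U" and w: "w \<in> closure (complex_vector.span V)"
  shows "f w \<in> opspan U"
proof -
  have sub: "op_vector.subspace (opspan U)" by (rule opspan_subspace)
  have "f 0 = 0" using B[of 0] by simp
  have span: "f v \<in> opspan U" if "v \<in> complex_vector.span V" for v
    using that by (induction rule: complex_vector.span_induct_alt)
      (use sub V in \<open>auto simp: \<open>f 0 = 0\<close> add sc op_vector.subspace_0 op_vector.subspace_add op_vector.subspace_scale\<close>)
  obtain s where s: "\<And>n. s n \<in> complex_vector.span V" "s \<longlonglongrightarrow> w"
    using w by (auto simp: closure_sequential)
  have "(\<lambda>n. f (s n)) \<longlonglongrightarrow> f w"
  proof (rule LIM_zero_cancel, rule Lim_null_comparison)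
    show "(\<lambda>n. B * norm (s n - w)) \<longlonglongrightarrow> 0"
      using s(2) by (intro tendsto_mult_right_zero) (simp add: LIM_zero_iff tendsto_norm_zero_iff)
    have "f (s n) = f (s n - w) + f w" for n
      using add[of "s n - w" w] by simp
    then have "norm (f (s n) - f w) \<le> B * norm (s n - w)" for n
      using B[of "s n - w"] by (metis add_diff_cancel_right')
    then show "\<forall>\<^sub>F n in sequentially. norm (f (s n) - f w) \<le> B * norm (s n - w)" by simp
  qed
  then show ?thesis using closed_sequentially[of "opspan U" "\<lambda>n. f (s n)"] span s(1) by simp
qed

subsection \<open>Finite orthonormal systems and compact operators\<close>

lift_definition rank_one :: "'v::chilbert_space \<Rightarrow> 'v \<Rightarrow> 'v op" is "\<lambda>u v x. cinner v x *\<^sub>C u"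
proof -
  fix u v :: 'v
  show "bounded_linear (\<lambda>x. cinner v x *\<^sub>C u)"
  proof (rule bounded_linear_intro[where K = "norm u * norm v"])
    show "norm (cinner v x *\<^sub>C u) \<le> norm x * (norm u * norm v)" for x
      using mult_right_mono[OF cinner_Cauchy_Schwarz[of v x], of "norm u"]
      by (simp add: norm_scaleC mult.commute mult.left_commute)
  qed (simp_all add: cinner_add_right scaleC_add_left scaleR_scaleC cinner_scaleC_right scaleC_scaleC)
qed

lemmas rank_one_apply [simp] = rank_one.rep_eq

lemma clin_rank_one: "clin (rank_one u v)"
  by (simp add: clin_def cinner_scaleC_right scaleC_scaleC)

lemma rank_one_bop: "complex_vector.subspace K \<Longrightarrow> u \<in> K \<Longrightarrow> v \<in> H \<Longrightarrow> rank_one u v \<in> bop H K"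
  by (rule bopI) (auto simp: clin_rank_one complex_vector.subspace_scale)

definition orthonormal :: "('v::chilbert_space) set \<Rightarrow> bool" where
  "orthonormal E \<longleftrightarrow> (\<forall>e\<in>E. \<forall>e'\<in>E. cinner e e' = (if e = e' then 1 else 0))"

text \<open>Gram-Schmidt. The expansions of the earlier vectors survive an induction step because
  the new unit vector is perpendicular to all of them.\<close>

lemma exists_orthonormal:
  fixes Y :: "('v::chilbert_space) set"
  assumes "finite Y" "Y \<subseteq> H" and H: "complex_vector.subspace H"
  shows "\<exists>E. finite E \<and> E \<subseteq> H \<and> orthonormal E \<and> (\<forall>y\<in>Y. y = (\<Sum>e\<in>E. cinner e y *\<^sub>C e))"
  using assms(1,2)
proof (induction rule: finite_induct)
  case empty
  then show ?case by (intro exI[of _ "{}"]) (auto simp: orthonormal_def)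
next
  case (insert y Y)
  then obtain E where E: "finite E" "E \<subseteq> H" "orthonormal E" "\<forall>y\<in>Y. y = (\<Sum>e\<in>E. cinner e y *\<^sub>C e)"
    by auto
  define z where "z = y - (\<Sum>e\<in>E. cinner e y *\<^sub>C e)"
  have zH: "z \<in> H" unfolding z_def using insert.prems E(2) H
    by (intro complex_vector.subspace_diff complex_vector.subspace_sum complex_vector.subspace_scale) auto
  have ez: "cinner e z = 0" if "e \<in> E" for e
  proof -
    have "cinner e (\<Sum>e'\<in>E. cinner e' y *\<^sub>C e') = (\<Sum>e'\<in>E. if e' = e then cinner e y else 0)"
      using E(3) that
      by (auto simp: cinner.sum_right cinner_scaleC_right orthonormal_def intro!: sum.cong)
    then show ?thesis using that E(1) by (simp add: z_def cinner.diff_right)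
  qed
  show ?case
  proof (cases "z = 0")
    case True
    then show ?thesis using E by (intro exI[of _ E]) (auto simp: z_def)
  next
    case False
    define f where "f = complex_of_real (1 / norm z) *\<^sub>C z"
    have ff: "cinner f f = 1"
      using False by (simp add: f_def cinner_self norm_scaleC norm_divide)
    have ef: "cinner e f = 0" if "e \<in> E" for e using ez[OF that] by (simp add: f_def cinner_scaleC_right)
    have fe: "cinner f e = 0" if "e \<in> E" for e using ef[OF that] by (metis cinner_commute complex_cnj_zero)
    have "f \<notin> E" using ef ff by fastforce
    have E': "orthonormal (insert f E)"
      using E(3) ef fe ff \<open>f \<notin> E\<close> by (auto simp: orthonormal_def)
    have "cinner f y *\<^sub>C f = z"
    proof -
      have "cinner f y = cinner f z + cinner f (\<Sum>e\<in>E. cinner e y *\<^sub>C e)"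
        by (simp add: z_def cinner.diff_right)
      also have "\<dots> = cinner f z" using fe by (simp add: cinner.sum_right cinner_scaleC_right)
      also have "\<dots> = norm z" using False
        by (simp add: f_def cinner_scaleC_left cinner_self power2_eq_square)
      finally show ?thesis using False by (simp add: f_def scaleC_scaleC)
    qed
    then have "y = (\<Sum>e\<in>insert f E. cinner e y *\<^sub>C e)"
      using \<open>f \<notin> E\<close> E(1) by (simp add: z_def)
    moreover have "y' = (\<Sum>e\<in>insert f E. cinner e y' *\<^sub>C e)" if "y' \<in> Y" for y'
    proof -
      have eq: "y' = (\<Sum>e\<in>E. cinner e y' *\<^sub>C e)" using E(4) that by blast
      have "cinner f y' = 0"
        by (subst eq) (use fe in \<open>simp add: cinner.sum_right cinner_scaleC_right\<close>)
      with eq show ?thesis using \<open>f \<notin> E\<close> E(1) by simp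
    qed
    moreover have "f \<in> H" using zH H by (simp add: f_def complex_vector.subspace_scale)
    ultimately show ?thesis using E E' by (intro exI[of _ "insert f E"]) auto
  qed
qed

text \<open>The residual \<open>w\<close> is perpendicular to the span of \<open>E\<close> while
  \<open>d\<close> lies in it, so Pythagoras applies to \<open>v - y\<close>.\<close>

lemma orthonormal_nearest:
  assumes "finite E" "orthonormal E" and y: "y = (\<Sum>e\<in>E. cinner e y *\<^sub>C e)"
  shows "norm (v - (\<Sum>e\<in>E. cinner e v *\<^sub>C e)) \<le> norm (v - (y :: 'v::chilbert_space))"
proof -
  define w where "w = v - (\<Sum>e\<in>E. cinner e v *\<^sub>C e)"
  have ew: "cinner e w = 0" if "e \<in> E" for e
  proof -
    have "cinner e (\<Sum>e'\<in>E. cinner e' v *\<^sub>C e') = (\<Sum>e'\<in>E. if e' = e then cinner e v else 0)"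
      using assms(2) that
      by (auto simp: cinner.sum_right cinner_scaleC_right orthonormal_def intro!: sum.cong)
    then show ?thesis using that assms(1) by (simp add: w_def cinner.diff_right)
  qed
  define d where "d = (\<Sum>e\<in>E. cinner e v *\<^sub>C e) - y"
  have "d = (\<Sum>e\<in>E. cinner e v *\<^sub>C e) - (\<Sum>e\<in>E. cinner e y *\<^sub>C e)"
    using y by (simp add: d_def)
  then have "cinner d w = 0" using ew
    by (simp add: cinner.diff_left cinner.sum_left cinner_scaleC_left)
  then have "(norm (d + w))\<^sup>2 = (norm d)\<^sup>2 + (norm w)\<^sup>2" by (rule Pythagoras)
  moreover have "d + w = v - y" by (simp add: d_def w_def)
  ultimately have "(norm w)\<^sup>2 \<le> (norm (v - y))\<^sup>2" by simp
  then show ?thesis by (simp add: w_def power_mono_iff)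
qed

lemma compact_rank_one:
  assumes K: "complex_vector.subspace K" and "u \<in> K" "v \<in> H"
  shows "rank_one u v \<in> compact_op H (K :: 'v::chilbert_space set)"
proof -
  let ?S = "(\<lambda>a. a *\<^sub>C u) ` cball 0 (norm v)"
  have lin: "bounded_linear (\<lambda>a. a *\<^sub>C u)"
    by (rule bounded_linear_intro[where K = "norm u"])
      (simp_all add: scaleC_add_left scaleR_scaleC scaleC_scaleC norm_scaleC scaleR_conv_of_real)
  have "compact ?S"
    by (intro compact_continuous_image bounded_linear.continuous_on[OF lin] continuous_on_id compact_cball)
  moreover have "rank_one u v ` {x \<in> H. norm x \<le> 1} \<subseteq> ?S"
  proof (clarsimp, intro imageI)
    fix x assume "x \<in> H" "norm x \<le> 1"
    then have "cmod (cinner v x) \<le> norm v"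
      using cinner_Cauchy_Schwarz[of v x] mult_left_le[of "norm x" "norm v"] by simp
    then show "cinner v x \<in> cball 0 (norm v)" by simp
  qed
  ultimately have "closure (rank_one u v ` {x \<in> H. norm x \<le> 1}) \<subseteq> ?S"
    by (intro closure_minimal compact_imp_closed)
  then have "compact (closure (rank_one u v ` {x \<in> H. norm x \<le> 1}))"
    using compact_Int_closed[OF \<open>compact ?S\<close> closed_closure[of "rank_one u v ` {x \<in> H. norm x \<le> 1}"]]
    by (simp only: Int_absorb1)
  then show ?thesis using assms by (simp add: compact_op_def rank_one_bop)
qed

text \<open>Finitely many small balls cover the image of the unit ball; projecting \<open>T\<close>
  onto the span of their centres changes it little and leaves a finite sum of rank one
  operators.\<close>

lemma compact_op_approx:
  assumes H: "hilbert_subspace H" and K: "hilbert_subspace K" and T: "T \<in> compact_op H K"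
  shows "T \<in> opspan {rank_one u v | u v. u \<in> K \<and> v \<in> H}"
proof -
  let ?R = "{rank_one u v | u v. u \<in> K \<and> v \<in> H}"
  have Tb: "T \<in> bop H K" and cpt: "compact (closure (T ` {x \<in> H. norm x \<le> 1}))"
    using T by (auto simp: compact_op_def)
  have "\<exists>S\<in>op_vector.span ?R. dist S T < e" if "e > 0" for e
  proof -
    \<comment> \<open>Half of \<open>e\<close>, since passing to the operator norm turns strict
      bounds on vectors into a weak one.\<close>
    have e2: "e / 2 > 0" using that by simp
    obtain Y where Y: "finite Y" "Y \<subseteq> T ` {x \<in> H. norm x \<le> 1}"
      "closure (T ` {x \<in> H. norm x \<le> 1}) \<subseteq> (\<Union>y\<in>Y. ball y (e/2))"
    proof -
      let ?C = "T ` {x \<in> H. norm x \<le> 1}"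
      have "closure ?C \<subseteq> (\<Union>y\<in>?C. ball y (e/2))"
      proof
        fix x assume "x \<in> closure ?C"
        then obtain y where "y \<in> ?C" "dist y x < e/2" using e2 unfolding closure_approachable by blast
        then show "x \<in> (\<Union>y\<in>?C. ball y (e/2))" by (intro UN_I) simp_all
      qed
      from compactE_image[OF cpt, of ?C "\<lambda>y. ball y (e/2)"] this obtain Y
        where "Y \<subseteq> ?C" "finite Y" "closure ?C \<subseteq> (\<Union>y\<in>Y. ball y (e/2))" by auto
      then show ?thesis using that by blast
    qed
    have "Y \<subseteq> K" using Y(2) Tb bop_range by blast
    then obtain E where E: "finite E" "E \<subseteq> K" "orthonormal E" "\<forall>y\<in>Y. y = (\<Sum>e\<in>E. cinner e y *\<^sub>C e)"
      using exists_orthonormal[OF Y(1), of K] K by (auto simp: hilbert_subspace_def)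
    \<comment> \<open>The projection onto the span of \<open>E\<close> after \<open>T\<close>, with
      \<open>cinner e (T x)\<close> rewritten as \<open>cinner (adj T e) x\<close>.\<close>
    define S where "S = (\<Sum>e\<in>E. rank_one e (adj T e))"
    have S_apply: "S x = (\<Sum>e\<in>E. cinner e (T x) *\<^sub>C e)" for x
      using bop_clin[OF Tb] by (simp add: S_def blinfun.sum_left cinner_adj)
    have "S \<in> op_vector.span ?R"
      unfolding S_def using E(2) bop_range[OF adj_bop[OF H Tb]]
      by (intro op_vector.span_sum op_vector.span_base) auto
    moreover have "norm (S - T) \<le> e / 2"
    proof (rule norm_blinfun_bound)
      fix x
      \<comment> \<open>The covering concerns vectors of \<open>H\<close> only; \<open>T\<close>
        does not distinguish \<open>x\<close> from its projection to \<open>H\<close>.\<close>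
      define p where "p = ident H x"
      have p: "p \<in> H" "norm p \<le> norm x" "T x = T p"
        using bop_range[OF ident_bop[OF H]] norm_ident_le[OF H] bop_apply_ident[OF H Tb]
        by (simp_all add: p_def)
      have unit: "norm (S q - T q) \<le> e / 2" if "q \<in> H" "norm q \<le> 1" for q
      proof -
        have "T q \<in> closure (T ` {x \<in> H. norm x \<le> 1})"
          using that by (intro closure_subset[THEN subsetD] imageI) simp
        then obtain y where y: "y \<in> Y" "dist y (T q) < e / 2" using Y(3) by auto
        have "norm (T q - S q) \<le> norm (T q - y)"
          unfolding S_apply using E y(1) by (intro orthonormal_nearest) auto
        then show ?thesis using y(2) by (simp add: dist_norm norm_minus_commute)
      qed
      have "norm ((S - T) p) \<le> e / 2 * norm p"
      proof (cases "p = 0")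
        case False
        let ?q = "(1 / norm p) *\<^sub>R p"
        have "?q \<in> H" using p(1) H
          by (simp add: scaleR_scaleC hilbert_subspace_def complex_vector.subspace_scale)
        from unit[OF this] False have "norm (S ?q - T ?q) \<le> e / 2" by simp
        moreover have "S ?q - T ?q = (1 / norm p) *\<^sub>R ((S - T) p)"
          by (simp add: blinfun.scaleR_right blinfun.diff_left scaleR_diff_right)
        ultimately show ?thesis using False by (simp add: field_simps del: scaleR_diff_right)
      qed simp
      also have "\<dots> \<le> e / 2 * norm x" using p(2) e2 by (intro mult_left_mono) auto
      finally show "norm ((S - T) x) \<le> e / 2 * norm x"
        by (simp add: blinfun.diff_left S_apply p(3))
    qed (use that in simp)
    ultimately show ?thesis using that by (intro bexI[of _ S]) (auto simp: dist_norm)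
  qed
  then show ?thesis by (simp add: closure_approachable)
qed

subsection \<open>Extension of isometries and tensor products\<close>

text \<open>Continuous linear extension from a total family. The norm inequality for all finite
  combinations makes the assignment well defined and at the same time carries it to the
  closure.\<close>

lemma bop_extend:
  fixes g t :: "'i \<Rightarrow> 'v::chilbert_space"
  assumes K: "hilbert_subspace K" and H: "H = closure (complex_vector.span (g ` I))"
    and t: "\<And>i. i \<in> I \<Longrightarrow> t i \<in> K"
    and le: "\<And>l :: (complex \<times> 'i) list. snd ` set l \<subseteq> I \<Longrightarrow>
       norm (\<Sum>(a, i)\<leftarrow>l. a *\<^sub>C t i) \<le> C * norm (\<Sum>(a, i)\<leftarrow>l. a *\<^sub>C g i)"
  shows "\<exists>T. T \<in> bop H K \<and> norm T \<le> \<bar>C\<bar> \<and> (\<forall>i\<in>I. blinfun_apply T (g i) = t i)"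
proof -
  \<comment> \<open>The operator is built from its graph: closing \<open>G0\<close> in the product
    space provides all limits at once, and linearity and the bound pass to the closure.\<close>
  define G0 where "G0 = {((\<Sum>(a, i)\<leftarrow>l. a *\<^sub>C g i), (\<Sum>(a, i)\<leftarrow>l. a *\<^sub>C t i)) | l. snd ` set l \<subseteq> I}"
  have G0_iff: "(x, y) \<in> G0 \<longleftrightarrow>
      (\<exists>l. snd ` set l \<subseteq> I \<and> x = (\<Sum>(a, i)\<leftarrow>l. a *\<^sub>C g i) \<and> y = (\<Sum>(a, i)\<leftarrow>l. a *\<^sub>C t i))" for x y
    unfolding G0_def by blast
  define G where "G = closure G0"
  have Hh: "hilbert_subspace H" by (simp add: H hilbert_subspace_closure_span)
  have G0_add: "(x + x', y + y') \<in> G0" if "(x, y) \<in> G0" "(x', y') \<in> G0" for x x' y y'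
  proof -
    obtain l l' where "snd ` set l \<subseteq> I" "x = (\<Sum>(a, i)\<leftarrow>l. a *\<^sub>C g i)" "y = (\<Sum>(a, i)\<leftarrow>l. a *\<^sub>C t i)"
      "snd ` set l' \<subseteq> I" "x' = (\<Sum>(a, i)\<leftarrow>l'. a *\<^sub>C g i)" "y' = (\<Sum>(a, i)\<leftarrow>l'. a *\<^sub>C t i)"
      using \<open>(x, y) \<in> G0\<close> \<open>(x', y') \<in> G0\<close> unfolding G0_iff by blast
    then show ?thesis unfolding G0_iff
      by (intro exI[of _ "l @ l'"]) (simp add: image_Un)
  qed
  have G0_scale: "(b *\<^sub>C x, b *\<^sub>C y) \<in> G0" if "(x, y) \<in> G0" for b x y
  proof -
    obtain l where "snd ` set l \<subseteq> I" "x = (\<Sum>(a, i)\<leftarrow>l. a *\<^sub>C g i)" "y = (\<Sum>(a, i)\<leftarrow>l. a *\<^sub>C t i)"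
      using \<open>(x, y) \<in> G0\<close> unfolding G0_iff by blast
    then show ?thesis unfolding G0_iff
      by (intro exI[of _ "map (\<lambda>(a, i). (b * a, i)) l"])
        (simp add: scaleC_sum_list o_def case_prod_unfold scaleC_scaleC image_image)
  qed
  have G0_le: "norm y \<le> C * norm x \<and> y \<in> K" if "(x, y) \<in> G0" for x y
  proof -
    obtain l where l: "snd ` set l \<subseteq> I" "x = (\<Sum>(a, i)\<leftarrow>l. a *\<^sub>C g i)" "y = (\<Sum>(a, i)\<leftarrow>l. a *\<^sub>C t i)"
      using \<open>(x, y) \<in> G0\<close> unfolding G0_iff by blast
    have "(\<Sum>(a, i)\<leftarrow>l. a *\<^sub>C t i) \<in> K" using l(1) t K
      by (induction l) (auto simp: hilbert_subspace_def complex_vector.subspace_0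
          complex_vector.subspace_add complex_vector.subspace_scale)
    with l le[OF l(1)] show ?thesis by simp
  qed
  have G_lim: "\<exists>f h. (\<forall>n. (f n, h n) \<in> G0) \<and> f \<longlonglongrightarrow> x \<and> h \<longlonglongrightarrow> y" if "(x, y) \<in> G" for x y
  proof -
    obtain s where s: "\<And>n. s n \<in> G0" "s \<longlonglongrightarrow> (x, y)"
      using \<open>(x, y) \<in> G\<close> unfolding G_def closure_sequential by auto
    then show ?thesis using tendsto_fst[OF s(2)] tendsto_snd[OF s(2)]
      by (intro exI[of _ "\<lambda>n. fst (s n)"] exI[of _ "\<lambda>n. snd (s n)"]) auto
  qed
  have G_limI: "(x, y) \<in> G" if "\<And>n. (f n, h n) \<in> G0" "f \<longlonglongrightarrow> x" "h \<longlonglongrightarrow> y" for f h x y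
    unfolding G_def closure_sequential using that
    by (intro exI[of _ "\<lambda>n. (f n, h n)"]) (auto intro: tendsto_Pair)
  have G_add: "(x + x', y + y') \<in> G" if "(x, y) \<in> G" "(x', y') \<in> G" for x x' y y'
  proof -
    obtain f h f' h' where "\<And>n. (f n, h n) \<in> G0" "f \<longlonglongrightarrow> x" "h \<longlonglongrightarrow> y"
       "\<And>n. (f' n, h' n) \<in> G0" "f' \<longlonglongrightarrow> x'" "h' \<longlonglongrightarrow> y'"
      using G_lim[OF \<open>(x, y) \<in> G\<close>] G_lim[OF \<open>(x', y') \<in> G\<close>] by blast
    then show ?thesis
      by (intro G_limI[where f = "\<lambda>n. f n + f' n" and h = "\<lambda>n. h n + h' n"] G0_add tendsto_add)
  qed
  have G_scale: "(b *\<^sub>C x, b *\<^sub>C y) \<in> G" if "(x, y) \<in> G" for b x y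
  proof -
    obtain f h where "\<And>n. (f n, h n) \<in> G0" "f \<longlonglongrightarrow> x" "h \<longlonglongrightarrow> y"
      using G_lim[OF \<open>(x, y) \<in> G\<close>] by blast
    then show ?thesis
      by (intro G_limI[where f = "\<lambda>n. b *\<^sub>C f n" and h = "\<lambda>n. b *\<^sub>C h n"] G0_scale
          bounded_linear.tendsto[OF bounded_linear_scaleC])
  qed
  have G_le: "norm y \<le> C * norm x \<and> y \<in> K" if "(x, y) \<in> G" for x y
  proof -
    obtain f h where fh: "\<And>n. (f n, h n) \<in> G0" "f \<longlonglongrightarrow> x" "h \<longlonglongrightarrow> y"
      using G_lim[OF \<open>(x, y) \<in> G\<close>] by blast
    have "norm y \<le> C * norm x"
      by (rule LIMSEQ_le[of "\<lambda>n. norm (h n)" _ "\<lambda>n. C * norm (f n)"])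
        (use fh G0_le in \<open>auto intro!: tendsto_intros\<close>)
    moreover have "y \<in> K"
      using closed_sequentially[of K h y] K fh G0_le by (auto simp: hilbert_subspace_def)
    ultimately show ?thesis by blast
  qed
  have G_diff: "(x - x', y - y') \<in> G" if "(x, y) \<in> G" "(x', y') \<in> G" for x x' y y'
    using G_add[OF that(1) G_scale[OF that(2), of "-1"]] by simp
  have G_unique: "y = y'" if "(x, y) \<in> G" "(x, y') \<in> G" for x y y'
    using G_le[OF G_diff[OF that]] by simp
  have G0_ex: "\<exists>y. (x, y) \<in> G0" if "x \<in> complex_vector.span (g ` I)" for x
    using that
  proof (induction rule: complex_vector.span_induct_alt)
    case base
    show ?case by (auto simp: G0_def intro!: exI[of _ 0] exI[of _ "[]"])
  next
    case (step c x y)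
    then obtain i z where "i \<in> I" "x = g i" "(y, z) \<in> G0" by auto
    moreover from this have "(c *\<^sub>C g i, c *\<^sub>C t i) \<in> G0"
      by (auto simp: G0_def intro!: exI[of _ "[(c, i)]"])
    ultimately show ?case using G0_add by blast
  qed
  have G_ex: "\<exists>y. (x, y) \<in> G" if xH: "x \<in> H" for x
  proof -
    obtain s where s: "\<And>n. s n \<in> complex_vector.span (g ` I)" "s \<longlonglongrightarrow> x"
      using xH by (auto simp: H closure_sequential)
    have "\<forall>n. \<exists>y. (s n, y) \<in> G0" using s(1) G0_ex by blast
    from choice[OF this] obtain h where h: "\<And>n. (s n, h n) \<in> G0" by blast
    have sG: "(s n, h n) \<in> G" for n using h closure_subset by (auto simp: G_def)
    have "Cauchy h"
    proof (rule metric_CauchyI)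
      fix e :: real assume e: "e > 0"
      have "Cauchy s" using s(2) by (rule LIMSEQ_imp_Cauchy)
      then obtain M where M: "\<And>m n. m \<ge> M \<Longrightarrow> n \<ge> M \<Longrightarrow> dist (s m) (s n) < e / (\<bar>C\<bar> + 1)"
        using e by (metis metric_CauchyD abs_ge_zero add_nonneg_pos divide_pos_pos zero_less_one)
      have "dist (h m) (h n) < e" if "m \<ge> M" "n \<ge> M" for m n
      proof -
        have "norm (h m - h n) \<le> C * norm (s m - s n)" using G_le[OF G_diff[OF sG sG]] by blast
        also have "\<dots> \<le> (\<bar>C\<bar> + 1) * norm (s m - s n)" by (intro mult_right_mono) auto
        also have "\<dots> < e" using M[OF that] by (simp add: dist_norm field_simps)
        finally show ?thesis by (simp add: dist_norm)
      qed
      then show "\<exists>M. \<forall>m\<ge>M. \<forall>n\<ge>M. dist (h m) (h n) < e" by blast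
    qed
    then obtain y where "h \<longlonglongrightarrow> y" by (auto simp: Cauchy_convergent_iff convergent_def)
    then show ?thesis using G_limI[OF h s(2)] by blast
  qed
  \<comment> \<open>Precomposition with the projection onto \<open>H\<close> gives the extension by
    zero that \<open>bop\<close> demands.\<close>
  define F where "F x = (THE y. (ident H x, y) \<in> G)" for x
  have F: "(ident H x, F x) \<in> G" for x
    unfolding F_def using G_ex[OF bop_range[OF ident_bop[OF Hh]]] G_unique by (metis theI)
  have F_eq: "F x = y" if "(ident H x, y) \<in> G" for x y
    using F that G_unique by blast
  have F_add: "F (x + y) = F x + F y" for x y
    by (rule F_eq) (simp add: blinfun.add_right G_add F)
  have F_scale: "F (a *\<^sub>C x) = a *\<^sub>C F x" for a x
    by (rule F_eq) (simp add: clin_scaleC[OF bop_clin[OF ident_bop[OF Hh]]] G_scale F)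
  have "norm (F x) \<le> norm x * \<bar>C\<bar>" for x
  proof -
    have "norm (F x) \<le> C * norm (ident H x)" using G_le[OF F] by blast
    also have "\<dots> \<le> \<bar>C\<bar> * norm x"
      using norm_ident_le[OF Hh, of x] by (intro mult_mono) auto
    finally show ?thesis by (simp add: mult.commute)
  qed
  note le_C = this
  then have bl: "bounded_linear F"
    by (intro bounded_linear_intro) (simp_all add: F_add scaleR_scaleC F_scale)
  have "Blinfun F \<in> bop H K"
  proof (rule bopI)
    show "clin (Blinfun F)" by (simp add: clin_def bounded_linear_Blinfun_apply[OF bl] F_scale)
    show "Blinfun F x \<in> K" for x using G_le[OF F] by (simp add: bounded_linear_Blinfun_apply[OF bl])
    show "Blinfun F x = 0" if "cperp H x" for x
      using G_le[OF F[of x]] bop_perp[OF ident_bop[OF Hh] that]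
      by (simp add: bounded_linear_Blinfun_apply[OF bl])
  qed
  moreover have "norm (Blinfun F) \<le> \<bar>C\<bar>"
    using le_C by (intro norm_blinfun_bound) (simp_all add: bounded_linear_Blinfun_apply[OF bl] mult.commute)
  moreover have "Blinfun F (g i) = t i" if "i \<in> I" for i
  proof -
    have "(g i, t i) \<in> G0" using that by (auto simp: G0_def intro!: exI[of _ "[(1, i)]"])
    then have G: "(g i, t i) \<in> G" using closure_subset by (auto simp: G_def)
    have "g i \<in> H" unfolding H
      using that by (intro closure_subset[THEN subsetD] complex_vector.span_base imageI)
    then show ?thesis using F_eq[of "g i"] G
      by (simp add: bounded_linear_Blinfun_apply[OF bl] ident_apply[OF Hh])
  qed
  ultimately show ?thesis by blast
qed

lemma cinner_sum_list_left:
  "cinner (\<Sum>i\<leftarrow>l. f i) x = (\<Sum>i\<leftarrow>l. cinner (f i) (x :: 'v::chilbert_space))"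
  by (induction l) (simp_all add: cinner_add_left cinner.zero_left)

text \<open>Equal Gram matrices give finite combinations of equal norm.\<close>

lemma bop_extend_isometry:
  fixes g t :: "'i \<Rightarrow> 'v::chilbert_space"
  assumes K: "hilbert_subspace K" and H: "H = closure (complex_vector.span (g ` I))"
    and t: "\<And>i. i \<in> I \<Longrightarrow> t i \<in> K"
    and eq: "\<And>i j. i \<in> I \<Longrightarrow> j \<in> I \<Longrightarrow> cinner (t i) (t j) = cinner (g i) (g j)"
  shows "\<exists>T. T \<in> bop H K \<and> (\<forall>i\<in>I. blinfun_apply T (g i) = t i)"
proof -
  have "\<exists>T. T \<in> bop H K \<and> norm T \<le> \<bar>1\<bar> \<and> (\<forall>i\<in>I. blinfun_apply T (g i) = t i)"
  proof (rule bop_extend[OF K H t])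
    fix l :: "(complex \<times> 'i) list" assume l: "snd ` set l \<subseteq> I"
    have sq: "cinner (\<Sum>(a, i)\<leftarrow>l. a *\<^sub>C u i) (\<Sum>(a, i)\<leftarrow>m. a *\<^sub>C u i) =
        (\<Sum>(a, i)\<leftarrow>l. \<Sum>(b, j)\<leftarrow>m. cnj a * b * cinner (u i) (u j))"
      for u :: "'i \<Rightarrow> 'v" and l m :: "(complex \<times> 'i) list"
      unfolding cinner_sum_list_left
      by (simp add: cinner_sum_list_right cinner_scaleC_left cinner_scaleC_right
        case_prod_unfold mult.assoc mult.left_commute sum_list_const_mult[symmetric])
    have "(\<Sum>(a, i)\<leftarrow>l. \<Sum>(b, j)\<leftarrow>l. cnj a * b * cinner (t i) (t j)) =
        (\<Sum>(a, i)\<leftarrow>l. \<Sum>(b, j)\<leftarrow>l. cnj a * b * cinner (g i) (g j))"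
    proof -
      have "i \<in> I" if "(a, i) \<in> set l" for a i using l that by force
      then show ?thesis using eq by (intro arg_cong[where f = sum_list] map_cong refl)
          (auto intro!: arg_cong[where f = sum_list] map_cong)
    qed
    then have "cinner (\<Sum>(a, i)\<leftarrow>l. a *\<^sub>C t i) (\<Sum>(a, i)\<leftarrow>l. a *\<^sub>C t i) =
        cinner (\<Sum>(a, i)\<leftarrow>l. a *\<^sub>C g i) (\<Sum>(a, i)\<leftarrow>l. a *\<^sub>C g i)"
      by (simp only: sq)
    then have "(norm (\<Sum>(a, i)\<leftarrow>l. a *\<^sub>C t i))\<^sup>2 = (norm (\<Sum>(a, i)\<leftarrow>l. a *\<^sub>C g i))\<^sup>2"
      unfolding cinner_self of_real_eq_iff .
    then show "norm (\<Sum>(a, i)\<leftarrow>l. a *\<^sub>C t i) \<le> 1 * norm (\<Sum>(a, i)\<leftarrow>l. a *\<^sub>C g i)"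
      by simp
  qed
  then show ?thesis by blast
qed

section \<open>Tensor products of Hilbert spaces and of bounded operators\<close>

lemma hilbert_tensor_swap: "hilbert_tensor H K T t \<Longrightarrow> hilbert_tensor K H T (\<lambda>y x. t x y)"
proof -
  have "{t y x | x y. x \<in> K \<and> y \<in> H} = {t x y | x y. x \<in> H \<and> y \<in> K}" by blast
  then show "hilbert_tensor H K T t \<Longrightarrow> hilbert_tensor K H T (\<lambda>y x. t x y)"
    by (auto simp: hilbert_tensor_def mult.commute)
qed

locale tensor =
  fixes H K T :: "('v::chilbert_space) set" and t :: "'v \<Rightarrow> 'v \<Rightarrow> 'v"
  assumes tensor: "hilbert_tensor H K T t" and H: "hilbert_subspace H" and K: "hilbert_subspace K"
begin

lemma add_left: "x \<in> H \<Longrightarrow> x' \<in> H \<Longrightarrow> y \<in> K \<Longrightarrow> t (x + x') y = t x y + t x' y"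
  and add_right: "x \<in> H \<Longrightarrow> y \<in> K \<Longrightarrow> y' \<in> K \<Longrightarrow> t x (y + y') = t x y + t x y'"
  and scale_left: "x \<in> H \<Longrightarrow> y \<in> K \<Longrightarrow> t (a *\<^sub>C x) y = a *\<^sub>C t x y"
  and scale_right: "x \<in> H \<Longrightarrow> y \<in> K \<Longrightarrow> t x (a *\<^sub>C y) = a *\<^sub>C t x y"
  and cinner: "x \<in> H \<Longrightarrow> x' \<in> H \<Longrightarrow> y \<in> K \<Longrightarrow> y' \<in> K \<Longrightarrow>
    cinner (t x y) (t x' y') = cinner x x' * cinner y y'"
  and total: "T = closure (complex_vector.span {t x y | x y. x \<in> H \<and> y \<in> K})"
  using tensor by (simp_all add: hilbert_tensor_def)

lemma subH: "complex_vector.subspace H" and subK: "complex_vector.subspace K"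
  using H K by (simp_all add: hilbert_subspace_def)

lemma zero_left: "y \<in> K \<Longrightarrow> t 0 y = 0" and zero_right: "x \<in> H \<Longrightarrow> t x 0 = 0"
  using scale_left[of 0 y 0] scale_right[of x 0 0] subH subK
  by (simp_all add: complex_vector.subspace_0)

lemma norm_tensor: "x \<in> H \<Longrightarrow> y \<in> K \<Longrightarrow> norm (t x y) = norm x * norm y"
proof -
  assume "x \<in> H" "y \<in> K"
  then have "complex_of_real ((norm (t x y))\<^sup>2) = complex_of_real ((norm x * norm y)\<^sup>2)"
    using cinner[of x x y y] by (simp add: cinner_self power_mult_distrib)
  then show ?thesis by (simp only: of_real_eq_iff) (simp add: power2_eq_iff_nonneg)
qed

lemma in_T: "x \<in> H \<Longrightarrow> y \<in> K \<Longrightarrow> t x y \<in> T"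
  unfolding total by (intro closure_subset[THEN subsetD] complex_vector.span_base) blast

lemma T: "hilbert_subspace T"
  unfolding total by (rule hilbert_subspace_closure_span)

lemma span_image: "T = closure (complex_vector.span ((\<lambda>(x, y). t x y) ` (H \<times> K)))"
proof -
  have "(\<lambda>(x, y). t x y) ` (H \<times> K) = {t x y | x y. x \<in> H \<and> y \<in> K}" by auto
  then show ?thesis using total by simp
qed

lemma perp: "(\<And>x y. x \<in> H \<Longrightarrow> y \<in> K \<Longrightarrow> cinner (t x y) w = 0) \<Longrightarrow> z \<in> T \<Longrightarrow> cinner z w = 0"
  unfolding total by (erule cinner_closure_span_0[rotated]) auto

lemma eqI:
  assumes "R \<in> bop T Z" "R' \<in> bop T Z'" "\<And>x y. x \<in> H \<Longrightarrow> y \<in> K \<Longrightarrow> R (t x y) = R' (t x y)"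
  shows "R = R'"
proof (rule bop_eqI[OF T assms(1,2)])
  fix z assume z: "z \<in> T"
  have cl: "clin (R - R')" using assms(1,2)[THEN bop_clin]
    by (simp add: clin_def blinfun.diff_left complex_vector.scale_right_diff_distrib)
  have "cinner z (adj (R - R') (R z - R' z)) = 0"
    by (rule perp[OF _ z]) (simp add: cl cinner_adj_right blinfun.diff_left assms(3) cinner.zero_left)
  then have "cinner (R z - R' z) (R z - R' z) = 0"
    by (simp add: cl cinner_adj_right blinfun.diff_left)
  then show "R z = R' z" by simp
qed

lemma sum_right:
  assumes "finite E" "\<And>e. e \<in> E \<Longrightarrow> f e \<in> K" "x \<in> H"
  shows "t x (\<Sum>e\<in>E. f e) = (\<Sum>e\<in>E. t x (f e))"
  using assms(1,2) by (induction rule: finite_induct)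
    (simp_all add: zero_right assms(3) add_right complex_vector.subspace_sum[OF subK])

lemma norm_orthonormal:
  assumes "finite E" "orthonormal E" "E \<subseteq> K" "\<And>e. e \<in> E \<Longrightarrow> w e \<in> H"
  shows "(norm (\<Sum>e\<in>E. t (w e) e))\<^sup>2 = (\<Sum>e\<in>E. (norm (w e))\<^sup>2)"
proof -
  have "cinner (\<Sum>e\<in>E. t (w e) e) (\<Sum>e\<in>E. t (w e) e) =
      (\<Sum>e\<in>E. \<Sum>e'\<in>E. cinner (w e) (w e') * cinner e e')"
    unfolding cinner.sum_left unfolding cinner.sum_right
    using assms(3,4) by (intro sum.cong refl cinner) auto
  also have "\<dots> = (\<Sum>e\<in>E. \<Sum>e'\<in>E. if e = e' then cinner (w e) (w e') else 0)"
    using assms(2) by (intro sum.cong refl) (auto simp: orthonormal_def)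
  also have "\<dots> = (\<Sum>e\<in>E. complex_of_real ((norm (w e))\<^sup>2))"
    using assms(1) by (simp add: cinner_self)
  finally show ?thesis unfolding cinner_self by (simp flip: of_real_sum of_real_power)
qed

end

text \<open>Once the second legs of a finite sum of elementary tensors are orthonormal, its squared
  norm is the sum of the squared norms of the first legs, and \<open>S\<close> can be estimated term
  by term.\<close>

lemma tensor_op_left:
  assumes t: "tensor H K T t" and t': "tensor H' K T' t'" and S: "S \<in> bop H H'"
  shows "\<exists>R. R \<in> bop T T' \<and> norm R \<le> norm S \<and> (\<forall>x\<in>H. \<forall>y\<in>K. blinfun_apply R (t x y) = t' (S x) y)"
proof -
  interpret t: tensor H K T t by fact
  interpret t': tensor H' K T' t' by fact
  have SH: "S x \<in> H'" for x using S by (rule bop_range)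
  have "\<exists>R. R \<in> bop T T' \<and> norm R \<le> \<bar>norm S\<bar> \<and>
      (\<forall>p\<in>H \<times> K. blinfun_apply R ((\<lambda>(x, y). t x y) p) = (\<lambda>(x, y). t' (S x) y) p)"
  proof (rule bop_extend[OF t'.T t.span_image])
    show "(\<lambda>(x, y). t' (S x) y) p \<in> T'" if "p \<in> H \<times> K" for p
      using that SH by (auto simp: t'.in_T)
  next
    fix l :: "(complex \<times> 'a \<times> 'a) list"
    assume l: "snd ` set l \<subseteq> H \<times> K"
    \<comment> \<open>All second legs in \<open>l\<close> are expanded in a common orthonormal
      system \<open>E\<close>; \<open>z e\<close> below collects the first legs that belong to
      \<open>e\<close>.\<close>
    define Y where "Y = (snd \<circ> snd) ` set l"
    have "finite Y" "Y \<subseteq> K" using l by (auto simp: Y_def)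
    then obtain E where E: "finite E" "E \<subseteq> K" "orthonormal E"
      and exp: "\<And>y. y \<in> Y \<Longrightarrow> y = (\<Sum>e\<in>E. cinner e y *\<^sub>C e)"
      using exists_orthonormal[OF _ _ t.subK] by metis
    define z where "z e = (\<Sum>(a, x, y)\<leftarrow>l. (a * cinner e y) *\<^sub>C x)" for e
    have zH: "z e \<in> H" for e
      unfolding z_def using l
      by (induction l) (auto simp: complex_vector.subspace_0[OF t.subH]
          intro!: complex_vector.subspace_add[OF t.subH] complex_vector.subspace_scale[OF t.subH])
    \<comment> \<open>Stated for a general tensor product and a general linear map, so that it
      serves the source with the identity and the target with \<open>S\<close>.\<close>
    have expand: "(\<Sum>(a, p)\<leftarrow>l. a *\<^sub>C (\<lambda>(x, y). r (u x) y) p) = (\<Sum>e\<in>E. r (u (z e)) e)"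
      if r: "tensor G K R r" and u: "\<And>x. x \<in> H \<Longrightarrow> u x \<in> G" "bounded_linear u" "\<And>a x. u (a *\<^sub>C x) = a *\<^sub>C u x"
      for G R r and u :: "'a \<Rightarrow> 'a"
    proof -
      interpret r: tensor G K R r by fact
      interpret u: bounded_linear u by fact
      \<comment> \<open>The induction runs over lists \<open>m\<close> of entries of
        \<open>l\<close>, while \<open>E\<close> stays the system belonging to
        \<open>l\<close>.\<close>
      have *: "(\<Sum>(a, p)\<leftarrow>m. a *\<^sub>C (\<lambda>(x, y). r (u x) y) p) =
          (\<Sum>e\<in>E. r (u (\<Sum>(a, x, y)\<leftarrow>m. (a * cinner e y) *\<^sub>C x)) e)
          \<and> (\<forall>e. (\<Sum>(a, x, y)\<leftarrow>m. (a * cinner e y) *\<^sub>C x) \<in> H)"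
        if "set m \<subseteq> set l" for m
        using that
      proof (induction m)
        case Nil
        have "(\<Sum>e\<in>E. r (u 0) e) = 0" using E(2) by (intro sum.neutral) (auto simp: u.zero r.zero_left)
        then show ?case by (simp add: complex_vector.subspace_0[OF t.subH])
      next
        case (Cons q m)
        obtain a x y where q: "q = (a, x, y)" by (cases q)
        have mem: "x \<in> H" "y \<in> K" "y \<in> Y" using Cons.prems l q by (force simp: Y_def)+
        define w where "w e = (\<Sum>(a, x, y)\<leftarrow>m. (a * cinner e y) *\<^sub>C x)" for e
        have wH: "w e \<in> H" for e using Cons by (simp add: w_def)
        have "r (u x) y = r (u x) (\<Sum>e\<in>E. cinner e y *\<^sub>C e)" using exp[OF mem(3)] by simp
        also have "\<dots> = (\<Sum>e\<in>E. cinner e y *\<^sub>C r (u x) e)"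
          using E mem u(1) r.subK by (subst r.sum_right)
            (auto intro!: sum.cong r.scale_right complex_vector.subspace_scale[OF r.subK])
        finally have "a *\<^sub>C r (u x) y = (\<Sum>e\<in>E. (a * cinner e y) *\<^sub>C r (u x) e)"
          by (simp add: complex_vector.scale_sum_right scaleC_scaleC)
        also have "\<dots> = (\<Sum>e\<in>E. r (u ((a * cinner e y) *\<^sub>C x)) e)"
          using E mem u by (intro sum.cong refl) (auto simp: r.scale_left)
        finally have 1: "a *\<^sub>C r (u x) y = (\<Sum>e\<in>E. r (u ((a * cinner e y) *\<^sub>C x)) e)" .
        have 2: "r (u ((a * cinner e y) *\<^sub>C x + w e)) e = r (u ((a * cinner e y) *\<^sub>C x)) e + r (u (w e)) e"
          if "e \<in> E" for e
          using that E mem u(1) wH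
          by (auto simp: u.add intro!: r.add_left complex_vector.subspace_scale[OF t.subH])
        show ?case using Cons 1 2 mem
          by (auto simp: q w_def[symmetric] sum.distrib
              intro!: complex_vector.subspace_add[OF t.subH] complex_vector.subspace_scale[OF t.subH] wH)
      qed
      from *[of l] show ?thesis by (simp add: z_def)
    qed
    have eg: "(\<Sum>(a, p)\<leftarrow>l. a *\<^sub>C (\<lambda>(x, y). t x y) p) = (\<Sum>e\<in>E. t (z e) e)"
      using expand[OF t, of "\<lambda>x. x"] by (simp add: bounded_linear_ident)
    have et: "(\<Sum>(a, p)\<leftarrow>l. a *\<^sub>C (\<lambda>(x, y). t' (S x) y) p) = (\<Sum>e\<in>E. t' (S (z e)) e)"
      by (rule expand[OF t']) (simp_all add: SH blinfun.bounded_linear_right clin_scaleC[OF bop_clin[OF S]])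
    have "(norm (\<Sum>e\<in>E. t' (S (z e)) e))\<^sup>2 = (\<Sum>e\<in>E. (norm (S (z e)))\<^sup>2)"
      by (rule t'.norm_orthonormal[OF E(1,3,2)]) (rule SH)
    also have "\<dots> \<le> (\<Sum>e\<in>E. (norm S)\<^sup>2 * (norm (z e))\<^sup>2)"
      using norm_blinfun by (intro sum_mono) (simp flip: power_mult_distrib add: power_mono)
    also have "\<dots> = (norm S)\<^sup>2 * (norm (\<Sum>e\<in>E. t (z e) e))\<^sup>2"
      by (subst t.norm_orthonormal[OF E(1,3,2)]) (auto simp: zH sum_distrib_left)
    finally have "(norm (\<Sum>e\<in>E. t' (S (z e)) e))\<^sup>2 \<le> (norm S * norm (\<Sum>e\<in>E. t (z e) e))\<^sup>2"
      by (simp add: power_mult_distrib)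
    then have "norm (\<Sum>e\<in>E. t' (S (z e)) e) \<le> norm S * norm (\<Sum>e\<in>E. t (z e) e)"
      by (rule power2_le_imp_le) simp
    then show "norm (\<Sum>(a, p)\<leftarrow>l. a *\<^sub>C (\<lambda>(x, y). t' (S x) y) p) \<le>
        norm S * norm (\<Sum>(a, p)\<leftarrow>l. a *\<^sub>C (\<lambda>(x, y). t x y) p)"
      by (simp only: eg et)
  qed
  then show ?thesis by auto
qed

text \<open>One leg at a time, through the tensor product \<open>M\<close> of \<open>H'\<close> and
  \<open>K\<close>; the second leg is treated by swapping the factors.\<close>

lemma tensor_op:
  assumes "tensor H K T t" and "tensor H' K' T' t'" and m: "tensor H' K M m"
    and S: "S \<in> bop H H'" and R: "R \<in> bop K K'"
  shows "\<exists>Q. Q \<in> bop T T' \<and> norm Q \<le> norm S * norm R \<and>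
    (\<forall>x\<in>H. \<forall>y\<in>K. blinfun_apply Q (t x y) = t' (S x) (R y))"
proof -
  have sw: "tensor K H' M (\<lambda>y x. m x y)" "tensor K' H' T' (\<lambda>y x. t' x y)"
    using m assms(2) by (auto simp: tensor_def hilbert_tensor_swap)
  obtain P where P: "P \<in> bop T M" "norm P \<le> norm S" "\<forall>x\<in>H. \<forall>y\<in>K. blinfun_apply P (t x y) = m (S x) y"
    using tensor_op_left[OF assms(1) m S] by blast
  obtain Q where Q: "Q \<in> bop M T'" "norm Q \<le> norm R" "\<forall>y\<in>K. \<forall>x\<in>H'. blinfun_apply Q (m x y) = t' x (R y)"
    using tensor_op_left[OF sw R] by blast
  have "norm (Q o\<^sub>L P) \<le> norm S * norm R"
    using norm_blinfun_compose[of Q P] mult_mono[OF Q(2) P(2)] by (simp add: mult.commute)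
  then show ?thesis using P Q bop_range[OF S]
    by (intro exI[of _ "Q o\<^sub>L P"]) (auto intro: bop_comp)
qed

text \<open>\<open>tket t H K x\<close> is the operator \<open>y \<mapsto> x \<otimes> y\<close>; projecting \<open>x\<close> onto \<open>H\<close> makes it linear in
  \<open>x\<close> on the whole ambient space.\<close>

definition tket :: "('v \<Rightarrow> 'v \<Rightarrow> 'v) \<Rightarrow> 'v set \<Rightarrow> 'v set \<Rightarrow> 'v \<Rightarrow> ('v::chilbert_space) op" where
  "tket t H K x = Blinfun (\<lambda>y. t (ident H x) (ident K y))"

context tensor
begin

lemma ident_H: "ident H x \<in> H" and ident_K: "ident K x \<in> K"
  using bop_range[OF ident_bop[OF H]] bop_range[OF ident_bop[OF K]] by auto

lemmas ident_scale = clin_scaleC[OF bop_clin[OF ident_bop[OF H]]] clin_scaleC[OF bop_clin[OF ident_bop[OF K]]]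

lemma bounded_linear_tket: "bounded_linear (\<lambda>y. t (ident H x) (ident K y))"
proof (rule bounded_linear_intro[where K = "norm x"])
  show "norm (t (ident H x) (ident K y)) \<le> norm y * norm x" for y
    using mult_mono[OF norm_ident_le[OF H, of x] norm_ident_le[OF K, of y]]
    by (simp add: norm_tensor ident_H ident_K mult.commute)
qed (simp_all add: blinfun.add_right add_right ident_H ident_K scaleR_scaleC ident_scale scale_right)

lemma tket_apply': "tket t H K x y = t (ident H x) (ident K y)"
  by (simp add: tket_def bounded_linear_Blinfun_apply[OF bounded_linear_tket])

lemma tket_apply: "x \<in> H \<Longrightarrow> y \<in> K \<Longrightarrow> tket t H K x y = t x y"
  by (simp add: tket_apply' ident_apply H K)

lemma tket_bop: "tket t H K x \<in> bop K T"
  by (rule bopI) (auto simp: clin_def tket_apply' ident_scale scale_right ident_H ident_K in_T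
      bop_perp[OF ident_bop[OF K]] zero_right)

lemma tket_add: "tket t H K (x + x') = tket t H K x + tket t H K x'"
  by (rule blinfun_eqI) (simp add: tket_apply' blinfun.add_left blinfun.add_right add_left ident_H ident_K)

lemma tket_scale: "tket t H K (a *\<^sub>C x) = op_scale a (tket t H K x)"
  by (rule blinfun_eqI) (simp add: tket_apply' ident_scale scale_left ident_H ident_K)

lemma norm_tket: "norm (tket t H K x) \<le> norm x"
proof (rule norm_blinfun_bound)
  show "norm (tket t H K x y) \<le> norm x * norm y" for y
    using mult_mono[OF norm_ident_le[OF H, of x] norm_ident_le[OF K, of y]]
    by (simp add: tket_apply' norm_tensor ident_H ident_K)
qed simp

lemma tket_adj_comp:
  assumes "x \<in> H" "x' \<in> H"
  shows "adj (tket t H K x) o\<^sub>L tket t H K x' = op_scale (cinner x x') (ident K)"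
proof (rule bop_eqI[OF K])
  show "adj (tket t H K x) o\<^sub>L tket t H K x' \<in> bop K K"
    by (rule bop_comp[OF adj_bop[OF K tket_bop] tket_bop])
  show "op_scale (cinner x x') (ident K) \<in> bop K K" by (intro bop_scale subK ident_bop K)
  fix y assume y: "y \<in> K"
  show "(adj (tket t H K x) o\<^sub>L tket t H K x') y = op_scale (cinner x x') (ident K) y"
  proof (rule cinner_eqI)
    fix z
    have "cinner z ((adj (tket t H K x) o\<^sub>L tket t H K x') y) = cinner (tket t H K x z) (t x' y)"
      using assms y by (simp add: cinner_adj_right[OF bop_clin[OF tket_bop]] tket_apply)
    also have "\<dots> = cinner x x' * cinner (ident K z) y"
      using assms y by (simp add: tket_apply' ident_apply[OF H] cinner ident_K)
    also have "cinner (ident K z) y = cinner z y"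
      using cinner_ident_left[OF K y, of z] by (metis cinner_commute)
    finally show "cinner z ((adj (tket t H K x) o\<^sub>L tket t H K x') y) =
        cinner z (op_scale (cinner x x') (ident K) y)"
      using y by (simp add: ident_apply[OF K] cinner_scaleC_right)
  qed
qed

end

section \<open>Calculus in a concrete monoidal category\<close>

definition lands :: "('v::chilbert_space) op \<Rightarrow> 'v set \<Rightarrow> bool" where
  "lands T K \<longleftrightarrow> (\<forall>x. T x \<in> K)"

definition vanishes :: "('v::chilbert_space) op \<Rightarrow> 'v set \<Rightarrow> bool" where
  "vanishes T H \<longleftrightarrow> (\<forall>x. cperp H x \<longrightarrow> T x = 0)"

text \<open>Splitting \<open>bop\<close> in this way makes membership of a composition syntax directed.\<close>

lemma bop_iff: "T \<in> bop H K \<longleftrightarrow> clin T \<and> lands T K \<and> vanishes T H"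
  by (auto simp: bop_def clin_def lands_def vanishes_def)

lemma lands_comp: "lands S K \<Longrightarrow> lands (S o\<^sub>L T) K"
  by (simp add: lands_def)

lemma vanishes_comp: "vanishes T H \<Longrightarrow> vanishes (S o\<^sub>L T) H"
  by (simp add: vanishes_def blinfun.zero_right)

text \<open>Allows the two halves of \<open>adj_bop\<close> to be used separately, with the whole
  space as the missing source or target.\<close>

lemma bop_UNIV: "clin T \<Longrightarrow> T \<in> bop UNIV (UNIV :: 'v::chilbert_space set)"
proof (rule bopI)
  show "T x = 0" if "cperp UNIV x" for x
  proof -
    have "cinner x x = 0" using that by blast
    then show ?thesis by (simp add: blinfun.zero_right)
  qed
qed simp_all

lemma lands_adj: "clin T \<Longrightarrow> vanishes T H \<Longrightarrow> hilbert_subspace H \<Longrightarrow> lands (adj T) H"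
  using adj_bop[of H T UNIV] by (simp add: bop_iff lands_def[of _ UNIV])

lemma vanishes_adj: "clin T \<Longrightarrow> lands T K \<Longrightarrow> vanishes (adj T) K"
  using adj_bop[of UNIV T K] bop_UNIV[of T]
  by (simp add: bop_iff hilbert_subspace_def complex_vector.subspace_UNIV)

lemma lands_add: "hilbert_subspace K \<Longrightarrow> lands S K \<Longrightarrow> lands T K \<Longrightarrow> lands (S + T) K"
  by (simp add: lands_def blinfun.add_left hilbert_subspace_def complex_vector.subspace_add)

lemma vanishes_add: "vanishes S H \<Longrightarrow> vanishes T H \<Longrightarrow> vanishes (S + T) H"
  by (simp add: vanishes_def blinfun.add_left)

lemma lands_op_scale: "hilbert_subspace K \<Longrightarrow> lands T K \<Longrightarrow> lands (op_scale a T) K"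
  by (simp add: lands_def hilbert_subspace_def complex_vector.subspace_scale)

lemma vanishes_op_scale: "vanishes T H \<Longrightarrow> vanishes (op_scale a T) H"
  by (simp add: vanishes_def)

lemma clin_ident: "hilbert_subspace H \<Longrightarrow> clin (ident H)"
  and lands_ident: "hilbert_subspace H \<Longrightarrow> lands (ident H) H"
  and vanishes_ident: "hilbert_subspace H \<Longrightarrow> vanishes (ident H) H"
  using ident_bop[of H] by (simp_all add: bop_iff)

lemma ident_comp: "lands T K \<Longrightarrow> hilbert_subspace K \<Longrightarrow> ident K o\<^sub>L T = T"
  by (intro blinfun_eqI) (simp add: ident_apply lands_def)

lemma comp_ident: "clin T \<Longrightarrow> vanishes T H \<Longrightarrow> hilbert_subspace H \<Longrightarrow> T o\<^sub>L ident H = T"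
  by (rule ident_right[where K = UNIV]) (simp_all add: bop_iff lands_def)

lemma rank_one_lands: "hilbert_subspace K \<Longrightarrow> u \<in> K \<Longrightarrow> lands (rank_one u v) K"
  by (simp add: lands_def hilbert_subspace_def complex_vector.subspace_scale)

lemma rank_one_vanishes: "v \<in> H \<Longrightarrow> vanishes (rank_one u v) H"
  by (simp add: vanishes_def)

lemmas bop_simps [simp] = bop_iff clin_comp clin_adj clin_ident clin_add clin_op_scale clin_rank_one
  lands_comp lands_adj lands_ident lands_add lands_op_scale rank_one_lands
  vanishes_comp vanishes_adj vanishes_ident vanishes_add vanishes_op_scale rank_one_vanishes
  adj_adj adj_comp adj_ident ident_comp comp_ident

lemma lands_in: "lands T K \<Longrightarrow> T x \<in> K"
  by (simp add: lands_def)

lemma blinfun_compose_assoc: "(a o\<^sub>L b) o\<^sub>L d = a o\<^sub>L (b o\<^sub>L d)"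
  by (rule blinfun_eqI) simp

text \<open>In a word associated to the right, an equation for a product of two factors applies in
  the interior only in this prolonged form.\<close>

lemma comp_reassoc: "a o\<^sub>L b = d \<Longrightarrow> a o\<^sub>L (b o\<^sub>L k) = d o\<^sub>L k"
  by (metis blinfun_compose_assoc)

lemma op_scale_comp_left: "op_scale a S o\<^sub>L T = op_scale a (S o\<^sub>L T)"
  by (rule blinfun_eqI) simp

lemma op_scale_comp_right: "clin S \<Longrightarrow> S o\<^sub>L op_scale a T = op_scale a (S o\<^sub>L T)"
  by (rule blinfun_eqI) (simp add: clin_scaleC)

context concrete_monoidal_wstar_category
begin

declare tens_Obj [simp] hilbert_subspace_Hs [simp]

abbreviation B :: "'o \<Rightarrow> 'o \<Rightarrow> 'v op set" where "B X Y \<equiv> bop (Hs \<C> X) (Hs \<C> Y)"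

lemma tens: "X \<in> Obj \<C> \<Longrightarrow> Y \<in> Obj \<C> \<Longrightarrow> tensor (Hs \<C> X) (Hs \<C> Y) (Hs \<C> (X \<otimes> Y)) (vten \<C> X Y)"
  by (simp add: tensor_def vten_tensor)

lemma vten_in [simp]: "\<lbrakk>X \<in> Obj \<C>; Y \<in> Obj \<C>; x \<in> Hs \<C> X; y \<in> Hs \<C> Y\<rbrakk> \<Longrightarrow> vten \<C> X Y x y \<in> Hs \<C> (X \<otimes> Y)"
  by (rule tensor.in_T[OF tens])

lemma idm_bop [simp]: "X \<in> Obj \<C> \<Longrightarrow> clin (idm \<C> X)" "X \<in> Obj \<C> \<Longrightarrow> lands (idm \<C> X) (Hs \<C> X)"
    "X \<in> Obj \<C> \<Longrightarrow> vanishes (idm \<C> X) (Hs \<C> X)" "X \<in> Obj \<C> \<Longrightarrow> adj (idm \<C> X) = idm \<C> X"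
  by (simp_all add: idm_def)

lemma idm_apply [simp]: "X \<in> Obj \<C> \<Longrightarrow> x \<in> Hs \<C> X \<Longrightarrow> idm \<C> X x = x"
  by (simp add: idm_def ident_apply)

lemma idm_comp [simp]: "X \<in> Obj \<C> \<Longrightarrow> lands T (Hs \<C> X) \<Longrightarrow> idm \<C> X o\<^sub>L T = T"
  and comp_idm [simp]: "X \<in> Obj \<C> \<Longrightarrow> clin T \<Longrightarrow> vanishes T (Hs \<C> X) \<Longrightarrow> T o\<^sub>L idm \<C> X = T"
  by (simp_all add: idm_def)

subsection \<open>Tensor products of operators\<close>

text \<open>Justifies the description in \<open>tensop\<close>; the norm bound is what later allows
  limits in one factor.\<close>

lemma tens_ex:
  assumes "X \<in> Obj \<C>" "X' \<in> Obj \<C>" "Y \<in> Obj \<C>" "Y' \<in> Obj \<C>" "S \<in> B X X'" "T \<in> B Y Y'"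
  shows "tensop \<C> X X' Y Y' S T \<in> B (X \<otimes> Y) (X' \<otimes> Y') \<and>
     (\<forall>x\<in>Hs \<C> X. \<forall>y\<in>Hs \<C> Y. tensop \<C> X X' Y Y' S T (vten \<C> X Y x y) = vten \<C> X' Y' (S x) (T y)) \<and>
     norm (tensop \<C> X X' Y Y' S T) \<le> norm S * norm T"
proof -
  obtain Q where Q: "Q \<in> B (X \<otimes> Y) (X' \<otimes> Y')" "norm Q \<le> norm S * norm T"
     "\<forall>x\<in>Hs \<C> X. \<forall>y\<in>Hs \<C> Y. Q (vten \<C> X Y x y) = vten \<C> X' Y' (S x) (T y)"
    using tensor_op[OF tens tens tens assms(5,6)] assms by blast
  have "tensop \<C> X X' Y Y' S T = Q"
    unfolding tensop_def using Q(1,3) tensor.eqI[OF tens[of X Y]] assms(1,3)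
    by (intro the_equality) (auto simp del: bop_iff)
  with Q show ?thesis by blast
qed

lemma tens_bop [simp]:
  assumes "X \<in> Obj \<C>" "X' \<in> Obj \<C>" "Y \<in> Obj \<C>" "Y' \<in> Obj \<C>" "S \<in> B X X'" "T \<in> B Y Y'"
  shows "clin (tensop \<C> X X' Y Y' S T)" "lands (tensop \<C> X X' Y Y' S T) (Hs \<C> (X' \<otimes> Y'))"
    "vanishes (tensop \<C> X X' Y Y' S T) (Hs \<C> (X \<otimes> Y))"
  using tens_ex[OF assms] by simp_all

lemma tens_apply [simp]:
  assumes "X \<in> Obj \<C>" "X' \<in> Obj \<C>" "Y \<in> Obj \<C>" "Y' \<in> Obj \<C>" "S \<in> B X X'" "T \<in> B Y Y'" "x \<in> Hs \<C> X" "y \<in> Hs \<C> Y"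
  shows "tensop \<C> X X' Y Y' S T (vten \<C> X Y x y) = vten \<C> X' Y' (S x) (T y)"
  using tens_ex[OF assms(1-6)] assms(7,8) by simp

lemma tens_eqI:
  assumes "X \<in> Obj \<C>" "Y \<in> Obj \<C>" "S \<in> bop (Hs \<C> (X \<otimes> Y)) K" "T \<in> bop (Hs \<C> (X \<otimes> Y)) K'"
    and "\<And>x y. x \<in> Hs \<C> X \<Longrightarrow> y \<in> Hs \<C> Y \<Longrightarrow> S (vten \<C> X Y x y) = T (vten \<C> X Y x y)"
  shows "S = T"
  by (rule tensor.eqI[OF tens[OF assms(1,2)] assms(3,4)]) (rule assms(5))

lemma vten_perp:
  assumes "X \<in> Obj \<C>" "Y \<in> Obj \<C>"
    and "\<And>x y. x \<in> Hs \<C> X \<Longrightarrow> y \<in> Hs \<C> Y \<Longrightarrow> cinner (vten \<C> X Y x y) w = 0" "z \<in> Hs \<C> (X \<otimes> Y)"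
  shows "cinner z w = 0"
  using tensor.perp[OF tens[OF assms(1,2)] assms(3,4)] .

lemma tens_comp:
  assumes "X \<in> Obj \<C>" "X' \<in> Obj \<C>" "X'' \<in> Obj \<C>" "Y \<in> Obj \<C>" "Y' \<in> Obj \<C>" "Y'' \<in> Obj \<C>"
    "S \<in> B X X'" "T \<in> B Y Y'" "S' \<in> B X' X''" "T' \<in> B Y' Y''"
  shows "tensop \<C> X' X'' Y' Y'' S' T' o\<^sub>L tensop \<C> X X' Y Y' S T = tensop \<C> X X'' Y Y'' (S' o\<^sub>L S) (T' o\<^sub>L T)"
  by (rule tens_eqI[of X Y _ "Hs \<C> (X'' \<otimes> Y'')" _ "Hs \<C> (X'' \<otimes> Y'')"])
    (use assms in \<open>simp_all add: lands_in\<close>)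

lemma tens_idm [simp]: "X \<in> Obj \<C> \<Longrightarrow> Y \<in> Obj \<C> \<Longrightarrow> tensop \<C> X X Y Y (idm \<C> X) (idm \<C> Y) = idm \<C> (X \<otimes> Y)"
  by (rule tens_eqI[of X Y _ "Hs \<C> (X \<otimes> Y)" _ "Hs \<C> (X \<otimes> Y)"]) simp_all

text \<open>Both sides take values in \<open>Hs \<C> (X \<otimes> Y)\<close>, so inner products with
  elementary tensors decide equality.\<close>

lemma tens_adj [simp]:
  assumes "X \<in> Obj \<C>" "X' \<in> Obj \<C>" "Y \<in> Obj \<C>" "Y' \<in> Obj \<C>" "S \<in> B X X'" "T \<in> B Y Y'"
  shows "adj (tensop \<C> X X' Y Y' S T) = tensop \<C> X' X Y' Y (adj S) (adj T)"
proof (rule tens_eqI[of X' Y' _ "Hs \<C> (X \<otimes> Y)" _ "Hs \<C> (X \<otimes> Y)"])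
  fix x y assume xy: "x \<in> Hs \<C> X'" "y \<in> Hs \<C> Y'"
  let ?L = "adj (tensop \<C> X X' Y Y' S T) (vten \<C> X' Y' x y)"
  let ?R = "tensop \<C> X' X Y' Y (adj S) (adj T) (vten \<C> X' Y' x y)"
  have memb: "?L \<in> Hs \<C> (X \<otimes> Y)" "?R \<in> Hs \<C> (X \<otimes> Y)" using assms by (auto intro!: lands_in)
  have eq: "cinner (vten \<C> X Y u v) ?L = cinner (vten \<C> X Y u v) ?R" if "u \<in> Hs \<C> X" "v \<in> Hs \<C> Y" for u v
    using assms xy that
    by (simp add: cinner_adj_right lands_in tensor.cinner[OF tens])
  have "cinner z (?L - ?R) = 0" if "z \<in> Hs \<C> (X \<otimes> Y)" for z
    by (rule vten_perp[OF assms(1,3) _ that]) (simp add: cinner.diff_right eq)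
  moreover have "?L - ?R \<in> Hs \<C> (X \<otimes> Y)"
    using memb assms hilbert_subspace_Hs[of "X \<otimes> Y"]
    by (auto simp: hilbert_subspace_def intro!: complex_vector.subspace_diff)
  ultimately have "cinner (?L - ?R) (?L - ?R) = 0" by blast
  then show "?L = ?R" by simp
qed (use assms in simp_all)

lemma B_subspace:
  "X \<in> Obj \<C> \<Longrightarrow> op_vector.subspace (bop H (Hs \<C> X))" "X \<in> Obj \<C> \<Longrightarrow> closed (bop H (Hs \<C> X))"
proof -
  assume "X \<in> Obj \<C>"
  then have "hilbert_subspace (Hs \<C> X)" by simp
  then show "op_vector.subspace (bop H (Hs \<C> X))" "closed (bop H (Hs \<C> X))"
    by (auto simp: hilbert_subspace_def op_vector.subspace_def bop_add bop_scale bop_0 closed_bop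
        simp del: bop_iff)
qed

lemma semilin_tens_left:
  assumes "X \<in> Obj \<C>" "X' \<in> Obj \<C>" "Y \<in> Obj \<C>" "Y' \<in> Obj \<C>" "T \<in> B Y Y'"
  shows "semilin_on (B X X') (\<lambda>S. tensop \<C> X X' Y Y' S T)"
proof (rule semilin_onI[where g = "\<lambda>a. a" and B = "norm T"])
  interpret t: tensor "Hs \<C> X'" "Hs \<C> Y'" "Hs \<C> (X' \<otimes> Y')" "vten \<C> X' Y'" by (rule tens) fact+
  show "tensop \<C> X X' Y Y' (R + S) T = tensop \<C> X X' Y Y' R T + tensop \<C> X X' Y Y' S T"
    if "R \<in> B X X'" "S \<in> B X X'" for R S
    by (rule tens_eqI[of X Y _ "Hs \<C> (X' \<otimes> Y')" _ "Hs \<C> (X' \<otimes> Y')"])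
      (use assms that in \<open>simp_all add: blinfun.add_left t.add_left lands_in\<close>)
  show "tensop \<C> X X' Y Y' (op_scale a S) T = op_scale a (tensop \<C> X X' Y Y' S T)"
    if "S \<in> B X X'" for a S
    by (rule tens_eqI[of X Y _ "Hs \<C> (X' \<otimes> Y')" _ "Hs \<C> (X' \<otimes> Y')"])
      (use assms that in \<open>simp_all add: t.scale_left lands_in\<close>)
  show "norm (tensop \<C> X X' Y Y' S T) \<le> norm T * norm S" if "S \<in> B X X'" for S
    using tens_ex[OF assms(1-4) that assms(5)] by (simp add: mult.commute)
qed (use assms in \<open>simp_all add: B_subspace del: bop_iff\<close>)

subsection \<open>Kets\<close>

definition ket :: "'o \<Rightarrow> 'o \<Rightarrow> 'v \<Rightarrow> 'v op" where
  "ket X Y x = tket (vten \<C> X Y) (Hs \<C> X) (Hs \<C> Y) x"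

text \<open>The operator \<open>x \<mapsto> x \<otimes> y\<close>, obtained from \<open>tket\<close>
  by swapping the factors; its adjoint peels off a second leg.\<close>

definition ket_right :: "'o \<Rightarrow> 'o \<Rightarrow> 'v \<Rightarrow> 'v op" where
  "ket_right X Y y = tket (\<lambda>y x. vten \<C> X Y x y) (Hs \<C> Y) (Hs \<C> X) y"

lemma tens_swap: "X \<in> Obj \<C> \<Longrightarrow> Y \<in> Obj \<C> \<Longrightarrow>
    tensor (Hs \<C> Y) (Hs \<C> X) (Hs \<C> (X \<otimes> Y)) (\<lambda>y x. vten \<C> X Y x y)"
  using tens[of X Y] by (simp add: tensor_def hilbert_tensor_swap)

lemma
  assumes "X \<in> Obj \<C>" "Y \<in> Obj \<C>"
  shows ket_bop [simp]: "clin (ket X Y x)" "lands (ket X Y x) (Hs \<C> (X \<otimes> Y))" "vanishes (ket X Y x) (Hs \<C> Y)"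
    and ket_add: "ket X Y (x + x') = ket X Y x + ket X Y x'"
    and ket_scale: "ket X Y (a *\<^sub>C x) = op_scale a (ket X Y x)"
    and norm_ket: "norm (ket X Y x) \<le> norm x"
  using tensor.tket_bop[OF tens[OF assms], of x]
  by (simp_all add: ket_def tensor.tket_add[OF tens[OF assms]] tensor.tket_scale[OF tens[OF assms]]
      tensor.norm_tket[OF tens[OF assms]])

lemma ket_apply [simp]:
  "\<lbrakk>X \<in> Obj \<C>; Y \<in> Obj \<C>; x \<in> Hs \<C> X; y \<in> Hs \<C> Y\<rbrakk> \<Longrightarrow> ket X Y x y = vten \<C> X Y x y"
  by (simp add: ket_def tensor.tket_apply[OF tens])

lemma
  assumes "X \<in> Obj \<C>" "Y \<in> Obj \<C>"
  shows ket_right_bop [simp]: "clin (ket_right X Y y)" "lands (ket_right X Y y) (Hs \<C> (X \<otimes> Y))"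
      "vanishes (ket_right X Y y) (Hs \<C> X)"
    and ket_right_apply [simp]: "x \<in> Hs \<C> X \<Longrightarrow> y \<in> Hs \<C> Y \<Longrightarrow> ket_right X Y y x = vten \<C> X Y x y"
  using tensor.tket_bop[OF tens_swap[OF assms], of y]
  by (simp_all add: ket_right_def tensor.tket_apply[OF tens_swap[OF assms]])

lemma ket_eqI:
  assumes "X \<in> Obj \<C>" "Y \<in> Obj \<C>" "S \<in> bop (Hs \<C> (X \<otimes> Y)) K" "T \<in> bop (Hs \<C> (X \<otimes> Y)) K'"
    and "\<And>x. x \<in> Hs \<C> X \<Longrightarrow> S o\<^sub>L ket X Y x = T o\<^sub>L ket X Y x"
  shows "S = T"
proof (rule tens_eqI[OF assms(1-4)])
  fix x y assume "x \<in> Hs \<C> X" "y \<in> Hs \<C> Y"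
  then show "S (vten \<C> X Y x y) = T (vten \<C> X Y x y)"
    using arg_cong[OF assms(5)[of x], of "\<lambda>R. blinfun_apply R y"] assms(1,2) by simp
qed

lemma op_eqI:
  assumes "X \<in> Obj \<C>" "S \<in> bop (Hs \<C> X) K" "T \<in> bop (Hs \<C> X) K'" "\<And>x. x \<in> Hs \<C> X \<Longrightarrow> S x = T x"
  shows "S = T"
  using bop_eqI[OF hilbert_subspace_Hs[OF assms(1)] assms(2-4)] .

text \<open>This and the next three rules move an operator on one leg across a ket or a bra;
  computations with slices are rewriting by them.\<close>

lemma tensL_ket:
  assumes "Z \<in> Obj \<C>" "Y \<in> Obj \<C>" "Y' \<in> Obj \<C>" "T \<in> B Y Y'" "x \<in> Hs \<C> Z"
  shows "tensL \<C> Z Y Y' T o\<^sub>L ket Z Y x = ket Z Y' x o\<^sub>L T"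
  by (rule op_eqI[of Y _ "Hs \<C> (Z \<otimes> Y')" _ "Hs \<C> (Z \<otimes> Y')"]) (use assms in \<open>simp_all add: lands_in\<close>)

lemma tensR_ket:
  assumes "X \<in> Obj \<C>" "X' \<in> Obj \<C>" "Y \<in> Obj \<C>" "S \<in> B X X'" "x \<in> Hs \<C> X"
  shows "tensR \<C> X X' S Y o\<^sub>L ket X Y x = ket X' Y (S x)"
  by (rule op_eqI[of Y _ "Hs \<C> (X' \<otimes> Y)" _ "Hs \<C> (X' \<otimes> Y)"]) (use assms in \<open>simp_all add: lands_in\<close>)

lemma bra_tensL:
  assumes "Z \<in> Obj \<C>" "Y \<in> Obj \<C>" "Y' \<in> Obj \<C>" "T \<in> B Y Y'" "x \<in> Hs \<C> Z"
  shows "adj (ket Z Y' x) o\<^sub>L tensL \<C> Z Y Y' T = T o\<^sub>L adj (ket Z Y x)"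
proof -
  have "adj (tensL \<C> Z Y' Y (adj T) o\<^sub>L ket Z Y' x) = adj (ket Z Y x o\<^sub>L adj T)"
    using assms by (subst tensL_ket) simp_all
  with assms show ?thesis by simp
qed

lemma bra_tensR:
  assumes "X \<in> Obj \<C>" "X' \<in> Obj \<C>" "Y \<in> Obj \<C>" "S \<in> B X X'" "x \<in> Hs \<C> X'"
  shows "adj (ket X' Y x) o\<^sub>L tensR \<C> X X' S Y = adj (ket X Y (adj S x))"
proof -
  have "adj (tensR \<C> X' X (adj S) Y o\<^sub>L ket X' Y x) = adj (ket X Y (adj S x))"
    using assms by (subst tensR_ket) simp_all
  with assms show ?thesis by simp
qed

lemma bra_ket:
  assumes "X \<in> Obj \<C>" "Y \<in> Obj \<C>" "x \<in> Hs \<C> X" "x' \<in> Hs \<C> X"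
  shows "adj (ket X Y x) o\<^sub>L ket X Y x' = op_scale (cinner x x') (idm \<C> Y)"
  using tensor.tket_adj_comp[OF tens] assms by (simp add: ket_def idm_def)

text \<open>The source of the rank one operators in products of slices: the inner ket and bra of two
  adjacent slices merge into an operator on the auxiliary leg.\<close>

lemma ket_bra:
  assumes "X \<in> Obj \<C>" "X' \<in> Obj \<C>" "Y \<in> Obj \<C>" "x \<in> Hs \<C> X" "x' \<in> Hs \<C> X'"
  shows "ket X Y x o\<^sub>L adj (ket X' Y x') = tensR \<C> X' X (rank_one x x') Y"
proof (rule ket_eqI[of X' Y _ "Hs \<C> (X \<otimes> Y)" _ "Hs \<C> (X \<otimes> Y)"])
  fix u assume u: "u \<in> Hs \<C> X'"
  have "(ket X Y x o\<^sub>L adj (ket X' Y x')) o\<^sub>L ket X' Y u = op_scale (cinner x' u) (ket X Y x)"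
    using assms u by (simp add: blinfun_compose_assoc bra_ket op_scale_comp_right)
  also have "\<dots> = tensR \<C> X' X (rank_one x x') Y o\<^sub>L ket X' Y u"
    using assms u by (subst tensR_ket) (simp_all add: ket_scale)
  finally show "(ket X Y x o\<^sub>L adj (ket X' Y x')) o\<^sub>L ket X' Y u = tensR \<C> X' X (rank_one x x') Y o\<^sub>L ket X' Y u" .
qed (use assms in simp_all)

subsection \<open>Associators\<close>

text \<open>Totality is tested by orthogonality; an adjoint \<open>ket_right\<close> reduces the
  case of three legs to that of two.\<close>

lemma tens3_span:
  assumes "X \<in> Obj \<C>" "Y \<in> Obj \<C>" "Z \<in> Obj \<C>"
  shows "Hs \<C> ((X \<otimes> Y) \<otimes> Z) = closure (complex_vector.span
    ((\<lambda>(x, y, z). vten \<C> (X \<otimes> Y) Z (vten \<C> X Y x y) z) ` (Hs \<C> X \<times> Hs \<C> Y \<times> Hs \<C> Z)))" (is "_ = ?S")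
proof
  have H: "hilbert_subspace (Hs \<C> ((X \<otimes> Y) \<otimes> Z))" using assms by simp
  show "?S \<subseteq> Hs \<C> ((X \<otimes> Y) \<otimes> Z)"
    using H assms unfolding hilbert_subspace_def
    by (intro closure_minimal complex_vector.span_minimal) auto
  show "Hs \<C> ((X \<otimes> Y) \<otimes> Z) \<subseteq> ?S"
  proof
    fix w assume w: "w \<in> Hs \<C> ((X \<otimes> Y) \<otimes> Z)"
    show "w \<in> ?S"
    proof (rule in_closure_spanI)
      fix v assume v: "cperp ((\<lambda>(x, y, z). vten \<C> (X \<otimes> Y) Z (vten \<C> X Y x y) z) ` (Hs \<C> X \<times> Hs \<C> Y \<times> Hs \<C> Z)) v"
      show "cinner w v = 0"
      proof (rule vten_perp[OF _ _ _ w])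
        fix u z assume u: "u \<in> Hs \<C> (X \<otimes> Y)" and z: "z \<in> Hs \<C> Z"
        have "cinner u (adj (ket_right (X \<otimes> Y) Z z) v) = 0"
        proof (rule vten_perp[OF assms(1,2) _ u])
          fix x y assume xy: "x \<in> Hs \<C> X" "y \<in> Hs \<C> Y"
          have "(\<lambda>(x, y, z). vten \<C> (X \<otimes> Y) Z (vten \<C> X Y x y) z) (x, y, z) \<in>
              (\<lambda>(x, y, z). vten \<C> (X \<otimes> Y) Z (vten \<C> X Y x y) z) ` (Hs \<C> X \<times> Hs \<C> Y \<times> Hs \<C> Z)"
            using xy z by (intro imageI) simp
          with v have "cinner (vten \<C> (X \<otimes> Y) Z (vten \<C> X Y x y) z) v = 0" by fastforce
          then show "cinner (vten \<C> X Y x y) (adj (ket_right (X \<otimes> Y) Z z) v) = 0"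
            using assms xy z by (simp add: cinner_adj_right)
        qed
        then show "cinner (vten \<C> (X \<otimes> Y) Z u z) v = 0"
          using assms u z by (simp add: cinner_adj_right)
      qed (use assms in simp_all)
    qed
  qed
qed

lemma tens3_eqI:
  assumes "X \<in> Obj \<C>" "Y \<in> Obj \<C>" "Z \<in> Obj \<C>"
    "S \<in> bop (Hs \<C> ((X \<otimes> Y) \<otimes> Z)) (Hs \<C> W)" "T \<in> bop (Hs \<C> ((X \<otimes> Y) \<otimes> Z)) (Hs \<C> W)"
    and eq: "\<And>x y z. x \<in> Hs \<C> X \<Longrightarrow> y \<in> Hs \<C> Y \<Longrightarrow> z \<in> Hs \<C> Z \<Longrightarrow>
      S (vten \<C> (X \<otimes> Y) Z (vten \<C> X Y x y) z) = T (vten \<C> (X \<otimes> Y) Z (vten \<C> X Y x y) z)"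
  shows "S = T"
proof (rule tens_eqI[OF _ _ assms(4,5)])
  fix w z assume w: "w \<in> Hs \<C> (X \<otimes> Y)" and z: "z \<in> Hs \<C> Z"
  have "S o\<^sub>L ket_right (X \<otimes> Y) Z z = T o\<^sub>L ket_right (X \<otimes> Y) Z z"
    by (rule tens_eqI[of X Y _ "Hs \<C> W" _ "Hs \<C> W"]) (use assms z in simp_all)
  from arg_cong[OF this, of "\<lambda>R. blinfun_apply R w"]
  show "S (vten \<C> (X \<otimes> Y) Z w z) = T (vten \<C> (X \<otimes> Y) Z w z)" using assms w z by simp
qed (use assms in simp_all)

text \<open>The elementary tensors of both bracketings have the same Gram matrix, so the isometric
  extension exists.\<close>

lemma assoc_ex:
  assumes "X \<in> Obj \<C>" "Y \<in> Obj \<C>" "Z \<in> Obj \<C>"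
  shows "assoc \<C> X Y Z \<in> B ((X \<otimes> Y) \<otimes> Z) (X \<otimes> (Y \<otimes> Z)) \<and>
    (\<forall>x\<in>Hs \<C> X. \<forall>y\<in>Hs \<C> Y. \<forall>z\<in>Hs \<C> Z. assoc \<C> X Y Z (vten \<C> (X \<otimes> Y) Z (vten \<C> X Y x y) z) =
           vten \<C> X (Y \<otimes> Z) x (vten \<C> Y Z y z))"
proof -
  have "\<exists>R. R \<in> B ((X \<otimes> Y) \<otimes> Z) (X \<otimes> (Y \<otimes> Z)) \<and> (\<forall>p\<in>Hs \<C> X \<times> Hs \<C> Y \<times> Hs \<C> Z.
      blinfun_apply R ((\<lambda>(x, y, z). vten \<C> (X \<otimes> Y) Z (vten \<C> X Y x y) z) p) =
      (\<lambda>(x, y, z). vten \<C> X (Y \<otimes> Z) x (vten \<C> Y Z y z)) p)"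
    by (rule bop_extend_isometry[OF _ tens3_span])
      (use assms in \<open>auto simp: tensor.cinner[OF tens] mult.assoc simp del: bop_iff\<close>)
  then obtain R where R: "R \<in> B ((X \<otimes> Y) \<otimes> Z) (X \<otimes> (Y \<otimes> Z))"
    "\<forall>x\<in>Hs \<C> X. \<forall>y\<in>Hs \<C> Y. \<forall>z\<in>Hs \<C> Z. R (vten \<C> (X \<otimes> Y) Z (vten \<C> X Y x y) z) =
           vten \<C> X (Y \<otimes> Z) x (vten \<C> Y Z y z)"
    by auto
  have "assoc \<C> X Y Z = R" unfolding assoc_def
  proof (rule the_equality)
    show "R \<in> B ((X \<otimes> Y) \<otimes> Z) (X \<otimes> (Y \<otimes> Z)) \<and> (\<forall>x\<in>Hs \<C> X. \<forall>y\<in>Hs \<C> Y. \<forall>z\<in>Hs \<C> Z.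
        R (vten \<C> (X \<otimes> Y) Z (vten \<C> X Y x y) z) = vten \<C> X (Y \<otimes> Z) x (vten \<C> Y Z y z))"
      using R by blast
    fix S assume S: "S \<in> B ((X \<otimes> Y) \<otimes> Z) (X \<otimes> (Y \<otimes> Z)) \<and> (\<forall>x\<in>Hs \<C> X. \<forall>y\<in>Hs \<C> Y. \<forall>z\<in>Hs \<C> Z.
        blinfun_apply S (vten \<C> (X \<otimes> Y) Z (vten \<C> X Y x y) z) = vten \<C> X (Y \<otimes> Z) x (vten \<C> Y Z y z))"
    show "S = R"
      by (rule tens3_eqI[OF assms, of _ "X \<otimes> (Y \<otimes> Z)"]) (use R S in \<open>auto simp del: bop_iff\<close>)
  qed
  with R show ?thesis by blast
qed

lemma assoc_bop [simp]:
  assumes "X \<in> Obj \<C>" "Y \<in> Obj \<C>" "Z \<in> Obj \<C>"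
  shows "clin (assoc \<C> X Y Z)" "lands (assoc \<C> X Y Z) (Hs \<C> (X \<otimes> (Y \<otimes> Z)))"
    "vanishes (assoc \<C> X Y Z) (Hs \<C> ((X \<otimes> Y) \<otimes> Z))"
  using assoc_ex[OF assms] by simp_all

lemma assoc_apply [simp]:
  assumes "X \<in> Obj \<C>" "Y \<in> Obj \<C>" "Z \<in> Obj \<C>" "x \<in> Hs \<C> X" "y \<in> Hs \<C> Y" "z \<in> Hs \<C> Z"
  shows "assoc \<C> X Y Z (vten \<C> (X \<otimes> Y) Z (vten \<C> X Y x y) z) = vten \<C> X (Y \<otimes> Z) x (vten \<C> Y Z y z)"
  using assoc_ex[OF assms(1-3)] assms(4-6) by simp

lemma assoc_ket:
  assumes "X \<in> Obj \<C>" "Y \<in> Obj \<C>" "Z \<in> Obj \<C>" "x \<in> Hs \<C> X" "y \<in> Hs \<C> Y"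
  shows "assoc \<C> X Y Z o\<^sub>L ket (X \<otimes> Y) Z (vten \<C> X Y x y) = ket X (Y \<otimes> Z) x o\<^sub>L ket Y Z y"
  by (rule op_eqI[of Z _ "Hs \<C> (X \<otimes> Y \<otimes> Z)" _ "Hs \<C> (X \<otimes> Y \<otimes> Z)"]) (use assms in simp_all)

lemma assoc_tensR_ket:
  assumes "X \<in> Obj \<C>" "Y \<in> Obj \<C>" "Z \<in> Obj \<C>" "x \<in> Hs \<C> X"
  shows "assoc \<C> X Y Z o\<^sub>L tensR \<C> Y (X \<otimes> Y) (ket X Y x) Z = ket X (Y \<otimes> Z) x"
  by (rule tens_eqI[of Y Z _ "Hs \<C> (X \<otimes> Y \<otimes> Z)" _ "Hs \<C> (X \<otimes> Y \<otimes> Z)"]) (use assms in simp_all)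

text \<open>For an isometry \<open>U\<close> the defect \<open>y - U (adj U y)\<close> is
  annihilated by \<open>adj U\<close>, so injectivity of \<open>adj U\<close> forces it to
  vanish.\<close>

lemma unitaryI:
  assumes X: "X \<in> Obj \<C>" and Y: "Y \<in> Obj \<C>" and U: "U \<in> B X Y"
    and iso: "adj U o\<^sub>L U = idm \<C> X"
    and total: "\<And>y. y \<in> Hs \<C> Y \<Longrightarrow> adj U y = 0 \<Longrightarrow> y = 0"
  shows "U o\<^sub>L adj U = idm \<C> Y"
proof (rule op_eqI[OF Y, of _ "Hs \<C> Y" _ "Hs \<C> Y"])
  fix y assume y: "y \<in> Hs \<C> Y"
  let ?w = "y - U (adj U y)"
  have "adj U (U (adj U y)) = adj U y"
    using arg_cong[OF iso, of "\<lambda>R. blinfun_apply R (adj U y)"] X U by (simp add: lands_in)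
  then have "adj U ?w = 0" by (simp add: blinfun.diff_right)
  moreover have "?w \<in> Hs \<C> Y"
    using y U hilbert_subspace_Hs[OF Y]
    by (auto simp: hilbert_subspace_def lands_in intro!: complex_vector.subspace_diff)
  ultimately have "?w = 0" using total by blast
  then show "(U o\<^sub>L adj U) y = idm \<C> Y y" using y Y by simp
qed (use X Y U in simp_all)

lemma assoc_adj_comp: 
  assumes "X \<in> Obj \<C>" "Y \<in> Obj \<C>" "Z \<in> Obj \<C>"
  shows "adj (assoc \<C> X Y Z) o\<^sub>L assoc \<C> X Y Z = idm \<C> ((X \<otimes> Y) \<otimes> Z)" (is "?L = _")
proof (rule tens3_eqI[OF assms, of _ "(X \<otimes> Y) \<otimes> Z"])
  fix x y z assume xyz: "x \<in> Hs \<C> X" "y \<in> Hs \<C> Y" "z \<in> Hs \<C> Z"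
  let ?v = "vten \<C> (X \<otimes> Y) Z (vten \<C> X Y x y) z"
  have "cinner w (?L ?v - ?v) = 0" if "w \<in> Hs \<C> ((X \<otimes> Y) \<otimes> Z)" for w
  proof (rule cinner_closure_span_0)
    show "w \<in> closure (complex_vector.span
      ((\<lambda>(x, y, z). vten \<C> (X \<otimes> Y) Z (vten \<C> X Y x y) z) ` (Hs \<C> X \<times> Hs \<C> Y \<times> Hs \<C> Z)))"
      using that tens3_span[OF assms] by simp
    show "cinner u (?L ?v - ?v) = 0"
      if "u \<in> (\<lambda>(x, y, z). vten \<C> (X \<otimes> Y) Z (vten \<C> X Y x y) z) ` (Hs \<C> X \<times> Hs \<C> Y \<times> Hs \<C> Z)" for u
      using that assms xyz
      by (auto simp: cinner.diff_right cinner_adj_right tensor.cinner[OF tens] mult.assoc)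
  qed
  moreover have "?L ?v - ?v \<in> Hs \<C> ((X \<otimes> Y) \<otimes> Z)"
    using assms xyz hilbert_subspace_Hs[of "(X \<otimes> Y) \<otimes> Z"]
    by (auto simp: hilbert_subspace_def lands_in intro!: complex_vector.subspace_diff)
  ultimately have "cinner (?L ?v - ?v) (?L ?v - ?v) = 0" by blast
  then show "?L ?v = idm \<C> ((X \<otimes> Y) \<otimes> Z) ?v" using assms xyz by simp
qed (use assms in simp_all)

lemma assoc_comp_adj:
  assumes "X \<in> Obj \<C>" "Y \<in> Obj \<C>" "Z \<in> Obj \<C>"
  shows "assoc \<C> X Y Z o\<^sub>L adj (assoc \<C> X Y Z) = idm \<C> (X \<otimes> (Y \<otimes> Z))"
proof (rule unitaryI[OF _ _ _ assoc_adj_comp[OF assms]])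
  fix w assume w: "w \<in> Hs \<C> (X \<otimes> (Y \<otimes> Z))" "adj (assoc \<C> X Y Z) w = 0"
  have "cinner u w = 0" if u: "u \<in> Hs \<C> (X \<otimes> (Y \<otimes> Z))" for u
  proof (rule vten_perp[OF _ _ _ u])
    fix x v assume x: "x \<in> Hs \<C> X" and v: "v \<in> Hs \<C> (Y \<otimes> Z)"
    have "cinner v (adj (ket X (Y \<otimes> Z) x) w) = 0"
    proof (rule vten_perp[OF _ _ _ v])
      fix y z assume "y \<in> Hs \<C> Y" "z \<in> Hs \<C> Z"
      then have "cinner (vten \<C> X (Y \<otimes> Z) x (vten \<C> Y Z y z)) w =
          cinner (vten \<C> (X \<otimes> Y) Z (vten \<C> X Y x y) z) (adj (assoc \<C> X Y Z) w)"
        using assms x by (simp add: cinner_adj_right)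
      then show "cinner (vten \<C> Y Z y z) (adj (ket X (Y \<otimes> Z) x) w) = 0"
        using assms x w \<open>y \<in> Hs \<C> Y\<close> \<open>z \<in> Hs \<C> Z\<close> by (simp add: cinner_adj_right cinner.zero_right)
    qed (use assms in simp_all)
    then show "cinner (vten \<C> X (Y \<otimes> Z) x v) w = 0" using assms x v by (simp add: cinner_adj_right)
  qed (use assms in simp_all)
  with w have "cinner w w = 0" by blast
  then show "w = 0" by simp
qed (use assms in simp_all)

lemma inv_op_unitary:
  assumes "X \<in> Obj \<C>" "Y \<in> Obj \<C>" "U \<in> B X Y" "adj U o\<^sub>L U = idm \<C> X" "U o\<^sub>L adj U = idm \<C> Y"
  shows "invm \<C> X Y U = adj U"
  unfolding invm_def inv_op_def
proof (rule the_equality)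
  show "adj U \<in> B Y X \<and> adj U o\<^sub>L U = ident (Hs \<C> X) \<and> U o\<^sub>L adj U = ident (Hs \<C> Y)"
    using assms by (simp add: idm_def)
  fix S assume S: "S \<in> B Y X \<and> S o\<^sub>L U = ident (Hs \<C> X) \<and> U o\<^sub>L S = ident (Hs \<C> Y)"
  have "S = S o\<^sub>L (U o\<^sub>L adj U)" using assms S by simp
  also have "\<dots> = (S o\<^sub>L U) o\<^sub>L adj U" by (rule blinfun_compose_assoc[symmetric])
  also have "\<dots> = adj U" using assms S by simp
  finally show "S = adj U" .
qed

lemma assoc_inv [simp]:
  assumes "X \<in> Obj \<C>" "Y \<in> Obj \<C>" "Z \<in> Obj \<C>"
  shows "assoc_inv \<C> X Y Z = adj (assoc \<C> X Y Z)"
  unfolding assoc_inv_def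
  by (rule inv_op_unitary) (use assms assoc_adj_comp assoc_comp_adj in simp_all)

lemma assoc_natural:
  assumes "X \<in> Obj \<C>" "Y \<in> Obj \<C>" "Z \<in> Obj \<C>" "X' \<in> Obj \<C>" "Y' \<in> Obj \<C>" "Z' \<in> Obj \<C>"
    "R \<in> B X X'" "S \<in> B Y Y'" "T \<in> B Z Z'"
  shows "assoc \<C> X' Y' Z' o\<^sub>L tensop \<C> (X \<otimes> Y) (X' \<otimes> Y') Z Z' (tensop \<C> X X' Y Y' R S) T =
    tensop \<C> X X' (Y \<otimes> Z) (Y' \<otimes> Z') R (tensop \<C> Y Y' Z Z' S T) o\<^sub>L assoc \<C> X Y Z"
  by (rule tens3_eqI[of X Y Z _ "X' \<otimes> Y' \<otimes> Z'"]) (use assms in \<open>simp_all add: lands_in\<close>)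

end

lemma semilin_comp:
  assumes f: "semilin_on D f" and g: "semilin_on UNIV g"
  shows "semilin_on D (\<lambda>x. g (f x))"
proof -
  obtain a A where D: "op_vector.subspace D" "closed D"
    and f: "\<And>S T. S \<in> D \<Longrightarrow> T \<in> D \<Longrightarrow> f (S + T) = f S + f T"
    "\<And>r T. T \<in> D \<Longrightarrow> f (op_scale r T) = op_scale (a r) (f T)" "\<And>T. T \<in> D \<Longrightarrow> norm (f T) \<le> A * norm T"
    using f unfolding semilin_on_def by blast
  obtain b B where g: "\<And>S T. g (S + T) = g S + g T"
    "\<And>r T. g (op_scale r T) = op_scale (b r) (g T)" "\<And>T. norm (g T) \<le> B * norm T"
    using g unfolding semilin_on_def by blast
  show ?thesis
  proof (rule semilin_onI[OF D, where g = "\<lambda>r. b (a r)" and B = "\<bar>B\<bar> * A"])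
    fix T assume "T \<in> D"
    have "norm (g (f T)) \<le> B * norm (f T)" by (rule g)
    also have "\<dots> \<le> \<bar>B\<bar> * norm (f T)" by (intro mult_right_mono) simp_all
    also have "\<dots> \<le> \<bar>B\<bar> * (A * norm T)" using f(3)[OF \<open>T \<in> D\<close>] by (intro mult_left_mono) simp_all
    finally show "norm (g (f T)) \<le> \<bar>B\<bar> * A * norm T" by (simp add: mult.assoc)
  qed (simp_all add: f g)
qed

lemma opspan_swap:
  assumes m: "\<And>i. i \<in> I \<Longrightarrow> semilin_on D (m i)" and PQ: "opspan P = opspan Q" "P \<subseteq> D" "Q \<subseteq> D"
  shows "opspan {m i R | i R. i \<in> I \<and> R \<in> P} = opspan {m i R | i R. i \<in> I \<and> R \<in> Q}"
proof -
  have "opspan {m i R | i R. i \<in> I \<and> R \<in> P} \<subseteq> opspan {m i R | i R. i \<in> I \<and> R \<in> Q}"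
    if "opspan P = opspan Q" "Q \<subseteq> D" for P Q
  proof (rule opspan_subsetI)
    fix x assume "x \<in> {m i R | i R. i \<in> I \<and> R \<in> P}"
    then obtain i R where x: "i \<in> I" "R \<in> P" "x = m i R" by blast
    have R: "R \<in> opspan Q" using x(2) that(1) opspan_base by blast
    show "x \<in> opspan {m i R | i R. i \<in> I \<and> R \<in> Q}" unfolding x(3)
      by (rule semilin_on_opspan[OF m[OF x(1)] that(2) _ R]) (use x(1) in \<open>auto intro!: opspan_base\<close>)
  qed
  then show ?thesis using PQ by blast
qed

context concrete_monoidal_wstar_category
begin

subsection \<open>Slices\<close>

text \<open>\<open>coef H H' K K' \<eta> \<xi> T\<close> is the slice of \<open>T\<close> by the vector functional of \<open>\<xi>\<close> and \<open>\<eta>\<close>;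
  by norm convergence these span the same closed space as all slices by normal functionals.\<close>

abbreviation coef :: "'o \<Rightarrow> 'o \<Rightarrow> 'o \<Rightarrow> 'o \<Rightarrow> 'v \<Rightarrow> 'v \<Rightarrow> 'v op \<Rightarrow> 'v op" where
  "coef H H' K K' \<eta> \<xi> T \<equiv> adj (ket H' K' \<eta>) o\<^sub>L (T o\<^sub>L ket H K \<xi>)"

definition coefs :: "'o \<Rightarrow> 'o \<Rightarrow> 'o \<Rightarrow> 'o \<Rightarrow> 'v op \<Rightarrow> 'v op set" where
  "coefs H H' K K' T = {coef H H' K K' \<eta> \<xi> T | \<xi> \<eta>. \<xi> \<in> Hs \<C> H \<and> \<eta> \<in> Hs \<C> H'}"

abbreviation slices :: "'o \<Rightarrow> 'o \<Rightarrow> 'o \<Rightarrow> 'o \<Rightarrow> 'v op \<Rightarrow> 'v op set" where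
  "slices H H' K K' T \<equiv> opspan (coefs H H' K K' T)"

lemma coefsI: "\<xi> \<in> Hs \<C> H \<Longrightarrow> \<eta> \<in> Hs \<C> H' \<Longrightarrow> coef H H' K K' \<eta> \<xi> T \<in> coefs H H' K K' T"
  unfolding coefs_def by blast

lemma coefsE:
  assumes "x \<in> coefs H H' K K' T"
  obtains \<xi> \<eta> where "\<xi> \<in> Hs \<C> H" "\<eta> \<in> Hs \<C> H'" "x = coef H H' K K' \<eta> \<xi> T"
  using assms unfolding coefs_def by blast

lemma coefs_B:
  assumes "H \<in> Obj \<C>" "H' \<in> Obj \<C>" "K \<in> Obj \<C>" "K' \<in> Obj \<C>" "clin T"
  shows "coefs H H' K K' T \<subseteq> B K K'"
  using assms by (auto simp: coefs_def)

lemma coefs_clin: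
  assumes "H \<in> Obj \<C>" "H' \<in> Obj \<C>" "K \<in> Obj \<C>" "K' \<in> Obj \<C>" "clin T"
  shows "coefs H H' K K' T \<subseteq> {T. clin T}"
  using assms by (auto simp: coefs_def)

lemma slices_B:
  assumes "H \<in> Obj \<C>" "H' \<in> Obj \<C>" "K \<in> Obj \<C>" "K' \<in> Obj \<C>" "clin T"
  shows "slices H H' K K' T \<subseteq> B K K'"
  using coefs_B[OF assms] B_subspace[OF assms(4)] by (intro opspan_minimal)

lemma coef_snd:
  assumes "H \<in> Obj \<C>" "H' \<in> Obj \<C>" "K \<in> Obj \<C>" "K' \<in> Obj \<C>" "T \<in> B (H \<otimes> K) (H' \<otimes> K')"
    and "x \<in> Hs \<C> K" "y \<in> Hs \<C> K'"
  shows "coeff_snd \<C> H H' K K' T y x = adj (ket_right H' K' y) o\<^sub>L T o\<^sub>L ket_right H K x"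
  unfolding coeff_snd_def
proof (rule the_equality)
  let ?R = "adj (ket_right H' K' y) o\<^sub>L T o\<^sub>L ket_right H K x"
  have R: "?R \<in> B H H'" using assms by simp
  have eq: "cinner h' (?R h) = cinner (vten \<C> H' K' h' y) (T (vten \<C> H K h x))"
    if "h \<in> Hs \<C> H" "h' \<in> Hs \<C> H'" for h h'
    using that assms by (simp add: cinner_adj_right)
  show "?R \<in> B H H' \<and> (\<forall>h\<in>Hs \<C> H. \<forall>h'\<in>Hs \<C> H'. cinner h' (?R h) =
      cinner (vten \<C> H' K' h' y) (T (vten \<C> H K h x)))"
    using R eq by blast
  fix S assume S: "S \<in> B H H' \<and> (\<forall>h\<in>Hs \<C> H. \<forall>h'\<in>Hs \<C> H'. cinner h' (blinfun_apply S h) =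
      cinner (vten \<C> H' K' h' y) (T (vten \<C> H K h x)))"
  show "S = ?R"
  proof (rule op_eqI[OF assms(1) conjunct1[OF S] R])
    fix h assume h: "h \<in> Hs \<C> H"
    have mem: "S h - ?R h \<in> Hs \<C> H'"
      using S R assms(2) hilbert_subspace_Hs[OF assms(2)]
      by (intro complex_vector.subspace_diff bop_range[of _ "Hs \<C> H"]) (auto simp: hilbert_subspace_def simp del: bop_iff)
    have "cinner (S h - ?R h) (S h) = cinner (S h - ?R h) (?R h)" using S eq[OF h mem] h mem by simp
    then have "cinner (S h - ?R h) (S h - ?R h) = 0" by (simp add: cinner.diff_right)
    then show "S h = ?R h" by simp
  qed
qed

text \<open>Square summability makes the series of vector slices absolutely convergent, so a slice
  by any normal functional is a norm limit of sums of vector slices.\<close>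

lemma slice_fst_sums:
  assumes obj: "H \<in> Obj \<C>" "H' \<in> Obj \<C>" "K \<in> Obj \<C>" "K' \<in> Obj \<C>" and T: "T \<in> B (H \<otimes> K) (H' \<otimes> K')"
    and \<xi>: "range \<xi> \<subseteq> Hs \<C> H" "summable (\<lambda>n. (norm (\<xi> n))\<^sup>2)"
    and \<eta>: "range \<eta> \<subseteq> Hs \<C> H'" "summable (\<lambda>n. (norm (\<eta> n))\<^sup>2)"
  shows "(\<lambda>n. coef H H' K K' (\<eta> n) (\<xi> n) T) sums
    slice_fst \<C> H H' K K' T (\<lambda>S. \<Sum>n. cinner (\<eta> n) (blinfun_apply S (\<xi> n)))"
proof -
  let ?f = "\<lambda>n. coef H H' K K' (\<eta> n) (\<xi> n) T"
  have in_H: "\<xi> n \<in> Hs \<C> H" "\<eta> n \<in> Hs \<C> H'" for n using \<xi>(1) \<eta>(1) by auto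
  have "norm (?f n) \<le> norm T * ((norm (\<xi> n))\<^sup>2 + (norm (\<eta> n))\<^sup>2)" for n
  proof -
    have "norm (?f n) \<le> norm (adj (ket H' K' (\<eta> n))) * (norm T * norm (ket H K (\<xi> n)))"
      by (rule order_trans[OF norm_blinfun_compose mult_left_mono[OF norm_blinfun_compose]]) simp
    also have "\<dots> \<le> norm (\<eta> n) * (norm T * norm (\<xi> n))"
      using norm_adj_le[of "ket H' K' (\<eta> n)"] norm_ket[of H' K' "\<eta> n"] norm_ket[of H K "\<xi> n"] obj
      by (intro mult_mono) simp_all
    also have "\<dots> = norm T * (norm (\<eta> n) * norm (\<xi> n))" by simp
    also have "\<dots> \<le> norm T * ((norm (\<xi> n))\<^sup>2 + (norm (\<eta> n))\<^sup>2)"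
    proof (rule mult_left_mono)
      have "0 \<le> (norm (\<xi> n) - norm (\<eta> n))\<^sup>2 + (norm (\<xi> n))\<^sup>2 + (norm (\<eta> n))\<^sup>2" by simp
      then show "norm (\<eta> n) * norm (\<xi> n) \<le> (norm (\<xi> n))\<^sup>2 + (norm (\<eta> n))\<^sup>2"
        by (simp add: power2_eq_square algebra_simps)
    qed simp
    finally show ?thesis .
  qed
  then have sm: "summable ?f"
    by (rule summable_comparison_test'[of _ 0, rotated]) (intro summable_mult summable_add \<xi> \<eta>)
  define R where "R = suminf ?f"
  have R: "?f sums R" using sm by (simp add: R_def summable_sums)
  have RB: "R \<in> B K K'"
  proof -
    have "?f n \<in> B K K'" for n using obj T by simp
    then have "(\<Sum>i<n. ?f i) \<in> B K K'" for n
      using B_subspace(1)[OF obj(4)] by (intro op_vector.subspace_sum) auto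
    then show ?thesis
      by (rule closed_sequentially[OF B_subspace(2)[OF obj(4)] _ R[unfolded sums_def]])
  qed
  let ?\<omega> = "\<lambda>S. \<Sum>n. cinner (\<eta> n) (blinfun_apply S (\<xi> n))"
  have eq: "cinner y (R x) = ?\<omega> (coeff_snd \<C> H H' K K' T y x)" if "x \<in> Hs \<C> K" "y \<in> Hs \<C> K'" for x y
  proof -
    have "(\<lambda>n. ?f n x) sums R x"
      using bounded_linear.sums[OF blinfun.bounded_linear_left R] .
    then have "(\<lambda>n. cinner y (?f n x)) sums cinner y (R x)"
      by (rule bounded_linear.sums[OF cinner.bounded_linear_right])
    moreover have "cinner y (?f n x) = cinner (\<eta> n) (coeff_snd \<C> H H' K K' T y x (\<xi> n))" for n
      using obj T that in_H
      by (simp add: coef_snd cinner_adj_right)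
    ultimately show ?thesis by (simp add: sums_unique)
  qed
  have "slice_fst \<C> H H' K K' T ?\<omega> = R"
    unfolding slice_fst_def
  proof (rule the_equality)
    show "R \<in> B K K' \<and> (\<forall>x\<in>Hs \<C> K. \<forall>y\<in>Hs \<C> K'. cinner y (R x) = ?\<omega> (coeff_snd \<C> H H' K K' T y x))"
      using RB eq by blast
    fix S assume S: "S \<in> B K K' \<and> (\<forall>x\<in>Hs \<C> K. \<forall>y\<in>Hs \<C> K'. cinner y (blinfun_apply S x) = ?\<omega> (coeff_snd \<C> H H' K K' T y x))"
    show "S = R"
    proof (rule op_eqI[OF obj(3) conjunct1[OF S] RB])
      fix h assume h: "h \<in> Hs \<C> K"
      have mem: "S h - R h \<in> Hs \<C> K'"
        using S RB hilbert_subspace_Hs[OF obj(4)]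
        by (intro complex_vector.subspace_diff bop_range[of _ "Hs \<C> K"]) (auto simp: hilbert_subspace_def simp del: bop_iff)
      have "cinner (S h - R h) (S h) = cinner (S h - R h) (R h)" using S eq[OF h mem] h mem by simp
      then have "cinner (S h - R h) (S h - R h) = 0" by (simp add: cinner.diff_right)
      then show "S h = R h" by simp
    qed
  qed
  with R show ?thesis by simp
qed

lemma slice_fst_opspan:
  assumes obj: "H \<in> Obj \<C>" "H' \<in> Obj \<C>" "K \<in> Obj \<C>" "K' \<in> Obj \<C>" and T: "T \<in> B (H \<otimes> K) (H' \<otimes> K')"
  shows "opspan {slice_fst \<C> H H' K K' T \<omega> | \<omega>. \<omega> \<in> normal_on \<C> H H'} = slices H H' K K' T"
proof (rule opspan_eqI)
  fix x assume "x \<in> {slice_fst \<C> H H' K K' T \<omega> | \<omega>. \<omega> \<in> normal_on \<C> H H'}"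
  then obtain \<xi> \<eta> where \<xi>: "range \<xi> \<subseteq> Hs \<C> H" "summable (\<lambda>n. (norm (\<xi> n))\<^sup>2)"
    and \<eta>: "range \<eta> \<subseteq> Hs \<C> H'" "summable (\<lambda>n. (norm (\<eta> n))\<^sup>2)"
    and x: "x = slice_fst \<C> H H' K K' T (\<lambda>S. \<Sum>n. cinner (\<eta> n) (blinfun_apply S (\<xi> n)))"
    by (auto simp: normal_functionals_def)
  have "(\<lambda>n. coef H H' K K' (\<eta> n) (\<xi> n) T) sums x"
    unfolding x by (rule slice_fst_sums[OF obj T \<xi> \<eta>])
  moreover have "(\<Sum>i<n. coef H H' K K' (\<eta> i) (\<xi> i) T) \<in> op_vector.span (coefs H H' K K' T)" for n
    using \<xi>(1) \<eta>(1) by (intro op_vector.span_sum op_vector.span_base coefsI) auto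
  ultimately show "x \<in> slices H H' K K' T"
    unfolding sums_def closure_sequential
    by (intro exI[of _ "\<lambda>n. \<Sum>i<n. coef H H' K K' (\<eta> i) (\<xi> i) T"] conjI allI)
next
  fix x assume "x \<in> coefs H H' K K' T"
  then obtain \<xi> \<eta> where v: "\<xi> \<in> Hs \<C> H" "\<eta> \<in> Hs \<C> H'" and x: "x = coef H H' K K' \<eta> \<xi> T"
    by (rule coefsE)
  \<comment> \<open>A vector functional seen as a normal one: square summable sequences supported at
    index 0.\<close>
  define f where "f n = (if n = 0 then \<xi> else 0)" for n :: nat
  define g where "g n = (if n = 0 then \<eta> else 0)" for n :: nat
  have z: "0 \<in> Hs \<C> H" "0 \<in> Hs \<C> H'"
    using hilbert_subspace_Hs[OF obj(1)] hilbert_subspace_Hs[OF obj(2)]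
    by (auto simp: hilbert_subspace_def complex_vector.subspace_0)
  have fg: "range f \<subseteq> Hs \<C> H" "range g \<subseteq> Hs \<C> H'" using v z by (auto simp: f_def g_def)
  have fg': "summable (\<lambda>n. (norm (f n))\<^sup>2)" "summable (\<lambda>n. (norm (g n))\<^sup>2)"
    by (rule summable_finite[of "{0}"]; simp add: f_def g_def)+
  have 1: "(\<lambda>n. coef H H' K K' (g n) (f n) T) sums
      slice_fst \<C> H H' K K' T (\<lambda>S. \<Sum>n. cinner (g n) (blinfun_apply S (f n)))"
    by (rule slice_fst_sums[OF obj T fg(1) fg'(1) fg(2) fg'(2)])
  have ket0: "ket H K 0 = 0" using ket_scale[OF obj(1,3), of 0 0] by simp
  have "(\<lambda>n. coef H H' K K' (g n) (f n) T) sums (\<Sum>n\<in>{0}. coef H H' K K' (g n) (f n) T)"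
    by (rule sums_finite) (auto simp: f_def ket0)
  then have 2: "(\<lambda>n. coef H H' K K' (g n) (f n) T) sums x"
    by (simp add: f_def g_def x)
  have "x = slice_fst \<C> H H' K K' T (\<lambda>S. \<Sum>n. cinner (g n) (blinfun_apply S (f n)))"
    by (rule sums_unique2[OF 2 1])
  then show "x \<in> opspan {slice_fst \<C> H H' K K' T \<omega> | \<omega>. \<omega> \<in> normal_on \<C> H H'}"
    using fg fg' by (intro opspan_base) (auto simp: normal_functionals_def)
qed

text \<open>A slice is linear in \<open>\<xi>\<close> and antilinear in \<open>\<eta>\<close>, hence
  the different scalings in the two uses of \<open>opspan_vec\<close>.\<close>

lemma coef_total:
  assumes obj: "H \<in> Obj \<C>" "H' \<in> Obj \<C>" "K \<in> Obj \<C>" "K' \<in> Obj \<C>" and T: "clin T"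
    and V: "\<And>v v'. v \<in> V \<Longrightarrow> v' \<in> V' \<Longrightarrow> coef H H' K K' v' v T \<in> opspan U"
    and \<xi>: "\<xi> \<in> closure (complex_vector.span V)" and \<eta>: "\<eta> \<in> closure (complex_vector.span V')"
  shows "coef H H' K K' \<eta> \<xi> T \<in> opspan U"
proof (rule opspan_vec[OF _ _ _ _ \<eta>, where g = cnj and B = "norm (T o\<^sub>L ket H K \<xi>)"])
  show "norm (coef H H' K K' v \<xi> T) \<le> norm (T o\<^sub>L ket H K \<xi>) * norm v" for v
    using order_trans[OF norm_blinfun_compose mult_right_mono[OF order_trans[OF norm_adj_le norm_ket]]] obj
    by (simp add: mult.commute)
  show "coef H H' K K' (v + w) \<xi> T = coef H H' K K' v \<xi> T + coef H H' K K' w \<xi> T" for v w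
    using obj by (simp add: ket_add adj_add) (simp add: blinfun_eqI blinfun.add_left)
  show "coef H H' K K' (a *\<^sub>C v) \<xi> T = op_scale (cnj a) (coef H H' K K' v \<xi> T)" for a v
    using obj by (simp add: ket_scale adj_op_scale op_scale_comp_left)
  fix v assume v: "v \<in> V'"
  show "coef H H' K K' v \<xi> T \<in> opspan U"
  proof (rule opspan_vec[OF _ _ _ _ \<xi>, where g = "\<lambda>a. a" and B = "norm (adj (ket H' K' v)) * norm T"])
    show "norm (coef H H' K K' v w T) \<le> norm (adj (ket H' K' v)) * norm T * norm w" for w
    proof -
      have "norm (coef H H' K K' v w T) \<le> norm (adj (ket H' K' v)) * (norm T * norm (ket H K w))"
        by (rule order_trans[OF norm_blinfun_compose mult_left_mono[OF norm_blinfun_compose]]) simp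
      also have "\<dots> \<le> norm (adj (ket H' K' v)) * (norm T * norm w)"
        using norm_ket[OF obj(1,3)] by (intro mult_left_mono) simp_all
      finally show ?thesis by (simp add: mult.assoc)
    qed
    show "coef H H' K K' v (w + w') T = coef H H' K K' v w T + coef H H' K K' v w' T" for w w'
      using obj by (intro blinfun_eqI) (simp add: ket_add blinfun.add_left blinfun.add_right)
    show "coef H H' K K' v (a *\<^sub>C w) T = op_scale a (coef H H' K K' v w T)" for a w
      using obj T by (simp add: ket_scale op_scale_comp_right)
    show "coef H H' K K' v w T \<in> opspan U" if "w \<in> V" for w
      using V[OF that v] .
  qed
qed

lemma Hs_tens: "X \<in> Obj \<C> \<Longrightarrow> Y \<in> Obj \<C> \<Longrightarrow>
    Hs \<C> (X \<otimes> Y) = closure (complex_vector.span {vten \<C> X Y x y | x y. x \<in> Hs \<C> X \<and> y \<in> Hs \<C> Y})"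
  by (rule tensor.total[OF tens])

lemma slices_tens:
  assumes obj: "H1 \<in> Obj \<C>" "H2 \<in> Obj \<C>" "H1' \<in> Obj \<C>" "H2' \<in> Obj \<C>" "K \<in> Obj \<C>" "K' \<in> Obj \<C>" and T: "clin T"
  shows "slices (H1 \<otimes> H2) (H1' \<otimes> H2') K K' T =
    opspan {coef (H1 \<otimes> H2) (H1' \<otimes> H2') K K' (vten \<C> H1' H2' \<eta>1 \<eta>2) (vten \<C> H1 H2 \<xi>1 \<xi>2) T | \<xi>1 \<xi>2 \<eta>1 \<eta>2.
      \<xi>1 \<in> Hs \<C> H1 \<and> \<xi>2 \<in> Hs \<C> H2 \<and> \<eta>1 \<in> Hs \<C> H1' \<and> \<eta>2 \<in> Hs \<C> H2'}" (is "_ = opspan ?U")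
proof (rule opspan_eqI)
  fix x assume "x \<in> coefs (H1 \<otimes> H2) (H1' \<otimes> H2') K K' T"
  then obtain \<xi> \<eta> where v: "\<xi> \<in> Hs \<C> (H1 \<otimes> H2)" "\<eta> \<in> Hs \<C> (H1' \<otimes> H2')"
    and x: "x = coef (H1 \<otimes> H2) (H1' \<otimes> H2') K K' \<eta> \<xi> T" by (rule coefsE)
  show "x \<in> opspan ?U" unfolding x
    by (rule coef_total[OF _ _ _ _ T _ v[unfolded Hs_tens[OF obj(1,2)] Hs_tens[OF obj(3,4)]]])
      (use obj in \<open>auto intro!: opspan_base\<close>)
next
  fix x assume "x \<in> ?U"
  then show "x \<in> slices (H1 \<otimes> H2) (H1' \<otimes> H2') K K' T"
    using obj by (auto intro!: opspan_base coefsI)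
qed

text \<open>Operators on the auxiliary leg are absorbed by the vectors: \<open>\<xi>\<close> becomes
  \<open>U \<xi>\<close> and \<open>\<eta>\<close> becomes \<open>adj W \<eta>\<close>.\<close>

lemma slices_sandwich:
  assumes obj: "H \<in> Obj \<C>" "H' \<in> Obj \<C>" "K \<in> Obj \<C>" "K' \<in> Obj \<C>" "G \<in> Obj \<C>" "G' \<in> Obj \<C>"
    and T: "clin T" and U: "U \<in> B G H" and W: "W \<in> B H' G'"
  shows "slices G G' K K' (tensR \<C> H' G' W K' o\<^sub>L (T o\<^sub>L tensR \<C> G H U K)) \<subseteq> slices H H' K K' T"
proof (rule opspan_subsetI)
  fix x assume "x \<in> coefs G G' K K' (tensR \<C> H' G' W K' o\<^sub>L (T o\<^sub>L tensR \<C> G H U K))"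
  then obtain \<xi> \<eta> where v: "\<xi> \<in> Hs \<C> G" "\<eta> \<in> Hs \<C> G'"
    and x: "x = coef G G' K K' \<eta> \<xi> (tensR \<C> H' G' W K' o\<^sub>L (T o\<^sub>L tensR \<C> G H U K))" by (rule coefsE)
  have "x = coef H H' K K' (adj W \<eta>) (U \<xi>) T"
    unfolding x using obj U W v
    by (simp add: blinfun_compose_assoc tensR_ket bra_tensR[THEN comp_reassoc])
  then show "x \<in> slices H H' K K' T"
    using obj U W by (auto intro!: opspan_base coefsI lands_in)
qed

text \<open>Both inclusions come from \<open>slices_sandwich\<close>, the second one with
  \<open>adj U\<close> and \<open>adj W\<close>, which undo \<open>U\<close> and
  \<open>W\<close>.\<close>

lemma slices_unitary:
  assumes obj: "H \<in> Obj \<C>" "H' \<in> Obj \<C>" "K \<in> Obj \<C>" "K' \<in> Obj \<C>" "G \<in> Obj \<C>" "G' \<in> Obj \<C>"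
    and T: "T \<in> B (H \<otimes> K) (H' \<otimes> K')" and U: "U \<in> B G H" "U o\<^sub>L adj U = idm \<C> H"
    and W: "W \<in> B H' G'" "adj W o\<^sub>L W = idm \<C> H'"
  shows "slices G G' K K' (tensR \<C> H' G' W K' o\<^sub>L (T o\<^sub>L tensR \<C> G H U K)) = slices H H' K K' T" (is "?L = ?R")
proof
  show "?L \<subseteq> ?R" using assms by (intro slices_sandwich) simp_all
  let ?S = "tensR \<C> H' G' W K' o\<^sub>L (T o\<^sub>L tensR \<C> G H U K)"
  have "slices H H' K K' (tensR \<C> G' H' (adj W) K' o\<^sub>L (?S o\<^sub>L tensR \<C> H G (adj U) K)) \<subseteq> ?L"
    using assms by (intro slices_sandwich) simp_all
  also have "tensR \<C> G' H' (adj W) K' o\<^sub>L (?S o\<^sub>L tensR \<C> H G (adj U) K) = T"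
    using assms by (simp add: blinfun_compose_assoc tens_comp tens_comp[THEN comp_reassoc])
  finally show "?R \<subseteq> ?L" .
qed

lemma slices_adj:
  assumes obj: "H \<in> Obj \<C>" "H' \<in> Obj \<C>" "K \<in> Obj \<C>" "K' \<in> Obj \<C>" and T: "clin T"
    and x: "x \<in> slices H H' K K' T"
  shows "adj x \<in> slices H' H K' K (adj T)"
proof (rule opspan_adj[OF x])
  show "coefs H H' K K' T \<subseteq> {T. clin T}" by (rule coefs_clin[OF obj T])
  show "adj s \<in> slices H' H K' K (adj T)" if s: "s \<in> coefs H H' K K' T" for s
  proof -
    obtain \<xi> \<eta> where v: "\<xi> \<in> Hs \<C> H" "\<eta> \<in> Hs \<C> H'" "s = coef H H' K K' \<eta> \<xi> T" using s by (rule coefsE)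
    then have "adj s = coef H' H K' K \<xi> \<eta> (adj T)"
      using obj T by (simp add: blinfun_compose_assoc)
    then show ?thesis using v by (simp add: opspan_base coefsI)
  qed
qed

text \<open>\<open>T\<close> on the last two of three legs, bracketed so that the two legs to be
  sliced form a single object \<open>E \<otimes> H\<close>.\<close>

definition leg_snd :: "'o \<Rightarrow> 'o \<Rightarrow> 'o \<Rightarrow> 'o \<Rightarrow> 'o \<Rightarrow> 'v op \<Rightarrow> 'v op" where
  "leg_snd E H H' K K' T =
     adj (assoc \<C> E H' K') o\<^sub>L (tensL \<C> E (H \<otimes> K) (H' \<otimes> K') T o\<^sub>L assoc \<C> E H K)"

lemma leg_snd_simps [simp]:
  assumes "E \<in> Obj \<C>" "H \<in> Obj \<C>" "H' \<in> Obj \<C>" "K \<in> Obj \<C>" "K' \<in> Obj \<C>" "T \<in> B (H \<otimes> K) (H' \<otimes> K')"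
  shows "clin (leg_snd E H H' K K' T)" "lands (leg_snd E H H' K K' T) (Hs \<C> ((E \<otimes> H') \<otimes> K'))"
    "vanishes (leg_snd E H H' K K' T) (Hs \<C> ((E \<otimes> H) \<otimes> K))"
    "adj (leg_snd E H H' K K' T) = leg_snd E H' H K' K (adj T)"
  unfolding leg_snd_def using assms by (simp_all add: blinfun_compose_assoc)

lemma leg_snd_ket:
  assumes "E \<in> Obj \<C>" "H \<in> Obj \<C>" "H' \<in> Obj \<C>" "K \<in> Obj \<C>" "K' \<in> Obj \<C>" "T \<in> B (H \<otimes> K) (H' \<otimes> K')"
    and "\<zeta> \<in> Hs \<C> E" "\<xi> \<in> Hs \<C> H"
  shows "leg_snd E H H' K K' T o\<^sub>L ket (E \<otimes> H) K (vten \<C> E H \<zeta> \<xi>) =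
    adj (assoc \<C> E H' K') o\<^sub>L (ket E (H' \<otimes> K') \<zeta> o\<^sub>L (T o\<^sub>L ket H K \<xi>))"
  unfolding leg_snd_def using assms
  by (simp add: blinfun_compose_assoc assoc_ket tensL_ket[THEN comp_reassoc])

lemma bra_leg_snd:
  assumes "E \<in> Obj \<C>" "H \<in> Obj \<C>" "H' \<in> Obj \<C>" "K \<in> Obj \<C>" "K' \<in> Obj \<C>" "T \<in> B (H \<otimes> K) (H' \<otimes> K')"
    and "\<zeta> \<in> Hs \<C> E" "\<xi> \<in> Hs \<C> H'"
  shows "adj (ket (E \<otimes> H') K' (vten \<C> E H' \<zeta> \<xi>)) o\<^sub>L leg_snd E H H' K K' T =
    adj (ket H' K' \<xi>) o\<^sub>L (T o\<^sub>L (adj (ket E (H \<otimes> K) \<zeta>) o\<^sub>L assoc \<C> E H K))"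
proof -
  have "adj (leg_snd E H' H K' K (adj T) o\<^sub>L ket (E \<otimes> H') K' (vten \<C> E H' \<zeta> \<xi>)) =
    adj (adj (assoc \<C> E H K) o\<^sub>L (ket E (H \<otimes> K) \<zeta> o\<^sub>L (adj T o\<^sub>L ket H' K' \<xi>)))"
    using assms by (subst leg_snd_ket) simp_all
  then show ?thesis using assms by (simp add: blinfun_compose_assoc)
qed

text \<open>A slice amplified by \<open>H\<close> is a slice of the amplified operator; only the
  bracketing has to change before the bra and the ket can act.\<close>

lemma tensR_coef:
  assumes obj: "E \<in> Obj \<C>" "E' \<in> Obj \<C>" "K \<in> Obj \<C>" "K' \<in> Obj \<C>" "H \<in> Obj \<C>" and Z: "Z \<in> B (E \<otimes> K) (E' \<otimes> K')"
    and v: "\<zeta> \<in> Hs \<C> E" "\<zeta>' \<in> Hs \<C> E'"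
  shows "tensR \<C> K K' (coef E E' K K' \<zeta>' \<zeta> Z) H =
    adj (ket E' (K' \<otimes> H) \<zeta>') o\<^sub>L (assoc \<C> E' K' H o\<^sub>L (tensR \<C> (E \<otimes> K) (E' \<otimes> K') Z H o\<^sub>L
      (adj (assoc \<C> E K H) o\<^sub>L ket E (K \<otimes> H) \<zeta>)))"
proof -
  have 1: "tensR \<C> K K' (coef E E' K K' \<zeta>' \<zeta> Z) H =
    adj (tensR \<C> K' (E' \<otimes> K') (ket E' K' \<zeta>') H) o\<^sub>L (tensR \<C> (E \<otimes> K) (E' \<otimes> K') Z H o\<^sub>L
      tensR \<C> K (E \<otimes> K) (ket E K \<zeta>) H)"
    using assms by (simp add: tens_comp)
  have 2: "tensR \<C> K (E \<otimes> K) (ket E K \<zeta>) H = adj (assoc \<C> E K H) o\<^sub>L ket E (K \<otimes> H) \<zeta>"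
    if "E \<in> Obj \<C>" "K \<in> Obj \<C>" "\<zeta> \<in> Hs \<C> E" for E K \<zeta>
  proof -
    have "adj (assoc \<C> E K H) o\<^sub>L ket E (K \<otimes> H) \<zeta> =
      (adj (assoc \<C> E K H) o\<^sub>L assoc \<C> E K H) o\<^sub>L tensR \<C> K (E \<otimes> K) (ket E K \<zeta>) H"
      using that obj by (simp add: blinfun_compose_assoc assoc_tensR_ket)
    then show ?thesis using that obj by (simp add: assoc_adj_comp)
  qed
  show ?thesis unfolding 1 using obj v by (simp add: 2 blinfun_compose_assoc)
qed

text \<open>The product of two slices has a rank one operator in the middle.  Rank one operators have
  the same closed span as the slices of \<open>Z\<close>, which makes the product a slice again.\<close>

lemma slices_product:
  assumes obj: "E \<in> Obj \<C>" "E' \<in> Obj \<C>" "K1 \<in> Obj \<C>" "K1' \<in> Obj \<C>" "K2 \<in> Obj \<C>" "K2' \<in> Obj \<C>"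
      "H \<in> Obj \<C>" "H' \<in> Obj \<C>" "H'' \<in> Obj \<C>"
    and X: "X \<in> B (K1 \<otimes> H) (K1' \<otimes> H')" and Y: "Y \<in> B (K2 \<otimes> H'') (K2' \<otimes> H)"
    and Z: "Z \<in> B (E \<otimes> K2') (E' \<otimes> K1)" and Zc: "slices E E' K2' K1 Z = compact_op (Hs \<C> K2') (Hs \<C> K1)"
  shows "opspan {x o\<^sub>L y | x y. x \<in> slices K1 K1' H H' X \<and> y \<in> slices K2 K2' H'' H Y} =
    slices (E \<otimes> K2) (E' \<otimes> K1') H'' H'
      (leg_snd E' K1 K1' H H' X o\<^sub>L (tensR \<C> (E \<otimes> K2') (E' \<otimes> K1) Z H o\<^sub>L leg_snd E K2 K2' H'' H Y))"
    (is "?L = slices _ _ _ _ ?M")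
proof -
  \<comment> \<open>\<open>m\<close> isolates the middle operator \<open>R\<close>; being bounded
    and linear in \<open>R\<close>, it admits the exchange of rank one operators for slices of
    \<open>Z\<close>.\<close>
  define m where "m \<eta> \<xi> R = adj (ket K1' H' \<eta>) o\<^sub>L (X o\<^sub>L (tensR \<C> K2' K1 R H o\<^sub>L (Y o\<^sub>L ket K2 H'' \<xi>)))" for \<eta> \<xi> R
  let ?P = "{rank_one u v | u v. u \<in> Hs \<C> K1 \<and> v \<in> Hs \<C> K2'}"
  let ?G = "\<lambda>P. {m \<eta> \<xi> R | \<xi> \<eta> R. \<xi> \<in> Hs \<C> K2 \<and> \<eta> \<in> Hs \<C> K1' \<and> R \<in> P}"
  have semi: "semilin_on (B K2' K1) (m \<eta> \<xi>)" for \<eta> \<xi>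
    unfolding m_def using obj X
    by (intro semilin_comp[OF _ semilin_right] semilin_comp[OF _ semilin_left] semilin_tens_left) simp_all
  have PB: "?P \<subseteq> B K2' K1" using obj by auto
  have CB: "coefs E E' K2' K1 Z \<subseteq> B K2' K1" using obj Z by (intro coefs_B) simp_all
  have P_eq: "opspan ?P = compact_op (Hs \<C> K2') (Hs \<C> K1)"
  proof
    have Z1: "?P \<subseteq> compact_op (Hs \<C> K2') (Hs \<C> K1)"
      using compact_rank_one[of "Hs \<C> K1"] hilbert_subspace_Hs[OF obj(3)] by (auto simp: hilbert_subspace_def)
    \<comment> \<open>\<open>Zc\<close> displays the compact operators as a closed span, so they
      contain the closed span of the rank one operators.\<close>
    then show "opspan ?P \<subseteq> compact_op (Hs \<C> K2') (Hs \<C> K1)"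
      unfolding Zc[symmetric] by (intro opspan_subsetI) blast
    show "compact_op (Hs \<C> K2') (Hs \<C> K1) \<subseteq> opspan ?P"
      using compact_op_approx[of "Hs \<C> K2'" "Hs \<C> K1"] obj by auto
  qed
  have eqG: "opspan (?G ?P) = opspan (?G (coefs E E' K2' K1 Z))"
    using opspan_swap[of "Hs \<C> K2 \<times> Hs \<C> K1'" "B K2' K1" "\<lambda>i. m (snd i) (fst i)", OF semi _ PB CB] P_eq Zc
    by simp
  have prod: "coef K1 K1' H H' \<eta> \<xi>' X o\<^sub>L coef K2 K2' H'' H \<eta>' \<xi> Y = m \<eta> \<xi> (rank_one \<xi>' \<eta>')"
    if "\<xi>' \<in> Hs \<C> K1" "\<eta>' \<in> Hs \<C> K2'" for \<eta> \<xi> \<xi>' \<eta>'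
    unfolding m_def using that obj by (simp add: blinfun_compose_assoc flip: ket_bra)
  have "?L = opspan (?G ?P)"
  proof
    show "?L \<subseteq> opspan (?G ?P)"
    proof (rule opspan_subsetI)
      fix s assume "s \<in> {x o\<^sub>L y | x y. x \<in> slices K1 K1' H H' X \<and> y \<in> slices K2 K2' H'' H Y}"
      then obtain x y where s: "s = x o\<^sub>L y" and x: "x \<in> slices K1 K1' H H' X" and y: "y \<in> slices K2 K2' H'' H Y"
        by blast
      show "s \<in> opspan (?G ?P)" unfolding s
      proof (rule opspan_comp[OF x y])
        show "coefs K1 K1' H H' X \<subseteq> {T. clin T}" using obj X by (intro coefs_clin) simp_all
        fix a b assume a: "a \<in> coefs K1 K1' H H' X" and b: "b \<in> coefs K2 K2' H'' H Y"
        obtain \<xi>' \<eta> where u: "\<xi>' \<in> Hs \<C> K1" "\<eta> \<in> Hs \<C> K1'" "a = coef K1 K1' H H' \<eta> \<xi>' X"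
          using a by (rule coefsE)
        obtain \<xi> \<eta>' where v: "\<xi> \<in> Hs \<C> K2" "\<eta>' \<in> Hs \<C> K2'" "b = coef K2 K2' H'' H \<eta>' \<xi> Y"
          using b by (rule coefsE)
        have "a o\<^sub>L b = m \<eta> \<xi> (rank_one \<xi>' \<eta>')" unfolding u(3) v(3) by (rule prod[OF u(1) v(2)])
        then show "a o\<^sub>L b \<in> opspan (?G ?P)" using u(1,2) v(1,2) by (intro opspan_base) blast
      qed
    qed
    show "opspan (?G ?P) \<subseteq> ?L"
    proof (rule opspan_subsetI)
      fix s assume "s \<in> ?G ?P"
      then obtain \<xi> \<eta> u v where s: "\<xi> \<in> Hs \<C> K2" "\<eta> \<in> Hs \<C> K1'" "u \<in> Hs \<C> K1" "v \<in> Hs \<C> K2'"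
        "s = m \<eta> \<xi> (rank_one u v)" by blast
      then show "s \<in> ?L"
        unfolding s(5) prod[OF s(3,4), symmetric] by (auto intro!: opspan_base coefsI exI)
    qed
  qed
  also note eqG
  also have "opspan (?G (coefs E E' K2' K1 Z)) = slices (E \<otimes> K2) (E' \<otimes> K1') H'' H' ?M"
  proof -
    \<comment> \<open>The vectors \<open>\<zeta>\<close> and \<open>\<zeta>'\<close> of a slice of
      \<open>Z\<close> become additional auxiliary legs of one large slice.\<close>
    have coefM: "coef (E \<otimes> K2) (E' \<otimes> K1') H'' H' (vten \<C> E' K1' \<zeta>' \<eta>) (vten \<C> E K2 \<zeta> \<xi>) ?M =
        m \<eta> \<xi> (coef E E' K2' K1 \<zeta>' \<zeta> Z)"
      if "\<zeta> \<in> Hs \<C> E" "\<zeta>' \<in> Hs \<C> E'" "\<xi> \<in> Hs \<C> K2" "\<eta> \<in> Hs \<C> K1'" for \<zeta> \<zeta>' \<xi> \<eta>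
      unfolding m_def using that obj X Y Z
      by (simp add: tensR_coef blinfun_compose_assoc leg_snd_ket bra_leg_snd[THEN comp_reassoc])
    have M: "clin ?M" using obj X Y Z by simp
    show ?thesis unfolding slices_tens[OF obj(1,5,2,4,9,8) M]
    proof (rule opspan_eqI; rule opspan_base)
      fix s assume "s \<in> ?G (coefs E E' K2' K1 Z)"
      then obtain \<xi> \<eta> R where s: "\<xi> \<in> Hs \<C> K2" "\<eta> \<in> Hs \<C> K1'" "R \<in> coefs E E' K2' K1 Z" "s = m \<eta> \<xi> R"
        by blast
      obtain \<zeta> \<zeta>' where R: "\<zeta> \<in> Hs \<C> E" "\<zeta>' \<in> Hs \<C> E'" "R = coef E E' K2' K1 \<zeta>' \<zeta> Z"
        using s(3) by (rule coefsE)
      have "s = coef (E \<otimes> K2) (E' \<otimes> K1') H'' H' (vten \<C> E' K1' \<zeta>' \<eta>) (vten \<C> E K2 \<zeta> \<xi>) ?M"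
        unfolding s(4) R(3) by (rule coefM[OF R(1,2) s(1,2), symmetric])
      then show "s \<in> {coef (E \<otimes> K2) (E' \<otimes> K1') H'' H' (vten \<C> E' K1' \<eta>1 \<eta>2) (vten \<C> E K2 \<xi>1 \<xi>2) ?M | \<xi>1 \<xi>2 \<eta>1 \<eta>2.
          \<xi>1 \<in> Hs \<C> E \<and> \<xi>2 \<in> Hs \<C> K2 \<and> \<eta>1 \<in> Hs \<C> E' \<and> \<eta>2 \<in> Hs \<C> K1'}"
        using s(1,2) R(1,2) by blast
    next
      fix s assume "s \<in> {coef (E \<otimes> K2) (E' \<otimes> K1') H'' H' (vten \<C> E' K1' \<eta>1 \<eta>2) (vten \<C> E K2 \<xi>1 \<xi>2) ?M | \<xi>1 \<xi>2 \<eta>1 \<eta>2.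
          \<xi>1 \<in> Hs \<C> E \<and> \<xi>2 \<in> Hs \<C> K2 \<and> \<eta>1 \<in> Hs \<C> E' \<and> \<eta>2 \<in> Hs \<C> K1'}"
      then obtain \<zeta> \<xi> \<zeta>' \<eta> where s: "\<zeta> \<in> Hs \<C> E" "\<xi> \<in> Hs \<C> K2" "\<zeta>' \<in> Hs \<C> E'" "\<eta> \<in> Hs \<C> K1'"
          "s = coef (E \<otimes> K2) (E' \<otimes> K1') H'' H' (vten \<C> E' K1' \<zeta>' \<eta>) (vten \<C> E K2 \<zeta> \<xi>) ?M"
        by blast
      have "s = m \<eta> \<xi> (coef E E' K2' K1 \<zeta>' \<zeta> Z)" unfolding s(5) by (rule coefM[OF s(1,3,2,4)])
      with s show "s \<in> ?G (coefs E E' K2' K1 Z)" using coefsI[OF s(1,3)] by blast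
    qed
  qed
  finally show ?thesis .
qed

end

section \<open>Braided tensor products\<close>

locale braided_wstar_category = concrete_monoidal_wstar_category \<C>
  for \<C> :: "('o, 'v::chilbert_space, 'm) wcat_scheme" (structure) +
  fixes c :: "'o \<Rightarrow> 'o \<Rightarrow> 'v op"
  assumes bi_regular: "bi_regular_braiding \<C> c"
begin

lemma c_Hom: "X \<in> Obj \<C> \<Longrightarrow> Y \<in> Obj \<C> \<Longrightarrow> c X Y \<in> Hom \<C> (X \<otimes> Y) (Y \<otimes> X)"
  using bi_regular by (simp add: bi_regular_braiding_def unitaries_def)

lemma Hom_B: "S \<in> Hom \<C> X Y \<Longrightarrow> X \<in> Obj \<C> \<Longrightarrow> Y \<in> Obj \<C> \<Longrightarrow> S \<in> B X Y"
  using Hom_bop by blast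

lemma c_bop [simp]:
  assumes "X \<in> Obj \<C>" "Y \<in> Obj \<C>"
  shows "clin (c X Y)" "lands (c X Y) (Hs \<C> (Y \<otimes> X))" "vanishes (c X Y) (Hs \<C> (X \<otimes> Y))"
  using Hom_B[OF c_Hom[OF assms]] assms by simp_all

lemma c_unitary [simp]:
  assumes "X \<in> Obj \<C>" "Y \<in> Obj \<C>"
  shows "adj (c X Y) o\<^sub>L c X Y = idm \<C> (X \<otimes> Y)" "c X Y o\<^sub>L adj (c X Y) = idm \<C> (Y \<otimes> X)"
  using bi_regular assms by (simp_all add: bi_regular_braiding_def unitaries_def)

lemma braid_inv [simp]: "X \<in> Obj \<C> \<Longrightarrow> Y \<in> Obj \<C> \<Longrightarrow> braid_inv \<C> c X Y = adj (c X Y)"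
  unfolding braid_inv_def by (rule inv_op_unitary) simp_all

lemma c_natural:
  assumes "X \<in> Obj \<C>" "X' \<in> Obj \<C>" "Y \<in> Obj \<C>" "Y' \<in> Obj \<C>" "S \<in> Hom \<C> X X'" "T \<in> Hom \<C> Y Y'"
  shows "c X' Y' o\<^sub>L tensop \<C> X X' Y Y' S T = tensop \<C> Y Y' X X' T S o\<^sub>L c X Y"
  using bi_regular assms unfolding bi_regular_braiding_def braiding_def by blast

lemma hexagon1:
  assumes "U \<in> Obj \<C>" "V \<in> Obj \<C>" "W \<in> Obj \<C>"
  shows "assoc \<C> V W U o\<^sub>L (c U (V \<otimes> W) o\<^sub>L assoc \<C> U V W) =
    tensL \<C> V (U \<otimes> W) (W \<otimes> U) (c U W) o\<^sub>L (assoc \<C> V U W o\<^sub>L tensR \<C> (U \<otimes> V) (V \<otimes> U) (c U V) W)"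
  using bi_regular assms unfolding bi_regular_braiding_def braiding_def
  by (simp only: blinfun_compose_assoc)

lemma hexagon2:
  assumes "U \<in> Obj \<C>" "V \<in> Obj \<C>" "W \<in> Obj \<C>"
  shows "adj (assoc \<C> W U V) o\<^sub>L (c (U \<otimes> V) W o\<^sub>L adj (assoc \<C> U V W)) =
    tensR \<C> (U \<otimes> W) (W \<otimes> U) (c U W) V o\<^sub>L (adj (assoc \<C> U W V) o\<^sub>L tensL \<C> U (V \<otimes> W) (W \<otimes> V) (c V W))"
proof -
  have "assoc_inv \<C> W U V o\<^sub>L c (U \<otimes> V) W o\<^sub>L assoc_inv \<C> U V W =
    tensR \<C> (U \<otimes> W) (W \<otimes> U) (c U W) V o\<^sub>L assoc_inv \<C> U W V o\<^sub>L tensL \<C> U (V \<otimes> W) (W \<otimes> V) (c V W)"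
    using bi_regular assms unfolding bi_regular_braiding_def braiding_def by blast
  then show ?thesis using assms by (simp add: blinfun_compose_assoc)
qed

lemma slices_c:
  assumes "H \<in> Obj \<C>" "K \<in> Obj \<C>"
  shows "slices H K K H (c H K) = compact_op (Hs \<C> K) (Hs \<C> H)"
proof -
  have "opspan {slice_fst \<C> H K K H (c H K) \<omega> | \<omega>. \<omega> \<in> normal_on \<C> H K} = compact_op (Hs \<C> K) (Hs \<C> H)"
    using bi_regular assms unfolding bi_regular_braiding_def by blast
  then show ?thesis using assms by (simp add: slice_fst_opspan)
qed

lemma compact_op_opspan:
  assumes "H \<in> Obj \<C>" "K \<in> Obj \<C>" and closed: "opspan S = compact_op (Hs \<C> H) (Hs \<C> K)"
  shows "compact_op (Hs \<C> H) (Hs \<C> K) = opspan {rank_one u v | u v. u \<in> Hs \<C> K \<and> v \<in> Hs \<C> H}"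
proof
  show "compact_op (Hs \<C> H) (Hs \<C> K) \<subseteq> opspan {rank_one u v | u v. u \<in> Hs \<C> K \<and> v \<in> Hs \<C> H}"
    using compact_op_approx[of "Hs \<C> H" "Hs \<C> K"] assms by auto
  have "{rank_one u v | u v. u \<in> Hs \<C> K \<and> v \<in> Hs \<C> H} \<subseteq> opspan S"
    unfolding closed using compact_rank_one[of "Hs \<C> K"] hilbert_subspace_Hs[OF assms(2)]
    by (auto simp: hilbert_subspace_def)
  then show "opspan {rank_one u v | u v. u \<in> Hs \<C> K \<and> v \<in> Hs \<C> H} \<subseteq> compact_op (Hs \<C> H) (Hs \<C> K)"
    unfolding closed[symmetric] by (intro opspan_subsetI) blast
qed

lemma adj_rank_one: "adj (rank_one u v) = rank_one v u"
proof (rule adj_eqI)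
  show "cinner (rank_one v u x) y = cinner x (rank_one u v y)" for x y
    using cinner_commute[of x u] by (simp add: cinner_scaleC_left cinner_scaleC_right mult.commute)
qed (rule clin_rank_one)

lemma adj_compact:
  assumes obj: "H \<in> Obj \<C>" "K \<in> Obj \<C>" and x: "x \<in> compact_op (Hs \<C> H) (Hs \<C> K)"
  shows "adj x \<in> compact_op (Hs \<C> K) (Hs \<C> H)"
proof -
  note eq = compact_op_opspan[OF obj(2,1) slices_c[OF obj]] compact_op_opspan[OF obj slices_c[OF obj(2,1)]]
  show ?thesis unfolding eq(1)
    by (rule opspan_adj[OF x[unfolded eq(2)]]) (auto simp: adj_rank_one intro!: opspan_base, blast)
qed

text \<open>Slices of \<open>adj (c K H)\<close> are adjoints of slices of \<open>c K H\<close>, and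
  compact operators are stable under adjoints because rank one operators are.\<close>

lemma slices_c_adj:
  assumes obj: "H \<in> Obj \<C>" "K \<in> Obj \<C>"
  shows "slices H K K H (adj (c K H)) = compact_op (Hs \<C> K) (Hs \<C> H)"
proof (intro equalityI subsetI)
  fix x assume "x \<in> slices H K K H (adj (c K H))"
  then have "adj x \<in> slices K H H K (c K H)"
    using slices_adj[of H K K H "adj (c K H)" x] obj by simp
  then have "adj (adj x) \<in> compact_op (Hs \<C> K) (Hs \<C> H)"
    using obj by (intro adj_compact[of H K "adj x"]) (simp_all only: slices_c)
  moreover have "clin x"
    using \<open>x \<in> slices H K K H (adj (c K H))\<close> opspan_clin coefs_clin[of H K K H "adj (c K H)"] obj by auto
  ultimately show "x \<in> compact_op (Hs \<C> K) (Hs \<C> H)" by simp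
next
  fix x assume x: "x \<in> compact_op (Hs \<C> K) (Hs \<C> H)"
  then have "adj x \<in> slices K H H K (c K H)" using obj adj_compact[of K H x] by (simp add: slices_c)
  then have "adj (adj x) \<in> slices H K K H (adj (c K H))" using obj by (intro slices_adj) simp_all
  moreover have "clin x" using x bop_clin by (auto simp: compact_op_def simp del: bop_simps)
  ultimately show "x \<in> slices H K K H (adj (c K H))" by simp
qed

subsection \<open>The embeddings of the factors\<close>

lemma iota2_eq: "H1 \<in> Obj \<C> \<Longrightarrow> H2 \<in> Obj \<C> \<Longrightarrow>
    iota2 \<C> c H1 H2 b = c H2 H1 o\<^sub>L (tensR \<C> H2 H2 b H1 o\<^sub>L adj (c H2 H1))"
  by (simp add: iota2_def blinfun_compose_assoc)

lemma iota_simps [simp]: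
  assumes "H1 \<in> Obj \<C>" "H2 \<in> Obj \<C>"
  shows "a \<in> B H1 H1 \<Longrightarrow> clin (iota1 \<C> H1 H2 a)"
    "a \<in> B H1 H1 \<Longrightarrow> lands (iota1 \<C> H1 H2 a) (Hs \<C> (H1 \<otimes> H2))"
    "a \<in> B H1 H1 \<Longrightarrow> vanishes (iota1 \<C> H1 H2 a) (Hs \<C> (H1 \<otimes> H2))"
    "a \<in> B H1 H1 \<Longrightarrow> adj (iota1 \<C> H1 H2 a) = iota1 \<C> H1 H2 (adj a)"
    "b \<in> B H2 H2 \<Longrightarrow> clin (iota2 \<C> c H1 H2 b)"
    "b \<in> B H2 H2 \<Longrightarrow> lands (iota2 \<C> c H1 H2 b) (Hs \<C> (H1 \<otimes> H2))"
    "b \<in> B H2 H2 \<Longrightarrow> vanishes (iota2 \<C> c H1 H2 b) (Hs \<C> (H1 \<otimes> H2))"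
    "b \<in> B H2 H2 \<Longrightarrow> adj (iota2 \<C> c H1 H2 b) = iota2 \<C> c H1 H2 (adj b)"
  using assms by (simp_all add: iota1_def iota2_eq blinfun_compose_assoc)

lemma iota1_mult:
  assumes "H1 \<in> Obj \<C>" "H2 \<in> Obj \<C>" "a \<in> B H1 H1" "b \<in> B H1 H1"
  shows "iota1 \<C> H1 H2 a o\<^sub>L iota1 \<C> H1 H2 b = iota1 \<C> H1 H2 (a o\<^sub>L b)"
  using assms by (simp add: iota1_def tens_comp)

lemma iota2_mult:
  assumes "H1 \<in> Obj \<C>" "H2 \<in> Obj \<C>" "a \<in> B H2 H2" "b \<in> B H2 H2"
  shows "iota2 \<C> c H1 H2 a o\<^sub>L iota2 \<C> c H1 H2 b = iota2 \<C> c H1 H2 (a o\<^sub>L b)"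
  using assms by (simp add: iota2_eq blinfun_compose_assoc c_unitary[THEN comp_reassoc] tens_comp
      tens_comp[THEN comp_reassoc])

lemma semilin_iota1: "H1 \<in> Obj \<C> \<Longrightarrow> H2 \<in> Obj \<C> \<Longrightarrow> semilin_on (B H1 H1) (iota1 \<C> H1 H2)"
  unfolding iota1_def by (rule semilin_tens_left) simp_all

lemma semilin_iota2:
  assumes "H1 \<in> Obj \<C>" "H2 \<in> Obj \<C>" shows "semilin_on (B H2 H2) (iota2 \<C> c H1 H2)"
proof -
  have "semilin_on (B H2 H2) (\<lambda>b. c H2 H1 o\<^sub>L (tensR \<C> H2 H2 b H1 o\<^sub>L adj (c H2 H1)))"
    using assms by (intro semilin_comp[OF _ semilin_right] semilin_comp[OF _ semilin_left] semilin_tens_left) simp_all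
  moreover have "iota2 \<C> c H1 H2 = (\<lambda>b. c H2 H1 o\<^sub>L (tensR \<C> H2 H2 b H1 o\<^sub>L adj (c H2 H1)))"
    using assms by (intro ext iota2_eq)
  ultimately show ?thesis by simp
qed

text \<open>Naturality carries the morphism \<open>X\<close> through both crossings, and between
  them it acts on another leg than \<open>b\<close>. Thus \<open>b\<close> can be any bounded
  operator.\<close>

lemma iota2_tensR_commute:
  assumes "G \<in> Obj \<C>" "H \<in> Obj \<C>" "b \<in> B H H" "X \<in> Hom \<C> G G"
  shows "iota2 \<C> c G H b o\<^sub>L tensR \<C> G G X H = tensR \<C> G G X H o\<^sub>L iota2 \<C> c G H b"
proof -
  have X: "X \<in> B G G" using Hom_B assms by simp
  have nat: "c H G o\<^sub>L tensL \<C> H G G X = tensR \<C> G G X H o\<^sub>L c H G"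
    using assms by (intro c_natural Hom_id)
  have nat': "adj (c H G) o\<^sub>L tensR \<C> G G X H = tensL \<C> H G G X o\<^sub>L adj (c H G)"
  proof -
    have "adj (c H G) o\<^sub>L tensR \<C> G G X H = adj (c H G) o\<^sub>L ((tensR \<C> G G X H o\<^sub>L c H G) o\<^sub>L adj (c H G))"
      using assms X by (simp add: blinfun_compose_assoc)
    also have "\<dots> = tensL \<C> H G G X o\<^sub>L adj (c H G)"
      unfolding nat[symmetric] using assms X by (simp add: blinfun_compose_assoc c_unitary[THEN comp_reassoc])
    finally show ?thesis .
  qed
  show ?thesis using assms X
    by (simp add: iota2_eq blinfun_compose_assoc nat' tens_comp[THEN comp_reassoc]
        nat[symmetric, THEN comp_reassoc])
qed

text \<open>The crossing of the first two legs of \<open>U \<otimes> (W \<otimes> V)\<close>. By the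
  second hexagon it is the crossing of \<open>U \<otimes> V\<close> with \<open>W\<close> from which
  the crossing of \<open>V\<close> with \<open>W\<close> has been removed.\<close>

definition hexC :: "'o \<Rightarrow> 'o \<Rightarrow> 'o \<Rightarrow> 'v op" where
  "hexC U W V = assoc \<C> W U V o\<^sub>L (tensR \<C> (U \<otimes> W) (W \<otimes> U) (c U W) V o\<^sub>L adj (assoc \<C> U W V))"

lemma hexC_simps [simp]:
  assumes "U \<in> Obj \<C>" "V \<in> Obj \<C>" "W \<in> Obj \<C>"
  shows "clin (hexC U W V)" "lands (hexC U W V) (Hs \<C> (W \<otimes> (U \<otimes> V)))"
    "vanishes (hexC U W V) (Hs \<C> (U \<otimes> (W \<otimes> V)))"
    "adj (hexC U W V) o\<^sub>L hexC U W V = idm \<C> (U \<otimes> (W \<otimes> V))"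
    "hexC U W V o\<^sub>L adj (hexC U W V) = idm \<C> (W \<otimes> (U \<otimes> V))"
  using assms by (simp_all add: hexC_def blinfun_compose_assoc assoc_adj_comp assoc_comp_adj
      assoc_adj_comp[THEN comp_reassoc] assoc_comp_adj[THEN comp_reassoc] tens_comp tens_comp[THEN comp_reassoc])

lemma hexC:
  assumes "U \<in> Obj \<C>" "V \<in> Obj \<C>" "W \<in> Obj \<C>"
  shows "hexC U W V o\<^sub>L tensL \<C> U (V \<otimes> W) (W \<otimes> V) (c V W) = c (U \<otimes> V) W o\<^sub>L adj (assoc \<C> U V W)"
  unfolding hexC_def using assms
  by (simp add: blinfun_compose_assoc hexagon2[symmetric] assoc_comp_adj[THEN comp_reassoc])

lemma c_tens_left:
  assumes "U \<in> Obj \<C>" "V \<in> Obj \<C>" "W \<in> Obj \<C>"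
  shows "c (U \<otimes> V) W = hexC U W V o\<^sub>L (tensL \<C> U (V \<otimes> W) (W \<otimes> V) (c V W) o\<^sub>L assoc \<C> U V W)"
  using assms hexC[OF assms, THEN comp_reassoc, of "assoc \<C> U V W"]
  by (simp add: blinfun_compose_assoc assoc_adj_comp)

text \<open>\<open>lift1\<close> and \<open>lift2\<close> amplify \<open>X\<close> to an operator on
  \<open>K \<otimes> (H1 \<otimes> H2)\<close>. They are designed so that slicing over
  \<open>K\<close> yields the embedded slices of \<open>X\<close>, for \<open>iota1\<close> and
  \<open>iota2\<close> respectively.\<close>

definition lift1 :: "'o \<Rightarrow> 'o \<Rightarrow> 'o \<Rightarrow> 'v op \<Rightarrow> 'v op" where
  "lift1 K H1 H2 X = assoc \<C> K H1 H2 o\<^sub>L (tensR \<C> (K \<otimes> H1) (K \<otimes> H1) X H2 o\<^sub>L adj (assoc \<C> K H1 H2))"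

definition lift2 :: "'o \<Rightarrow> 'o \<Rightarrow> 'o \<Rightarrow> 'v op \<Rightarrow> 'v op" where
  "lift2 K H1 H2 X = tensL \<C> K (H2 \<otimes> H1) (H1 \<otimes> H2) (c H2 H1) o\<^sub>L (lift1 K H2 H1 X o\<^sub>L
     tensL \<C> K (H1 \<otimes> H2) (H2 \<otimes> H1) (adj (c H2 H1)))"

lemma lift1_simps [simp]:
  assumes "K \<in> Obj \<C>" "H1 \<in> Obj \<C>" "H2 \<in> Obj \<C>" "X \<in> B (K \<otimes> H1) (K \<otimes> H1)"
  shows "clin (lift1 K H1 H2 X)" "lands (lift1 K H1 H2 X) (Hs \<C> (K \<otimes> (H1 \<otimes> H2)))"
    "vanishes (lift1 K H1 H2 X) (Hs \<C> (K \<otimes> (H1 \<otimes> H2)))"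
  using assms by (simp_all add: lift1_def)

lemma lift2_simps [simp]:
  assumes "K \<in> Obj \<C>" "H1 \<in> Obj \<C>" "H2 \<in> Obj \<C>" "X \<in> B (K \<otimes> H2) (K \<otimes> H2)"
  shows "clin (lift2 K H1 H2 X)" "lands (lift2 K H1 H2 X) (Hs \<C> (K \<otimes> (H1 \<otimes> H2)))"
    "vanishes (lift2 K H1 H2 X) (Hs \<C> (K \<otimes> (H1 \<otimes> H2)))"
  using assms by (simp_all add: lift2_def)

lemma assoc_adj_Hom: "X \<in> Obj \<C> \<Longrightarrow> Y \<in> Obj \<C> \<Longrightarrow> Z \<in> Obj \<C> \<Longrightarrow>
    adj (assoc \<C> X Y Z) \<in> Hom \<C> (X \<otimes> (Y \<otimes> Z)) ((X \<otimes> Y) \<otimes> Z)"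
  by (intro Hom_adj assoc_Hom) simp_all

lemma lift1_Hom:
  assumes "K \<in> Obj \<C>" "H1 \<in> Obj \<C>" "H2 \<in> Obj \<C>" "X \<in> Hom \<C> (K \<otimes> H1) (K \<otimes> H1)"
  shows "lift1 K H1 H2 X \<in> Hom \<C> (K \<otimes> (H1 \<otimes> H2)) (K \<otimes> (H1 \<otimes> H2))"
  unfolding lift1_def
  by (rule Hom_comp[OF _ _ _ Hom_comp[OF _ _ _ assoc_adj_Hom tens_Hom] assoc_Hom])
    (use assms in \<open>simp_all add: Hom_id\<close>)

lemma lift2_Hom:
  assumes "K \<in> Obj \<C>" "H1 \<in> Obj \<C>" "H2 \<in> Obj \<C>" "X \<in> Hom \<C> (K \<otimes> H2) (K \<otimes> H2)"
  shows "lift2 K H1 H2 X \<in> Hom \<C> (K \<otimes> (H1 \<otimes> H2)) (K \<otimes> (H1 \<otimes> H2))"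
  unfolding lift2_def
  by (rule Hom_comp[OF _ _ _ Hom_comp[OF _ _ _ tens_Hom lift1_Hom] tens_Hom])
    (use assms in \<open>simp_all add: Hom_id Hom_adj c_Hom\<close>)

lemma coef_lift1:
  assumes "K \<in> Obj \<C>" "H1 \<in> Obj \<C>" "H2 \<in> Obj \<C>" "X \<in> B (K \<otimes> H1) (K \<otimes> H1)" "\<xi> \<in> Hs \<C> K" "\<eta> \<in> Hs \<C> K"
  shows "coef K K (H1 \<otimes> H2) (H1 \<otimes> H2) \<eta> \<xi> (lift1 K H1 H2 X) = iota1 \<C> H1 H2 (coef K K H1 H1 \<eta> \<xi> X)"
  unfolding iota1_def lift1_def using assms by (simp add: tensR_coef blinfun_compose_assoc)

lemma coef_lift2:
  assumes "K \<in> Obj \<C>" "H1 \<in> Obj \<C>" "H2 \<in> Obj \<C>" "X \<in> B (K \<otimes> H2) (K \<otimes> H2)" "\<xi> \<in> Hs \<C> K" "\<eta> \<in> Hs \<C> K"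
  shows "coef K K (H1 \<otimes> H2) (H1 \<otimes> H2) \<eta> \<xi> (lift2 K H1 H2 X) = iota2 \<C> c H1 H2 (coef K K H2 H2 \<eta> \<xi> X)"
proof -
  have "coef K K (H1 \<otimes> H2) (H1 \<otimes> H2) \<eta> \<xi> (lift2 K H1 H2 X) =
      c H2 H1 o\<^sub>L (coef K K (H2 \<otimes> H1) (H2 \<otimes> H1) \<eta> \<xi> (lift1 K H2 H1 X) o\<^sub>L adj (c H2 H1))"
    unfolding lift2_def using assms
    by (simp add: blinfun_compose_assoc tensL_ket bra_tensL[THEN comp_reassoc])
  then show ?thesis using assms by (simp add: coef_lift1 iota2_eq iota1_def)
qed

lemma coef_eqI:
  assumes obj: "H \<in> Obj \<C>" "H' \<in> Obj \<C>" "K \<in> Obj \<C>" "K' \<in> Obj \<C>"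
    and ST: "S \<in> B (H \<otimes> K) (H' \<otimes> K')" "T \<in> B (H \<otimes> K) (H' \<otimes> K')"
    and eq: "\<And>\<xi> \<eta>. \<xi> \<in> Hs \<C> H \<Longrightarrow> \<eta> \<in> Hs \<C> H' \<Longrightarrow> coef H H' K K' \<eta> \<xi> S = coef H H' K K' \<eta> \<xi> T"
  shows "S = T"
proof (rule ket_eqI[OF obj(1,3) ST])
  fix \<xi> assume \<xi>: "\<xi> \<in> Hs \<C> H"
  have "adj (S o\<^sub>L ket H K \<xi>) = adj (T o\<^sub>L ket H K \<xi>)"
  proof (rule ket_eqI[OF obj(2,4), of _ "Hs \<C> K" _ "Hs \<C> K"])
    fix \<eta> assume \<eta>: "\<eta> \<in> Hs \<C> H'"
    show "adj (S o\<^sub>L ket H K \<xi>) o\<^sub>L ket H' K' \<eta> = adj (T o\<^sub>L ket H K \<xi>) o\<^sub>L ket H' K' \<eta>"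
      using arg_cong[OF eq[OF \<xi> \<eta>], of adj] obj ST by (simp add: blinfun_compose_assoc)
  qed (use obj ST in simp_all)
  from arg_cong[OF this, of adj] show "S o\<^sub>L ket H K \<xi> = T o\<^sub>L ket H K \<xi>" using obj ST by simp
qed

text \<open>Completed by the crossing of \<open>V\<close> with \<open>W\<close>, \<open>hexC\<close>
  is the crossing of \<open>U \<otimes> V\<close> with \<open>W\<close>, through which
  \<open>Y\<close> passes by naturality. The conjugation by the added crossing is what
  \<open>lift2\<close> contains.\<close>

lemma tensL_hexC:
  assumes obj: "U \<in> Obj \<C>" "V \<in> Obj \<C>" "W \<in> Obj \<C>" and Y: "Y \<in> Hom \<C> (U \<otimes> V) (U \<otimes> V)"
  shows "tensL \<C> W (U \<otimes> V) (U \<otimes> V) Y o\<^sub>L hexC U W V = hexC U W V o\<^sub>L lift2 U W V Y"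
proof -
  have YB: "Y \<in> B (U \<otimes> V) (U \<otimes> V)" using Y obj Hom_B by simp
  have "hexC U W V o\<^sub>L lift2 U W V Y = c (U \<otimes> V) W o\<^sub>L (tensR \<C> (U \<otimes> V) (U \<otimes> V) Y W o\<^sub>L
      (adj (assoc \<C> U V W) o\<^sub>L tensL \<C> U (W \<otimes> V) (V \<otimes> W) (adj (c V W))))"
    unfolding lift2_def lift1_def using obj YB
    by (simp add: hexC[THEN comp_reassoc] blinfun_compose_assoc assoc_adj_comp[THEN comp_reassoc])
  also have "\<dots> = tensL \<C> W (U \<otimes> V) (U \<otimes> V) Y o\<^sub>L (c (U \<otimes> V) W o\<^sub>L
      (adj (assoc \<C> U V W) o\<^sub>L tensL \<C> U (W \<otimes> V) (V \<otimes> W) (adj (c V W))))"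
    using c_natural[of "U \<otimes> V" "U \<otimes> V" W W Y "idm \<C> W", THEN comp_reassoc] obj Y
    by (simp add: Hom_id blinfun_compose_assoc)
  also have "c (U \<otimes> V) W o\<^sub>L (adj (assoc \<C> U V W) o\<^sub>L tensL \<C> U (W \<otimes> V) (V \<otimes> W) (adj (c V W))) = hexC U W V"
    using obj by (simp add: blinfun_compose_assoc tens_comp flip: hexC[THEN comp_reassoc] blinfun_compose_assoc[of "c (U \<otimes> V) W"] hexC)
  finally show ?thesis by simp
qed

lemma tens_tens_assoc:
  assumes "X \<in> Obj \<C>" "Y \<in> Obj \<C>" "Z \<in> Obj \<C>" "b \<in> B X X"
  shows "assoc \<C> X Y Z o\<^sub>L tensR \<C> (X \<otimes> Y) (X \<otimes> Y) (tensR \<C> X X b Y) Z =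
    tensR \<C> X X b (Y \<otimes> Z) o\<^sub>L assoc \<C> X Y Z"
  using assms assoc_natural[of X Y Z X Y Z b "idm \<C> Y" "idm \<C> Z"] by simp

lemma tens_tens_assoc_adj:
  assumes "X \<in> Obj \<C>" "Y \<in> Obj \<C>" "Z \<in> Obj \<C>" "b \<in> B X X"
  shows "tensR \<C> (X \<otimes> Y) (X \<otimes> Y) (tensR \<C> X X b Y) Z o\<^sub>L adj (assoc \<C> X Y Z) =
    adj (assoc \<C> X Y Z) o\<^sub>L tensR \<C> X X b (Y \<otimes> Z)"
  using arg_cong[OF tens_tens_assoc[of X Y Z "adj b"], of adj] assms by simp

lemma cancel_right:
  assumes "P o\<^sub>L U = Q o\<^sub>L U" "U o\<^sub>L V = idm \<C> X" "X \<in> Obj \<C>"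
    "clin P" "vanishes P (Hs \<C> X)" "clin Q" "vanishes Q (Hs \<C> X)"
  shows "P = Q"
proof -
  have "P o\<^sub>L (U o\<^sub>L V) = Q o\<^sub>L (U o\<^sub>L V)" using assms(1) by (simp flip: blinfun_compose_assoc)
  then show ?thesis using assms by simp
qed

text \<open>The crossing of \<open>U \<otimes> V\<close> with \<open>W\<close> is made of one for
  \<open>V\<close> and one for \<open>U\<close>; since \<open>b\<close> acts on \<open>U\<close>
  only, the one for \<open>V\<close> cancels.\<close>

lemma iota2_tensR:
  assumes obj: "U \<in> Obj \<C>" "V \<in> Obj \<C>" "W \<in> Obj \<C>" and b: "b \<in> B U U"
  shows "iota2 \<C> c W (U \<otimes> V) (tensR \<C> U U b V) o\<^sub>L assoc \<C> W U V =
    assoc \<C> W U V o\<^sub>L tensR \<C> (W \<otimes> U) (W \<otimes> U) (iota2 \<C> c W U b) V"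
proof -
  \<comment> \<open>The part of \<open>c (U \<otimes> V) W\<close> in which \<open>V\<close> crosses
    \<open>W\<close>; it leaves the leg of \<open>b\<close> untouched.\<close>
  let ?Q = "adj (assoc \<C> U W V) o\<^sub>L (tensL \<C> U (V \<otimes> W) (W \<otimes> V) (c V W) o\<^sub>L assoc \<C> U V W)"
  have cQ: "c (U \<otimes> V) W = assoc \<C> W U V o\<^sub>L (tensR \<C> (U \<otimes> W) (W \<otimes> U) (c U W) V o\<^sub>L ?Q)"
    unfolding c_tens_left[OF obj] hexC_def by (simp add: blinfun_compose_assoc)
  have Qb: "?Q o\<^sub>L tensR \<C> (U \<otimes> V) (U \<otimes> V) (tensR \<C> U U b V) W =
      tensR \<C> (U \<otimes> W) (U \<otimes> W) (tensR \<C> U U b W) V o\<^sub>L ?Q"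
    using obj b by (simp add: blinfun_compose_assoc tens_tens_assoc tens_comp[THEN comp_reassoc]
        tens_tens_assoc_adj[THEN comp_reassoc] tens_comp)
  have "(iota2 \<C> c W (U \<otimes> V) (tensR \<C> U U b V) o\<^sub>L assoc \<C> W U V) o\<^sub>L (adj (assoc \<C> W U V) o\<^sub>L c (U \<otimes> V) W) =
      c (U \<otimes> V) W o\<^sub>L tensR \<C> (U \<otimes> V) (U \<otimes> V) (tensR \<C> U U b V) W"
    using obj b by (simp add: iota2_eq blinfun_compose_assoc assoc_comp_adj[THEN comp_reassoc])
  also have "\<dots> = assoc \<C> W U V o\<^sub>L (tensR \<C> (U \<otimes> W) (W \<otimes> U) (c U W) V o\<^sub>L
      (tensR \<C> (U \<otimes> W) (U \<otimes> W) (tensR \<C> U U b W) V o\<^sub>L ?Q))"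
    unfolding cQ by (simp only: blinfun_compose_assoc Qb[unfolded blinfun_compose_assoc])
  also have "\<dots> = (assoc \<C> W U V o\<^sub>L tensR \<C> (W \<otimes> U) (W \<otimes> U) (iota2 \<C> c W U b) V) o\<^sub>L
      (adj (assoc \<C> W U V) o\<^sub>L c (U \<otimes> V) W)"
    unfolding cQ using obj b
    by (simp add: blinfun_compose_assoc assoc_adj_comp[THEN comp_reassoc] tens_comp[THEN comp_reassoc]
        iota2_eq)
  finally show ?thesis
    by (rule cancel_right[of _ "adj (assoc \<C> W U V) o\<^sub>L c (U \<otimes> V) W" _ "adj (c (U \<otimes> V) W) o\<^sub>L assoc \<C> W U V" "(W \<otimes> U) \<otimes> V"])
      (use obj b in \<open>simp_all add: blinfun_compose_assoc c_unitary[THEN comp_reassoc] assoc_adj_comp\<close>)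
qed

text \<open>The counterpart of \<open>hexC\<close> for the first hexagon: the crossing of the last
  two of three legs bracketed to the left.\<close>

definition hexE :: "'o \<Rightarrow> 'o \<Rightarrow> 'o \<Rightarrow> 'v op" where
  "hexE V U W = adj (assoc \<C> V W U) o\<^sub>L (tensL \<C> V (U \<otimes> W) (W \<otimes> U) (c U W) o\<^sub>L assoc \<C> V U W)"

lemma hexE_simps [simp]:
  assumes "U \<in> Obj \<C>" "V \<in> Obj \<C>" "W \<in> Obj \<C>"
  shows "clin (hexE V U W)" "lands (hexE V U W) (Hs \<C> ((V \<otimes> W) \<otimes> U))"
    "vanishes (hexE V U W) (Hs \<C> ((V \<otimes> U) \<otimes> W))"
    "adj (hexE V U W) o\<^sub>L hexE V U W = idm \<C> ((V \<otimes> U) \<otimes> W)"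
    "hexE V U W o\<^sub>L adj (hexE V U W) = idm \<C> ((V \<otimes> W) \<otimes> U)"
  using assms by (simp_all add: hexE_def blinfun_compose_assoc assoc_adj_comp assoc_comp_adj
      assoc_adj_comp[THEN comp_reassoc] assoc_comp_adj[THEN comp_reassoc] tens_comp tens_comp[THEN comp_reassoc])

lemma hexE:
  assumes "U \<in> Obj \<C>" "V \<in> Obj \<C>" "W \<in> Obj \<C>"
  shows "c U (V \<otimes> W) o\<^sub>L assoc \<C> U V W = hexE V U W o\<^sub>L tensR \<C> (U \<otimes> V) (V \<otimes> U) (c U V) W"
  unfolding hexE_def using assms
  by (simp add: blinfun_compose_assoc hexagon1[symmetric] assoc_adj_comp[THEN comp_reassoc])

text \<open>By the first hexagon, \<open>U\<close> crosses \<open>V \<otimes> W\<close> by crossing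
  \<open>V\<close> and then performing \<open>hexE\<close>; the crossing with \<open>V\<close> is
  invertible and cancels at the end.\<close>

lemma iota2_hexE:
  assumes obj: "U \<in> Obj \<C>" "V \<in> Obj \<C>" "W \<in> Obj \<C>" and b: "b \<in> B U U"
  shows "iota2 \<C> c (V \<otimes> W) U b o\<^sub>L hexE V U W = hexE V U W o\<^sub>L tensR \<C> (V \<otimes> U) (V \<otimes> U) (iota2 \<C> c V U b) W"
proof -
  let ?c = "tensR \<C> (U \<otimes> V) (V \<otimes> U) (c U V) W"
  have "(iota2 \<C> c (V \<otimes> W) U b o\<^sub>L hexE V U W) o\<^sub>L ?c =
      c U (V \<otimes> W) o\<^sub>L (tensR \<C> U U b (V \<otimes> W) o\<^sub>L assoc \<C> U V W)"
    using obj b by (simp add: blinfun_compose_assoc hexE[symmetric] iota2_eq c_unitary[THEN comp_reassoc])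
  also have "\<dots> = hexE V U W o\<^sub>L (?c o\<^sub>L tensR \<C> (U \<otimes> V) (U \<otimes> V) (tensR \<C> U U b V) W)"
    using obj b by (simp add: tens_tens_assoc[symmetric] hexE[THEN comp_reassoc] blinfun_compose_assoc)
  also have "\<dots> = (hexE V U W o\<^sub>L tensR \<C> (V \<otimes> U) (V \<otimes> U) (iota2 \<C> c V U b) W) o\<^sub>L ?c"
    using obj b by (simp add: blinfun_compose_assoc tens_comp iota2_eq)
  finally show ?thesis
    by (rule cancel_right[of _ ?c _ "adj ?c" "(V \<otimes> U) \<otimes> W"]) (use obj b in \<open>simp_all add: tens_comp\<close>)
qed

text \<open>Embedding past \<open>H1\<close> and then past \<open>K\<close> agrees with embedding
  past \<open>K \<otimes> H1\<close>, since the strand of \<open>H2\<close> crosses the same strands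
  in either case.\<close>

lemma iota2_iota2:
  assumes obj: "K \<in> Obj \<C>" "H1 \<in> Obj \<C>" "H2 \<in> Obj \<C>" and b: "b \<in> B H2 H2"
  shows "iota2 \<C> c K (H1 \<otimes> H2) (iota2 \<C> c H1 H2 b) o\<^sub>L assoc \<C> K H1 H2 =
    assoc \<C> K H1 H2 o\<^sub>L iota2 \<C> c (K \<otimes> H1) H2 b"
proof -
  let ?c = "tensL \<C> K (H2 \<otimes> H1) (H1 \<otimes> H2) (c H2 H1)"
  \<comment> \<open>The crossing of \<open>H2\<close> with \<open>H1\<close> is itself a morphism,
    hence slides through the crossing with \<open>K\<close>; this brings the inner embedding to the
    outside.\<close>
  have nat: "c (H1 \<otimes> H2) K o\<^sub>L tensR \<C> (H2 \<otimes> H1) (H1 \<otimes> H2) (c H2 H1) K = ?c o\<^sub>L c (H2 \<otimes> H1) K"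
    using obj by (intro c_natural) (simp_all add: c_Hom Hom_id)
  have 1: "iota2 \<C> c K (H1 \<otimes> H2) (iota2 \<C> c H1 H2 b) o\<^sub>L ?c = ?c o\<^sub>L iota2 \<C> c K (H2 \<otimes> H1) (tensR \<C> H2 H2 b H1)"
  proof (rule cancel_right[of _ "c (H2 \<otimes> H1) K" _ "adj (c (H2 \<otimes> H1) K)" "K \<otimes> (H2 \<otimes> H1)"])
    show "(iota2 \<C> c K (H1 \<otimes> H2) (iota2 \<C> c H1 H2 b) o\<^sub>L ?c) o\<^sub>L c (H2 \<otimes> H1) K =
        (?c o\<^sub>L iota2 \<C> c K (H2 \<otimes> H1) (tensR \<C> H2 H2 b H1)) o\<^sub>L c (H2 \<otimes> H1) K" (is "?l = ?r")
    proof -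
      have "?l = c (H1 \<otimes> H2) K o\<^sub>L (tensR \<C> (H1 \<otimes> H2) (H1 \<otimes> H2) (iota2 \<C> c H1 H2 b) K o\<^sub>L
          tensR \<C> (H2 \<otimes> H1) (H1 \<otimes> H2) (c H2 H1) K)"
        using obj b by (simp add: blinfun_compose_assoc nat[symmetric] iota2_eq[of K] c_unitary[THEN comp_reassoc])
      also have "\<dots> = c (H1 \<otimes> H2) K o\<^sub>L (tensR \<C> (H2 \<otimes> H1) (H1 \<otimes> H2) (c H2 H1) K o\<^sub>L
          tensR \<C> (H2 \<otimes> H1) (H2 \<otimes> H1) (tensR \<C> H2 H2 b H1) K)"
        using obj b by (simp add: tens_comp iota2_eq[of H1] blinfun_compose_assoc)
      also have "\<dots> = ?r"
        using obj b by (simp add: nat[THEN comp_reassoc] blinfun_compose_assoc iota2_eq)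
      finally show ?thesis .
    qed
  qed (use obj b in simp_all)
  have "iota2 \<C> c K (H1 \<otimes> H2) (iota2 \<C> c H1 H2 b) o\<^sub>L (assoc \<C> K H1 H2 o\<^sub>L hexE K H2 H1) =
      assoc \<C> K H1 H2 o\<^sub>L (iota2 \<C> c (K \<otimes> H1) H2 b o\<^sub>L hexE K H2 H1)"
  proof -
    have E: "assoc \<C> K H1 H2 o\<^sub>L hexE K H2 H1 = ?c o\<^sub>L assoc \<C> K H2 H1"
      unfolding hexE_def using obj by (simp add: assoc_comp_adj[THEN comp_reassoc])
    show ?thesis
      using obj b
      by (simp add: iota2_hexE E[THEN comp_reassoc] blinfun_compose_assoc iota2_tensR[symmetric])
        (simp add: E 1[THEN comp_reassoc] blinfun_compose_assoc)
  qed
  then have "(iota2 \<C> c K (H1 \<otimes> H2) (iota2 \<C> c H1 H2 b) o\<^sub>L assoc \<C> K H1 H2) o\<^sub>L hexE K H2 H1 =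
      (assoc \<C> K H1 H2 o\<^sub>L iota2 \<C> c (K \<otimes> H1) H2 b) o\<^sub>L hexE K H2 H1"
    by (simp only: blinfun_compose_assoc)
  then show ?thesis
    by (rule cancel_right[of _ _ _ "adj (hexE K H2 H1)" "(K \<otimes> H1) \<otimes> H2"]) (use obj b in simp_all)
qed

text \<open>The two legs of a braided tensor product commute up to the crossing of the auxiliary objects:
  \<open>lift2 K2 K1 _ (lift2 K2 H1 H2 Y)\<close> passes over everything that \<open>lift1 K1 H1 H2 X\<close> touches.\<close>

lemma lift_commute:
  assumes obj: "K1 \<in> Obj \<C>" "K2 \<in> Obj \<C>" "H1 \<in> Obj \<C>" "H2 \<in> Obj \<C>"
    and X: "X \<in> Hom \<C> (K1 \<otimes> H1) (K1 \<otimes> H1)" and Y: "Y \<in> B (K2 \<otimes> H2) (K2 \<otimes> H2)"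
  defines "H \<equiv> H1 \<otimes> H2"
  shows "lift2 K2 K1 H (lift2 K2 H1 H2 Y) o\<^sub>L tensL \<C> K2 (K1 \<otimes> H) (K1 \<otimes> H) (lift1 K1 H1 H2 X) =
    tensL \<C> K2 (K1 \<otimes> H) (K1 \<otimes> H) (lift1 K1 H1 H2 X) o\<^sub>L lift2 K2 K1 H (lift2 K2 H1 H2 Y)"
proof (rule coef_eqI[of K2 K2 "K1 \<otimes> H" "K1 \<otimes> H"])
  have XB: "X \<in> B (K1 \<otimes> H1) (K1 \<otimes> H1)" using X obj Hom_B by simp
  let ?D = "lift2 K2 K1 H (lift2 K2 H1 H2 Y)" and ?X = "lift1 K1 H1 H2 X"
  show "?D o\<^sub>L tensL \<C> K2 (K1 \<otimes> H) (K1 \<otimes> H) ?X \<in> B (K2 \<otimes> (K1 \<otimes> H)) (K2 \<otimes> (K1 \<otimes> H))"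
    "tensL \<C> K2 (K1 \<otimes> H) (K1 \<otimes> H) ?X o\<^sub>L ?D \<in> B (K2 \<otimes> (K1 \<otimes> H)) (K2 \<otimes> (K1 \<otimes> H))"
    using obj XB Y by (simp_all add: H_def)
  fix \<xi> \<eta> assume v: "\<xi> \<in> Hs \<C> K2" "\<eta> \<in> Hs \<C> K2"
  \<comment> \<open>Slicing over \<open>K2\<close> turns \<open>Y\<close> into a bounded operator
    \<open>b\<close> embedded in two stages, which commutes with the morphism \<open>X\<close> on
    other legs.\<close>
  define b where "b = coef K2 K2 H2 H2 \<eta> \<xi> Y"
  have b: "b \<in> B H2 H2" using obj Y by (simp add: b_def)
  have D: "coef K2 K2 (K1 \<otimes> H) (K1 \<otimes> H) \<eta> \<xi> ?D = iota2 \<C> c K1 H (iota2 \<C> c H1 H2 b)"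
    using obj Y v by (simp add: H_def coef_lift2 b_def)
  have "iota2 \<C> c K1 H (iota2 \<C> c H1 H2 b) o\<^sub>L ?X = ?X o\<^sub>L iota2 \<C> c K1 H (iota2 \<C> c H1 H2 b)"
  proof -
    let ?a = "assoc \<C> K1 H1 H2" and ?Z = "tensR \<C> (K1 \<otimes> H1) (K1 \<otimes> H1) X H2"
    have i: "iota2 \<C> c K1 H (iota2 \<C> c H1 H2 b) o\<^sub>L ?a = ?a o\<^sub>L iota2 \<C> c (K1 \<otimes> H1) H2 b" if "b \<in> B H2 H2" for b
      using iota2_iota2[OF obj(1,3,4) that] by (simp add: H_def)
    have i': "adj ?a o\<^sub>L iota2 \<C> c K1 H (iota2 \<C> c H1 H2 b) = iota2 \<C> c (K1 \<otimes> H1) H2 b o\<^sub>L adj ?a"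
      using arg_cong[OF i[of "adj b"], of adj] obj b by (simp add: H_def)
    show ?thesis
      unfolding lift1_def using obj XB b
      by (simp add: blinfun_compose_assoc i i' i[THEN comp_reassoc] iota2_tensR_commute[OF _ _ b X, THEN comp_reassoc])
  qed
  moreover have "coef K2 K2 (K1 \<otimes> H) (K1 \<otimes> H) \<eta> \<xi> (?D o\<^sub>L tensL \<C> K2 (K1 \<otimes> H) (K1 \<otimes> H) ?X) =
      coef K2 K2 (K1 \<otimes> H) (K1 \<otimes> H) \<eta> \<xi> ?D o\<^sub>L ?X"
    using obj XB v by (simp add: H_def blinfun_compose_assoc tensL_ket)
  moreover have "coef K2 K2 (K1 \<otimes> H) (K1 \<otimes> H) \<eta> \<xi> (tensL \<C> K2 (K1 \<otimes> H) (K1 \<otimes> H) ?X o\<^sub>L ?D) =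
      ?X o\<^sub>L coef K2 K2 (K1 \<otimes> H) (K1 \<otimes> H) \<eta> \<xi> ?D"
    using obj XB v by (simp add: H_def blinfun_compose_assoc bra_tensL[THEN comp_reassoc])
  ultimately show "coef K2 K2 (K1 \<otimes> H) (K1 \<otimes> H) \<eta> \<xi> (?D o\<^sub>L tensL \<C> K2 (K1 \<otimes> H) (K1 \<otimes> H) ?X) =
      coef K2 K2 (K1 \<otimes> H) (K1 \<otimes> H) \<eta> \<xi> (tensL \<C> K2 (K1 \<otimes> H) (K1 \<otimes> H) ?X o\<^sub>L ?D)"
    by (simp only: D)
qed (use obj in \<open>simp_all add: H_def\<close>)

end

section \<open>Algebras and morphisms\<close>

text \<open>Products of sets without any closed span, hence strictly associative;
  \<open>opspan\<close> then has to be taken only on the outside.\<close>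

definition op_prod :: "('v::chilbert_space) op set \<Rightarrow> 'v op set \<Rightarrow> 'v op set" where
  "op_prod S T = {x o\<^sub>L y | x y. x \<in> S \<and> y \<in> T}"

lemma op_prodI: "x \<in> S \<Longrightarrow> y \<in> T \<Longrightarrow> x o\<^sub>L y \<in> op_prod S T"
  unfolding op_prod_def by blast

lemma op_prodE:
  assumes "z \<in> op_prod S T" obtains x y where "x \<in> S" "y \<in> T" "z = x o\<^sub>L y"
  using assms unfolding op_prod_def by blast

lemma op_prod_assoc: "op_prod (op_prod S T) U = op_prod S (op_prod T U)"
proof (intro equalityI subsetI)
  fix z assume "z \<in> op_prod (op_prod S T) U"
  then show "z \<in> op_prod S (op_prod T U)"
    by (elim op_prodE) (simp add: blinfun_compose_assoc op_prodI)
next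
  fix z assume "z \<in> op_prod S (op_prod T U)"
  then show "z \<in> op_prod (op_prod S T) U"
    by (elim op_prodE) (simp add: blinfun_compose_assoc[symmetric] op_prodI)
qed

lemma op_prod_mono: "S \<subseteq> S' \<Longrightarrow> T \<subseteq> T' \<Longrightarrow> op_prod S T \<subseteq> op_prod S' T'"
  unfolding op_prod_def by blast

lemma opspan_mono: "S \<subseteq> T \<Longrightarrow> opspan S \<subseteq> opspan T"
  by (intro closure_mono op_vector.span_mono)

lemma subset_opspan: "S \<subseteq> opspan S"
  using opspan_base by blast

lemma opspan_prod_left: "opspan (op_prod (opspan S) T) = opspan (op_prod S T)"
proof
  show "opspan (op_prod (opspan S) T) \<subseteq> opspan (op_prod S T)"
  proof (rule opspan_subsetI)
    fix z assume "z \<in> op_prod (opspan S) T"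
    then obtain x y where z: "x \<in> opspan S" "y \<in> T" "z = x o\<^sub>L y" by (rule op_prodE)
    show "z \<in> opspan (op_prod S T)" unfolding z(3)
      by (rule opspan_comp_left[OF z(1)]) (auto intro!: opspan_base op_prodI z(2))
  qed
qed (intro opspan_mono op_prod_mono subset_opspan subset_refl)

text \<open>Scalars have to pass through the left factor, hence the condition on
  \<open>S\<close>.\<close>

lemma opspan_prod_right:
  assumes "S \<subseteq> {T. clin T}"
  shows "opspan (op_prod S (opspan T)) = opspan (op_prod S T)"
proof
  show "opspan (op_prod S (opspan T)) \<subseteq> opspan (op_prod S T)"
  proof (rule opspan_subsetI)
    fix z assume "z \<in> op_prod S (opspan T)"
    then obtain x y where z: "x \<in> S" "y \<in> opspan T" "z = x o\<^sub>L y" by (rule op_prodE)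
    show "z \<in> opspan (op_prod S T)" unfolding z(3)
      by (rule opspan_comp_right[OF z(2)]) (use assms z in \<open>auto intro!: opspan_base op_prodI\<close>)
  qed
qed (intro opspan_mono op_prod_mono subset_opspan subset_refl)

lemma op_prod_clin: "S \<subseteq> {T. clin T} \<Longrightarrow> T \<subseteq> {T. clin T} \<Longrightarrow> op_prod S T \<subseteq> {T. clin T}"
  by (auto elim!: op_prodE simp: subset_eq)

lemma opspan_image:
  assumes f: "semilin_on D f" and S: "S \<subseteq> D"
  shows "opspan (f ` opspan S) = opspan (f ` S)"
proof
  show "opspan (f ` opspan S) \<subseteq> opspan (f ` S)"
  proof (rule opspan_subsetI)
    fix x assume "x \<in> f ` opspan S"
    then obtain y where y: "y \<in> opspan S" "x = f y" by blast
    show "x \<in> opspan (f ` S)" unfolding y(2)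
      by (rule semilin_on_opspan[OF f S _ y(1)]) (auto intro!: opspan_base)
  qed
qed (intro opspan_mono image_mono subset_opspan)

lemma opspan_prod_cong_right:
  assumes "S \<subseteq> {T. clin T}" "opspan T = opspan T'"
  shows "opspan (op_prod S T) = opspan (op_prod S T')"
  using opspan_prod_right[OF assms(1)] assms(2) by metis

lemma opspan_prod_cong_left:
  assumes "opspan T = opspan T'"
  shows "opspan (op_prod T S) = opspan (op_prod T' S)"
  using opspan_prod_left assms by metis

lemma cstar_subalgebraD:
  assumes "cstar_subalgebra H A"
  shows "A \<subseteq> bop H H" "opspan A = A" "\<And>a b. a \<in> A \<Longrightarrow> b \<in> A \<Longrightarrow> a o\<^sub>L b \<in> A" "\<And>a. a \<in> A \<Longrightarrow> adj a \<in> A"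
  using assms by (auto simp: cstar_subalgebra_def intro!: opspan_idem simp del: bop_simps)

lemma adj_image_eq:
  assumes "S \<subseteq> {T. clin T}" "\<And>s. s \<in> S \<Longrightarrow> adj s \<in> T" "\<And>t. t \<in> T \<Longrightarrow> adj t \<in> S" "T \<subseteq> {T. clin T}"
  shows "adj ` S = T"
proof (intro equalityI subsetI)
  fix t assume "t \<in> T"
  then have "adj t \<in> S" "adj (adj t) = t" using assms by auto
  then show "t \<in> adj ` S" by (metis imageI)
qed (use assms in blast)

lemma op_prod_adj:
  assumes "S \<subseteq> {T. clin T}" "T \<subseteq> {T. clin T}"
  shows "adj ` op_prod S T = op_prod (adj ` T) (adj ` S)"
proof (intro equalityI subsetI)
  fix x assume "x \<in> adj ` op_prod S T"
  then show "x \<in> op_prod (adj ` T) (adj ` S)"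
    using assms by (auto elim!: op_prodE intro!: op_prodI simp: subset_eq)
next
  fix x assume "x \<in> op_prod (adj ` T) (adj ` S)"
  then obtain s t where "s \<in> S" "t \<in> T" "x = adj t o\<^sub>L adj s" by (auto elim!: op_prodE)
  moreover from this have "x = adj (s o\<^sub>L t)" using assms by (auto simp: subset_eq)
  ultimately show "x \<in> adj ` op_prod S T" using op_prodI by blast
qed

lemma opspan_adj_image:
  assumes "S \<subseteq> {T. clin T}" shows "adj ` opspan S = opspan (adj ` S)"
proof -
  have cl: "opspan S \<subseteq> {T. clin T}" using opspan_clin[OF assms] by blast
  have "adj ` S \<subseteq> {T. clin T}" using assms by auto
  then have cl': "opspan (adj ` S) \<subseteq> {T. clin T}" using opspan_clin by blast
  show ?thesis
  proof (rule adj_image_eq[OF cl _ _ cl'])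
    show "adj s \<in> opspan (adj ` S)" if "s \<in> opspan S" for s
      by (rule opspan_adj[OF that assms]) (auto intro!: opspan_base)
    show "adj t \<in> opspan S" if "t \<in> opspan (adj ` S)" for t
      by (rule opspan_adj[OF that]) (use assms in \<open>auto intro!: opspan_base\<close>)
  qed
qed

text \<open>Density of the span of \<open>A H\<close> in \<open>H\<close>, phrased by orthogonality
  to match the last clause of \<open>multipliers\<close>.\<close>

definition nondegenerate :: "('v::chilbert_space) set \<Rightarrow> 'v op set \<Rightarrow> bool" where
  "nondegenerate H A \<longleftrightarrow> (\<forall>x. (\<forall>a\<in>A. \<forall>h\<in>H. cinner (a h) x = 0) \<longrightarrow> cperp H x)"

lemma nondegenerateD: "nondegenerate H A \<Longrightarrow> (\<And>a h. a \<in> A \<Longrightarrow> h \<in> H \<Longrightarrow> cinner (a h) x = 0) \<Longrightarrow> cperp H x"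
  unfolding nondegenerate_def by blast

lemma multipliersI:
  assumes "T \<in> bop H H" "\<And>a. a \<in> A \<Longrightarrow> T o\<^sub>L a \<in> A" "\<And>a. a \<in> A \<Longrightarrow> a o\<^sub>L T \<in> A" "nondegenerate H A"
  shows "T \<in> multipliers H A"
proof -
  have "T x = 0" if "\<forall>a\<in>A. \<forall>h\<in>H. cinner (a h) x = 0" for x
    using bop_perp[OF assms(1)] nondegenerateD[OF assms(4)] that by blast
  then show ?thesis using assms(1-3) by (auto simp: multipliers_def simp del: bop_simps)
qed

lemma multipliersD:
  assumes "T \<in> multipliers H A"
  shows "T \<in> bop H H" "\<And>a. a \<in> A \<Longrightarrow> T o\<^sub>L a \<in> A" "\<And>a. a \<in> A \<Longrightarrow> a o\<^sub>L T \<in> A"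
  using assms by (auto simp: multipliers_def simp del: bop_simps)

text \<open>\<open>S\<close> and \<open>T\<close> agree on all \<open>a h\<close>, so the difference
  of their adjoints has values perpendicular to all \<open>a h\<close>, and these values lie in
  \<open>H\<close>.\<close>

lemma nondegenerate_cancel:
  assumes nd: "nondegenerate H A" and A: "A \<subseteq> bop H H" and H: "hilbert_subspace H"
    and ST: "S \<in> bop H H" "T \<in> bop H H" and eq: "\<And>a. a \<in> A \<Longrightarrow> S o\<^sub>L a = T o\<^sub>L a"
  shows "S = T"
proof -
  have cl: "clin S" "clin T" using ST by simp_all
  have "adj S x - adj T x = 0" for x
  proof -
    let ?w = "adj S x - adj T x"
    have "cperp H ?w"
    proof (rule nondegenerateD[OF nd])
      fix a h assume "a \<in> A" "h \<in> H"
      then have "S (a h) = T (a h)" using arg_cong[OF eq, of a "\<lambda>R. blinfun_apply R h"] by simp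
      then show "cinner (a h) ?w = 0" using cl by (simp add: cinner.diff_right cinner_adj_right)
    qed
    moreover have "?w \<in> H"
      using ST H bop_range[OF adj_bop[OF H]] by (auto simp: hilbert_subspace_def simp del: bop_simps
        intro!: complex_vector.subspace_diff)
    ultimately show ?thesis by auto
  qed
  then have "adj S = adj T" by (intro blinfun_eqI) simp
  then have "adj (adj S) = adj (adj T)" by simp
  then show ?thesis using cl by simp
qed

section \<open>Objects of A(C), their braided tensor products, and morphisms between them\<close>

context braided_wstar_category
begin

lemma alg_obj_iff: "alg_obj \<C> (H, A) \<longleftrightarrow> H \<in> Obj \<C> \<and> cstar_subalgebra (Hs \<C> H) A \<and>
    (\<exists>K\<in>Obj \<C>. \<exists>X\<in>Hom \<C> (K \<otimes> H) (K \<otimes> H). A = slices K K H H X)"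
proof -
  have *: "opspan {slice_fst \<C> K K H H X \<omega> | \<omega>. \<omega> \<in> normal_on \<C> K K} = slices K K H H X"
    if "H \<in> Obj \<C>" "K \<in> Obj \<C>" "X \<in> Hom \<C> (K \<otimes> H) (K \<otimes> H)" for K X
    using that Hom_B[OF that(3)] by (intro slice_fst_opspan) simp_all
  show ?thesis
  proof (cases "H \<in> Obj \<C>")
    case True
    then show ?thesis by (simp add: alg_obj_def * cong: bex_cong)
  qed (simp add: alg_obj_def)
qed

abbreviation box :: "'o \<Rightarrow> 'o \<Rightarrow> 'v op set \<Rightarrow> 'v op set \<Rightarrow> 'v op set" where
  "box H1 H2 A1 A2 \<equiv> opspan (op_prod (iota1 \<C> H1 H2 ` A1) (iota2 \<C> c H1 H2 ` A2))"

lemma box_obj: "box_obj \<C> c (H1, A1) (H2, A2) = (H1 \<otimes> H2, box H1 H2 A1 A2)"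
proof -
  have "{iota1 \<C> H1 H2 a o\<^sub>L iota2 \<C> c H1 H2 b | a b. a \<in> A1 \<and> b \<in> A2} =
      op_prod (iota1 \<C> H1 H2 ` A1) (iota2 \<C> c H1 H2 ` A2)"
    unfolding op_prod_def by blast
  then show ?thesis by (simp add: box_obj_def)
qed

lemma leg_snd_Hom:
  assumes "E \<in> Obj \<C>" "H \<in> Obj \<C>" "H' \<in> Obj \<C>" "K \<in> Obj \<C>" "K' \<in> Obj \<C>" "T \<in> Hom \<C> (H \<otimes> K) (H' \<otimes> K')"
  shows "leg_snd E H H' K K' T \<in> Hom \<C> ((E \<otimes> H) \<otimes> K) ((E \<otimes> H') \<otimes> K')"
  unfolding leg_snd_def
  by (rule Hom_comp[OF _ _ _ Hom_comp[OF _ _ _ assoc_Hom tens_Hom] assoc_adj_Hom])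
    (use assms in \<open>simp_all add: Hom_id\<close>)

lemma slices_lift1:
  assumes "K \<in> Obj \<C>" "H1 \<in> Obj \<C>" "H2 \<in> Obj \<C>" "X \<in> B (K \<otimes> H1) (K \<otimes> H1)"
  shows "slices K K (H1 \<otimes> H2) (H1 \<otimes> H2) (lift1 K H1 H2 X) = opspan (iota1 \<C> H1 H2 ` slices K K H1 H1 X)"
proof -
  have "coefs K K (H1 \<otimes> H2) (H1 \<otimes> H2) (lift1 K H1 H2 X) = iota1 \<C> H1 H2 ` coefs K K H1 H1 X"
    unfolding coefs_def using coef_lift1[OF assms] by (auto simp: image_iff) metis+
  then show ?thesis
    using opspan_image[OF semilin_iota1 coefs_B[of K K H1 H1 X]] assms by simp
qed

lemma slices_lift2:
  assumes "K \<in> Obj \<C>" "H1 \<in> Obj \<C>" "H2 \<in> Obj \<C>" "X \<in> B (K \<otimes> H2) (K \<otimes> H2)"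
  shows "slices K K (H1 \<otimes> H2) (H1 \<otimes> H2) (lift2 K H1 H2 X) = opspan (iota2 \<C> c H1 H2 ` slices K K H2 H2 X)"
proof -
  have "coefs K K (H1 \<otimes> H2) (H1 \<otimes> H2) (lift2 K H1 H2 X) = iota2 \<C> c H1 H2 ` coefs K K H2 H2 X"
    unfolding coefs_def using coef_lift2[OF assms] by (auto simp: image_iff) metis+
  then show ?thesis
    using opspan_image[OF semilin_iota2 coefs_B[of K K H2 H2 X]] assms by simp
qed

lemma iota_image_clin:
  assumes "H1 \<in> Obj \<C>" "H2 \<in> Obj \<C>"
  shows "A \<subseteq> B H1 H1 \<Longrightarrow> iota1 \<C> H1 H2 ` A \<subseteq> {T. clin T}"
    "A' \<subseteq> B H2 H2 \<Longrightarrow> iota2 \<C> c H1 H2 ` A' \<subseteq> {T. clin T}"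
  using assms by (auto simp: subset_eq)

text \<open>Since the crossing of the auxiliary objects is unitary, it is absorbed by the functionals in
  the comparison of the two orders of multiplication.\<close>

lemma box_slices:
  assumes P: "alg_obj \<C> (H1, A1)" and Q: "alg_obj \<C> (H2, A2)"
  shows "box H1 H2 A1 A2 = opspan (op_prod (iota2 \<C> c H1 H2 ` A2) (iota1 \<C> H1 H2 ` A1)) \<and>
    (\<exists>K\<in>Obj \<C>. \<exists>X\<in>Hom \<C> (K \<otimes> (H1 \<otimes> H2)) (K \<otimes> (H1 \<otimes> H2)).
      box H1 H2 A1 A2 = slices K K (H1 \<otimes> H2) (H1 \<otimes> H2) X)"
proof -
  obtain K1 X where K1: "K1 \<in> Obj \<C>" and X: "X \<in> Hom \<C> (K1 \<otimes> H1) (K1 \<otimes> H1)" and A1: "A1 = slices K1 K1 H1 H1 X"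
    using P by (auto simp: alg_obj_iff)
  obtain K2 Y where K2: "K2 \<in> Obj \<C>" and Y: "Y \<in> Hom \<C> (K2 \<otimes> H2) (K2 \<otimes> H2)" and A2: "A2 = slices K2 K2 H2 H2 Y"
    using Q by (auto simp: alg_obj_iff)
  have H12: "H1 \<in> Obj \<C>" "H2 \<in> Obj \<C>" using P Q by (auto simp: alg_obj_iff)
  note obj = K1 K2 H12
  have XB: "X \<in> B (K1 \<otimes> H1) (K1 \<otimes> H1)" and YB: "Y \<in> B (K2 \<otimes> H2) (K2 \<otimes> H2)"
    using X Y obj Hom_B by simp_all
  have AB: "A1 \<subseteq> B H1 H1" "A2 \<subseteq> B H2 H2" unfolding A1 A2
    using slices_B[of K1 K1 H1 H1 X] slices_B[of K2 K2 H2 H2 Y] obj XB YB by simp_all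
  define H where "H = H1 \<otimes> H2"
  have H: "H \<in> Obj \<C>" using obj by (simp add: H_def)
  define X1 where "X1 = lift1 K1 H1 H2 X"
  define Y2 where "Y2 = lift2 K2 H1 H2 Y"
  have X1: "X1 \<in> Hom \<C> (K1 \<otimes> H) (K1 \<otimes> H)" and Y2: "Y2 \<in> Hom \<C> (K2 \<otimes> H) (K2 \<otimes> H)"
    unfolding X1_def Y2_def H_def using obj X Y by (auto intro!: lift1_Hom lift2_Hom)
  have X1B: "X1 \<in> B (K1 \<otimes> H) (K1 \<otimes> H)" and Y2B: "Y2 \<in> B (K2 \<otimes> H) (K2 \<otimes> H)"
    using X1 Y2 obj H Hom_B by simp_all
  have S1: "slices K1 K1 H H X1 = opspan (iota1 \<C> H1 H2 ` A1)"
    unfolding X1_def H_def A1 by (rule slices_lift1[OF K1 H12 XB])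
  have S2: "slices K2 K2 H H Y2 = opspan (iota2 \<C> c H1 H2 ` A2)"
    unfolding Y2_def H_def A2 by (rule slices_lift2[OF K2 H12 YB])
  note cl = iota_image_clin(1)[OF H12 AB(1)] iota_image_clin(2)[OF H12 AB(2)]
  let ?XX = "leg_snd K2 K1 K1 H H X1" and ?YY = "leg_snd K1 K2 K2 H H Y2"
  let ?C = "tensR \<C> (K2 \<otimes> K1) (K1 \<otimes> K2) (c K2 K1) H"
  let ?C' = "tensR \<C> (K1 \<otimes> K2) (K2 \<otimes> K1) (adj (c K2 K1)) H"
  \<comment> \<open>The middle crossings of \<open>M\<close> and \<open>N\<close> are mutually
    inverse. Pulling \<open>?YY\<close> through \<open>?C\<close> turns it into an operator
    \<open>D'\<close> that commutes with \<open>?XX\<close>, and so \<open>N\<close> arises from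
    \<open>M\<close> by multiplication with \<open>?C\<close> on both sides.\<close>
  define M where "M = ?XX o\<^sub>L (?C' o\<^sub>L ?YY)"
  define N where "N = ?YY o\<^sub>L (?C o\<^sub>L ?XX)"
  have "box H1 H2 A1 A2 = opspan (op_prod (slices K1 K1 H H X1) (slices K2 K2 H H Y2))"
    unfolding S1 S2 by (simp only: opspan_prod_left opspan_prod_right[OF cl(1)])
  also have "\<dots> = slices (K1 \<otimes> K2) (K2 \<otimes> K1) H H M"
    unfolding op_prod_def M_def using obj H X1B Y2B by (intro slices_product slices_c_adj) simp_all
  finally have P12: "box H1 H2 A1 A2 = slices (K1 \<otimes> K2) (K2 \<otimes> K1) H H M" .
  have "opspan (op_prod (iota2 \<C> c H1 H2 ` A2) (iota1 \<C> H1 H2 ` A1)) =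
      opspan (op_prod (slices K2 K2 H H Y2) (slices K1 K1 H H X1))"
    unfolding S1 S2 by (simp only: opspan_prod_left opspan_prod_right[OF cl(2)])
  also have "\<dots> = slices (K2 \<otimes> K1) (K1 \<otimes> K2) H H N"
    unfolding op_prod_def N_def using obj H X1B Y2B by (intro slices_product slices_c) simp_all
  finally have P21: "opspan (op_prod (iota2 \<C> c H1 H2 ` A2) (iota1 \<C> H1 H2 ` A1)) =
    slices (K2 \<otimes> K1) (K1 \<otimes> K2) H H N" .
  define D where "D = lift2 K2 K1 H Y2"
  have DB: "D \<in> B (K2 \<otimes> (K1 \<otimes> H)) (K2 \<otimes> (K1 \<otimes> H))" unfolding D_def using obj H Y2B by simp
  define D' where "D' = adj (assoc \<C> K2 K1 H) o\<^sub>L (D o\<^sub>L assoc \<C> K2 K1 H)"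
  have D'B: "clin D'" "lands D' (Hs \<C> ((K2 \<otimes> K1) \<otimes> H))" unfolding D'_def using obj H DB by simp_all
  have YC: "?YY o\<^sub>L ?C = ?C o\<^sub>L D'"
  proof -
    have hC: "hexC K2 K1 H o\<^sub>L assoc \<C> K2 K1 H = assoc \<C> K1 K2 H o\<^sub>L ?C"
      unfolding hexC_def using obj H by (simp add: blinfun_compose_assoc assoc_adj_comp)
    have "?YY o\<^sub>L ?C = adj (assoc \<C> K1 K2 H) o\<^sub>L ((tensL \<C> K1 (K2 \<otimes> H) (K2 \<otimes> H) Y2 o\<^sub>L hexC K2 K1 H) o\<^sub>L assoc \<C> K2 K1 H)"
      unfolding leg_snd_def by (simp add: blinfun_compose_assoc hC)
    also have "\<dots> = adj (assoc \<C> K1 K2 H) o\<^sub>L (hexC K2 K1 H o\<^sub>L (D o\<^sub>L assoc \<C> K2 K1 H))"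
      unfolding D_def using tensL_hexC[OF obj(2) H obj(1) Y2] by (simp add: blinfun_compose_assoc)
    also have "\<dots> = ?C o\<^sub>L D'"
      unfolding hexC_def D'_def using obj H
      by (simp add: blinfun_compose_assoc assoc_adj_comp[THEN comp_reassoc])
    finally show ?thesis .
  qed
  have XD: "?XX o\<^sub>L D' = D' o\<^sub>L ?XX"
    unfolding leg_snd_def D'_def D_def X1_def Y2_def using obj H XB YB
    by (simp add: blinfun_compose_assoc assoc_comp_adj[THEN comp_reassoc] H_def
        lift_commute[OF obj X YB, THEN comp_reassoc])
  have CC: "?C' o\<^sub>L ?C = idm \<C> ((K2 \<otimes> K1) \<otimes> H)" using obj H by (simp add: tens_comp)
  have MC: "M o\<^sub>L ?C = ?XX o\<^sub>L D'"
    unfolding M_def using D'B obj H by (simp add: blinfun_compose_assoc YC CC[THEN comp_reassoc])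
  have NM: "N = ?C o\<^sub>L (M o\<^sub>L ?C)"
    unfolding N_def MC XD using YC[THEN comp_reassoc, of ?XX] by (simp add: blinfun_compose_assoc)
  have MB: "M \<in> B ((K1 \<otimes> K2) \<otimes> H) ((K2 \<otimes> K1) \<otimes> H)" unfolding M_def using obj H X1B Y2B by simp
  have sN: "slices (K2 \<otimes> K1) (K1 \<otimes> K2) H H N = slices (K1 \<otimes> K2) (K2 \<otimes> K1) H H M"
    unfolding NM using obj H MB by (intro slices_unitary) simp_all
  have "slices (K2 \<otimes> K1) (K2 \<otimes> K1) H H (tensR \<C> (K2 \<otimes> K1) (K2 \<otimes> K1) (idm \<C> (K2 \<otimes> K1)) H o\<^sub>L (M o\<^sub>L ?C)) =
      slices (K1 \<otimes> K2) (K2 \<otimes> K1) H H M"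
    using obj H MB by (intro slices_unitary) simp_all
  then have sM: "slices (K2 \<otimes> K1) (K2 \<otimes> K1) H H (M o\<^sub>L ?C) = slices (K1 \<otimes> K2) (K2 \<otimes> K1) H H M"
    using obj H MB by simp
  \<comment> \<open>The auxiliary legs of \<open>M\<close> have different source and target, whereas
    \<open>alg_obj\<close> asks for slices of an endomorphism; the factor \<open>?C\<close> repairs
    this without changing the slices.\<close>
  have "M o\<^sub>L ?C \<in> Hom \<C> ((K2 \<otimes> K1) \<otimes> H) ((K2 \<otimes> K1) \<otimes> H)"
    unfolding M_def
    by (rule Hom_comp[OF _ _ _ _ Hom_comp[OF _ _ _ Hom_comp[OF _ _ _ leg_snd_Hom tens_Hom] leg_snd_Hom]])
      (use obj H X1 Y2 in \<open>simp_all add: Hom_id tens_Hom c_Hom Hom_adj\<close>)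
  moreover have "box H1 H2 A1 A2 = slices (K2 \<otimes> K1) (K2 \<otimes> K1) H H (M o\<^sub>L ?C)"
    unfolding sM by (rule P12)
  ultimately show ?thesis
    unfolding H_def[symmetric] using P12 P21 sN obj H by (auto intro!: bexI[of _ "K2 \<otimes> K1"])
qed

lemmas box_commute = box_slices[THEN conjunct1]

lemma iota1_prod:
  assumes "H1 \<in> Obj \<C>" "H2 \<in> Obj \<C>" "S \<subseteq> B H1 H1" "T \<subseteq> B H1 H1"
  shows "op_prod (iota1 \<C> H1 H2 ` S) (iota1 \<C> H1 H2 ` T) = iota1 \<C> H1 H2 ` op_prod S T"
proof -
  have "iota1 \<C> H1 H2 a o\<^sub>L iota1 \<C> H1 H2 b = iota1 \<C> H1 H2 (a o\<^sub>L b)" if "a \<in> S" "b \<in> T" for a b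
    using that assms by (intro iota1_mult) blast+
  then show ?thesis by (force simp: op_prod_def image_iff)
qed

lemma iota2_prod:
  assumes "H1 \<in> Obj \<C>" "H2 \<in> Obj \<C>" "S \<subseteq> B H2 H2" "T \<subseteq> B H2 H2"
  shows "op_prod (iota2 \<C> c H1 H2 ` S) (iota2 \<C> c H1 H2 ` T) = iota2 \<C> c H1 H2 ` op_prod S T"
proof -
  have "iota2 \<C> c H1 H2 a o\<^sub>L iota2 \<C> c H1 H2 b = iota2 \<C> c H1 H2 (a o\<^sub>L b)" if "a \<in> S" "b \<in> T" for a b
    using that assms by (intro iota2_mult) blast+
  then show ?thesis by (force simp: op_prod_def image_iff)
qed

lemma op_prod_B: "S \<subseteq> B X Y \<Longrightarrow> T \<subseteq> B Z X' \<Longrightarrow> op_prod S T \<subseteq> B Z Y"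
  by (auto elim!: op_prodE simp: subset_eq)

lemma iota_adj_image:
  assumes "H1 \<in> Obj \<C>" "H2 \<in> Obj \<C>"
  shows "cstar_subalgebra (Hs \<C> H1) A1 \<Longrightarrow> adj ` iota1 \<C> H1 H2 ` A1 = iota1 \<C> H1 H2 ` A1"
    "cstar_subalgebra (Hs \<C> H2) A2 \<Longrightarrow> adj ` iota2 \<C> c H1 H2 ` A2 = iota2 \<C> c H1 H2 ` A2"
proof -
  assume A: "cstar_subalgebra (Hs \<C> H1) A1"
  show "adj ` iota1 \<C> H1 H2 ` A1 = iota1 \<C> H1 H2 ` A1"
  proof (rule adj_image_eq)
    show "iota1 \<C> H1 H2 ` A1 \<subseteq> {T. clin T}" "iota1 \<C> H1 H2 ` A1 \<subseteq> {T. clin T}"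
      using iota_image_clin(1)[OF assms] cstar_subalgebraD(1)[OF A] by blast+
    show "adj s \<in> iota1 \<C> H1 H2 ` A1" "adj s \<in> iota1 \<C> H1 H2 ` A1" if "s \<in> iota1 \<C> H1 H2 ` A1" for s
      using that cstar_subalgebraD(1,4)[OF A] assms by (auto simp: subset_eq)
  qed
next
  assume A: "cstar_subalgebra (Hs \<C> H2) A2"
  show "adj ` iota2 \<C> c H1 H2 ` A2 = iota2 \<C> c H1 H2 ` A2"
  proof (rule adj_image_eq)
    show "iota2 \<C> c H1 H2 ` A2 \<subseteq> {T. clin T}" "iota2 \<C> c H1 H2 ` A2 \<subseteq> {T. clin T}"
      using iota_image_clin(2)[OF assms] cstar_subalgebraD(1)[OF A] by blast+
    show "adj s \<in> iota2 \<C> c H1 H2 ` A2" "adj s \<in> iota2 \<C> c H1 H2 ` A2" if "s \<in> iota2 \<C> c H1 H2 ` A2" for s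
      using that cstar_subalgebraD(1,4)[OF A] assms by (auto simp: subset_eq)
  qed
qed

lemma alg_obj_box:
  assumes P: "alg_obj \<C> (H1, A1)" and Q: "alg_obj \<C> (H2, A2)"
  shows "alg_obj \<C> (H1 \<otimes> H2, box H1 H2 A1 A2)"
proof -
  have obj: "H1 \<in> Obj \<C>" "H2 \<in> Obj \<C>" and A: "cstar_subalgebra (Hs \<C> H1) A1" "cstar_subalgebra (Hs \<C> H2) A2"
    using P Q by (auto simp: alg_obj_iff)
  note AB = cstar_subalgebraD(1)[OF A(1)] cstar_subalgebraD(1)[OF A(2)]
  let ?I = "iota1 \<C> H1 H2 ` A1" and ?J = "iota2 \<C> c H1 H2 ` A2"
  note cl = iota_image_clin(1)[OF obj AB(1)] iota_image_clin(2)[OF obj AB(2)]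
  note com = box_commute[OF P Q]
  have gen: "op_prod ?I ?J \<subseteq> B (H1 \<otimes> H2) (H1 \<otimes> H2)"
    using AB obj by (auto elim!: op_prodE simp: subset_eq)
  have box_B: "box H1 H2 A1 A2 \<subseteq> B (H1 \<otimes> H2) (H1 \<otimes> H2)"
    using obj by (intro opspan_minimal gen B_subspace) simp_all
  have adj_box: "adj ` box H1 H2 A1 A2 = box H1 H2 A1 A2"
    unfolding opspan_adj_image[OF op_prod_clin[OF cl]] op_prod_adj[OF cl]
      iota_adj_image(1)[OF obj A(1)] iota_adj_image(2)[OF obj A(2)] by (rule com[symmetric])
  have II: "op_prod ?I ?I \<subseteq> ?I" and JJ: "op_prod ?J ?J \<subseteq> ?J"
    using AB obj cstar_subalgebraD(3)[OF A(1)] cstar_subalgebraD(3)[OF A(2)]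
    by (auto simp: iota1_prod iota2_prod elim!: op_prodE)
  \<comment> \<open>In the product \<open>?I ?J ?I ?J\<close> the inner pair is reordered by
    \<open>com\<close>, after which equal factors are adjacent.\<close>
  have "opspan (op_prod (box H1 H2 A1 A2) (box H1 H2 A1 A2)) = opspan (op_prod (op_prod ?I ?J) (op_prod ?I ?J))"
    by (simp only: opspan_prod_left opspan_prod_right[OF op_prod_clin[OF cl]])
  also have "\<dots> = opspan (op_prod ?I (op_prod (op_prod ?J ?I) ?J))"
    by (simp only: op_prod_assoc)
  also have "\<dots> = opspan (op_prod ?I (op_prod (op_prod ?I ?J) ?J))"
    by (intro opspan_prod_cong_right[OF cl(1)] opspan_prod_cong_left com[symmetric])
  also have "\<dots> = opspan (op_prod (op_prod ?I ?I) (op_prod ?J ?J))"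
    by (simp only: op_prod_assoc)
  also have "\<dots> \<subseteq> box H1 H2 A1 A2" by (intro opspan_mono op_prod_mono II JJ)
  finally have mult: "opspan (op_prod (box H1 H2 A1 A2) (box H1 H2 A1 A2)) \<subseteq> box H1 H2 A1 A2" .
  have "cstar_subalgebra (Hs \<C> (H1 \<otimes> H2)) (box H1 H2 A1 A2)"
    unfolding cstar_subalgebra_def
  proof (intro conjI ballI)
    show "a o\<^sub>L b \<in> box H1 H2 A1 A2" if "a \<in> box H1 H2 A1 A2" "b \<in> box H1 H2 A1 A2" for a b
      using mult opspan_base[OF op_prodI[OF that]] by blast
    show "adj a \<in> box H1 H2 A1 A2" if "a \<in> box H1 H2 A1 A2" for a
      using adj_box that by blast
  qed (use box_B opspan_subspace in simp_all)
  then show ?thesis unfolding alg_obj_iff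
    by (intro conjI box_slices[OF P Q, THEN conjunct2]) (use obj in simp_all)
qed

lemma nondegenerate_tens:
  assumes obj: "H \<in> Obj \<C>" "K \<in> Obj \<C>" and nd: "nondegenerate (Hs \<C> H) A" and A: "A \<subseteq> B H H"
    and w: "\<And>a x y. a \<in> A \<Longrightarrow> x \<in> Hs \<C> H \<Longrightarrow> y \<in> Hs \<C> K \<Longrightarrow> cinner (vten \<C> H K (a x) y) w = 0"
  shows "cperp (Hs \<C> (H \<otimes> K)) w"
proof
  fix z assume z: "z \<in> Hs \<C> (H \<otimes> K)"
  show "cinner z w = 0"
  proof (rule vten_perp[OF obj _ z])
    fix x y assume x: "x \<in> Hs \<C> H" and y: "y \<in> Hs \<C> K"
    have "cperp (Hs \<C> H) (adj (ket_right H K y) w)"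
    proof (rule nondegenerateD[OF nd])
      fix a h assume a: "a \<in> A" and h: "h \<in> Hs \<C> H"
      then have "a h \<in> Hs \<C> H" using A bop_range by blast
      then show "cinner (a h) (adj (ket_right H K y) w) = 0"
        using obj y w[OF a h y] by (simp add: cinner_adj_right)
    qed
    then have "cinner x (adj (ket_right H K y) w) = 0" using x by blast
    then show "cinner (vten \<C> H K x y) w = 0" using obj x y by (simp add: cinner_adj_right)
  qed
qed

lemma isometry_apply:
  "adj U o\<^sub>L U = idm \<C> X \<Longrightarrow> X \<in> Obj \<C> \<Longrightarrow> x \<in> Hs \<C> X \<Longrightarrow> adj U (U x) = x"
  by (metis blinfun_apply_blinfun_compose idm_apply)

text \<open>The factors are peeled off one after the other: \<open>iota1 \<C> H1 H2 a w\<close> is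
  perpendicular to the ranges of all \<open>iota2 \<C> c H1 H2 b\<close>, hence zero, and therefore
  \<open>w\<close> is perpendicular to the ranges of the embedded \<open>A1\<close>.\<close>

lemma nondegenerate_box:
  assumes P: "alg_obj \<C> (H1, A1)" and Q: "alg_obj \<C> (H2, A2)"
    and nd: "nondegenerate (Hs \<C> H1) A1" "nondegenerate (Hs \<C> H2) A2"
  shows "nondegenerate (Hs \<C> (H1 \<otimes> H2)) (box H1 H2 A1 A2)"
  unfolding nondegenerate_def
proof (intro allI impI)
  fix w assume w: "\<forall>a\<in>box H1 H2 A1 A2. \<forall>h\<in>Hs \<C> (H1 \<otimes> H2). cinner (a h) w = 0"
  have obj: "H1 \<in> Obj \<C>" "H2 \<in> Obj \<C>" and A: "cstar_subalgebra (Hs \<C> H1) A1" "cstar_subalgebra (Hs \<C> H2) A2"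
    using P Q by (auto simp: alg_obj_iff)
  note AB = cstar_subalgebraD(1)[OF A(1)] cstar_subalgebraD(1)[OF A(2)]
  have zero: "iota1 \<C> H1 H2 a w = 0" if a: "a \<in> A1" for a
  proof -
    have aB: "a \<in> B H1 H1" "adj a \<in> A1" using a AB cstar_subalgebraD(4)[OF A(1)] by auto
    define w' where "w' = iota1 \<C> H1 H2 a w"
    have w'H: "w' \<in> Hs \<C> (H1 \<otimes> H2)" unfolding w'_def using aB obj by (intro lands_in) simp
    have "cperp (Hs \<C> (H2 \<otimes> H1)) (adj (c H2 H1) w')"
    proof (rule nondegenerate_tens[OF obj(2,1) nd(2) AB(2)])
      fix b x y assume b: "b \<in> A2" and x: "x \<in> Hs \<C> H2" and y: "y \<in> Hs \<C> H1"
      have bB: "b \<in> B H2 H2" using b AB by blast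
      let ?u = "c H2 H1 (vten \<C> H2 H1 x y)"
      have u: "?u \<in> Hs \<C> (H1 \<otimes> H2)" using obj by (intro lands_in) simp
      have "adj (c H2 H1) ?u = vten \<C> H2 H1 x y"
        using obj x y by (intro isometry_apply[OF c_unitary(1)[OF obj(2,1)]]) simp_all
      then have "c H2 H1 (vten \<C> H2 H1 (b x) y) = iota2 \<C> c H1 H2 b ?u"
        using obj bB x y by (simp add: iota2_eq)
      then have "cinner (vten \<C> H2 H1 (b x) y) (adj (c H2 H1) w') =
          cinner ((iota1 \<C> H1 H2 (adj a) o\<^sub>L iota2 \<C> c H1 H2 b) ?u) w"
        using obj aB by (simp add: cinner_adj_right w'_def)
          (metis adj_adj cinner_adj_right clin_adj iota_simps(1,4) bop_iff adj_adj lands_adj vanishes_adj aB(1)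
            hilbert_subspace_Hs)
      also have "\<dots> = 0"
      proof -
        have "iota1 \<C> H1 H2 (adj a) o\<^sub>L iota2 \<C> c H1 H2 b \<in> box H1 H2 A1 A2"
          using aB(2) b by (intro opspan_base op_prodI imageI)
        then show ?thesis using w u by blast
      qed
      finally show "cinner (vten \<C> H2 H1 (b x) y) (adj (c H2 H1) w') = 0" .
    qed
    moreover have "adj (c H2 H1) w' \<in> Hs \<C> (H2 \<otimes> H1)" using obj by (intro lands_in) simp
    ultimately have "adj (c H2 H1) w' = 0" by (metis cinner_self_0)
    then have "(c H2 H1 o\<^sub>L adj (c H2 H1)) w' = 0" by (simp add: blinfun.zero_right)
    then show "iota1 \<C> H1 H2 a w = 0" using obj w'H by (simp add: w'_def)
  qed
  show "cperp (Hs \<C> (H1 \<otimes> H2)) w"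
  proof (rule nondegenerate_tens[OF obj nd(1) AB(1)])
    fix a x y assume a: "a \<in> A1" and x: "x \<in> Hs \<C> H1" and y: "y \<in> Hs \<C> H2"
    have aB: "a \<in> B H1 H1" "adj a \<in> A1" using a AB cstar_subalgebraD(4)[OF A(1)] by auto
    have "cinner (vten \<C> H1 H2 (a x) y) w = cinner (iota1 \<C> H1 H2 a (vten \<C> H1 H2 x y)) w"
      using obj aB x y by (simp add: iota1_def)
    also have "\<dots> = cinner (vten \<C> H1 H2 x y) (adj (iota1 \<C> H1 H2 a) w)"
      using obj aB by (simp add: cinner_adj_right del: iota_simps(4))
    also have "\<dots> = 0" using zero[OF aB(2)] obj aB by (simp add: cinner.zero_right)
    finally show "cinner (vten \<C> H1 H2 (a x) y) w = 0" .
  qed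
qed

text \<open>The form that A(C) prescribes for its morphisms, taken as a map on all bounded operators
  and not just on one algebra.\<close>

definition conj_tens :: "'o \<Rightarrow> 'o \<Rightarrow> 'v op \<Rightarrow> 'v op \<Rightarrow> 'v op" where
  "conj_tens H K V x = V o\<^sub>L (tensR \<C> H H x K o\<^sub>L adj V)"

lemma conj_tens_simps [simp]:
  assumes "H \<in> Obj \<C>" "K \<in> Obj \<C>" "clin V" "x \<in> B H H"
  shows "clin (conj_tens H K V x)" "lands V S \<Longrightarrow> lands (conj_tens H K V x) S"
    "lands V S \<Longrightarrow> vanishes (conj_tens H K V x) S" "adj (conj_tens H K V x) = conj_tens H K V (adj x)"
  using assms by (simp_all add: conj_tens_def blinfun_compose_assoc lands_comp vanishes_comp vanishes_adj)

lemma semilin_conj_tens: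
  assumes "H \<in> Obj \<C>" "K \<in> Obj \<C>" "clin V"
  shows "semilin_on (B H H) (conj_tens H K V)"
proof -
  have "semilin_on (B H H) (\<lambda>x. V o\<^sub>L (tensR \<C> H H x K o\<^sub>L adj V))"
    using assms by (intro semilin_comp[OF _ semilin_right] semilin_comp[OF _ semilin_left] semilin_tens_left) simp_all
  moreover have "conj_tens H K V = (\<lambda>x. V o\<^sub>L (tensR \<C> H H x K o\<^sub>L adj V))"
    by (intro ext) (rule conj_tens_def)
  ultimately show ?thesis by simp
qed

lemma conj_tens_mult:
  assumes "H \<in> Obj \<C>" "K \<in> Obj \<C>" "H' \<in> Obj \<C>" "V \<in> B (H \<otimes> K) H'" "adj V o\<^sub>L V = idm \<C> (H \<otimes> K)"
    "x \<in> B H H" "y \<in> B H H"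
  shows "conj_tens H K V x o\<^sub>L conj_tens H K V y = conj_tens H K V (x o\<^sub>L y)"
  using assms by (simp add: conj_tens_def blinfun_compose_assoc assms(5)[THEN comp_reassoc] tens_comp[THEN comp_reassoc])

text \<open>Isometry of \<open>V\<close> makes the conjugation multiplicative. What remains is
  \<open>h\<close>, which expresses nondegeneracy and also puts the values into the
  multipliers.\<close>

lemma alg_mor_conj_tens:
  assumes P: "alg_obj \<C> (H, A)" and Q: "alg_obj \<C> (H', A')" and nd: "nondegenerate (Hs \<C> H') A'"
    and K: "K \<in> Obj \<C>" and V: "V \<in> Hom \<C> (H \<otimes> K) H'" "adj V o\<^sub>L V = idm \<C> (H \<otimes> K)"
    and h: "opspan (op_prod (conj_tens H K V ` A) A') = A'"
  shows "alg_mor \<C> (H, A) (H', A') (conj_tens H K V)"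
proof -
  let ?h = "conj_tens H K V"
  have obj: "H \<in> Obj \<C>" "H' \<in> Obj \<C>" and cA: "cstar_subalgebra (Hs \<C> H) A" and cB: "cstar_subalgebra (Hs \<C> H') A'"
    using P Q by (auto simp: alg_obj_iff)
  have VB: "V \<in> B (H \<otimes> K) H'" using V(1) obj K Hom_B by simp
  have AB: "x \<in> B H H" if "x \<in> A" for x using that cstar_subalgebraD(1)[OF cA] by blast
  have hB: "?h x \<in> B H' H'" if "x \<in> A" for x
    using AB[OF that] obj K VB by simp
  have left: "?h x o\<^sub>L b \<in> A'" if "x \<in> A" "b \<in> A'" for x b
    using opspan_base[OF op_prodI[OF imageI[OF that(1), of ?h] that(2)]] h by simp
  \<comment> \<open>Right multiplication is the adjoint of left multiplication, and both algebras
    are selfadjoint.\<close>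
  have right: "b o\<^sub>L ?h x \<in> A'" if "x \<in> A" "b \<in> A'" for x b
  proof -
    have "?h (adj x) o\<^sub>L adj b \<in> A'"
      using that cstar_subalgebraD(4)[OF cA] cstar_subalgebraD(4)[OF cB] by (intro left)
    then have "adj (adj (?h x) o\<^sub>L adj b) \<in> A'"
      using cstar_subalgebraD(4)[OF cB] AB[OF that(1)] obj K VB by simp
    moreover have "b \<in> B H' H'" using that(2) cstar_subalgebraD(1)[OF cB] by blast
    ultimately show ?thesis using hB[OF that(1)] by simp
  qed
  have "semilin_on (B H H) ?h" using obj K VB by (intro semilin_conj_tens) simp_all
  then have lin: "?h (x + y) = ?h x + ?h y" if "x \<in> B H H" "y \<in> B H H" for x y
    using that unfolding semilin_on_def by blast
  have scale: "?h (op_scale t x) = op_scale t (?h x)" if "x \<in> A" for t x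
  proof -
    have "tensR \<C> H H (op_scale t x) K = op_scale t (tensR \<C> H H x K)"
    proof (rule tens_eqI[of H K _ "Hs \<C> (H \<otimes> K)" _ "Hs \<C> (H \<otimes> K)"])
      fix u v assume "u \<in> Hs \<C> H" "v \<in> Hs \<C> K"
      then show "tensR \<C> H H (op_scale t x) K (vten \<C> H K u v) =
          op_scale t (tensR \<C> H H x K) (vten \<C> H K u v)"
        using AB[OF that] obj K tensor.scale_left[OF tens[of H K]]
        by (simp add: lands_in)
    qed (use AB[OF that] obj K in simp_all)
    then show ?thesis using VB by (simp add: conj_tens_def op_scale_comp_left op_scale_comp_right)
  qed
  show ?thesis
    unfolding alg_mor_def prod.case
  proof (intro conjI ballI allI P Q)
    show "?h ` A \<subseteq> multipliers (Hs \<C> H') A'"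
      using hB left right nd by (auto intro!: multipliersI simp del: bop_simps)
    show "opspan {?h a o\<^sub>L b | a b. a \<in> A \<and> b \<in> A'} = A'"
    proof -
      have "{?h a o\<^sub>L b | a b. a \<in> A \<and> b \<in> A'} = op_prod (?h ` A) A'" unfolding op_prod_def by blast
      then show ?thesis using h by simp
    qed
    have "V o\<^sub>L adj V o\<^sub>L V = V" using V(2) VB obj K by (simp add: blinfun_compose_assoc)
    then show "\<exists>K\<in>Obj \<C>. \<exists>V\<in>Hom \<C> (H \<otimes> K) H'. V o\<^sub>L adj V o\<^sub>L V = V \<and>
        (\<forall>a\<in>A. ?h a = V o\<^sub>L tensR \<C> H H a K o\<^sub>L adj V)"
      using K V(1) by (intro bexI[of _ K] bexI[of _ V]) (simp_all add: conj_tens_def blinfun_compose_assoc)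
    show "?h (adj a) = adj (?h a)" if "a \<in> A" for a
      using AB[OF that] obj K VB by simp
    show "?h (a + b) = ?h a + ?h b" if "a \<in> A" "b \<in> A" for a b using lin AB that by blast
    show "?h (a o\<^sub>L b) = ?h a o\<^sub>L ?h b" if "a \<in> A" "b \<in> A" for a b
      using conj_tens_mult[OF obj(1) K obj(2) VB V(2)] AB that by metis
  qed (rule scale)
qed

text \<open>The substance is nondegeneracy of \<open>h\<close>. The target algebra is written with
  its factors reversed so that \<open>g\<close>
  A2\<open>meets\<close>A2'\<open>, and then in the original order so that\<close>f
  \<open>A1\<close> meets \<open>A1'\<close>.\<close>

lemma is_box_morI:
  assumes P: "alg_obj \<C> (H1, A1)" and Q: "alg_obj \<C> (H2, A2)"
    and P': "alg_obj \<C> (H1', A1')" and Q': "alg_obj \<C> (H2', A2')"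
    and nd: "nondegenerate (Hs \<C> H1') A1'" "nondegenerate (Hs \<C> H2') A2'"
    and fB: "f ` A1 \<subseteq> B H1' H1'" and gB: "g ` A2 \<subseteq> B H2' H2'"
    and f: "opspan (op_prod (f ` A1) A1') = A1'" and g: "opspan (op_prod (g ` A2) A2') = A2'"
    and K: "K \<in> Obj \<C>" and V: "V \<in> Hom \<C> ((H1 \<otimes> H2) \<otimes> K) (H1' \<otimes> H2')" "adj V o\<^sub>L V = idm \<C> ((H1 \<otimes> H2) \<otimes> K)"
    and h: "h = conj_tens (H1 \<otimes> H2) K V"
    and hfg: "\<And>a b. a \<in> A1 \<Longrightarrow> b \<in> A2 \<Longrightarrow>
      h (iota1 \<C> H1 H2 a o\<^sub>L iota2 \<C> c H1 H2 b) = iota1 \<C> H1' H2' (f a) o\<^sub>L iota2 \<C> c H1' H2' (g b)"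
  shows "is_box_mor \<C> c (H1, A1) (H1', A1') (H2, A2) (H2', A2') f g h"
    and "opspan (op_prod (h ` box H1 H2 A1 A2) (box H1' H2' A1' A2')) = box H1' H2' A1' A2'"
proof -
  have obj: "H1 \<in> Obj \<C>" "H2 \<in> Obj \<C>" "H1' \<in> Obj \<C>" "H2' \<in> Obj \<C>"
    and A: "cstar_subalgebra (Hs \<C> H1) A1" "cstar_subalgebra (Hs \<C> H2) A2"
      "cstar_subalgebra (Hs \<C> H1') A1'" "cstar_subalgebra (Hs \<C> H2') A2'"
    using P Q P' Q' by (auto simp: alg_obj_iff)
  note AB = A[THEN cstar_subalgebraD(1)]
  note PQ = alg_obj_box[OF P Q] and PQ' = alg_obj_box[OF P' Q']
  let ?A = "box H1 H2 A1 A2" and ?B = "box H1' H2' A1' A2'"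
  have cA: "cstar_subalgebra (Hs \<C> (H1 \<otimes> H2)) ?A" and cB: "cstar_subalgebra (Hs \<C> (H1' \<otimes> H2')) ?B"
    using PQ PQ' by (auto simp: alg_obj_iff)
  have VB: "V \<in> B ((H1 \<otimes> H2) \<otimes> K) (H1' \<otimes> H2')" using V(1) obj K Hom_B by simp
  have semi: "semilin_on (B (H1 \<otimes> H2) (H1 \<otimes> H2)) h"
    unfolding h using obj K VB by (intro semilin_conj_tens) simp_all
  let ?I = "iota1 \<C> H1 H2 ` A1" and ?J = "iota2 \<C> c H1 H2 ` A2"
  let ?I' = "iota1 \<C> H1' H2' ` A1'" and ?J' = "iota2 \<C> c H1' H2' ` A2'"
  let ?If = "iota1 \<C> H1' H2' ` f ` A1" and ?Jg = "iota2 \<C> c H1' H2' ` g ` A2"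
  have gen: "op_prod ?I ?J \<subseteq> B (H1 \<otimes> H2) (H1 \<otimes> H2)"
    using AB obj by (auto elim!: op_prodE simp: subset_eq)
  have hgen: "h ` op_prod ?I ?J = op_prod ?If ?Jg"
  proof (intro equalityI subsetI)
    fix x assume "x \<in> h ` op_prod ?I ?J"
    then obtain a b where "a \<in> A1" "b \<in> A2" "x = h (iota1 \<C> H1 H2 a o\<^sub>L iota2 \<C> c H1 H2 b)"
      unfolding op_prod_def by blast
    then show "x \<in> op_prod ?If ?Jg" by (auto simp: hfg intro!: op_prodI)
  next
    fix x assume "x \<in> op_prod ?If ?Jg"
    then obtain a b where ab: "a \<in> A1" "b \<in> A2" "x = iota1 \<C> H1' H2' (f a) o\<^sub>L iota2 \<C> c H1' H2' (g b)"
      unfolding op_prod_def by blast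
    then have "x = h (iota1 \<C> H1 H2 a o\<^sub>L iota2 \<C> c H1 H2 b)" by (simp add: hfg)
    then show "x \<in> h ` op_prod ?I ?J" using ab by (intro image_eqI[where f = h]) (auto intro!: op_prodI)
  qed
  have cl': "?I' \<subseteq> {T. clin T}" "?J' \<subseteq> {T. clin T}" "?If \<subseteq> {T. clin T}" "?Jg \<subseteq> {T. clin T}"
    using iota_image_clin[OF obj(3,4)] AB fB gB by blast+
  have "opspan (op_prod (h ` ?A) ?B) = opspan (op_prod (opspan (h ` ?A)) ?B)"
    by (simp only: opspan_prod_left)
  also have "opspan (h ` ?A) = opspan (op_prod ?If ?Jg)"
    by (simp only: opspan_image[OF semi gen] hgen)
  also have "opspan (op_prod (opspan (op_prod ?If ?Jg)) ?B) = opspan (op_prod (op_prod ?If ?Jg) (op_prod ?J' ?I'))"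
    unfolding box_commute[OF P' Q'] by (simp only: opspan_prod_left opspan_prod_right[OF op_prod_clin[OF cl'(3,4)]])
  also have "\<dots> = opspan (op_prod ?If (op_prod (op_prod ?Jg ?J') ?I'))"
    by (simp only: op_prod_assoc)
  also have "\<dots> = opspan (op_prod ?If (op_prod ?J' ?I'))"
  proof (intro opspan_prod_cong_right[OF cl'(3)] opspan_prod_cong_left)
    have "opspan (iota2 \<C> c H1' H2' ` op_prod (g ` A2) A2') = opspan (iota2 \<C> c H1' H2' ` opspan (op_prod (g ` A2) A2'))"
      using obj gB AB by (intro opspan_image[OF semilin_iota2, symmetric] op_prod_B) simp_all
    then show "opspan (op_prod ?Jg ?J') = opspan ?J'"
      using obj gB AB g by (simp add: iota2_prod)
  qed
  also have "\<dots> = opspan (op_prod ?If (op_prod ?I' ?J'))"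
    by (intro opspan_prod_cong_right[OF cl'(3)] box_commute[OF P' Q', symmetric])
  also have "\<dots> = opspan (op_prod (op_prod ?If ?I') ?J')"
    by (simp only: op_prod_assoc)
  also have "\<dots> = ?B"
  proof (rule opspan_prod_cong_left)
    have "opspan (iota1 \<C> H1' H2' ` op_prod (f ` A1) A1') = opspan (iota1 \<C> H1' H2' ` opspan (op_prod (f ` A1) A1'))"
      using obj fB AB by (intro opspan_image[OF semilin_iota1, symmetric] op_prod_B) simp_all
    then show "opspan (op_prod ?If ?I') = opspan ?I'"
      using obj fB AB f by (simp add: iota1_prod)
  qed
  finally show ndh: "opspan (op_prod (h ` ?A) ?B) = ?B" .
  have "alg_mor \<C> (H1 \<otimes> H2, ?A) (H1' \<otimes> H2', ?B) h"
    unfolding h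
    by (rule alg_mor_conj_tens[OF PQ PQ' nondegenerate_box[OF P' Q' nd] K V ndh[unfolded h]])
  then show "is_box_mor \<C> c (H1, A1) (H1', A1') (H2, A2) (H2', A2') f g h"
    unfolding is_box_mor_def box_obj by (simp add: hfg)
qed

text \<open>The conjugation formula is multiplicative on all of \<open>B H H\<close>, so
  \<open>h m\<close> has the defining property of the extension; nondegeneracy of \<open>h\<close>
  and of the target leaves no other candidate.\<close>

lemma extend_conj_tens:
  assumes f: "alg_mor \<C> (H, A) (H', B') h" and h: "h = conj_tens H K V" and K: "K \<in> Obj \<C>"
    and V: "V \<in> B (H \<otimes> K) H'" "adj V o\<^sub>L V = idm \<C> (H \<otimes> K)"
    and nd: "nondegenerate (Hs \<C> H') B'" and m: "m \<in> multipliers (Hs \<C> H) A"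
  shows "extend \<C> (H, A) (H', B') h m = h m"
proof -
  have obj: "H \<in> Obj \<C>" "H' \<in> Obj \<C>" and A: "cstar_subalgebra (Hs \<C> H) A" and B: "cstar_subalgebra (Hs \<C> H') B'"
    using f by (auto simp: alg_mor_def alg_obj_iff)
  have "{h a o\<^sub>L b | a b. a \<in> A \<and> b \<in> B'} = op_prod (h ` A) B'" unfolding op_prod_def by blast
  then have ndh: "opspan (op_prod (h ` A) B') = B'" using f by (simp add: alg_mor_def)
  have AB: "a \<in> B H H" if "a \<in> A" for a using that cstar_subalgebraD(1)[OF A] by blast
  have hB: "h a \<in> B H' H'" "h (adj a) = adj (h a)" if "a \<in> B H H" for a
    using obj K V that by (simp_all add: h)
  define T where "T = h m"
  have mB: "m \<in> B H H" using multipliersD(1)[OF m] .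
  have T: "T \<in> B H' H'" unfolding T_def using hB(1)[OF mB] .
  have Th: "T o\<^sub>L h a = h (m o\<^sub>L a)" "h a o\<^sub>L T = h (a o\<^sub>L m)" if "a \<in> A" for a
    using conj_tens_mult[OF obj(1) K obj(2) V] mB AB[OF that] unfolding T_def h by blast+
  have hA: "h ` A \<subseteq> {T. clin T}" using hB(1) AB by auto
  have B'B: "B' \<subseteq> B H' H'" using cstar_subalgebraD(1)[OF B] .
  have B'c: "B' \<subseteq> {T. clin T}" using B'B by auto
  have adjA: "adj ` A = A"
    using cstar_subalgebraD(1,4)[OF A] by (intro adj_image_eq) (auto simp: subset_eq)
  have adjB: "adj ` B' = B'"
    using B'c cstar_subalgebraD(4)[OF B] by (intro adj_image_eq) auto
  have adjh: "adj ` h ` A = h ` A"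
  proof -
    have "adj ` h ` A = h ` adj ` A" using hB(2) AB by (force simp: image_iff simp del: bop_simps)
    then show ?thesis by (simp only: adjA)
  qed
  have h': "opspan (op_prod B' (h ` A)) = B'"
    using opspan_adj_image[OF op_prod_clin[OF hA B'c]] ndh adjB adjh by (simp add: op_prod_adj[OF hA B'c])
  have hB': "h a o\<^sub>L b \<in> B'" "b o\<^sub>L h a \<in> B'" if "a \<in> A" "b \<in> B'" for a b
    using opspan_base[OF op_prodI[OF imageI[OF that(1), of h] that(2)]]
      opspan_base[OF op_prodI[OF that(2) imageI[OF that(1), of h]]] ndh h' by auto
  have "T o\<^sub>L b \<in> B'" if b: "b \<in> B'" for b
  proof -
    have "T o\<^sub>L b \<in> opspan B'"
    proof (rule opspan_comp_right)
      show "b \<in> opspan (op_prod (h ` A) B')" using b ndh by simp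
      show "clin T" using T by simp
      fix s assume "s \<in> op_prod (h ` A) B'"
      then obtain a b' where s: "a \<in> A" "b' \<in> B'" "s = h a o\<^sub>L b'" by (auto elim!: op_prodE)
      have "T o\<^sub>L s = h (m o\<^sub>L a) o\<^sub>L b'" by (simp add: s(3) Th(1)[OF s(1)] flip: blinfun_compose_assoc)
      then show "T o\<^sub>L s \<in> opspan B'" using hB'(1)[OF multipliersD(2)[OF m s(1)] s(2)] by (simp add: opspan_base)
    qed
    then show ?thesis by (simp add: cstar_subalgebraD(2)[OF B])
  qed
  moreover have "b o\<^sub>L T \<in> B'" if b: "b \<in> B'" for b
  proof -
    have "b o\<^sub>L T \<in> opspan B'"
    proof (rule opspan_comp_left)
      show "b \<in> opspan (op_prod B' (h ` A))" using b h' by simp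
      fix s assume "s \<in> op_prod B' (h ` A)"
      then obtain a b' where s: "a \<in> A" "b' \<in> B'" "s = b' o\<^sub>L h a" by (auto elim!: op_prodE)
      have "s o\<^sub>L T = b' o\<^sub>L h (a o\<^sub>L m)" by (simp add: s(3) Th(2)[OF s(1)] blinfun_compose_assoc)
      then show "s o\<^sub>L T \<in> opspan B'" using hB'(2)[OF multipliersD(3)[OF m s(1)] s(2)] by (simp add: opspan_base)
    qed
    then show ?thesis by (simp add: cstar_subalgebraD(2)[OF B])
  qed
  ultimately have Tm: "T \<in> multipliers (Hs \<C> H') B'" using T nd by (intro multipliersI)
  show ?thesis unfolding extend_def fst_conv snd_conv T_def[symmetric]
  proof (rule the_equality)
    show "T \<in> multipliers (Hs \<C> H') B' \<and> (\<forall>a\<in>A. T o\<^sub>L h a = h (m o\<^sub>L a))" using Tm Th by blast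
    fix S assume S: "S \<in> multipliers (Hs \<C> H') B' \<and> (\<forall>a\<in>A. S o\<^sub>L h a = h (m o\<^sub>L a))"
    have SB: "S \<in> B H' H'" using S multipliersD by blast
    show "S = T"
    proof (rule nondegenerate_cancel[OF nd B'B _ SB T])
      show "hilbert_subspace (Hs \<C> H')" using obj by simp
      fix b assume b: "b \<in> B'"
      have "(S - T) o\<^sub>L b \<in> opspan {0}"
      proof (rule opspan_comp_right)
        show "b \<in> opspan (op_prod (h ` A) B')" using b ndh by simp
        show "clin (S - T)" using SB T
          by (simp add: clin_def blinfun.diff_left complex_vector.scale_right_diff_distrib)
        fix s assume "s \<in> op_prod (h ` A) B'"
        then obtain a b' where s: "a \<in> A" "b' \<in> B'" "s = h a o\<^sub>L b'" by (auto elim!: op_prodE)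
        have eq: "S o\<^sub>L h a = T o\<^sub>L h a" using S Th(1)[OF s(1)] s(1) by simp
        have "(S - T) o\<^sub>L s = 0"
        proof (rule blinfun_eqI)
          fix x show "((S - T) o\<^sub>L s) x = blinfun_apply 0 x"
            using arg_cong[OF eq, of "\<lambda>R. blinfun_apply R (b' x)"] by (simp add: s(3) blinfun.diff_left)
        qed
        then show "(S - T) o\<^sub>L s \<in> opspan {0}" by (simp add: opspan_base)
      qed
      moreover have "opspan {0} = {0 :: 'v op}"
        by (intro opspan_idem) (simp_all add: op_vector.subspace_single_0)
      ultimately have "(S - T) o\<^sub>L b = 0" by simp
      then show "S o\<^sub>L b = T o\<^sub>L b"
      proof (intro blinfun_eqI)
        fix x assume "(S - T) o\<^sub>L b = 0"
        from arg_cong[OF this, of "\<lambda>R. blinfun_apply R x"]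
        show "(S o\<^sub>L b) x = (T o\<^sub>L b) x" by (simp add: blinfun.diff_left)
      qed
    qed
  qed
qed

end

section \<open>Multiplicative unitaries\<close>

locale braided_multiplicative_unitary = braided_wstar_category +
  fixes L :: 'a and F :: "'b op"
  assumes L [simp]: "L \<in> Obj \<C>" and F: "F \<in> unitaries \<C> (L \<otimes> L) (L \<otimes> L)"
    and bi_regular_F: "bi_regular_multiplicative_unitary \<C> c L F"
begin

lemma F_Hom: "F \<in> Hom \<C> (L \<otimes> L) (L \<otimes> L)"
  using F by (simp add: unitaries_def)

lemma F_simps [simp]:
  "clin F" "lands F (Hs \<C> (L \<otimes> L))" "vanishes F (Hs \<C> (L \<otimes> L))"
  "adj F o\<^sub>L F = idm \<C> (L \<otimes> L)" "F o\<^sub>L adj F = idm \<C> (L \<otimes> L)"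
  using F Hom_B[OF F_Hom] by (simp_all add: unitaries_def)

abbreviation LL where "LL \<equiv> L \<otimes> L"
abbreviation F1 where "F1 \<equiv> tensR \<C> LL LL F L"
abbreviation F2 where "F2 \<equiv> leg_snd L L L L L F"
abbreviation c1 where "c1 \<equiv> tensR \<C> LL LL (c L L) L"
abbreviation A where "A \<equiv> slices L L L L F"
abbreviation \<Delta> where "\<Delta> \<equiv> conj_tens L L F"

section \<open>The pentagon equation and the algebra of slices\<close>

lemma leg_unitary:
  "F1 o\<^sub>L adj F1 = idm \<C> (LL \<otimes> L)" "adj F1 o\<^sub>L F1 = idm \<C> (LL \<otimes> L)"
  "F2 o\<^sub>L adj F2 = idm \<C> (LL \<otimes> L)" "adj F2 o\<^sub>L F2 = idm \<C> (LL \<otimes> L)"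
  "c1 o\<^sub>L adj c1 = idm \<C> (LL \<otimes> L)" "adj c1 o\<^sub>L c1 = idm \<C> (LL \<otimes> L)"
proof -
  show "F1 o\<^sub>L adj F1 = idm \<C> (LL \<otimes> L)" "adj F1 o\<^sub>L F1 = idm \<C> (LL \<otimes> L)"
    "c1 o\<^sub>L adj c1 = idm \<C> (LL \<otimes> L)" "adj c1 o\<^sub>L c1 = idm \<C> (LL \<otimes> L)"
    by (simp_all add: tens_comp)
  show "F2 o\<^sub>L adj F2 = idm \<C> (LL \<otimes> L)" "adj F2 o\<^sub>L F2 = idm \<C> (LL \<otimes> L)"
    by (simp_all add: leg_snd_def blinfun_compose_assoc assoc_comp_adj[THEN comp_reassoc] assoc_adj_comp
        tens_comp[THEN comp_reassoc])
qed

lemma pentagon: "F2 o\<^sub>L F1 = F1 o\<^sub>L (adj c1 o\<^sub>L (F2 o\<^sub>L (c1 o\<^sub>L F2)))"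
proof -
  have "leg23 \<C> L F o\<^sub>L leg12 \<C> L F = leg12 \<C> L F o\<^sub>L leg12 \<C> L (braid_inv \<C> c L L) o\<^sub>L leg23 \<C> L F o\<^sub>L
       leg12 \<C> L (c L L) o\<^sub>L leg23 \<C> L F"
    using bi_regular_F by (simp add: bi_regular_multiplicative_unitary_def multiplicative_unitary_def)
  then show ?thesis by (simp add: leg23_def leg12_def leg_snd_def blinfun_compose_assoc)
qed

lemma pentagon_F2_c_F2: "F2 o\<^sub>L (c1 o\<^sub>L F2) = c1 o\<^sub>L (adj F1 o\<^sub>L (F2 o\<^sub>L F1))"
  unfolding pentagon
  by (simp add: leg_unitary(2)[THEN comp_reassoc] leg_unitary(5)[THEN comp_reassoc]
      del: tens_adj leg_snd_simps(4))

lemma slices_cF: "slices L L L L (c L L o\<^sub>L adj F) = compact_op (Hs \<C> L) (Hs \<C> L)"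
  using bi_regular_F by (simp add: bi_regular_multiplicative_unitary_def slice_fst_opspan)

lemma A_B: "A \<subseteq> B L L"
  by (rule slices_B) simp_all

lemma A_clin: "A \<subseteq> {T. clin T}"
  using A_B by auto

text \<open>The slices over the unused leg only contribute scalars.\<close>

lemma slices_leg_snd: "slices LL LL L L F2 = A"
proof -
  have coef: "coef LL LL L L (vten \<C> L L \<zeta>' \<eta>) (vten \<C> L L \<zeta> \<xi>) F2 =
      op_scale (cinner \<zeta>' \<zeta>) (coef L L L L \<eta> \<xi> F)"
    if "\<zeta> \<in> Hs \<C> L" "\<zeta>' \<in> Hs \<C> L" "\<xi> \<in> Hs \<C> L" "\<eta> \<in> Hs \<C> L" for \<zeta> \<zeta>' \<xi> \<eta>
    using that
    by (simp add: bra_leg_snd[THEN comp_reassoc] blinfun_compose_assoc assoc_ket bra_ket[THEN comp_reassoc]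
        op_scale_comp_left op_scale_comp_right)
  show ?thesis unfolding slices_tens[OF L L L L L L leg_snd_simps(1)[OF L L L L L], of F, simplified]
  proof (rule opspan_eqI)
    fix x assume "x \<in> {coef LL LL L L (vten \<C> L L \<eta>1 \<eta>2) (vten \<C> L L \<xi>1 \<xi>2) F2 | \<xi>1 \<xi>2 \<eta>1 \<eta>2.
      \<xi>1 \<in> Hs \<C> L \<and> \<xi>2 \<in> Hs \<C> L \<and> \<eta>1 \<in> Hs \<C> L \<and> \<eta>2 \<in> Hs \<C> L}"
    then obtain \<xi>1 \<xi>2 \<eta>1 \<eta>2 where v: "\<xi>1 \<in> Hs \<C> L" "\<xi>2 \<in> Hs \<C> L" "\<eta>1 \<in> Hs \<C> L" "\<eta>2 \<in> Hs \<C> L"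
      "x = coef LL LL L L (vten \<C> L L \<eta>1 \<eta>2) (vten \<C> L L \<xi>1 \<xi>2) F2" by blast
    show "x \<in> A" unfolding v(5) coef[OF v(1,3,2,4)]
      using opspan_subspace opspan_base[OF coefsI[OF v(2,4)]] by (rule op_vector.subspace_scale)
  next
    fix x assume "x \<in> coefs L L L L F"
    then obtain \<xi> \<eta> where v: "\<xi> \<in> Hs \<C> L" "\<eta> \<in> Hs \<C> L" "x = coef L L L L \<eta> \<xi> F" by (rule coefsE)
    let ?S = "{coef LL LL L L (vten \<C> L L \<eta>1 \<eta>2) (vten \<C> L L \<xi>1 \<xi>2) F2 | \<xi>1 \<xi>2 \<eta>1 \<eta>2.
      \<xi>1 \<in> Hs \<C> L \<and> \<xi>2 \<in> Hs \<C> L \<and> \<eta>1 \<in> Hs \<C> L \<and> \<eta>2 \<in> Hs \<C> L}"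
    show "x \<in> opspan ?S"
    proof (cases "\<xi> = 0")
      case True
      have "x = 0" using True ket_scale[OF L L, of 0 0] by (simp add: v(3))
      show ?thesis unfolding \<open>x = 0\<close> by (rule op_vector.subspace_0[OF opspan_subspace])
    next
      case False
      have "coef LL LL L L (vten \<C> L L \<xi> \<eta>) (vten \<C> L L \<xi> \<xi>) F2 \<in> opspan ?S"
        using v by (intro opspan_base) blast
      then have "op_scale (1 / cinner \<xi> \<xi>) (op_scale (cinner \<xi> \<xi>) x) \<in> opspan ?S"
        unfolding coef[OF v(1,1,1,2)] v(3)[symmetric] by (rule op_vector.subspace_scale[OF opspan_subspace])
      moreover have "op_scale (1 / cinner \<xi> \<xi>) (op_scale (cinner \<xi> \<xi>) x) = x"
        using False by (simp add: op_vector.scale_scale)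
      ultimately show ?thesis by (simp only:)
    qed
  qed
qed

lemma A_mult: "opspan (op_prod A A) = A"
proof -
  have "opspan (op_prod A A) = slices LL LL L L (F2 o\<^sub>L (c1 o\<^sub>L F2))"
    unfolding op_prod_def by (rule slices_product) (simp_all add: slices_c)
  \<comment> \<open>Everything except \<open>F2\<close> now acts on the auxiliary legs,
    \<open>c\<close> and \<open>adj F\<close> from the left and \<open>F\<close> from the right, and
    is absorbed by the vectors.\<close>
  also have "F2 o\<^sub>L (c1 o\<^sub>L F2) = tensR \<C> LL LL (c L L o\<^sub>L adj F) L o\<^sub>L (F2 o\<^sub>L F1)"
    unfolding pentagon_F2_c_F2 by (simp add: tens_comp[THEN comp_reassoc])
  also have "slices LL LL L L \<dots> = A"
    unfolding slices_leg_snd[symmetric]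
    by (intro slices_unitary) (simp_all add: blinfun_compose_assoc c_unitary[THEN comp_reassoc])
  finally show ?thesis .
qed

lemma A_adj_eq: "adj ` A = slices L L L L (adj F)"
proof (rule adj_image_eq[OF A_clin])
  show "adj s \<in> slices L L L L (adj F)" if "s \<in> A" for s
    using slices_adj[OF L L L L _ that] by simp
  show "adj s \<in> A" if "s \<in> slices L L L L (adj F)" for s
    using slices_adj[OF L L L L _ that] by simp
  show "slices L L L L (adj F) \<subseteq> {T. clin T}" using slices_B[of L L L L "adj F"] by auto
qed

lemma A_adj_mult: "opspan (op_prod (adj ` A) A) = A"
proof -
  have "opspan (op_prod (adj ` A) A) =
      slices LL LL L L (leg_snd L L L L L (adj F) o\<^sub>L (tensR \<C> LL LL (c L L o\<^sub>L adj F) L o\<^sub>L F2))"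
    unfolding A_adj_eq op_prod_def by (rule slices_product) (simp_all add: slices_cF)
  \<comment> \<open>Inserting \<open>F1\<close> and \<open>adj F1\<close> on the right completes one
    side of the pentagon; its other side begins with \<open>F2\<close>, which cancels
    \<open>adj F2\<close>.\<close>
  also have "leg_snd L L L L L (adj F) o\<^sub>L (tensR \<C> LL LL (c L L o\<^sub>L adj F) L o\<^sub>L F2) =
      adj F2 o\<^sub>L ((c1 o\<^sub>L (adj F1 o\<^sub>L (F2 o\<^sub>L F1))) o\<^sub>L adj F1)"
    by (simp add: blinfun_compose_assoc tens_comp[THEN comp_reassoc] tens_comp)
  also have "\<dots> = c1 o\<^sub>L (F2 o\<^sub>L adj F1)"
    unfolding pentagon_F2_c_F2[symmetric]
    by (simp add: blinfun_compose_assoc leg_unitary(4)[THEN comp_reassoc] del: tens_adj leg_snd_simps(4))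
  also have "slices LL LL L L \<dots> = A"
  proof -
    have "slices LL LL L L (c1 o\<^sub>L (F2 o\<^sub>L tensR \<C> LL LL (adj F) L)) =
        slices LL LL L L F2"
      by (intro slices_unitary) simp_all
    then show ?thesis by (simp add: slices_leg_snd)
  qed
  finally show ?thesis .
qed

lemma adj_adj_image: "S \<subseteq> {T. clin T} \<Longrightarrow> adj ` adj ` S = S"
  by (force simp: image_iff subset_eq)

text \<open>By \<open>A_adj_mult\<close>, A is the closed span of the products of its adjoints with
  itself, a set that taking adjoints preserves.\<close>

lemma A_adj: "adj ` A = A"
proof -
  have cl: "adj ` A \<subseteq> {T. clin T}" using A_clin by auto
  have "adj ` A = adj ` opspan (op_prod (adj ` A) A)" by (simp only: A_adj_mult)
  also have "\<dots> = opspan (op_prod (adj ` A) (adj ` adj ` A))"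
    by (simp only: opspan_adj_image[OF op_prod_clin[OF cl A_clin]] op_prod_adj[OF cl A_clin])
  also have "\<dots> = A" by (simp only: adj_adj_image[OF A_clin] A_adj_mult)
  finally show ?thesis .
qed

lemma A_cstar: "cstar_subalgebra (Hs \<C> L) A"
  unfolding cstar_subalgebra_def
proof (intro conjI ballI A_B opspan_subspace closed_closure)
  show "a o\<^sub>L b \<in> A" if "a \<in> A" "b \<in> A" for a b
    using opspan_base[OF op_prodI[OF that]] A_mult by simp
  show "adj a \<in> A" if "a \<in> A" for a using A_adj that by blast
qed

lemma A_alg_obj: "alg_obj \<C> (L, A)"
  using A_cstar F_Hom unfolding alg_obj_iff by (intro conjI bexI[of _ L] bexI[of _ F]) simp_all

text \<open>If all slices of \<open>F\<close> kill \<open>x\<close>, then \<open>F\<close> kills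
  \<open>x \<otimes> x\<close>; as \<open>F\<close> is isometric, \<open>x \<otimes> x\<close> and
  hence \<open>x\<close> is zero.\<close>

lemma A_nondegenerate: "nondegenerate (Hs \<C> L) A"
  unfolding nondegenerate_def
proof (intro allI impI)
  fix w assume w: "\<forall>a\<in>A. \<forall>h\<in>Hs \<C> L. cinner (a h) w = 0"
  define x where "x = ident (Hs \<C> L) w"
  have xL: "x \<in> Hs \<C> L" unfolding x_def by (intro lands_in lands_ident) simp
  \<comment> \<open>Selfadjointness of A turns orthogonality to the ranges into annihilation:
    \<open>a w\<close> is tested against itself.\<close>
  have x0: "a x = 0" if a: "a \<in> A" for a
  proof -
    have aB: "a \<in> B L L" "adj a \<in> A" using A_B A_adj a by auto
    have "a w = 0"
    proof -
      have "cinner (a w) (a w) = cinner (adj a (a w)) w"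
        using aB by (simp add: cinner_adj)
      also have "\<dots> = 0" using w aB by (auto intro!: lands_in)
      finally show ?thesis by simp
    qed
    then show "a x = 0" using bop_apply_ident[OF hilbert_subspace_Hs[OF L] aB(1)] by (simp add: x_def)
  qed
  let ?v = "F (vten \<C> L L x x)"
  have "cinner z ?v = 0" if z: "z \<in> Hs \<C> LL" for z
  proof (rule vten_perp[OF L L _ z])
    fix \<eta> y assume v: "\<eta> \<in> Hs \<C> L" "y \<in> Hs \<C> L"
    have "coef L L L L \<eta> x F x = 0" using x0 v xL by (intro x0 opspan_base coefsI)
    then have "cinner y (coef L L L L \<eta> x F x) = 0" by (simp add: cinner.zero_right)
    then show "cinner (vten \<C> L L \<eta> y) ?v = 0" using v xL by (simp add: cinner_adj_right)
  qed
  moreover have "?v \<in> Hs \<C> LL" by (intro lands_in) simp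
  ultimately have "?v = 0" by (metis cinner_self_0)
  then have "vten \<C> L L x x = 0"
    using isometry_apply[OF F_simps(4)] xL by (metis L tens_Obj vten_in blinfun.zero_right)
  then have "norm x * norm x = 0" using tensor.norm_tensor[OF tens[OF L L] xL xL] by simp
  then have "x = 0" by simp
  then show "cperp (Hs \<C> L) w"
    using cinner_ident_left[of "Hs \<C> L" _ w] by (simp add: x_def cinner.zero_right)
qed

subsection \<open>Absorption of \<open>F\<close>\<close>

text \<open>The operators \<open>y \<mapsto> u \<otimes> a y\<close>. They stand for the compact
  operators tensored with A, with the input vector of the compact leg left out.\<close>

abbreviation G where "G \<equiv> op_prod (ket L L ` Hs \<C> L) A"

lemma ket_clin: "ket L L ` Hs \<C> L \<subseteq> {T. clin T}"
  by auto

lemma G_B: "G \<subseteq> B L LL"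
  using A_B by (auto elim!: op_prodE simp: subset_eq)

text \<open>This says that \<open>F\<close> is a multiplier of \<open>K \<otimes> A\<close>, where \<open>K\<close> are the compact operators.  The middle
  rank one operator of \<open>F (u \<otimes> a)\<close>, \<open>a\<close> a slice of \<open>F\<close>, is replaced by a slice of \<open>c\<close>; the pentagon
  equation then turns the product into one with a slice of \<open>c F\<^sup>*\<close> in the middle, which is again
  replaced by rank one operators.\<close>

lemma F_G: "opspan (op_prod {F} G) = opspan G"
proof -
  let ?P = "{rank_one u v | u v. u \<in> Hs \<C> L \<and> v \<in> Hs \<C> L}"
  have PB: "?P \<subseteq> B L L" by auto
  have P_c: "opspan ?P = slices L L L L (c L L)"
    using compact_op_opspan[OF L L slices_c[OF L L]] slices_c[OF L L] by simp
  have P_cF: "opspan ?P = slices L L L L (c L L o\<^sub>L adj F)"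
    using compact_op_opspan[OF L L slices_c[OF L L]] slices_cF by simp
  have cB: "coefs L L L L (c L L) \<subseteq> B L L" "coefs L L L L (c L L o\<^sub>L adj F) \<subseteq> B L L"
    by (rule coefs_B; simp)+
  \<comment> \<open>With a rank one \<open>R\<close>, \<open>m2\<close> is a generator of
    \<open>G\<close>: a ket followed by a slice of \<open>F\<close>. \<open>m1\<close> is the same
    with \<open>F\<close> applied, so the two families must be shown to have equal closed
    spans.\<close>
  define m2 where "m2 \<xi> R = tensR \<C> L L R L o\<^sub>L (F o\<^sub>L ket L L \<xi>)" for \<xi> R
  define m1 where "m1 \<xi> R = F o\<^sub>L m2 \<xi> R" for \<xi> R
  have semi2: "semilin_on (B L L) (m2 \<xi>)" for \<xi>
    unfolding m2_def by (intro semilin_comp[OF _ semilin_left] semilin_tens_left) simp_all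
  have semi1: "semilin_on (B L L) (m1 \<xi>)" for \<xi>
    unfolding m1_def by (intro semilin_comp[OF _ semilin_right] semi2) simp
  have m2_rank: "m2 \<xi> (rank_one u \<eta>) = ket L L u o\<^sub>L coef L L L L \<eta> \<xi> F" if "u \<in> Hs \<C> L" "\<eta> \<in> Hs \<C> L" for \<xi> u \<eta>
    unfolding m2_def using that by (simp add: blinfun_compose_assoc flip: ket_bra)
  have "opspan G = opspan (op_prod (ket L L ` Hs \<C> L) (coefs L L L L F))"
    by (rule opspan_prod_right[OF ket_clin])
  also have "op_prod (ket L L ` Hs \<C> L) (coefs L L L L F) = {m2 \<xi> R | \<xi> R. \<xi> \<in> Hs \<C> L \<and> R \<in> ?P}"
  proof (intro equalityI subsetI)
    fix x assume "x \<in> op_prod (ket L L ` Hs \<C> L) (coefs L L L L F)"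
    then obtain u \<xi> \<eta> where u: "u \<in> Hs \<C> L" "\<xi> \<in> Hs \<C> L" "\<eta> \<in> Hs \<C> L" "x = ket L L u o\<^sub>L coef L L L L \<eta> \<xi> F"
      by (auto elim!: op_prodE coefsE)
    have "x = m2 \<xi> (rank_one u \<eta>)" unfolding u(4) using u by (simp add: m2_rank)
    then show "x \<in> {m2 \<xi> R | \<xi> R. \<xi> \<in> Hs \<C> L \<and> R \<in> ?P}" using u(1-3) by blast
  next
    fix x assume "x \<in> {m2 \<xi> R | \<xi> R. \<xi> \<in> Hs \<C> L \<and> R \<in> ?P}"
    then obtain \<xi> u \<eta> where u: "u \<in> Hs \<C> L" "\<xi> \<in> Hs \<C> L" "\<eta> \<in> Hs \<C> L" "x = m2 \<xi> (rank_one u \<eta>)" by blast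
    then show "x \<in> op_prod (ket L L ` Hs \<C> L) (coefs L L L L F)"
      by (simp add: m2_rank op_prodI coefsI)
  qed
  finally have G_m2: "opspan G = opspan {m2 \<xi> R | \<xi> R. \<xi> \<in> Hs \<C> L \<and> R \<in> ?P}" .
  have "opspan (op_prod {F} G) = opspan (op_prod {F} (opspan G))"
    by (rule opspan_prod_right[symmetric]) simp
  also have "\<dots> = opspan (op_prod {F} {m2 \<xi> R | \<xi> R. \<xi> \<in> Hs \<C> L \<and> R \<in> ?P})"
    unfolding G_m2 by (rule opspan_prod_right) simp
  also have "op_prod {F} {m2 \<xi> R | \<xi> R. \<xi> \<in> Hs \<C> L \<and> R \<in> ?P} = {m1 \<xi> R | \<xi> R. \<xi> \<in> Hs \<C> L \<and> R \<in> ?P}"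
    unfolding op_prod_def m1_def by blast
  also have "opspan \<dots> = opspan {m1 \<xi> R | \<xi> R. \<xi> \<in> Hs \<C> L \<and> R \<in> coefs L L L L (c L L)}"
    by (rule opspan_swap[OF semi1 P_c PB cB(1)])
  finally have FG_m1: "opspan (op_prod {F} G) = opspan {m1 \<xi> R | \<xi> R. \<xi> \<in> Hs \<C> L \<and> R \<in> coefs L L L L (c L L)}" .
  have G_m2': "opspan G = opspan {m2 \<xi> R | \<xi> R. \<xi> \<in> Hs \<C> L \<and> R \<in> coefs L L L L (c L L o\<^sub>L adj F)}"
    unfolding G_m2 by (rule opspan_swap[OF semi2 P_cF PB cB(2)])
  \<comment> \<open>A common form for both families. After the exchange, \<open>m2\<close> gives
    \<open>n\<close> at elementary tensors, while \<open>m1\<close>, by the pentagon, gives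
    \<open>n\<close> at their images under \<open>F\<close>.\<close>
  define n where "n \<zeta>' w = adj (ket L LL \<zeta>') o\<^sub>L (assoc \<C> L L L o\<^sub>L
      (tensR \<C> LL LL (c L L o\<^sub>L adj F) L o\<^sub>L (F2 o\<^sub>L ket LL L w)))" for \<zeta>' w
  have m2_n: "m2 \<xi> (coef L L L L \<zeta>' \<zeta> (c L L o\<^sub>L adj F)) = n \<zeta>' (vten \<C> L L \<zeta> \<xi>)"
    if "\<zeta> \<in> Hs \<C> L" "\<zeta>' \<in> Hs \<C> L" "\<xi> \<in> Hs \<C> L" for \<zeta> \<zeta>' \<xi>
    unfolding m2_def n_def using that by (subst tensR_coef) (simp_all add: blinfun_compose_assoc leg_snd_ket)
  have m1_n: "m1 \<xi> (coef L L L L \<zeta>' \<zeta> (c L L)) = n \<zeta>' (F (vten \<C> L L \<zeta> \<xi>))"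
    if v: "\<zeta> \<in> Hs \<C> L" "\<zeta>' \<in> Hs \<C> L" "\<xi> \<in> Hs \<C> L" for \<zeta> \<zeta>' \<xi>
  proof -
    have "m1 \<xi> (coef L L L L \<zeta>' \<zeta> (c L L)) = adj (ket L LL \<zeta>') o\<^sub>L (tensL \<C> L LL LL F o\<^sub>L
        (assoc \<C> L L L o\<^sub>L (c1 o\<^sub>L (F2 o\<^sub>L ket LL L (vten \<C> L L \<zeta> \<xi>)))))"
      unfolding m1_def m2_def using v
      by (subst tensR_coef) (simp_all add: blinfun_compose_assoc leg_snd_ket bra_tensL[THEN comp_reassoc])
    also have "\<dots> = adj (ket L LL \<zeta>') o\<^sub>L
        (assoc \<C> L L L o\<^sub>L ((F2 o\<^sub>L (c1 o\<^sub>L F2)) o\<^sub>L ket LL L (vten \<C> L L \<zeta> \<xi>)))"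
      unfolding leg_snd_def by (simp add: blinfun_compose_assoc assoc_comp_adj[THEN comp_reassoc])
    also have "\<dots> = n \<zeta>' (F (vten \<C> L L \<zeta> \<xi>))"
      unfolding n_def pentagon_F2_c_F2 using v
      by (simp add: blinfun_compose_assoc tensR_ket tens_comp[THEN comp_reassoc])
    finally show ?thesis .
  qed
  have n_lin: "n \<zeta>' (v + w) = n \<zeta>' v + n \<zeta>' w" "n \<zeta>' (a *\<^sub>C v) = op_scale a (n \<zeta>' v)" for \<zeta>' v w a
    unfolding n_def by (simp_all add: ket_add ket_scale op_scale_comp_right)
      (simp add: blinfun_eqI blinfun.add_left blinfun.add_right)
  define N where "N \<zeta>' = norm (adj (ket L LL \<zeta>') o\<^sub>L (assoc \<C> L L L o\<^sub>L
      (tensR \<C> LL LL (c L L o\<^sub>L adj F) L o\<^sub>L F2)))" for \<zeta>'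
  have n_norm: "norm (n \<zeta>' w) \<le> N \<zeta>' * norm w" for \<zeta>' w
  proof -
    have "n \<zeta>' w = (adj (ket L LL \<zeta>') o\<^sub>L (assoc \<C> L L L o\<^sub>L
      (tensR \<C> LL LL (c L L o\<^sub>L adj F) L o\<^sub>L F2))) o\<^sub>L ket LL L w"
      unfolding n_def by (simp only: blinfun_compose_assoc)
    then have "norm (n \<zeta>' w) \<le> N \<zeta>' * norm (ket LL L w)"
      unfolding N_def by (metis norm_blinfun_compose)
    also have "\<dots> \<le> N \<zeta>' * norm w" unfolding N_def by (intro mult_left_mono norm_ket) simp_all
    finally show ?thesis .
  qed
  let ?V = "{vten \<C> L L x y | x y. x \<in> Hs \<C> L \<and> y \<in> Hs \<C> L}"
  let ?N = "{n \<zeta>' w | \<zeta>' w. \<zeta>' \<in> Hs \<C> L \<and> w \<in> Hs \<C> LL}"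
  have "opspan {m1 \<xi> R | \<xi> R. \<xi> \<in> Hs \<C> L \<and> R \<in> coefs L L L L (c L L)} = opspan ?N" (is "opspan ?M1 = _")
  proof (rule opspan_eqI)
    fix x assume "x \<in> ?M1"
    then obtain \<xi> \<zeta> \<zeta>' where v: "\<xi> \<in> Hs \<C> L" "\<zeta> \<in> Hs \<C> L" "\<zeta>' \<in> Hs \<C> L" "x = m1 \<xi> (coef L L L L \<zeta>' \<zeta> (c L L))"
      by (auto elim!: coefsE)
    have "F (vten \<C> L L \<zeta> \<xi>) \<in> Hs \<C> LL" by (intro lands_in) simp
    then show "x \<in> opspan ?N" unfolding v(4) m1_n[OF v(2,3,1)] using v(3) by (intro opspan_base) blast
  next
    fix x assume "x \<in> ?N"
    then obtain \<zeta>' w where x: "\<zeta>' \<in> Hs \<C> L" "w \<in> Hs \<C> LL" "x = n \<zeta>' w" by blast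
    \<comment> \<open>\<open>F\<close> is surjective, so \<open>w\<close> is the image of
      \<open>adj F w\<close>, which elementary tensors approximate.\<close>
    have w: "F (adj F w) = w"
      using F_simps(5) x(2) by (metis L tens_Obj blinfun_apply_blinfun_compose idm_apply)
    have "n \<zeta>' (F (adj F w)) \<in> opspan ?M1"
    proof (rule opspan_vec[where f = "\<lambda>v. n \<zeta>' (F v)" and w = "adj F w" and V = ?V and g = "\<lambda>a. a" and B = "\<bar>N \<zeta>'\<bar> * norm F"])
      show "n \<zeta>' (F (u + v)) = n \<zeta>' (F u) + n \<zeta>' (F v)" for u v by (simp add: blinfun.add_right n_lin)
      show "n \<zeta>' (F (a *\<^sub>C v)) = op_scale a (n \<zeta>' (F v))" for a v by (simp add: clin_scaleC n_lin)
      show "norm (n \<zeta>' (F v)) \<le> \<bar>N \<zeta>'\<bar> * norm F * norm v" for v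
      proof -
        have "norm (n \<zeta>' (F v)) \<le> \<bar>N \<zeta>'\<bar> * norm (F v)"
          by (rule order_trans[OF n_norm mult_right_mono[OF abs_ge_self norm_ge_zero]])
        also have "\<dots> \<le> \<bar>N \<zeta>'\<bar> * (norm F * norm v)" by (intro mult_left_mono norm_blinfun) simp
        finally show ?thesis by (simp add: mult.assoc)
      qed
      show "n \<zeta>' (F v) \<in> opspan ?M1" if "v \<in> ?V" for v
      proof -
        obtain \<zeta> \<xi> where v: "\<zeta> \<in> Hs \<C> L" "\<xi> \<in> Hs \<C> L" "v = vten \<C> L L \<zeta> \<xi>" using \<open>v \<in> ?V\<close> by blast
        show ?thesis unfolding v(3) m1_n[OF v(1) x(1) v(2), symmetric]
          using v x by (intro opspan_base) (auto intro!: coefsI)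
      qed
      show "adj F w \<in> closure (complex_vector.span ?V)"
        unfolding Hs_tens[OF L L, symmetric] by (intro lands_in) simp
    qed
    then show "x \<in> opspan ?M1" by (simp add: x(3) w)
  qed
  moreover have "opspan {m2 \<xi> R | \<xi> R. \<xi> \<in> Hs \<C> L \<and> R \<in> coefs L L L L (c L L o\<^sub>L adj F)} = opspan ?N" (is "opspan ?M2 = _")
  proof (rule opspan_eqI)
    fix x assume "x \<in> ?M2"
    then obtain \<xi> \<zeta> \<zeta>' where v: "\<xi> \<in> Hs \<C> L" "\<zeta> \<in> Hs \<C> L" "\<zeta>' \<in> Hs \<C> L"
        "x = m2 \<xi> (coef L L L L \<zeta>' \<zeta> (c L L o\<^sub>L adj F))"
      by (auto elim!: coefsE)
    have "vten \<C> L L \<zeta> \<xi> \<in> Hs \<C> LL" using v by simp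
    then show "x \<in> opspan ?N" unfolding v(4) m2_n[OF v(2,3,1)] using v(3) by (intro opspan_base) blast
  next
    fix x assume "x \<in> ?N"
    then obtain \<zeta>' w where x: "\<zeta>' \<in> Hs \<C> L" "w \<in> Hs \<C> LL" "x = n \<zeta>' w" by blast
    show "x \<in> opspan ?M2" unfolding x(3)
    proof (rule opspan_vec[where V = ?V and g = "\<lambda>a. a", OF n_lin n_norm])
      show "n \<zeta>' v \<in> opspan ?M2" if "v \<in> ?V" for v
      proof -
        obtain \<zeta> \<xi> where v: "\<zeta> \<in> Hs \<C> L" "\<xi> \<in> Hs \<C> L" "v = vten \<C> L L \<zeta> \<xi>" using \<open>v \<in> ?V\<close> by blast
        show ?thesis unfolding v(3) m2_n[OF v(1) x(1) v(2), symmetric]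
          using v x by (intro opspan_base) (auto intro!: coefsI)
      qed
      show "w \<in> closure (complex_vector.span ?V)" using x(2) unfolding Hs_tens[OF L L, symmetric] .
    qed
  qed
  ultimately show ?thesis unfolding FG_m1 G_m2' by simp
qed

lemma adj_F_G: "opspan (op_prod {adj F} G) = opspan G"
proof -
  have "opspan (op_prod {adj F} G) = opspan (op_prod {adj F} (op_prod {F} G))"
    by (rule opspan_prod_cong_right[OF _ F_G[symmetric]]) simp
  also have "op_prod {adj F} (op_prod {F} G) = G"
  proof -
    have "op_prod {adj F} {F} = {idm \<C> LL}" by (simp add: op_prod_def)
    moreover have "op_prod {idm \<C> LL} G = G"
    proof -
      have "idm \<C> LL o\<^sub>L x = x" if "x \<in> G" for x using that G_B by auto
      then show ?thesis by (force simp: op_prod_def[of "{idm \<C> LL}"])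
    qed
    ultimately show ?thesis by (simp flip: op_prod_assoc)
  qed
  finally show ?thesis .
qed

end

context braided_multiplicative_unitary
begin

subsection \<open>The comultiplication\<close>

lemma \<Delta>_B: "a \<in> B L L \<Longrightarrow> \<Delta> a \<in> B LL LL"
  by simp

lemma A_elem: "a \<in> A \<Longrightarrow> a \<in> B L L"
  using A_B by blast

abbreviation lF1 where "lF1 \<equiv> lift1 L L L F"
abbreviation lF2 where "lF2 \<equiv> lift2 L L L F"

lemma F2_c1: "F2 o\<^sub>L c1 = c1 o\<^sub>L (adj (assoc \<C> L L L) o\<^sub>L (lF2 o\<^sub>L assoc \<C> L L L))"
proof -
  have hC: "hexC L L L o\<^sub>L assoc \<C> L L L = assoc \<C> L L L o\<^sub>L c1"
    unfolding hexC_def by (simp add: blinfun_compose_assoc assoc_adj_comp)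
  have "F2 o\<^sub>L c1 = adj (assoc \<C> L L L) o\<^sub>L ((tensL \<C> L LL LL F o\<^sub>L hexC L L L) o\<^sub>L assoc \<C> L L L)"
    unfolding leg_snd_def by (simp add: blinfun_compose_assoc hC)
  also have "\<dots> = c1 o\<^sub>L (adj (assoc \<C> L L L) o\<^sub>L (lF2 o\<^sub>L assoc \<C> L L L))"
    unfolding tensL_hexC[OF L L L F_Hom] unfolding hexC_def
    by (simp add: blinfun_compose_assoc assoc_adj_comp[THEN comp_reassoc])
  finally show ?thesis .
qed

lemma pentagon_lift2: "F2 o\<^sub>L F1 = F1 o\<^sub>L (adj (assoc \<C> L L L) o\<^sub>L (lF2 o\<^sub>L (assoc \<C> L L L o\<^sub>L F2)))"
  unfolding pentagon F2_c1[THEN comp_reassoc]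
  by (simp add: blinfun_compose_assoc leg_unitary(6)[THEN comp_reassoc] del: tens_adj)

text \<open>The pentagon bracketed so that the first leg can be sliced off. The braided conjugate of
  \<open>F\<close> has become \<open>lF2\<close>, whose slices are the \<open>iota2\<close> of
  slices of \<open>F\<close>.\<close>

lemma pentagon_lift:
  "tensL \<C> L LL LL F o\<^sub>L lF1 = lF1 o\<^sub>L (lF2 o\<^sub>L tensL \<C> L LL LL F)"
proof -
  have "tensL \<C> L LL LL F o\<^sub>L lF1 = assoc \<C> L L L o\<^sub>L ((F2 o\<^sub>L F1) o\<^sub>L adj (assoc \<C> L L L))"
    unfolding leg_snd_def lift1_def by (simp add: blinfun_compose_assoc assoc_comp_adj[THEN comp_reassoc])
  also have "\<dots> = lF1 o\<^sub>L (lF2 o\<^sub>L tensL \<C> L LL LL F)"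
    unfolding pentagon_lift2 unfolding leg_snd_def lift1_def
    by (simp add: blinfun_compose_assoc assoc_comp_adj[THEN comp_reassoc] assoc_comp_adj)
  finally show ?thesis .
qed

text \<open>The braided form of the identity \<open>(id \<otimes> \<Delta>)(F) = F12 F13\<close>
  known for ordinary multiplicative unitaries; \<open>lF2\<close> takes the place of
  \<open>F13\<close>.\<close>

lemma \<Delta>_coef:
  assumes v: "\<xi> \<in> Hs \<C> L" "\<eta> \<in> Hs \<C> L"
  shows "\<Delta> (coef L L L L \<eta> \<xi> F) = adj (ket L LL \<eta>) o\<^sub>L (lF1 o\<^sub>L (lF2 o\<^sub>L ket L LL \<xi>))"
proof -
  let ?tF = "tensL \<C> L LL LL F"
  have "\<Delta> (coef L L L L \<eta> \<xi> F) = F o\<^sub>L (coef L L LL LL \<eta> \<xi> lF1 o\<^sub>L adj F)"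
    unfolding coef_lift1[OF L L L _ v, of F, simplified] by (simp add: conj_tens_def iota1_def)
  also have "\<dots> = adj (ket L LL \<eta>) o\<^sub>L ((?tF o\<^sub>L lF1) o\<^sub>L (adj ?tF o\<^sub>L ket L LL \<xi>))"
    using v by (simp add: blinfun_compose_assoc bra_tensL[THEN comp_reassoc] tensL_ket)
  also have "\<dots> = adj (ket L LL \<eta>) o\<^sub>L (lF1 o\<^sub>L (lF2 o\<^sub>L ket L LL \<xi>))"
    unfolding pentagon_lift using v by (simp add: blinfun_compose_assoc tens_comp[THEN comp_reassoc])
  finally show ?thesis .
qed

lemma semilin_\<Delta>: "semilin_on (B L L) \<Delta>"
  by (intro semilin_conj_tens) simp_all

abbreviation BA where "BA \<equiv> box L L A A"

text \<open>For slices \<open>a\<close>, the product of \<open>\<Delta> a\<close> and \<open>\<iota>(b)\<close> depends on the vector \<open>\<xi>\<close> and on \<open>b\<close> only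
  through \<open>X (\<xi> \<otimes> b)\<close>, where \<open>X\<close> can be absorbed.\<close>

lemma absorb_unitary:
  assumes X: "X \<in> B LL LL" "A = slices L L L L X" "opspan (op_prod {X} G) = opspan G"
    and \<kappa>: "semilin_on (B L L) \<kappa>" and p: "\<And>\<eta>. semilin_on (B L LL) (p \<eta>)"
    and 1: "\<And>\<xi> \<eta> b. \<lbrakk>\<xi> \<in> Hs \<C> L; \<eta> \<in> Hs \<C> L; b \<in> B L L\<rbrakk> \<Longrightarrow>
      \<Delta> (coef L L L L \<eta> \<xi> X) o\<^sub>L \<iota> b = p \<eta> (X o\<^sub>L (ket L L \<xi> o\<^sub>L b))"
    and 2: "\<And>\<xi> \<eta> b. \<lbrakk>\<xi> \<in> Hs \<C> L; \<eta> \<in> Hs \<C> L; b \<in> B L L\<rbrakk> \<Longrightarrow>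
      p \<eta> (ket L L \<xi> o\<^sub>L b) = \<kappa> (coef L L L L \<eta> \<xi> X) o\<^sub>L \<iota> b"
  shows "opspan (op_prod (\<Delta> ` A) (\<iota> ` A)) = opspan (op_prod (\<kappa> ` A) (\<iota> ` A))"
proof -
  let ?X = "coefs L L L L X"
  have XB: "?X \<subseteq> B L L" using X(1) by (intro coefs_B) simp_all
  have im: "opspan (f ` A) = opspan (f ` ?X)" if "semilin_on (B L L) f" for f
    unfolding X(2) by (rule opspan_image[OF that XB])
  \<comment> \<open>The two products are the images of \<open>G\<close> multiplied by
    \<open>X\<close> and of \<open>G\<close> itself under the same maps \<open>p \<eta>\<close>, so
    \<open>opspan_swap\<close> compares them.\<close>
  let ?P = "\<lambda>R. {p \<eta> T | \<eta> T. \<eta> \<in> Hs \<C> L \<and> T \<in> R}"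
  have "op_prod (\<Delta> ` ?X) (\<iota> ` A) = ?P (op_prod {X} G)"
  proof (intro equalityI subsetI)
    fix x assume "x \<in> op_prod (\<Delta> ` ?X) (\<iota> ` A)"
    then obtain \<xi> \<eta> b where v: "\<xi> \<in> Hs \<C> L" "\<eta> \<in> Hs \<C> L" "b \<in> A"
      "x = \<Delta> (coef L L L L \<eta> \<xi> X) o\<^sub>L \<iota> b" by (blast elim!: op_prodE coefsE)
    have "x = p \<eta> (X o\<^sub>L (ket L L \<xi> o\<^sub>L b))" unfolding v(4) by (rule 1[OF v(1,2) A_elem[OF v(3)]])
    moreover have "X o\<^sub>L (ket L L \<xi> o\<^sub>L b) \<in> op_prod {X} G" using v by (intro op_prodI) auto
    ultimately show "x \<in> ?P (op_prod {X} G)" using v(2) by blast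
  next
    fix x assume "x \<in> ?P (op_prod {X} G)"
    then obtain \<xi> \<eta> b where v: "\<xi> \<in> Hs \<C> L" "\<eta> \<in> Hs \<C> L" "b \<in> A"
      "x = p \<eta> (X o\<^sub>L (ket L L \<xi> o\<^sub>L b))" by (auto elim!: op_prodE)
    show "x \<in> op_prod (\<Delta> ` ?X) (\<iota> ` A)"
      unfolding v(4) 1[OF v(1,2) A_elem[OF v(3)], symmetric]
      by (intro op_prodI imageI coefsI v)
  qed
  moreover have "?P G = op_prod (\<kappa> ` ?X) (\<iota> ` A)"
  proof (intro equalityI subsetI)
    fix x assume "x \<in> ?P G"
    then obtain \<xi> \<eta> b where v: "\<xi> \<in> Hs \<C> L" "\<eta> \<in> Hs \<C> L" "b \<in> A" "x = p \<eta> (ket L L \<xi> o\<^sub>L b)"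
      by (auto elim!: op_prodE)
    show "x \<in> op_prod (\<kappa> ` ?X) (\<iota> ` A)"
      unfolding v(4) 2[OF v(1,2) A_elem[OF v(3)]] by (intro op_prodI imageI coefsI v)
  next
    fix x assume "x \<in> op_prod (\<kappa> ` ?X) (\<iota> ` A)"
    then obtain \<xi> \<eta> b where v: "\<xi> \<in> Hs \<C> L" "\<eta> \<in> Hs \<C> L" "b \<in> A"
      "x = \<kappa> (coef L L L L \<eta> \<xi> X) o\<^sub>L \<iota> b" by (blast elim!: op_prodE coefsE)
    have "x = p \<eta> (ket L L \<xi> o\<^sub>L b)" unfolding v(4) by (rule 2[OF v(1,2) A_elem[OF v(3)], symmetric])
    moreover have "ket L L \<xi> o\<^sub>L b \<in> G" using v by (intro op_prodI) auto
    ultimately show "x \<in> ?P G" using v(2) by blast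
  qed
  moreover have "opspan (?P (op_prod {X} G)) = opspan (?P G)"
    by (rule opspan_swap[of "Hs \<C> L" "B L LL" p, OF p X(3) op_prod_B[of _ LL, OF _ G_B] G_B])
      (use X(1) in auto)
  ultimately show ?thesis
    unfolding opspan_prod_cong_left[OF im[OF semilin_\<Delta>]] opspan_prod_cong_left[OF im[OF \<kappa>]] by simp
qed

lemma assoc_adj_ket:
  "v \<in> Hs \<C> L \<Longrightarrow> adj (assoc \<C> L L L) o\<^sub>L ket L LL v = tensR \<C> L LL (ket L L v) L"
  by (simp add: assoc_tensR_ket[symmetric] assoc_adj_comp[THEN comp_reassoc])

lemma tens_ket_comp:
  "a \<in> B L L \<Longrightarrow> tensR \<C> L LL (ket L L u o\<^sub>L a) L = tensR \<C> L LL (ket L L u) L o\<^sub>L tensR \<C> L L a L"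
  by (simp add: tens_comp)

text \<open>The crossings in \<open>lF2\<close> and in \<open>iota2 \<C> c L L b\<close> cancel,
  leaving \<open>F\<close> directly in front of \<open>\<xi> \<otimes> b\<close>. Absorbing it
  removes \<open>lF2\<close>, and the slice of \<open>lF1\<close> that remains is in the first
  embedded factor.\<close>

lemma \<Delta>_iota2: "opspan (op_prod (\<Delta> ` A) (iota2 \<C> c L L ` A)) = BA"
proof -
  define p where "p \<eta> T = adj (ket L LL \<eta>) o\<^sub>L (lF1 o\<^sub>L (tensL \<C> L LL LL (c L L) o\<^sub>L
      (assoc \<C> L L L o\<^sub>L (tensR \<C> L LL T L o\<^sub>L adj (c L L)))))" for \<eta> T
  show ?thesis
  proof (rule absorb_unitary[where p = p, OF _ refl F_G semilin_iota1[OF L L]])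
    show "semilin_on (B L LL) (p \<eta>)" for \<eta>
      unfolding p_def
      by (intro semilin_comp[OF _ semilin_right] semilin_comp[OF _ semilin_left] semilin_tens_left) simp_all
    fix \<xi> \<eta> b assume v: "\<xi> \<in> Hs \<C> L" "\<eta> \<in> Hs \<C> L" and b: "b \<in> B L L"
    have "lF2 o\<^sub>L (ket L LL \<xi> o\<^sub>L iota2 \<C> c L L b) = tensL \<C> L LL LL (c L L) o\<^sub>L
      (assoc \<C> L L L o\<^sub>L (tensR \<C> L LL (F o\<^sub>L (ket L L \<xi> o\<^sub>L b)) L o\<^sub>L adj (c L L)))"
      unfolding lift2_def lift1_def using v b
      by (simp add: blinfun_compose_assoc tensL_ket[THEN comp_reassoc] iota2_eq c_unitary[THEN comp_reassoc]
          assoc_adj_ket[THEN comp_reassoc] tens_comp[THEN comp_reassoc])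
    then show "\<Delta> (coef L L L L \<eta> \<xi> F) o\<^sub>L iota2 \<C> c L L b = p \<eta> (F o\<^sub>L (ket L L \<xi> o\<^sub>L b))"
      unfolding p_def \<Delta>_coef[OF v] by (simp add: blinfun_compose_assoc)
    have "p \<eta> (ket L L \<xi> o\<^sub>L b) = coef L L LL LL \<eta> \<xi> lF1 o\<^sub>L iota2 \<C> c L L b"
      unfolding p_def tens_ket_comp[OF b] using v b
      by (simp add: blinfun_compose_assoc assoc_tensR_ket[THEN comp_reassoc] tensL_ket[THEN comp_reassoc] iota2_eq)
    then show "p \<eta> (ket L L \<xi> o\<^sub>L b) = iota1 \<C> L L (coef L L L L \<eta> \<xi> F) o\<^sub>L iota2 \<C> c L L b"
      using v by (simp add: coef_lift1)
  qed simp
qed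

text \<open>In \<open>\<Delta>\<close> of a slice of \<open>F\<close> the factor \<open>lF1\<close>
  stands to the left of \<open>lF2\<close>. Using slices of \<open>adj F\<close> instead, which is
  possible as A is selfadjoint, reverses the order and brings \<open>adj lF1\<close> next to
  \<open>iota1 \<C> L L b\<close>.\<close>

lemma \<Delta>_iota1: "opspan (op_prod (\<Delta> ` A) (iota1 \<C> L L ` A)) = BA"
proof -
  define q where "q \<xi> T = adj (ket L LL \<xi>) o\<^sub>L (adj lF2 o\<^sub>L (assoc \<C> L L L o\<^sub>L tensR \<C> L LL T L))" for \<xi> T
  have "opspan (op_prod (\<Delta> ` A) (iota1 \<C> L L ` A)) = opspan (op_prod (iota2 \<C> c L L ` A) (iota1 \<C> L L ` A))"
  proof (rule absorb_unitary[where p = q, OF _ _ adj_F_G semilin_iota2[OF L L]])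
    show "A = slices L L L L (adj F)" using A_adj A_adj_eq by simp
    show "semilin_on (B L LL) (q \<xi>)" for \<xi>
      unfolding q_def by (intro semilin_comp[OF _ semilin_right] semilin_tens_left) simp_all
    fix \<xi> \<eta> b assume v: "\<xi> \<in> Hs \<C> L" "\<eta> \<in> Hs \<C> L" and b: "b \<in> B L L"
    have adj: "coef L L L L \<eta> \<xi> (adj F) = adj (coef L L L L \<xi> \<eta> F)"
      by (simp add: blinfun_compose_assoc)
    have "adj lF1 o\<^sub>L (ket L LL \<xi> o\<^sub>L iota1 \<C> L L b) =
        assoc \<C> L L L o\<^sub>L tensR \<C> L LL (adj F o\<^sub>L (ket L L \<xi> o\<^sub>L b)) L"
      unfolding lift1_def iota1_def using v b
      by (simp add: blinfun_compose_assoc assoc_adj_ket[THEN comp_reassoc] tens_comp)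
    moreover have "\<Delta> (adj (coef L L L L \<xi> \<eta> F)) = adj (\<Delta> (coef L L L L \<xi> \<eta> F))"
      by (subst conj_tens_simps(4)) simp_all
    ultimately show "\<Delta> (coef L L L L \<eta> \<xi> (adj F)) o\<^sub>L iota1 \<C> L L b = q \<eta> (adj F o\<^sub>L (ket L L \<xi> o\<^sub>L b))"
      unfolding q_def adj using v by (simp add: \<Delta>_coef blinfun_compose_assoc)
    have "q \<eta> (ket L L \<xi> o\<^sub>L b) = adj (coef L L LL LL \<xi> \<eta> lF2) o\<^sub>L iota1 \<C> L L b"
      unfolding q_def tens_ket_comp[OF b] iota1_def using v b
      by (simp add: blinfun_compose_assoc assoc_tensR_ket[THEN comp_reassoc])
    also have "adj (coef L L LL LL \<xi> \<eta> lF2) = iota2 \<C> c L L (coef L L L L \<eta> \<xi> (adj F))"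
      unfolding adj using v by (subst coef_lift2) simp_all
    finally show "q \<eta> (ket L L \<xi> o\<^sub>L b) = iota2 \<C> c L L (coef L L L L \<eta> \<xi> (adj F)) o\<^sub>L iota1 \<C> L L b" .
  qed simp
  \<comment> \<open>What survives absorption is \<open>lF2\<close>, so the embedded factors come out
    in reverse order.\<close>
  also have "\<dots> = BA" by (rule box_commute[OF A_alg_obj A_alg_obj, symmetric])
  finally show ?thesis .
qed

lemma BA_alg_obj: "alg_obj \<C> (LL, BA)"
  by (rule alg_obj_box[OF A_alg_obj A_alg_obj])

lemma BA_nondegenerate: "nondegenerate (Hs \<C> LL) BA"
  by (rule nondegenerate_box[OF A_alg_obj A_alg_obj A_nondegenerate A_nondegenerate])

text \<open>Nondegeneracy of \<open>\<Delta>\<close>: it is absorbed by the first embedded factor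
  through \<open>\<Delta>_iota1\<close>, at the cost of a second copy of the other factor, which
  \<open>A_mult\<close> removes.\<close>

lemma \<Delta>_BA: "opspan (op_prod (\<Delta> ` A) BA) = BA"
proof -
  let ?I = "iota1 \<C> L L ` A" and ?J = "iota2 \<C> c L L ` A"
  note cl = iota_image_clin(1)[OF L L A_B] iota_image_clin(2)[OF L L A_B]
  have \<Delta>cl: "\<Delta> ` A \<subseteq> {T. clin T}" using A_B \<Delta>_B by auto
  have "opspan (op_prod (\<Delta> ` A) BA) = opspan (op_prod (op_prod (\<Delta> ` A) ?I) ?J)"
    by (simp only: opspan_prod_right[OF \<Delta>cl] op_prod_assoc)
  also have "\<dots> = opspan (op_prod (op_prod ?I ?J) ?J)"
    by (rule opspan_prod_cong_left[OF \<Delta>_iota1])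
  also have "\<dots> = opspan (op_prod ?I (op_prod ?J ?J))"
    by (simp only: op_prod_assoc)
  also have "\<dots> = BA"
  proof (rule opspan_prod_cong_right[OF cl(1)])
    have "opspan (op_prod ?J ?J) = opspan (iota2 \<C> c L L ` op_prod A A)"
      by (simp only: iota2_prod[OF L L A_B A_B])
    also have "\<dots> = opspan (iota2 \<C> c L L ` opspan (op_prod A A))"
      by (rule opspan_image[OF semilin_iota2[OF L L] op_prod_B[OF A_B A_B], symmetric])
    finally show "opspan (op_prod ?J ?J) = opspan ?J" by (simp only: A_mult)
  qed
  finally show ?thesis .
qed

lemma \<Delta>_alg_mor: "alg_mor \<C> (L, A) (LL, BA) \<Delta>"
  by (rule alg_mor_conj_tens[OF A_alg_obj BA_alg_obj BA_nondegenerate L F_Hom F_simps(4) \<Delta>_BA])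

subsection \<open>Coassociativity\<close>

text \<open>The last leg is the auxiliary object on which \<open>F\<close> acts jointly with the
  factor to be comultiplied. For the first factor, \<open>hexE\<close> must bring it past the
  second; for the second factor, in \<open>V2\<close>, it is already adjacent.\<close>

definition V1 where "V1 = F1 o\<^sub>L hexE L L L"
definition V2 where "V2 = tensL \<C> L LL LL F o\<^sub>L assoc \<C> L L L"

lemma V1_simps [simp]:
  "clin V1" "lands V1 (Hs \<C> (LL \<otimes> L))" "vanishes V1 (Hs \<C> (LL \<otimes> L))"
  "adj V1 o\<^sub>L V1 = idm \<C> (LL \<otimes> L)" "V1 o\<^sub>L adj V1 = idm \<C> (LL \<otimes> L)"
  by (simp_all add: V1_def blinfun_compose_assoc tens_comp tens_comp[THEN comp_reassoc]
      hexE_simps(5)[THEN comp_reassoc])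

lemma V2_simps [simp]:
  "clin V2" "lands V2 (Hs \<C> (L \<otimes> LL))" "vanishes V2 (Hs \<C> (LL \<otimes> L))"
  "adj V2 o\<^sub>L V2 = idm \<C> (LL \<otimes> L)" "V2 o\<^sub>L adj V2 = idm \<C> (L \<otimes> LL)"
  by (simp_all add: V2_def blinfun_compose_assoc tens_comp tens_comp[THEN comp_reassoc]
      assoc_adj_comp assoc_comp_adj[THEN comp_reassoc])

lemma hexE_Hom: "hexE L L L \<in> Hom \<C> (LL \<otimes> L) (LL \<otimes> L)"
  unfolding hexE_def
  by (rule Hom_comp[OF _ _ _ Hom_comp[OF _ _ _ assoc_Hom tens_Hom] assoc_adj_Hom])
    (simp_all add: Hom_id c_Hom)

lemma V1_Hom: "V1 \<in> Hom \<C> (LL \<otimes> L) (LL \<otimes> L)"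
  unfolding V1_def by (rule Hom_comp[OF _ _ _ hexE_Hom tens_Hom]) (simp_all add: Hom_id F_Hom)

lemma V2_Hom: "V2 \<in> Hom \<C> (LL \<otimes> L) (L \<otimes> LL)"
  unfolding V2_def by (rule Hom_comp[OF _ _ _ assoc_Hom tens_Hom]) (simp_all add: Hom_id F_Hom)

lemma tens_hexE:
  assumes a: "a \<in> B L L"
  shows "hexE L L L o\<^sub>L tensR \<C> LL LL (tensR \<C> L L a L) L =
    tensR \<C> LL LL (tensR \<C> L L a L) L o\<^sub>L hexE L L L"
  unfolding hexE_def using a
  by (simp add: blinfun_compose_assoc tens_tens_assoc tens_tens_assoc_adj[THEN comp_reassoc]
      tens_comp[THEN comp_reassoc])

lemma V1_iota1:
  assumes a: "a \<in> B L L"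
  shows "V1 o\<^sub>L tensR \<C> LL LL (iota1 \<C> L L a) L = iota1 \<C> LL L (\<Delta> a) o\<^sub>L V1"
proof -
  have "V1 o\<^sub>L tensR \<C> LL LL (iota1 \<C> L L a) L =
      F1 o\<^sub>L (tensR \<C> LL LL (tensR \<C> L L a L) L o\<^sub>L hexE L L L)"
    unfolding V1_def iota1_def by (simp add: blinfun_compose_assoc tens_hexE[OF a])
  then show ?thesis using a
    by (simp add: V1_def iota1_def conj_tens_def blinfun_compose_assoc tens_comp[THEN comp_reassoc])
qed

text \<open>The embedded \<open>b\<close> passes \<open>hexE\<close> by \<open>iota2_hexE\<close>,
  and then commutes with \<open>F1\<close> because \<open>F\<close> is a morphism on the other
  legs.\<close>

lemma V1_iota2:
  assumes b: "b \<in> B L L"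
  shows "V1 o\<^sub>L tensR \<C> LL LL (iota2 \<C> c L L b) L = iota2 \<C> c LL L b o\<^sub>L V1"
  unfolding V1_def using iota2_tensR_commute[of "LL" L b F, THEN comp_reassoc] b F_Hom
  by (simp add: blinfun_compose_assoc flip: iota2_hexE)
    (simp flip: blinfun_compose_assoc add: iota2_tensR_commute[of "LL" L b F])

lemma V2_iota1:
  assumes a: "a \<in> B L L"
  shows "V2 o\<^sub>L tensR \<C> LL LL (iota1 \<C> L L a) L = iota1 \<C> L LL a o\<^sub>L V2"
  unfolding V2_def iota1_def using a
  by (simp add: blinfun_compose_assoc tens_tens_assoc tens_comp[THEN comp_reassoc])

text \<open>Naturality of the braiding for \<open>F\<close>: on one side of the crossing it acts as
  \<open>F1\<close>, on the other as \<open>F\<close> on the last two legs, so the conjugation moves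
  inside the embedding.\<close>

lemma V2_iota2:
  assumes b: "b \<in> B L L"
  shows "V2 o\<^sub>L tensR \<C> LL LL (iota2 \<C> c L L b) L = iota2 \<C> c L LL (\<Delta> b) o\<^sub>L V2"
proof -
  let ?tF = "tensL \<C> L LL LL F" and ?c = "c LL L"
  have nat: "?c o\<^sub>L F1 = ?tF o\<^sub>L ?c" by (intro c_natural) (simp_all add: F_Hom Hom_id)
  have nat': "adj ?c o\<^sub>L ?tF = F1 o\<^sub>L adj ?c"
  proof -
    have "adj ?c o\<^sub>L ?tF = adj ?c o\<^sub>L ((?tF o\<^sub>L ?c) o\<^sub>L adj ?c)" by (simp add: blinfun_compose_assoc)
    also have "\<dots> = F1 o\<^sub>L adj ?c"
      unfolding nat[symmetric] by (simp add: blinfun_compose_assoc c_unitary[THEN comp_reassoc])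
    finally show ?thesis .
  qed
  have "iota2 \<C> c L LL (\<Delta> b) o\<^sub>L ?tF = ?tF o\<^sub>L iota2 \<C> c L LL (tensR \<C> L L b L)"
  proof -
    have "iota2 \<C> c L LL (\<Delta> b) o\<^sub>L ?tF = ?c o\<^sub>L (F1 o\<^sub>L (tensR \<C> LL LL (tensR \<C> L L b L) L o\<^sub>L adj ?c))"
      using b by (simp add: iota2_eq conj_tens_def blinfun_compose_assoc nat' tens_comp tens_comp[THEN comp_reassoc])
    then show ?thesis using b by (simp add: nat[THEN comp_reassoc] iota2_eq blinfun_compose_assoc)
  qed
  from this[THEN comp_reassoc, of "assoc \<C> L L L"] show ?thesis
    unfolding V2_def using b by (simp add: blinfun_compose_assoc iota2_tensR)
qed

abbreviation \<Delta>1 where "\<Delta>1 \<equiv> conj_tens LL L V1"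
abbreviation \<Delta>2 where "\<Delta>2 \<equiv> conj_tens LL L V2"

lemma conj_tens_iota:
  assumes V: "V \<in> B (LL \<otimes> L) Z" "V o\<^sub>L adj V = idm \<C> Z" and Z: "Z \<in> Obj \<C>"
    and ab: "a \<in> B L L" "b \<in> B L L" "a' \<in> B Z Z" "b' \<in> B Z Z"
    and a: "V o\<^sub>L tensR \<C> LL LL (iota1 \<C> L L a) L = a' o\<^sub>L V"
    and b: "V o\<^sub>L tensR \<C> LL LL (iota2 \<C> c L L b) L = b' o\<^sub>L V"
  shows "conj_tens LL L V (iota1 \<C> L L a o\<^sub>L iota2 \<C> c L L b) = a' o\<^sub>L b'"
proof -
  have "conj_tens LL L V (iota1 \<C> L L a o\<^sub>L iota2 \<C> c L L b) =
      (V o\<^sub>L tensR \<C> LL LL (iota1 \<C> L L a) L) o\<^sub>L (tensR \<C> LL LL (iota2 \<C> c L L b) L o\<^sub>L adj V)"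
    using ab V Z by (simp add: conj_tens_def blinfun_compose_assoc tens_comp[THEN comp_reassoc])
  also have "\<dots> = a' o\<^sub>L ((V o\<^sub>L tensR \<C> LL LL (iota2 \<C> c L L b) L) o\<^sub>L adj V)"
    unfolding a by (simp only: blinfun_compose_assoc)
  also have "\<dots> = a' o\<^sub>L b'"
    unfolding b using V ab Z by (simp add: blinfun_compose_assoc)
  finally show ?thesis .
qed

lemma \<Delta>_image: "\<Delta> ` A \<subseteq> B LL LL"
  using A_elem \<Delta>_B by blast

lemma id_image: "(\<lambda>a. a) ` A \<subseteq> B L L" "opspan (op_prod ((\<lambda>a. a) ` A) A) = A"
  using A_B A_mult by simp_all

lemmas \<Delta>1_box = is_box_morI[OF A_alg_obj A_alg_obj BA_alg_obj A_alg_obj BA_nondegenerate A_nondegenerate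
  \<Delta>_image id_image(1) \<Delta>_BA id_image(2) L V1_Hom V1_simps(4) refl]

lemmas \<Delta>2_box = is_box_morI[OF A_alg_obj A_alg_obj A_alg_obj BA_alg_obj A_nondegenerate BA_nondegenerate
  id_image(1) \<Delta>_image id_image(2) \<Delta>_BA L V2_Hom V2_simps(4) refl]

lemma \<Delta>1_iota: "a \<in> A \<Longrightarrow> b \<in> A \<Longrightarrow>
    \<Delta>1 (iota1 \<C> L L a o\<^sub>L iota2 \<C> c L L b) = iota1 \<C> LL L (\<Delta> a) o\<^sub>L iota2 \<C> c LL L b"
  by (frule A_elem, drule A_elem, rule conj_tens_iota[of _ "LL \<otimes> L"])
    (use V1_iota1 V1_iota2 A_elem in \<open>simp_all del: bop_iff, simp_all\<close>)

lemma \<Delta>2_iota: "a \<in> A \<Longrightarrow> b \<in> A \<Longrightarrow>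
    \<Delta>2 (iota1 \<C> L L a o\<^sub>L iota2 \<C> c L L b) = iota1 \<C> L LL a o\<^sub>L iota2 \<C> c L LL (\<Delta> b)"
  by (frule A_elem, drule A_elem, rule conj_tens_iota[of _ "L \<otimes> LL"])
    (use V2_iota1 V2_iota2 A_elem in \<open>simp_all del: bop_iff, simp_all\<close>)

text \<open>The two sides are conjugations of \<open>a\<close> on the first leg by
  \<open>V1 o\<^sub>L F1\<close>, followed by the associator, and by \<open>V2 o\<^sub>L F1\<close>.
  The pentagon makes these unitaries differ by a right factor that commutes with
  \<open>a\<close>.\<close>

lemma coassociative:
  assumes a: "a \<in> B L L"
  shows "assoc \<C> L L L o\<^sub>L \<Delta>1 (\<Delta> a) o\<^sub>L adj (assoc \<C> L L L) = \<Delta>2 (\<Delta> a)"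
proof -
  let ?\<alpha> = "assoc \<C> L L L" and ?a = "tensR \<C> LL LL (tensR \<C> L L a L) L" and ?E = "hexE L L L"
  \<comment> \<open>The discrepancy between the two unitaries. It acts on the last two legs only,
    hence commutes with \<open>a\<close> on the first.\<close>
  define W where "W = adj ?E o\<^sub>L F2"
  have Wa: "W o\<^sub>L ?a = ?a o\<^sub>L W"
  proof -
    have 1: "F2 o\<^sub>L ?a = ?a o\<^sub>L F2"
      unfolding leg_snd_def using a
      by (simp add: blinfun_compose_assoc tens_tens_assoc tens_tens_assoc_adj[THEN comp_reassoc]
          tens_comp[THEN comp_reassoc])
    have "adj ?E o\<^sub>L ?a = ?a o\<^sub>L adj ?E"
      using arg_cong[OF tens_hexE[of "adj a"], of adj] a by simp
    then show ?thesis unfolding W_def by (simp add: blinfun_compose_assoc 1) (simp flip: blinfun_compose_assoc)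
  qed
  have W: "clin W" "lands W (Hs \<C> (LL \<otimes> L))" "W o\<^sub>L adj W = idm \<C> (LL \<otimes> L)"
    unfolding W_def by (simp_all add: blinfun_compose_assoc leg_unitary(3)[THEN comp_reassoc] del: leg_snd_simps(4))
  \<comment> \<open>The crossing in \<open>lift2\<close> is the one in \<open>hexE\<close>, up to
    associators; this is how the pentagon produces \<open>V1\<close>.\<close>
  have lF2: "adj ?\<alpha> o\<^sub>L (lF2 o\<^sub>L ?\<alpha>) = ?E o\<^sub>L (F1 o\<^sub>L adj ?E)"
    unfolding lift2_def lift1_def hexE_def by (simp add: blinfun_compose_assoc)
  have V: "V2 o\<^sub>L F1 = ?\<alpha> o\<^sub>L (V1 o\<^sub>L (F1 o\<^sub>L W))"
  proof -
    have "V2 o\<^sub>L F1 = ?\<alpha> o\<^sub>L (F2 o\<^sub>L F1)"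
      unfolding V2_def leg_snd_def by (simp add: blinfun_compose_assoc assoc_comp_adj[THEN comp_reassoc])
    also have "\<dots> = ?\<alpha> o\<^sub>L (F1 o\<^sub>L ((adj ?\<alpha> o\<^sub>L (lF2 o\<^sub>L ?\<alpha>)) o\<^sub>L F2))"
      unfolding pentagon_lift2 by (simp only: blinfun_compose_assoc)
    also have "\<dots> = ?\<alpha> o\<^sub>L (V1 o\<^sub>L (F1 o\<^sub>L W))"
      unfolding lF2 V1_def W_def by (simp only: blinfun_compose_assoc)
    finally show ?thesis .
  qed
  have \<Delta>a: "tensR \<C> LL LL (\<Delta> a) L = F1 o\<^sub>L (?a o\<^sub>L adj F1)"
    using a by (simp add: conj_tens_def tens_comp)
  have "\<Delta>2 (\<Delta> a) = (V2 o\<^sub>L F1) o\<^sub>L (?a o\<^sub>L adj (V2 o\<^sub>L F1))"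
    unfolding conj_tens_def[of "LL"] \<Delta>a by (simp add: blinfun_compose_assoc)
  also have "\<dots> = ?\<alpha> o\<^sub>L (V1 o\<^sub>L (F1 o\<^sub>L ((W o\<^sub>L ?a) o\<^sub>L (adj W o\<^sub>L (adj F1 o\<^sub>L (adj V1 o\<^sub>L adj ?\<alpha>))))))"
    unfolding V using W(1) by (simp add: blinfun_compose_assoc)
  also have "\<dots> = ?\<alpha> o\<^sub>L (V1 o\<^sub>L (F1 o\<^sub>L (?a o\<^sub>L (adj F1 o\<^sub>L (adj V1 o\<^sub>L adj ?\<alpha>)))))"
    unfolding Wa by (simp add: blinfun_compose_assoc W(3)[THEN comp_reassoc])
  also have "\<dots> = ?\<alpha> o\<^sub>L \<Delta>1 (\<Delta> a) o\<^sub>L adj ?\<alpha>"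
    unfolding conj_tens_def[of "LL"] \<Delta>a by (simp add: blinfun_compose_assoc)
  finally show ?thesis by simp
qed

lemma bialgebra: "cstar_bialgebra \<C> c (L, A) \<Delta>"
  unfolding cstar_bialgebra_def box_obj fst_conv snd_conv
proof (intro conjI exI ballI A_alg_obj \<Delta>_alg_mor)
  show b1: "is_box_mor \<C> c (L, A) (LL, BA) (L, A) (L, A) \<Delta> (\<lambda>a. a) \<Delta>1"
    by (rule \<Delta>1_box(1)) (rule \<Delta>1_iota)
  show b2: "is_box_mor \<C> c (L, A) (L, A) (L, A) (LL, BA) (\<lambda>a. a) \<Delta> \<Delta>2"
    by (rule \<Delta>2_box(1)) (rule \<Delta>2_iota)
  fix a assume a: "a \<in> A"
  \<comment> \<open>\<open>extend\<close> is characterised on multipliers; there both extensions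
    reduce to applying the conjugations themselves.\<close>
  have m: "\<Delta> a \<in> multipliers (Hs \<C> LL) BA"
    using \<Delta>_alg_mor a by (auto simp: alg_mor_def simp del: bop_simps)
  have e1: "extend \<C> (LL, BA) (LL \<otimes> L, box LL L BA A) \<Delta>1 (\<Delta> a) = \<Delta>1 (\<Delta> a)"
  proof (rule extend_conj_tens[OF _ refl L _ _ _ m])
    show "alg_mor \<C> (LL, BA) (LL \<otimes> L, box LL L BA A) \<Delta>1"
      using b1 by (simp add: is_box_mor_def box_obj)
    show "nondegenerate (Hs \<C> (LL \<otimes> L)) (box LL L BA A)"
      by (rule nondegenerate_box[OF BA_alg_obj A_alg_obj BA_nondegenerate A_nondegenerate])
  qed simp_all
  have e2: "extend \<C> (LL, BA) (L \<otimes> LL, box L LL A BA) \<Delta>2 (\<Delta> a) = \<Delta>2 (\<Delta> a)"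
  proof (rule extend_conj_tens[OF _ refl L _ _ _ m])
    show "alg_mor \<C> (LL, BA) (L \<otimes> LL, box L LL A BA) \<Delta>2"
      using b2 by (simp add: is_box_mor_def box_obj)
    show "nondegenerate (Hs \<C> (L \<otimes> LL)) (box L LL A BA)"
      by (rule nondegenerate_box[OF A_alg_obj BA_alg_obj A_nondegenerate BA_nondegenerate])
  qed simp_all
  show "assoc \<C> L L L o\<^sub>L extend \<C> (LL, BA) (LL \<otimes> L, box LL L BA A) \<Delta>1 (\<Delta> a) o\<^sub>L assoc_inv \<C> L L L =
      extend \<C> (LL, BA) (L \<otimes> LL, box L LL A BA) \<Delta>2 (\<Delta> a)"
    unfolding e1 e2 using coassociative[OF A_elem[OF a]] by simp
qed

lemma bisimplifiable: "bi_simplifiable \<C> c (L, A) \<Delta>"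
proof -
  have "{\<Delta> a o\<^sub>L iota1 \<C> L L b | a b. a \<in> A \<and> b \<in> A} = op_prod (\<Delta> ` A) (iota1 \<C> L L ` A)"
    "{\<Delta> a o\<^sub>L iota2 \<C> c L L b | a b. a \<in> A \<and> b \<in> A} = op_prod (\<Delta> ` A) (iota2 \<C> c L L ` A)"
    unfolding op_prod_def by blast+
  then show ?thesis unfolding bi_simplifiable_def box_obj fst_conv snd_conv by (simp only: \<Delta>_iota1 \<Delta>_iota2)
qed

lemma alg_of_eq: "alg_of \<C> L F = A"
  unfolding alg_of_def by (rule slice_fst_opspan) simp_all

lemma comult_of_eq: "comult_of \<C> L F = \<Delta>"
  by (rule ext) (simp add: comult_of_def conj_tens_def blinfun_compose_assoc)

end

theorem proposition27:
  fixes \<C> :: "('o, 'v::chilbert_space) wcat"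
    and c :: "'o \<Rightarrow> 'o \<Rightarrow> 'v op"
    and L :: 'o
    and F :: "'v op"
  assumes "concrete_monoidal_wstar_category \<C>"
    and "bi_regular_braiding \<C> c"
    and "L \<in> Obj \<C>"
    and "F \<in> unitaries \<C> (L \<otimes>\<^bsub>\<C>\<^esub> L) (L \<otimes>\<^bsub>\<C>\<^esub> L)"
    and "bi_regular_multiplicative_unitary \<C> c L F"
  shows "cstar_bialgebra \<C> c (L, alg_of \<C> L F) (comult_of \<C> L F) \<and>
         bi_simplifiable \<C> c (L, alg_of \<C> L F) (comult_of \<C> L F)"
proof -
  interpret braided_multiplicative_unitary \<C> c L F
    using assms by (intro braided_multiplicative_unitary.intro braided_wstar_category.intro
        braided_wstar_category_axioms.intro braided_multiplicative_unitary_axioms.intro)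
  show ?thesis
    unfolding alg_of_eq comult_of_eq using bialgebra bisimplifiable by blast
qed

end
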